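(* If $(\Lambda,d)$ is a source-free row-finite $k$-graph with $v\in\Lambda^0$ a sink, and $(\Lambda_S,d_S)$ is the $k$-graph of $\Lambda$ with $v$ deleted, then $C^*(\Lambda)$ is Morita equivalent to $C^*(\Lambda_S)$.
   Context: Fix $k\ge1$; $0\in\mathbb{N}$; $e_1,\dots,e_k$ are the standard basis vectors of $\mathbb{N}^k$, and $\mathbb{N}^k$ is regarded as a category with one object, composition being addition. For $n=\sum n_ie_i$, $|n|=\sum n_i$. A $k$-graph is a countable category $\Lambda$ with a functor $d:\Lambda\to\mathbb{N}^k$ satisfying the factorization rule: for every morphism $\lambda$ and $n,m\in\mathbb{N}^k$ with $d(\lambda)=n+m$ there exist unique $\mu,\nu\in\Lambda$ with $d(\mu)=m$, $d(\nu)=n$, $\lambda=\mu\nu$. $\Lambda^n=d^{-1}(n)$; $\Lambda^0$ is the set of vertices (identified with objects); $\Lambda^1=\{\lambda:|d(\lambda)|=1\}$ is the set of edges. $r(\lambda),s(\lambda)\in\Lambda^0$ are the unique vertices with $r(\lambda)\lambda s(\lambda)=\lambda$. $\Lambda$ is row-finite if $|\{\lambda\in\Lambda^{e_i}:r(\lambda)=v\}|<\infty$ for all $v\in\Lambda^0$, $1\le i\le k$. A vertex $v$ is a source if $r^{-1}(v)\cap\Lambda^{e_i}=\emptyset$ for some $i$; $\Lambda$ is source-free if it has no sources. A vertex $v$ is an $e_i$ sink if $s^{-1}(v)\cap\Lambda^{e_i}=\emptyset$; it is a sink if it is an $e_i$ sink for some $1\le i\le k$. The 1-skeleton of $\Lambda$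 is the directed graph $G=(\Lambda^0,\Lambda^1,r,s)$ with edges colored by $d$. For any $k$-colored directed graph, the path category (denoted by $*$, e.g. $G^*$) consists of all finite paths $f_n\cdots f_1$ with $s(f_i)=r(f_{i-1})$, including vertices as paths of length $0$, with range, source and (additively extended) degree. For $\lambda\in G^*$, $[\lambda]\in\Lambda$ denotes the morphism to which $\lambda$ composes. Sink deletion: let $v$ be a sink. Write $w\le v$ if there exists $\lambda\in G^*$ with $s(\lambda)=v$ and $r(\lambda)=w$. Define the $k$-colored graph $G_S=(\Lambda_S^0,\Lambda_S^1,r_S,s_S)$ by $\Lambda_S^0=\{w\in\Lambda^0:w\not\le v\}$, $\Lambda_S^1=\Lambda^1\setminus\{f\in\Lambda^1:r(f)\le v\}$, with $r_S=r$, $s_S=s$, $d_S=d$ (restricted). Let $\iota:G_S^*\to G^*$ be the inclusion and define an equivalence relation on $G_S^*$ by $\mu\sim_S\lambda$ when $[\iota(\mu)]=[\iota(\lambda)]\in\Lambda$. Then $\Lambda_S=G_S^*/\sim_S$, with composition induced by concatenation and degree map induced by $d_S$, is the $k$-graph of $\Lambda$ with the sink $v$ deleted (it is a source-free $k$-graph). For a row-finite source-free $k$-graph $\Lambda$, a Cuntz–Krieger $\Lambda$-family is a collection of projections $\{P_v:v\in\Lambda^0\}$ and partial isometries $\{T_f:f\in\Lambda^1\}$ such that: (CK1) the $P_v$ are mutually orthogonal; (CK2) if $a,b,f,g\in\Lambda^1$ satisfy $af=gb$ in $\Lambda$, then $T_aT_f=T_gT_b$; (CK3) $T_f^*T_f=P_{s(f)}$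 for all $f\in\Lambda^1$; (CK4) $P_v=\sum_{f:\,r(f)=v,\ d(f)=e_i}T_fT_f^*$ for all $v\in\Lambda^0$, $1\le i\le k$. $C^*(\Lambda)$ is the universal $C^*$-algebra generated by a Cuntz–Krieger $\Lambda$-family. *)

theory Defs
  imports "HOL-Analysis.Finite_Cartesian_Product" "HOL-Algebra.Module"
begin

section \<open>Higher-rank graphs\<close>

text \<open>
  The rank is the cardinality of the finite index type \<open>'k\<close>, and the basis vector \<open>e\<^sub>i\<close> is
  \<open>axis i 1\<close>. Since objects are identified with vertices, a small category is given by its
  morphisms alone: \<open>rng x\<close> and \<open>src x\<close> are the identity morphisms at the codomain and domain
  of \<open>x\<close>, and \<open>cmp x y\<close> is the composite, meaningful only if \<open>src x = rng y\<close>.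
\<close>

record ('m, 'k::finite) kgraph_data =
  mor :: "'m set"
  rng :: "'m \<Rightarrow> 'm"
  src :: "'m \<Rightarrow> 'm"
  cmp :: "'m \<Rightarrow> 'm \<Rightarrow> 'm"
  deg :: "'m \<Rightarrow> nat ^ 'k"

locale small_category =
  fixes \<Lambda> :: "('m, 'k::finite, 'z) kgraph_data_scheme"
  assumes rng_mor: "x \<in> mor \<Lambda> \<Longrightarrow> rng \<Lambda> x \<in> mor \<Lambda>"
    and src_mor: "x \<in> mor \<Lambda> \<Longrightarrow> src \<Lambda> x \<in> mor \<Lambda>"
    and rng_rng: "x \<in> mor \<Lambda> \<Longrightarrow> rng \<Lambda> (rng \<Lambda> x) = rng \<Lambda> x"
    and src_rng: "x \<in> mor \<Lambda> \<Longrightarrow> src \<Lambda> (rng \<Lambda> x) = rng \<Lambda> x"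
    and rng_src: "x \<in> mor \<Lambda> \<Longrightarrow> rng \<Lambda> (src \<Lambda> x) = src \<Lambda> x"
    and src_src: "x \<in> mor \<Lambda> \<Longrightarrow> src \<Lambda> (src \<Lambda> x) = src \<Lambda> x"
    and cmp_mor: "\<lbrakk>x \<in> mor \<Lambda>; y \<in> mor \<Lambda>; src \<Lambda> x = rng \<Lambda> y\<rbrakk> \<Longrightarrow> cmp \<Lambda> x y \<in> mor \<Lambda>"
    and rng_cmp: "\<lbrakk>x \<in> mor \<Lambda>; y \<in> mor \<Lambda>; src \<Lambda> x = rng \<Lambda> y\<rbrakk> \<Longrightarrow> rng \<Lambda> (cmp \<Lambda> x y) = rng \<Lambda> x"
    and src_cmp: "\<lbrakk>x \<in> mor \<Lambda>; y \<in> mor \<Lambda>; src \<Lambda> x = rng \<Lambda> y\<rbrakk> \<Longrightarrow> src \<Lambda> (cmp \<Lambda> x y) = src \<Lambda> y"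
    and cmp_assoc: "\<lbrakk>x \<in> mor \<Lambda>; y \<in> mor \<Lambda>; z \<in> mor \<Lambda>; src \<Lambda> x = rng \<Lambda> y; src \<Lambda> y = rng \<Lambda> z\<rbrakk>
      \<Longrightarrow> cmp \<Lambda> (cmp \<Lambda> x y) z = cmp \<Lambda> x (cmp \<Lambda> y z)"
    and rng_cmp_self: "x \<in> mor \<Lambda> \<Longrightarrow> cmp \<Lambda> (rng \<Lambda> x) x = x"
    and cmp_src_self: "x \<in> mor \<Lambda> \<Longrightarrow> cmp \<Lambda> x (src \<Lambda> x) = x"

locale k_graph = small_category \<Lambda> for \<Lambda> :: "('m, 'k::finite, 'z) kgraph_data_scheme" +
  assumes countable_mor: "countable (mor \<Lambda>)"
    and deg_ident: "x \<in> mor \<Lambda> \<Longrightarrow> deg \<Lambda> (rng \<Lambda> x) = 0"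
    and deg_cmp: "\<lbrakk>x \<in> mor \<Lambda>; y \<in> mor \<Lambda>; src \<Lambda> x = rng \<Lambda> y\<rbrakk>
      \<Longrightarrow> deg \<Lambda> (cmp \<Lambda> x y) = deg \<Lambda> x + deg \<Lambda> y"
    and factorization: "\<lbrakk>x \<in> mor \<Lambda>; deg \<Lambda> x = n + m\<rbrakk> \<Longrightarrow>
      \<exists>!(p, q). p \<in> mor \<Lambda> \<and> q \<in> mor \<Lambda> \<and> deg \<Lambda> p = m \<and> deg \<Lambda> q = n \<and>
        src \<Lambda> p = rng \<Lambda> q \<and> x = cmp \<Lambda> p q"

definition of_degree :: "('m, 'k::finite, 'z) kgraph_data_scheme \<Rightarrow> nat ^ 'k \<Rightarrow> 'm set" where
  "of_degree \<Lambda> n = {x \<in> mor \<Lambda>. deg \<Lambda> x = n}"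

definition vertices :: "('m, 'k::finite, 'z) kgraph_data_scheme \<Rightarrow> 'm set" where
  "vertices \<Lambda> = of_degree \<Lambda> 0"

definition edges :: "('m, 'k::finite, 'z) kgraph_data_scheme \<Rightarrow> 'm set" where
  "edges \<Lambda> = {x \<in> mor \<Lambda>. (\<Sum>i\<in>UNIV. deg \<Lambda> x $ i) = 1}"

definition row_finite :: "('m, 'k::finite, 'z) kgraph_data_scheme \<Rightarrow> bool" where
  "row_finite \<Lambda> \<longleftrightarrow> (\<forall>v\<in>vertices \<Lambda>. \<forall>i. finite {x \<in> of_degree \<Lambda> (axis i 1). rng \<Lambda> x = v})"

definition is_source :: "('m, 'k::finite, 'z) kgraph_data_scheme \<Rightarrow> 'm \<Rightarrow> bool" where
  "is_source \<Lambda> v \<longleftrightarrow> v \<in> vertices \<Lambda> \<and> (\<exists>i. {x \<in> of_degree \<Lambda> (axis i 1). rng \<Lambda> x = v} = {})"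

definition source_free :: "('m, 'k::finite, 'z) kgraph_data_scheme \<Rightarrow> bool" where
  "source_free \<Lambda> \<longleftrightarrow> (\<forall>v. \<not> is_source \<Lambda> v)"

definition is_sink :: "('m, 'k::finite, 'z) kgraph_data_scheme \<Rightarrow> 'm \<Rightarrow> bool" where
  "is_sink \<Lambda> v \<longleftrightarrow> v \<in> vertices \<Lambda> \<and> (\<exists>i. {x \<in> of_degree \<Lambda> (axis i 1). src \<Lambda> x = v} = {})"


section \<open>Coloured graphs and sink deletion\<close>

record ('v, 'e, 'k::finite) coloured_graph =
  gverts :: "'v set"
  gedges :: "'e set"
  grng :: "'e \<Rightarrow> 'v"
  gsrc :: "'e \<Rightarrow> 'v"
  gdeg :: "'e \<Rightarrow> nat ^ 'k"

text \<open>
  A path \<open>f\<^sub>n \<cdots> f\<^sub>1\<close> is represented as \<open>(r(f\<^sub>n), [f\<^sub>n, \<dots>, f\<^sub>1])\<close>, and the vertex \<open>v\<close>, as a path of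
  length zero, as \<open>(v, [])\<close>.
\<close>

fun is_path :: "('v, 'e, 'k::finite) coloured_graph \<Rightarrow> 'v \<Rightarrow> 'e list \<Rightarrow> bool" where
  "is_path G v [] \<longleftrightarrow> v \<in> gverts G"
| "is_path G v (f # fs) \<longleftrightarrow> v \<in> gverts G \<and> f \<in> gedges G \<and> grng G f = v \<and> is_path G (gsrc G f) fs"

definition paths :: "('v, 'e, 'k::finite) coloured_graph \<Rightarrow> ('v \<times> 'e list) set" where
  "paths G = {(v, fs). is_path G v fs}"

definition path_rng :: "'v \<times> 'e list \<Rightarrow> 'v" where
  "path_rng p = fst p"

definition path_src :: "('v, 'e, 'k::finite) coloured_graph \<Rightarrow> 'v \<times> 'e list \<Rightarrow> 'v" where
  "path_src G p = (if snd p = [] then fst p else gsrc G (last (snd p)))"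

definition path_deg :: "('v, 'e, 'k::finite) coloured_graph \<Rightarrow> 'v \<times> 'e list \<Rightarrow> nat ^ 'k" where
  "path_deg G p = sum_list (map (gdeg G) (snd p))"

text \<open>The concatenation \<open>pq\<close>, meaningful only if the source of \<open>p\<close> is the range of \<open>q\<close>.\<close>

definition path_concat :: "'v \<times> 'e list \<Rightarrow> 'v \<times> 'e list \<Rightarrow> 'v \<times> 'e list" where
  "path_concat p q = (fst p, snd p @ snd q)"

definition skeleton :: "('m, 'k::finite, 'z) kgraph_data_scheme \<Rightarrow> ('m, 'm, 'k) coloured_graph" where
  "skeleton \<Lambda> = \<lparr>gverts = vertices \<Lambda>, gedges = edges \<Lambda>,
     grng = rng \<Lambda>, gsrc = src \<Lambda>, gdeg = deg \<Lambda>\<rparr>"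

text \<open>The morphism \<open>[p]\<close> to which a path of the skeleton composes.\<close>

fun compose_list :: "('m, 'k::finite, 'z) kgraph_data_scheme \<Rightarrow> 'm \<Rightarrow> 'm list \<Rightarrow> 'm" where
  "compose_list \<Lambda> v [] = v"
| "compose_list \<Lambda> v (f # fs) = cmp \<Lambda> f (compose_list \<Lambda> (src \<Lambda> f) fs)"

definition path_class :: "('m, 'k::finite, 'z) kgraph_data_scheme \<Rightarrow> 'm \<times> 'm list \<Rightarrow> 'm" where
  "path_class \<Lambda> p = compose_list \<Lambda> (fst p) (snd p)"

text \<open>The relation \<open>w \<le> v\<close>.\<close>

definition reachable_from :: "('m, 'k::finite, 'z) kgraph_data_scheme \<Rightarrow> 'm \<Rightarrow> 'm \<Rightarrow> bool" where
  "reachable_from \<Lambda> v w \<longleftrightarrow>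
     (\<exists>p\<in>paths (skeleton \<Lambda>). path_src (skeleton \<Lambda>) p = v \<and> path_rng p = w)"

definition sink_deleted_graph ::
  "('m, 'k::finite, 'z) kgraph_data_scheme \<Rightarrow> 'm \<Rightarrow> ('m, 'm, 'k) coloured_graph" where
  "sink_deleted_graph \<Lambda> v = \<lparr>
     gverts = {w \<in> vertices \<Lambda>. \<not> reachable_from \<Lambda> v w},
     gedges = edges \<Lambda> - {f \<in> edges \<Lambda>. reachable_from \<Lambda> v (rng \<Lambda> f)},
     grng = rng \<Lambda>, gsrc = src \<Lambda>, gdeg = deg \<Lambda>\<rparr>"

text \<open>
  The inclusion of the path category of \<open>sink_deleted_graph \<Lambda> v\<close> into that of \<open>skeleton \<Lambda>\<close> is the
  identity on representatives.
\<close>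

definition sink_rel ::
  "('m, 'k::finite, 'z) kgraph_data_scheme \<Rightarrow> 'm \<Rightarrow> (('m \<times> 'm list) \<times> ('m \<times> 'm list)) set" where
  "sink_rel \<Lambda> v = {(p, q). p \<in> paths (sink_deleted_graph \<Lambda> v) \<and>
     q \<in> paths (sink_deleted_graph \<Lambda> v) \<and> path_class \<Lambda> p = path_class \<Lambda> q}"

definition delete_sink ::
  "('m, 'k::finite, 'z) kgraph_data_scheme \<Rightarrow> 'm \<Rightarrow> (('m \<times> 'm list) set, 'k) kgraph_data" where
  "delete_sink \<Lambda> v = \<lparr>
     mor = paths (sink_deleted_graph \<Lambda> v) // sink_rel \<Lambda> v,
     rng = (\<lambda>X. (\<Union>p\<in>X. sink_rel \<Lambda> v `` {(path_rng p, [])})),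
     src = (\<lambda>X. (\<Union>p\<in>X. sink_rel \<Lambda> v `` {(path_src (sink_deleted_graph \<Lambda> v) p, [])})),
     cmp = (\<lambda>X Y. (\<Union>p\<in>X. \<Union>q\<in>Y. sink_rel \<Lambda> v `` {path_concat p q})),
     deg = (\<lambda>X. the_elem (path_deg (sink_deleted_graph \<Lambda> v) ` X))\<rparr>"


section \<open>C*-algebras\<close>

text \<open>
  Complex vector spaces are modules over \<open>complex_ring\<close> below. C*-algebras need
  not be unital: the component \<open>one\<close> inherited from the ring record carries no information.
\<close>

record 'a cstar = "(complex, 'a) module" +
  star :: "'a \<Rightarrow> 'a"
  cnorm :: "'a \<Rightarrow> real"

definition complex_ring :: "complex ring" where
  "complex_ring = \<lparr>carrier = UNIV, mult = (*), one = 1, zero = 0, add = (+)\<rparr>"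

abbreviation complex_vector_space :: "(complex, 'a, 'z) module_scheme \<Rightarrow> bool" where
  "complex_vector_space X \<equiv> module complex_ring X"

text \<open>Completeness of \<open>X\<close> in the metric induced by a norm \<open>N\<close>.\<close>

definition complete_for :: "('a, 'z) ring_scheme \<Rightarrow> ('a \<Rightarrow> real) \<Rightarrow> bool" where
  "complete_for X N \<longleftrightarrow>
     (\<forall>s :: nat \<Rightarrow> 'a. (\<forall>n. s n \<in> carrier X) \<and>
         (\<forall>e>0. \<exists>n\<^sub>0. \<forall>m\<ge>n\<^sub>0. \<forall>n\<ge>n\<^sub>0. N (s m \<ominus>\<^bsub>X\<^esub> s n) < e) \<longrightarrow>
       (\<exists>l\<in>carrier X. (\<lambda>n. N (s n \<ominus>\<^bsub>X\<^esub> l)) \<longlonglongrightarrow> 0))"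

locale cstar_algebra =
  fixes A :: "('a, 'z) cstar_scheme" (structure)
  assumes vector_space: "complex_vector_space A"
    and mult_closed: "\<lbrakk>x \<in> carrier A; y \<in> carrier A\<rbrakk> \<Longrightarrow> x \<otimes> y \<in> carrier A"
    and mult_assoc: "\<lbrakk>x \<in> carrier A; y \<in> carrier A; z \<in> carrier A\<rbrakk>
      \<Longrightarrow> (x \<otimes> y) \<otimes> z = x \<otimes> (y \<otimes> z)"
    and mult_add_left: "\<lbrakk>x \<in> carrier A; y \<in> carrier A; z \<in> carrier A\<rbrakk>
      \<Longrightarrow> (x \<oplus> y) \<otimes> z = (x \<otimes> z) \<oplus> (y \<otimes> z)"
    and mult_add_right: "\<lbrakk>x \<in> carrier A; y \<in> carrier A; z \<in> carrier A\<rbrakk>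
      \<Longrightarrow> x \<otimes> (y \<oplus> z) = (x \<otimes> y) \<oplus> (x \<otimes> z)"
    and smult_mult_left: "\<lbrakk>x \<in> carrier A; y \<in> carrier A\<rbrakk> \<Longrightarrow> (c \<odot> x) \<otimes> y = c \<odot> (x \<otimes> y)"
    and smult_mult_right: "\<lbrakk>x \<in> carrier A; y \<in> carrier A\<rbrakk> \<Longrightarrow> x \<otimes> (c \<odot> y) = c \<odot> (x \<otimes> y)"
    and star_closed: "x \<in> carrier A \<Longrightarrow> star A x \<in> carrier A"
    and star_star: "x \<in> carrier A \<Longrightarrow> star A (star A x) = x"
    and star_add: "\<lbrakk>x \<in> carrier A; y \<in> carrier A\<rbrakk> \<Longrightarrow> star A (x \<oplus> y) = star A x \<oplus> star A y"
    and star_smult: "x \<in> carrier A \<Longrightarrow> star A (c \<odot> x) = cnj c \<odot> star A x"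
    and star_mult: "\<lbrakk>x \<in> carrier A; y \<in> carrier A\<rbrakk> \<Longrightarrow> star A (x \<otimes> y) = star A y \<otimes> star A x"
    and cnorm_nonneg: "x \<in> carrier A \<Longrightarrow> 0 \<le> cnorm A x"
    and cnorm_eq_0: "x \<in> carrier A \<Longrightarrow> cnorm A x = 0 \<longleftrightarrow> x = \<zero>"
    and cnorm_add: "\<lbrakk>x \<in> carrier A; y \<in> carrier A\<rbrakk> \<Longrightarrow> cnorm A (x \<oplus> y) \<le> cnorm A x + cnorm A y"
    and cnorm_smult: "x \<in> carrier A \<Longrightarrow> cnorm A (c \<odot> x) = cmod c * cnorm A x"
    and cnorm_mult: "\<lbrakk>x \<in> carrier A; y \<in> carrier A\<rbrakk> \<Longrightarrow> cnorm A (x \<otimes> y) \<le> cnorm A x * cnorm A y"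
    and cstar_identity: "x \<in> carrier A \<Longrightarrow> cnorm A (star A x \<otimes> x) = (cnorm A x)\<^sup>2"
    and complete: "complete_for A (cnorm A)"

definition star_hom :: "'a cstar \<Rightarrow> 'b cstar \<Rightarrow> ('a \<Rightarrow> 'b) \<Rightarrow> bool" where
  "star_hom A B \<phi> \<longleftrightarrow>
     (\<forall>x\<in>carrier A. \<phi> x \<in> carrier B \<and> \<phi> (star A x) = star B (\<phi> x) \<and>
        (\<forall>c. \<phi> (c \<odot>\<^bsub>A\<^esub> x) = c \<odot>\<^bsub>B\<^esub> \<phi> x) \<and>
        (\<forall>y\<in>carrier A. \<phi> (x \<oplus>\<^bsub>A\<^esub> y) = \<phi> x \<oplus>\<^bsub>B\<^esub> \<phi> y \<and> \<phi> (x \<otimes>\<^bsub>A\<^esub> y) = \<phi> x \<otimes>\<^bsub>B\<^esub> \<phi> y))"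

definition linear_subspace :: "(complex, 'a, 'z) module_scheme \<Rightarrow> 'a set \<Rightarrow> bool" where
  "linear_subspace X S \<longleftrightarrow> S \<subseteq> carrier X \<and> \<zero>\<^bsub>X\<^esub> \<in> S \<and>
     (\<forall>x\<in>S. (\<forall>c. c \<odot>\<^bsub>X\<^esub> x \<in> S) \<and> (\<forall>y\<in>S. x \<oplus>\<^bsub>X\<^esub> y \<in> S))"

definition norm_closed :: "('a, 'z) cstar_scheme \<Rightarrow> 'a set \<Rightarrow> bool" where
  "norm_closed A S \<longleftrightarrow>
     (\<forall>x\<in>carrier A. (\<forall>e>0. \<exists>y\<in>S. cnorm A (x \<ominus>\<^bsub>A\<^esub> y) < e) \<longrightarrow> x \<in> S)"

definition cstar_subalgebra :: "'a cstar \<Rightarrow> 'a set \<Rightarrow> bool" where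
  "cstar_subalgebra A S \<longleftrightarrow> linear_subspace A S \<and> norm_closed A S \<and>
     (\<forall>x\<in>S. star A x \<in> S \<and> (\<forall>y\<in>S. x \<otimes>\<^bsub>A\<^esub> y \<in> S))"

definition generated_by :: "'a cstar \<Rightarrow> 'a set \<Rightarrow> bool" where
  "generated_by A G \<longleftrightarrow> G \<subseteq> carrier A \<and> (\<forall>S. cstar_subalgebra A S \<and> G \<subseteq> S \<longrightarrow> S = carrier A)"

definition is_projection :: "'a cstar \<Rightarrow> 'a \<Rightarrow> bool" where
  "is_projection A p \<longleftrightarrow> p \<in> carrier A \<and> star A p = p \<and> p \<otimes>\<^bsub>A\<^esub> p = p"

definition is_partial_isometry :: "'a cstar \<Rightarrow> 'a \<Rightarrow> bool" where
  "is_partial_isometry A t \<longleftrightarrow> t \<in> carrier A \<and> t \<otimes>\<^bsub>A\<^esub> star A t \<otimes>\<^bsub>A\<^esub> t = t"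

definition is_positive :: "('a, 'z) cstar_scheme \<Rightarrow> 'a \<Rightarrow> bool" where
  "is_positive A a \<longleftrightarrow> (\<exists>c\<in>carrier A. a = star A c \<otimes>\<^bsub>A\<^esub> c)"


section \<open>The C*-algebra of a row-finite source-free k-graph\<close>

definition ck_family ::
  "('m, 'k::finite, 'z) kgraph_data_scheme \<Rightarrow> 'a cstar \<Rightarrow> ('m \<Rightarrow> 'a) \<Rightarrow> ('m \<Rightarrow> 'a) \<Rightarrow> bool" where
  "ck_family \<Lambda> A P T \<longleftrightarrow>
     (\<forall>v\<in>vertices \<Lambda>. is_projection A (P v)) \<and>
     (\<forall>f\<in>edges \<Lambda>. is_partial_isometry A (T f)) \<and>
     (\<forall>v\<in>vertices \<Lambda>. \<forall>w\<in>vertices \<Lambda>. v \<noteq> w \<longrightarrow> P v \<otimes>\<^bsub>A\<^esub> P w = \<zero>\<^bsub>A\<^esub>) \<and>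
     (\<forall>a\<in>edges \<Lambda>. \<forall>b\<in>edges \<Lambda>. \<forall>f\<in>edges \<Lambda>. \<forall>g\<in>edges \<Lambda>.
        src \<Lambda> a = rng \<Lambda> f \<and> src \<Lambda> g = rng \<Lambda> b \<and> cmp \<Lambda> a f = cmp \<Lambda> g b \<longrightarrow>
        T a \<otimes>\<^bsub>A\<^esub> T f = T g \<otimes>\<^bsub>A\<^esub> T b) \<and>
     (\<forall>f\<in>edges \<Lambda>. star A (T f) \<otimes>\<^bsub>A\<^esub> T f = P (src \<Lambda> f)) \<and>
     (\<forall>v\<in>vertices \<Lambda>. \<forall>i.
        P v = (\<Oplus>\<^bsub>A\<^esub>f\<in>{f \<in> edges \<Lambda>. rng \<Lambda> f = v \<and> deg \<Lambda> f = axis i 1}. T f \<otimes>\<^bsub>A\<^esub> star A (T f)))"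

text \<open>
  \<open>A\<close> is (a copy of) C*(\<open>\<Lambda>\<close>). HOL cannot quantify over all types inside a formula, so the target \<open>D\<close>
  of the universal property ranges over the C*-algebras whose underlying set is a set of reals
  (the operations and the norm on it being arbitrary). This loses nothing: by countability of \<open>\<Lambda>\<close>,
  the C*-algebra generated by a Cuntz-Krieger family is separable, hence has at most continuum many
  elements and is isomorphic to one of these. Uniqueness of \<open>\<phi>\<close> on the carrier follows from
  \<open>generated_by\<close>.
\<close>

definition is_universal_ck ::
  "('m, 'k::finite, 'z) kgraph_data_scheme \<Rightarrow> 'a cstar \<Rightarrow> ('m \<Rightarrow> 'a) \<Rightarrow> ('m \<Rightarrow> 'a) \<Rightarrow> bool" where
  "is_universal_ck \<Lambda> A P T \<longleftrightarrow>
     cstar_algebra A \<and> ck_family \<Lambda> A P T \<and>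
     generated_by A (P ` vertices \<Lambda> \<union> T ` edges \<Lambda>) \<and>
     (\<forall>(D :: real cstar) Q U. cstar_algebra D \<and> ck_family \<Lambda> D Q U \<longrightarrow>
        (\<exists>\<phi>. star_hom A D \<phi> \<and> (\<forall>v\<in>vertices \<Lambda>. \<phi> (P v) = Q v) \<and> (\<forall>f\<in>edges \<Lambda>. \<phi> (T f) = U f)))"

definition is_kgraph_cstar_algebra ::
  "('m, 'k::finite, 'z) kgraph_data_scheme \<Rightarrow> 'a cstar \<Rightarrow> bool" where
  "is_kgraph_cstar_algebra \<Lambda> A \<longleftrightarrow> (\<exists>P T. is_universal_ck \<Lambda> A P T)"


section \<open>Morita equivalence\<close>

record ('a, 'b, 'x) bimodule = "(complex, 'x) module" +
  lact :: "'a \<Rightarrow> 'x \<Rightarrow> 'x"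
  ract :: "'x \<Rightarrow> 'b \<Rightarrow> 'x"
  linner :: "'x \<Rightarrow> 'x \<Rightarrow> 'a"
  rinner :: "'x \<Rightarrow> 'x \<Rightarrow> 'b"

text \<open>The closed linear span of \<open>G\<close> is the whole algebra.\<close>

definition densely_spanned_by :: "'a cstar \<Rightarrow> 'a set \<Rightarrow> bool" where
  "densely_spanned_by A G \<longleftrightarrow>
     (\<forall>S. linear_subspace A S \<and> norm_closed A S \<and> G \<subseteq> S \<longrightarrow> S = carrier A)"

locale full_right_hilbert_module =
  fixes B :: "'b cstar" and X :: "('a, 'b, 'x) bimodule"
  assumes right_vector_space: "complex_vector_space X"
    and ract_closed: "\<lbrakk>x \<in> carrier X; b \<in> carrier B\<rbrakk> \<Longrightarrow> ract X x b \<in> carrier X"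
    and ract_add_left: "\<lbrakk>x \<in> carrier X; y \<in> carrier X; b \<in> carrier B\<rbrakk>
      \<Longrightarrow> ract X (x \<oplus>\<^bsub>X\<^esub> y) b = ract X x b \<oplus>\<^bsub>X\<^esub> ract X y b"
    and ract_add_right: "\<lbrakk>x \<in> carrier X; b \<in> carrier B; c \<in> carrier B\<rbrakk>
      \<Longrightarrow> ract X x (b \<oplus>\<^bsub>B\<^esub> c) = ract X x b \<oplus>\<^bsub>X\<^esub> ract X x c"
    and ract_mult: "\<lbrakk>x \<in> carrier X; b \<in> carrier B; c \<in> carrier B\<rbrakk>
      \<Longrightarrow> ract X x (b \<otimes>\<^bsub>B\<^esub> c) = ract X (ract X x b) c"
    and ract_smult_left: "\<lbrakk>x \<in> carrier X; b \<in> carrier B\<rbrakk>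
      \<Longrightarrow> ract X (z \<odot>\<^bsub>X\<^esub> x) b = z \<odot>\<^bsub>X\<^esub> ract X x b"
    and ract_smult_right: "\<lbrakk>x \<in> carrier X; b \<in> carrier B\<rbrakk>
      \<Longrightarrow> ract X x (z \<odot>\<^bsub>B\<^esub> b) = z \<odot>\<^bsub>X\<^esub> ract X x b"
    and rinner_closed: "\<lbrakk>x \<in> carrier X; y \<in> carrier X\<rbrakk> \<Longrightarrow> rinner X x y \<in> carrier B"
    and rinner_add: "\<lbrakk>x \<in> carrier X; y \<in> carrier X; w \<in> carrier X\<rbrakk>
      \<Longrightarrow> rinner X x (y \<oplus>\<^bsub>X\<^esub> w) = rinner X x y \<oplus>\<^bsub>B\<^esub> rinner X x w"
    and rinner_smult: "\<lbrakk>x \<in> carrier X; y \<in> carrier X\<rbrakk>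
      \<Longrightarrow> rinner X x (z \<odot>\<^bsub>X\<^esub> y) = z \<odot>\<^bsub>B\<^esub> rinner X x y"
    and rinner_ract: "\<lbrakk>x \<in> carrier X; y \<in> carrier X; b \<in> carrier B\<rbrakk>
      \<Longrightarrow> rinner X x (ract X y b) = rinner X x y \<otimes>\<^bsub>B\<^esub> b"
    and rinner_star: "\<lbrakk>x \<in> carrier X; y \<in> carrier X\<rbrakk> \<Longrightarrow> star B (rinner X x y) = rinner X y x"
    and rinner_positive: "x \<in> carrier X \<Longrightarrow> is_positive B (rinner X x x)"
    and rinner_definite: "\<lbrakk>x \<in> carrier X; rinner X x x = \<zero>\<^bsub>B\<^esub>\<rbrakk> \<Longrightarrow> x = \<zero>\<^bsub>X\<^esub>"
    and right_complete: "complete_for X (\<lambda>x. sqrt (cnorm B (rinner X x x)))"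
    and right_full: "densely_spanned_by B {rinner X x y | x y. x \<in> carrier X \<and> y \<in> carrier X}"

locale full_left_hilbert_module =
  fixes A :: "'a cstar" and X :: "('a, 'b, 'x) bimodule"
  assumes left_vector_space: "complex_vector_space X"
    and lact_closed: "\<lbrakk>a \<in> carrier A; x \<in> carrier X\<rbrakk> \<Longrightarrow> lact X a x \<in> carrier X"
    and lact_add_right: "\<lbrakk>a \<in> carrier A; x \<in> carrier X; y \<in> carrier X\<rbrakk>
      \<Longrightarrow> lact X a (x \<oplus>\<^bsub>X\<^esub> y) = lact X a x \<oplus>\<^bsub>X\<^esub> lact X a y"
    and lact_add_left: "\<lbrakk>a \<in> carrier A; c \<in> carrier A; x \<in> carrier X\<rbrakk>
      \<Longrightarrow> lact X (a \<oplus>\<^bsub>A\<^esub> c) x = lact X a x \<oplus>\<^bsub>X\<^esub> lact X c x"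
    and lact_mult: "\<lbrakk>a \<in> carrier A; c \<in> carrier A; x \<in> carrier X\<rbrakk>
      \<Longrightarrow> lact X (a \<otimes>\<^bsub>A\<^esub> c) x = lact X a (lact X c x)"
    and lact_smult_right: "\<lbrakk>a \<in> carrier A; x \<in> carrier X\<rbrakk>
      \<Longrightarrow> lact X a (z \<odot>\<^bsub>X\<^esub> x) = z \<odot>\<^bsub>X\<^esub> lact X a x"
    and lact_smult_left: "\<lbrakk>a \<in> carrier A; x \<in> carrier X\<rbrakk>
      \<Longrightarrow> lact X (z \<odot>\<^bsub>A\<^esub> a) x = z \<odot>\<^bsub>X\<^esub> lact X a x"
    and linner_closed: "\<lbrakk>x \<in> carrier X; y \<in> carrier X\<rbrakk> \<Longrightarrow> linner X x y \<in> carrier A"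
    and linner_add: "\<lbrakk>x \<in> carrier X; y \<in> carrier X; w \<in> carrier X\<rbrakk>
      \<Longrightarrow> linner X (x \<oplus>\<^bsub>X\<^esub> y) w = linner X x w \<oplus>\<^bsub>A\<^esub> linner X y w"
    and linner_smult: "\<lbrakk>x \<in> carrier X; y \<in> carrier X\<rbrakk>
      \<Longrightarrow> linner X (z \<odot>\<^bsub>X\<^esub> x) y = z \<odot>\<^bsub>A\<^esub> linner X x y"
    and linner_lact: "\<lbrakk>a \<in> carrier A; x \<in> carrier X; y \<in> carrier X\<rbrakk>
      \<Longrightarrow> linner X (lact X a x) y = a \<otimes>\<^bsub>A\<^esub> linner X x y"
    and linner_star: "\<lbrakk>x \<in> carrier X; y \<in> carrier X\<rbrakk> \<Longrightarrow> star A (linner X x y) = linner X y x"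
    and linner_positive: "x \<in> carrier X \<Longrightarrow> is_positive A (linner X x x)"
    and linner_definite: "\<lbrakk>x \<in> carrier X; linner X x x = \<zero>\<^bsub>A\<^esub>\<rbrakk> \<Longrightarrow> x = \<zero>\<^bsub>X\<^esub>"
    and left_complete: "complete_for X (\<lambda>x. sqrt (cnorm A (linner X x x)))"
    and left_full: "densely_spanned_by A {linner X x y | x y. x \<in> carrier X \<and> y \<in> carrier X}"

locale imprimitivity_bimodule =
  full_left_hilbert_module A X + full_right_hilbert_module B X
  for A :: "'a cstar" and B :: "'b cstar" and X :: "('a, 'b, 'x) bimodule" +
  assumes lact_ract: "\<lbrakk>a \<in> carrier A; x \<in> carrier X; b \<in> carrier B\<rbrakk>
      \<Longrightarrow> ract X (lact X a x) b = lact X a (ract X x b)"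
    and rinner_lact: "\<lbrakk>a \<in> carrier A; x \<in> carrier X; y \<in> carrier X\<rbrakk>
      \<Longrightarrow> rinner X (lact X a x) y = rinner X x (lact X (star A a) y)"
    and linner_ract: "\<lbrakk>x \<in> carrier X; y \<in> carrier X; b \<in> carrier B\<rbrakk>
      \<Longrightarrow> linner X (ract X x b) y = linner X x (ract X y (star B b))"
    and inner_compat: "\<lbrakk>x \<in> carrier X; y \<in> carrier X; w \<in> carrier X\<rbrakk>
      \<Longrightarrow> lact X (linner X x y) w = ract X x (rinner X y w)"

text \<open>
  Morita equivalence in the sense of Rieffel. The underlying set of the bimodule is taken inside
  \<open>'a \<times> 'b\<close>, which is no restriction: an imprimitivity bimodule \<open>X\<close> is the closure of the span of
  \<open>A\<cdot>Y\<close> for some \<open>Y \<subseteq> X\<close> with at most as many elements as a dense subset of \<open>B\<close> (up to a countable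
  factor), so for nonzero \<open>X\<close> it has at most \<open>|A| \<cdot> |B|\<close> elements, because a nonzero Banach space
  has as many elements as it has sequences.
\<close>

definition morita_equivalent :: "'a cstar \<Rightarrow> 'b cstar \<Rightarrow> bool" where
  "morita_equivalent A B \<longleftrightarrow>
     (\<exists>X :: ('a, 'b, 'a \<times> 'b) bimodule. imprimitivity_bimodule A B X)"

end

theory Submission
  imports Defs "HOL-Analysis.Abstract_Topology_2"
begin

text \<open>
  Suppose that no edge of colour \<open>i\<close> starts at \<open>v\<close>. By the factorization rule no edge of colour \<open>i\<close> starts
  at any vertex reachable from \<open>v\<close>: every colour-\<open>i\<close> edge has its source among the remaining
  vertices. By (CK4) for the colour \<open>i\<close>, each \<open>P\<^sub>w\<close> is a sum of elements \<open>T\<^sub>h T\<^sub>h\<^sup>*\<close> factoring through remaining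
  vertices, so the corner of \<open>C\<^sup>*(\<Lambda>)\<close> cut out by them is full. It is the image of the canonical map
  \<open>\<phi>\<close> from \<open>C\<^sup>*(\<Lambda>\<^sub>S)\<close>, because \<open>T\<^sub>f\<^sup>* a T\<^sub>h\<close> lies in that image for every \<open>a\<close> and all \<open>f, h\<close> of colour \<open>i\<close>.

  Injectivity of \<open>\<phi>\<close>, usually deduced from the gauge-invariant uniqueness theorem, is obtained here
  from an explicit left inverse: the matrices \<open>(T\<^sub>f\<^sup>* a T\<^sub>h)\<close> can be written down over \<open>C\<^sup>*(\<Lambda>\<^sub>S)\<close> for each
  generator \<open>a\<close> of \<open>C\<^sup>*(\<Lambda>)\<close> and form a Cuntz-Krieger \<open>\<Lambda>\<close>-family, so universality yields a homomorphism
  \<open>\<psi>\<close> from \<open>C\<^sup>*(\<Lambda>)\<close> to a matrix algebra; compressing \<open>\<psi> (\<phi> b)\<close> by the column with entries \<open>U\<^sub>f\<^sup>*\<close>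
  returns \<open>b\<close>, whence \<open>\<phi>\<close> is isometric.
\<close>

section \<open>Pre-C*-algebras\<close>

text \<open>Two obstacles shape the construction. Infinitely many vertices may remain, so in general
  neither the sum of their projections nor the column with entries \<open>U\<^sub>f\<^sup>*\<close>
  is an element of the algebra concerned. The former is replaced by approximate units, the latter by
  truncations to finite sets of vertices; a truncation undoes the map only on elements supported
  there, and these are dense. Moreover, universality speaks only of targets carried by sets of
  reals, whereas the matrix algebra is a completed operator algebra; the passage goes through a
  separable subalgebra whose elements are coded by reals.

  The analysis rests on one device. For k of norm at most 1 the recursion w -> (k + w^2)/2 converges
  to a solution of 2w = k + w^2, that is, of (1 - w)^2 = 1 - k. The recursion mentions no unit and
  stays in closed subalgebras, and homomorphisms preserve the limit equation. Square roots,
  positivity of \<open>star A x \<otimes> x\<close>, the Cauchy-Schwarz inequality and contractivity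
  of homomorphisms are all drawn from it, without spectral theory.\<close>

lemma carrier_complex_ring [simp]: "carrier complex_ring = UNIV"
  by (simp add: complex_ring_def)

lemma complex_ring_simps [simp]:
  "x \<otimes>\<^bsub>complex_ring\<^esub> y = x * y" "x \<oplus>\<^bsub>complex_ring\<^esub> y = x + y"
  "\<one>\<^bsub>complex_ring\<^esub> = 1" "\<zero>\<^bsub>complex_ring\<^esub> = 0"
  by (simp_all add: complex_ring_def)

lemma cring_complex_ring: "cring complex_ring"
proof (rule cringI)
  show "abelian_group complex_ring"
    by (rule abelian_groupI) (auto simp: algebra_simps intro: exI[of _ "- x" for x])
  show "Group.comm_monoid complex_ring"
    by (rule comm_monoidI) (auto simp: algebra_simps)
qed (auto simp: algebra_simps)

text \<open>Additive inverses are supplied by multiplication with -1, so a structure with pointwise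
  operations needs no inverse of its own.\<close>

lemma complex_vector_spaceI:
  fixes X (structure)
  assumes "\<And>x y. x \<in> carrier X \<Longrightarrow> y \<in> carrier X \<Longrightarrow> x \<oplus> y \<in> carrier X"
    and "\<zero> \<in> carrier X"
    and "\<And>x y z. x \<in> carrier X \<Longrightarrow> y \<in> carrier X \<Longrightarrow> z \<in> carrier X \<Longrightarrow> (x \<oplus> y) \<oplus> z = x \<oplus> (y \<oplus> z)"
    and "\<And>x y. x \<in> carrier X \<Longrightarrow> y \<in> carrier X \<Longrightarrow> x \<oplus> y = y \<oplus> x"
    and "\<And>x. x \<in> carrier X \<Longrightarrow> \<zero> \<oplus> x = x"
    and smult_closed: "\<And>c x. x \<in> carrier X \<Longrightarrow> c \<odot>\<^bsub>X\<^esub> x \<in> carrier X"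
    and add_l: "\<And>c d x. x \<in> carrier X \<Longrightarrow> (c + d) \<odot>\<^bsub>X\<^esub> x = c \<odot>\<^bsub>X\<^esub> x \<oplus> d \<odot>\<^bsub>X\<^esub> x"
    and "\<And>c x y. x \<in> carrier X \<Longrightarrow> y \<in> carrier X \<Longrightarrow> c \<odot>\<^bsub>X\<^esub> (x \<oplus> y) = c \<odot>\<^bsub>X\<^esub> x \<oplus> c \<odot>\<^bsub>X\<^esub> y"
    and "\<And>c d x. x \<in> carrier X \<Longrightarrow> (c * d) \<odot>\<^bsub>X\<^esub> x = c \<odot>\<^bsub>X\<^esub> (d \<odot>\<^bsub>X\<^esub> x)"
    and one: "\<And>x. x \<in> carrier X \<Longrightarrow> 1 \<odot>\<^bsub>X\<^esub> x = x"
    and zero: "\<And>x. x \<in> carrier X \<Longrightarrow> 0 \<odot>\<^bsub>X\<^esub> x = \<zero>"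
  shows "complex_vector_space X"
proof (rule moduleI)
  show "abelian_group X"
  proof (rule abelian_groupI)
    fix x assume x: "x \<in> carrier X"
    show "\<exists>y\<in>carrier X. y \<oplus> x = \<zero>"
      using add_l[OF x, of "-1" 1] one[OF x] zero[OF x] smult_closed[OF x, of "-1"] by auto
  qed (use assms in auto)
qed (use assms cring_complex_ring in auto)

text \<open>The iteration \<open>sqrt_iter\<close> below, run in the real numbers with k = 1. It
  increases to 1, the double root of t = (1 + t^2)/2, and majorizes both the norms and the
  increments of the iteration in any C*-algebra.\<close>

primrec sqrt_bound :: "nat \<Rightarrow> real" where
  "sqrt_bound 0 = 0"
| "sqrt_bound (Suc n) = (1 + (sqrt_bound n)\<^sup>2) / 2"

lemma sqrt_bound_nonneg [simp]: "0 \<le> sqrt_bound n"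
  by (induction n) auto

lemma sqrt_bound_le_1: "sqrt_bound n \<le> 1"
  by (induction n) (auto simp: power2_eq_square mult_le_one)

lemma sqrt_bound_mono: "sqrt_bound n \<le> sqrt_bound (Suc n)"
proof -
  have "0 \<le> (1 - sqrt_bound n)\<^sup>2" by simp
  then show ?thesis by (simp add: power2_eq_square algebra_simps)
qed

lemma sqrt_bound_LIMSEQ: "sqrt_bound \<longlonglongrightarrow> 1"
proof -
  obtain L where L: "sqrt_bound \<longlonglongrightarrow> L"
    using incseq_convergent[of sqrt_bound 1] sqrt_bound_le_1 sqrt_bound_mono
    by (metis incseq_SucI)
  have "(\<lambda>n. sqrt_bound (Suc n)) \<longlonglongrightarrow> (1 + L\<^sup>2) / 2"
    unfolding sqrt_bound.simps by (intro tendsto_intros L) auto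
  then have "L = (1 + L\<^sup>2) / 2" using LIMSEQ_Suc[OF L] LIMSEQ_unique by blast
  then have "(L - 1)\<^sup>2 = 0" by (simp add: power2_eq_square algebra_simps)
  then show ?thesis using L by simp
qed

text \<open>Definiteness of the norm and completeness are left out, because Cauchy sequences carry
  only a seminorm and completeness of the adjointable operators is not established. C*-algebras
  arise from these structures by completing and dividing out the elements of norm zero.\<close>

locale pre_cstar_algebra =
  fixes A :: "('a, 'z) cstar_scheme" (structure)
  assumes vector_space: "complex_vector_space A"
    and mult_closed [simp, intro]: "\<lbrakk>x \<in> carrier A; y \<in> carrier A\<rbrakk> \<Longrightarrow> x \<otimes> y \<in> carrier A"
    and mult_assoc: "\<lbrakk>x \<in> carrier A; y \<in> carrier A; z \<in> carrier A\<rbrakk>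
      \<Longrightarrow> (x \<otimes> y) \<otimes> z = x \<otimes> (y \<otimes> z)"
    and mult_add_left: "\<lbrakk>x \<in> carrier A; y \<in> carrier A; z \<in> carrier A\<rbrakk>
      \<Longrightarrow> (x \<oplus> y) \<otimes> z = (x \<otimes> z) \<oplus> (y \<otimes> z)"
    and mult_add_right: "\<lbrakk>x \<in> carrier A; y \<in> carrier A; z \<in> carrier A\<rbrakk>
      \<Longrightarrow> x \<otimes> (y \<oplus> z) = (x \<otimes> y) \<oplus> (x \<otimes> z)"
    and smult_mult_left: "\<lbrakk>x \<in> carrier A; y \<in> carrier A\<rbrakk> \<Longrightarrow> (c \<odot> x) \<otimes> y = c \<odot> (x \<otimes> y)"
    and smult_mult_right: "\<lbrakk>x \<in> carrier A; y \<in> carrier A\<rbrakk> \<Longrightarrow> x \<otimes> (c \<odot> y) = c \<odot> (x \<otimes> y)"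
    and star_closed [simp, intro]: "x \<in> carrier A \<Longrightarrow> star A x \<in> carrier A"
    and star_star [simp]: "x \<in> carrier A \<Longrightarrow> star A (star A x) = x"
    and star_add: "\<lbrakk>x \<in> carrier A; y \<in> carrier A\<rbrakk> \<Longrightarrow> star A (x \<oplus> y) = star A x \<oplus> star A y"
    and star_smult: "x \<in> carrier A \<Longrightarrow> star A (c \<odot> x) = cnj c \<odot> star A x"
    and star_mult: "\<lbrakk>x \<in> carrier A; y \<in> carrier A\<rbrakk> \<Longrightarrow> star A (x \<otimes> y) = star A y \<otimes> star A x"
    and cnorm_nonneg [simp]: "x \<in> carrier A \<Longrightarrow> 0 \<le> cnorm A x"
    and cnorm_zero [simp]: "cnorm A \<zero> = 0"
    and cnorm_add: "\<lbrakk>x \<in> carrier A; y \<in> carrier A\<rbrakk> \<Longrightarrow> cnorm A (x \<oplus> y) \<le> cnorm A x + cnorm A y"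
    and cnorm_smult: "x \<in> carrier A \<Longrightarrow> cnorm A (c \<odot> x) = cmod c * cnorm A x"
    and cnorm_mult: "\<lbrakk>x \<in> carrier A; y \<in> carrier A\<rbrakk> \<Longrightarrow> cnorm A (x \<otimes> y) \<le> cnorm A x * cnorm A y"
    and cstar_identity: "x \<in> carrier A \<Longrightarrow> cnorm A (star A x \<otimes> x) = (cnorm A x)\<^sup>2"

sublocale pre_cstar_algebra \<subseteq> abelian_group A
  using vector_space by (simp add: module_def)

sublocale cstar_algebra \<subseteq> pre_cstar_algebra
proof -
  interpret m: module complex_ring A by (rule vector_space)
  show "pre_cstar_algebra A"
    by unfold_locales (auto simp: vector_space mult_closed mult_assoc mult_add_left mult_add_right
      smult_mult_left smult_mult_right star_closed star_star star_add star_smult star_mult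
      cnorm_nonneg cnorm_add cnorm_smult cnorm_mult cstar_identity cnorm_eq_0)
qed

context pre_cstar_algebra
begin

lemma smult_closed [simp, intro]: "x \<in> carrier A \<Longrightarrow> c \<odot> x \<in> carrier A"
  using module.smult_closed[OF vector_space] by simp

lemma smult_add_left: "x \<in> carrier A \<Longrightarrow> (c + d) \<odot> x = c \<odot> x \<oplus> d \<odot> x"
  using module.smult_l_distr[OF vector_space] by simp

lemma smult_add_right: "x \<in> carrier A \<Longrightarrow> y \<in> carrier A \<Longrightarrow> c \<odot> (x \<oplus> y) = c \<odot> x \<oplus> c \<odot> y"
  using module.smult_r_distr[OF vector_space] by simp

lemma smult_smult: "x \<in> carrier A \<Longrightarrow> c \<odot> (d \<odot> x) = (c * d) \<odot> x"
  using module.smult_assoc1[OF vector_space, of c d x] by simp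

lemma smult_one [simp]: "x \<in> carrier A \<Longrightarrow> 1 \<odot> x = x"
  using module.smult_one[OF vector_space] by simp

lemma smult_zero_left [simp]: "x \<in> carrier A \<Longrightarrow> 0 \<odot> x = \<zero>"
  using module.smult_l_null[OF vector_space] by simp

lemma smult_zero_right [simp]: "c \<odot> \<zero> = \<zero>"
  using module.smult_r_null[OF vector_space] by simp

lemma smult_minus_one: "x \<in> carrier A \<Longrightarrow> (-1) \<odot> x = \<ominus> x"
  using smult_add_left[of x "-1" 1] by (simp add: minus_equality)

lemma smult_minus_left: "x \<in> carrier A \<Longrightarrow> (- c) \<odot> x = \<ominus> (c \<odot> x)"
  using smult_minus_one[of "c \<odot> x"] by (simp add: smult_smult)

lemma smult_minus_right: "x \<in> carrier A \<Longrightarrow> c \<odot> (\<ominus> x) = \<ominus> (c \<odot> x)"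
  using smult_minus_one[of "c \<odot> x"] smult_minus_one[of x] by (metis mult.commute smult_closed smult_smult)

lemma smult_diff_right:
  "x \<in> carrier A \<Longrightarrow> y \<in> carrier A \<Longrightarrow> c \<odot> (x \<ominus> y) = c \<odot> x \<ominus> c \<odot> y"
  by (simp add: minus_eq smult_add_right smult_minus_right)

lemma l_null [simp]: "x \<in> carrier A \<Longrightarrow> \<zero> \<otimes> x = \<zero>"
  by (metis smult_mult_left smult_zero_left zero_closed mult_closed)

lemma r_null [simp]: "x \<in> carrier A \<Longrightarrow> x \<otimes> \<zero> = \<zero>"
  by (metis smult_mult_right smult_zero_left zero_closed mult_closed)

lemma l_minus: "x \<in> carrier A \<Longrightarrow> y \<in> carrier A \<Longrightarrow> (\<ominus> x) \<otimes> y = \<ominus> (x \<otimes> y)"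
  by (metis smult_minus_one smult_mult_left mult_closed)

lemma r_minus: "x \<in> carrier A \<Longrightarrow> y \<in> carrier A \<Longrightarrow> x \<otimes> (\<ominus> y) = \<ominus> (x \<otimes> y)"
  by (metis smult_minus_one smult_mult_right mult_closed)

lemma minus_zero [simp]: "\<ominus> \<zero> = \<zero>"
  using minus_equality[of \<zero> \<zero>] by simp

text \<open>Registers the laws of a ring without commutativity and, so far, without unit for the
  \<open>algebra\<close> method. Scalar multiples are atoms for it, so scalars are moved by separate
  rewriting.\<close>

lemmas algebra_simprules
  [algebra ring "zero A" "add A" "a_inv A" "a_minus A" "one A" "mult A"] =
  a_closed zero_closed a_inv_closed minus_closed mult_closed smult_closed star_closed
  a_assoc l_zero l_neg a_comm mult_assoc mult_add_left minus_eq
  r_zero r_neg r_neg2 r_neg1 minus_add minus_minus minus_zero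
  a_lcomm mult_add_right l_null r_null l_minus r_minus

lemma diff_self [simp]: "x \<in> carrier A \<Longrightarrow> x \<ominus> x = \<zero>"
  by (simp add: minus_eq r_neg)

lemma diff_zero [simp]: "x \<in> carrier A \<Longrightarrow> x \<ominus> \<zero> = x"
  by (simp add: minus_eq)

lemma diff_eq_zero: "x \<in> carrier A \<Longrightarrow> y \<in> carrier A \<Longrightarrow> x \<ominus> y = \<zero> \<longleftrightarrow> x = y"
  by (simp add: minus_eq) (metis a_inv_closed minus_equality minus_minus r_neg)

lemma star_zero [simp]: "star A \<zero> = \<zero>"
  using star_smult[of \<zero> 0] by simp

lemma star_minus: "x \<in> carrier A \<Longrightarrow> star A (\<ominus> x) = \<ominus> (star A x)"
  using star_smult[of x "-1"] by (simp add: smult_minus_one)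

lemma star_diff: "x \<in> carrier A \<Longrightarrow> y \<in> carrier A \<Longrightarrow> star A (x \<ominus> y) = star A x \<ominus> star A y"
  by (simp add: minus_eq star_add star_minus)

lemma cnorm_minus [simp]: "x \<in> carrier A \<Longrightarrow> cnorm A (\<ominus> x) = cnorm A x"
  using cnorm_smult[of x "-1"] by (simp add: smult_minus_one)

lemma cnorm_diff_commute: "x \<in> carrier A \<Longrightarrow> y \<in> carrier A \<Longrightarrow> cnorm A (x \<ominus> y) = cnorm A (y \<ominus> x)"
proof -
  assume a: "x \<in> carrier A" "y \<in> carrier A"
  then have "x \<ominus> y = \<ominus> (y \<ominus> x)" by algebra
  then show ?thesis using a by simp
qed

lemma cnorm_diff_triangle:
  assumes "x \<in> carrier A" "y \<in> carrier A" "z \<in> carrier A"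
  shows "cnorm A (x \<ominus> z) \<le> cnorm A (x \<ominus> y) + cnorm A (y \<ominus> z)"
proof -
  have "x \<ominus> z = (x \<ominus> y) \<oplus> (y \<ominus> z)" using assms by algebra
  then show ?thesis using assms cnorm_add[of "x \<ominus> y" "y \<ominus> z"] by simp
qed

lemma abs_cnorm_diff:
  assumes "x \<in> carrier A" "y \<in> carrier A"
  shows "\<bar>cnorm A x - cnorm A y\<bar> \<le> cnorm A (x \<ominus> y)"
  using cnorm_diff_triangle[of x y \<zero>] cnorm_diff_triangle[of y x \<zero>] assms
    cnorm_diff_commute[of x y] by simp

text \<open>The C*-identity and submultiplicativity bound |x|^2 by the norm of the adjoint times
  |x|. Cancelling gives one inequality, and applying it to the adjoint gives the other.\<close>

lemma cnorm_star [simp]: "x \<in> carrier A \<Longrightarrow> cnorm A (star A x) = cnorm A x"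
proof -
  have *: "cnorm A x \<le> cnorm A (star A x)" if x: "x \<in> carrier A" for x
  proof (cases "cnorm A x = 0")
    case False
    have "(cnorm A x)\<^sup>2 \<le> cnorm A (star A x) * cnorm A x"
      using cstar_identity[of x] cnorm_mult[of "star A x" x] x by simp
    then have "cnorm A x * cnorm A x \<le> cnorm A (star A x) * cnorm A x"
      by (simp add: power2_eq_square)
    moreover have "cnorm A x > 0" using False x cnorm_nonneg[of x] by linarith
    ultimately show ?thesis by simp
  qed (use x in simp)
  assume "x \<in> carrier A"
  then show ?thesis using *[of x] *[of "star A x"] by simp
qed

lemma cnorm_selfadjoint_square:
  "x \<in> carrier A \<Longrightarrow> star A x = x \<Longrightarrow> cnorm A (x \<otimes> x) = (cnorm A x)\<^sup>2"
  using cstar_identity[of x] by simp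

section \<open>Convergent sequences and closed subalgebras\<close>

definition converges_to :: "(nat \<Rightarrow> 'a) \<Rightarrow> 'a \<Rightarrow> bool" where
  "converges_to s l \<longleftrightarrow> (\<forall>n. s n \<in> carrier A) \<and> l \<in> carrier A \<and> (\<lambda>n. cnorm A (s n \<ominus> l)) \<longlonglongrightarrow> 0"

lemma converges_toD:
  assumes "converges_to s l"
  shows "s n \<in> carrier A" "l \<in> carrier A" "(\<lambda>n. cnorm A (s n \<ominus> l)) \<longlonglongrightarrow> 0"
  using assms by (auto simp: converges_to_def)

lemma converges_toI:
  assumes "\<And>n. s n \<in> carrier A" "l \<in> carrier A" "\<And>n. cnorm A (s n \<ominus> l) \<le> g n" "g \<longlonglongrightarrow> 0"
  shows "converges_to s l"
  unfolding converges_to_def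
  using assms by (auto intro!: tendsto_sandwich[OF _ _ tendsto_const assms(4)])

lemma converges_to_const: "x \<in> carrier A \<Longrightarrow> converges_to (\<lambda>_. x) x"
  by (rule converges_toI[of _ _ "\<lambda>_. 0"]) auto

lemma converges_to_add:
  assumes "converges_to s l" "converges_to t m"
  shows "converges_to (\<lambda>n. s n \<oplus> t n) (l \<oplus> m)"
proof (rule converges_toI[where g = "\<lambda>n. cnorm A (s n \<ominus> l) + cnorm A (t n \<ominus> m)"])
  note c = converges_toD[OF assms(1)] converges_toD[OF assms(2)]
  fix n
  have "(s n \<oplus> t n) \<ominus> (l \<oplus> m) = (s n \<ominus> l) \<oplus> (t n \<ominus> m)"
    using c(1)[of n] c(2) c(4)[of n] c(5) by algebra
  then show "cnorm A (s n \<oplus> t n \<ominus> (l \<oplus> m)) \<le> cnorm A (s n \<ominus> l) + cnorm A (t n \<ominus> m)"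
    using cnorm_add c by auto
qed (use converges_toD[OF assms(1)] converges_toD[OF assms(2)] in \<open>auto intro!: tendsto_add_zero\<close>)

lemma converges_to_smult:
  assumes "converges_to s l"
  shows "converges_to (\<lambda>n. c \<odot> s n) (c \<odot> l)"
proof (rule converges_toI[where g = "\<lambda>n. cmod c * cnorm A (s n \<ominus> l)"])
  note c = converges_toD[OF assms(1)]
  fix n
  show "cnorm A (c \<odot> s n \<ominus> c \<odot> l) \<le> cmod c * cnorm A (s n \<ominus> l)"
    using c by (simp add: smult_diff_right[symmetric] cnorm_smult)
qed (use converges_toD[OF assms(1)] in \<open>auto intro!: tendsto_mult_right_zero\<close>)

lemma converges_to_star:
  assumes "converges_to s l"
  shows "converges_to (\<lambda>n. star A (s n)) (star A l)"
proof (rule converges_toI[where g = "\<lambda>n. cnorm A (s n \<ominus> l)"])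
  note c = converges_toD[OF assms(1)]
  fix n
  show "cnorm A (star A (s n) \<ominus> star A l) \<le> cnorm A (s n \<ominus> l)"
    using c by (simp add: star_diff[symmetric])
qed (use converges_toD[OF assms(1)] in auto)

lemma converges_to_mult:
  assumes "converges_to s l" "converges_to t m"
  shows "converges_to (\<lambda>n. s n \<otimes> t n) (l \<otimes> m)"
\<comment> \<open>The norm of \<open>t n\<close> is replaced by
  \<open>cnorm A (t n \<ominus> m) + cnorm A m\<close>, whose limit is immediate.\<close>
proof (rule converges_toI[where g = "\<lambda>n. cnorm A (s n \<ominus> l) * (cnorm A (t n \<ominus> m) + cnorm A m) + cnorm A l * cnorm A (t n \<ominus> m)"])
  note c = converges_toD[OF assms(1)] converges_toD[OF assms(2)]
  fix n
  have "s n \<otimes> t n \<ominus> l \<otimes> m = (s n \<ominus> l) \<otimes> t n \<oplus> l \<otimes> (t n \<ominus> m)"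
    using c(1)[of n] c(2) c(4)[of n] c(5) by algebra
  moreover have "cnorm A (t n) \<le> cnorm A (t n \<ominus> m) + cnorm A m"
    using abs_cnorm_diff[of "t n" m] c by simp
  then have "cnorm A ((s n \<ominus> l) \<otimes> t n) \<le> cnorm A (s n \<ominus> l) * (cnorm A (t n \<ominus> m) + cnorm A m)"
    using cnorm_mult[of "s n \<ominus> l" "t n"] c by (meson cnorm_nonneg minus_closed mult_left_mono order_trans)
  moreover have "cnorm A (l \<otimes> (t n \<ominus> m)) \<le> cnorm A l * cnorm A (t n \<ominus> m)"
    using cnorm_mult c by simp
  ultimately show "cnorm A (s n \<otimes> t n \<ominus> l \<otimes> m) \<le>
    cnorm A (s n \<ominus> l) * (cnorm A (t n \<ominus> m) + cnorm A m) + cnorm A l * cnorm A (t n \<ominus> m)"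
    using cnorm_add[of "(s n \<ominus> l) \<otimes> t n" "l \<otimes> (t n \<ominus> m)"] c by simp
next
  have "(\<lambda>n. cnorm A (s n \<ominus> l) * (cnorm A (t n \<ominus> m) + cnorm A m) + cnorm A l * cnorm A (t n \<ominus> m))
    \<longlonglongrightarrow> 0 * (0 + cnorm A m) + cnorm A l * 0"
    by (intro tendsto_intros converges_toD[OF assms(1)] converges_toD[OF assms(2)])
  then show "(\<lambda>n. cnorm A (s n \<ominus> l) * (cnorm A (t n \<ominus> m) + cnorm A m) + cnorm A l * cnorm A (t n \<ominus> m))
    \<longlonglongrightarrow> 0" by simp
qed (use converges_toD[OF assms(1)] converges_toD[OF assms(2)] in auto)

lemma converges_to_Suc: "converges_to s l \<Longrightarrow> converges_to (\<lambda>n. s (Suc n)) l"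
  unfolding converges_to_def using LIMSEQ_Suc by auto

lemma converges_to_cnorm: "converges_to s l \<Longrightarrow> (\<lambda>n. cnorm A (s n)) \<longlonglongrightarrow> cnorm A l"
proof -
  assume s: "converges_to s l"
  have "(\<lambda>n. cnorm A (s n) - cnorm A l) \<longlonglongrightarrow> 0"
  proof (rule tendsto_rabs_zero_cancel, rule tendsto_sandwich)
    show "\<forall>\<^sub>F n in sequentially. 0 \<le> \<bar>cnorm A (s n) - cnorm A l\<bar>" by simp
    show "\<forall>\<^sub>F n in sequentially. \<bar>cnorm A (s n) - cnorm A l\<bar> \<le> cnorm A (s n \<ominus> l)"
      using abs_cnorm_diff converges_toD[OF s] by auto
    show "(\<lambda>n. cnorm A (s n \<ominus> l)) \<longlonglongrightarrow> 0" using s by (rule converges_toD)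
  qed auto
  then show ?thesis by (simp add: LIM_zero_iff)
qed

text \<open>Closure under \<open>star\<close> is not demanded, so that the commutant of an arbitrary
  single element qualifies.\<close>

definition closed_subalgebra :: "'a set \<Rightarrow> bool" where
  "closed_subalgebra S \<longleftrightarrow> linear_subspace A S \<and> norm_closed A S \<and> (\<forall>x\<in>S. \<forall>y\<in>S. x \<otimes> y \<in> S)"

lemma approximable_converges:
  assumes "S \<subseteq> carrier A" "x \<in> carrier A" "\<forall>e>0. \<exists>y\<in>S. cnorm A (x \<ominus> y) < e"
  obtains s where "\<And>n. s n \<in> S" "converges_to s x"
proof -
  have "\<forall>n. \<exists>z. z \<in> S \<and> cnorm A (x \<ominus> z) < inverse (real (Suc n))"
    using assms(3) by (metis inverse_positive_iff_positive of_nat_0_less_iff zero_less_Suc)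
  then obtain s where s: "\<And>n. s n \<in> S" "\<And>n. cnorm A (x \<ominus> s n) < inverse (real (Suc n))"
    by metis
  have "converges_to s x"
  proof (rule converges_toI[where g = "\<lambda>n. inverse (real (Suc n))"])
    show "cnorm A (s n \<ominus> x) \<le> inverse (real (Suc n))" for n
      using s[of n] assms cnorm_diff_commute[of x "s n"] by auto
  qed (use s assms in \<open>auto intro: LIMSEQ_inverse_real_of_nat simp del: of_nat_Suc\<close>)
  then show ?thesis using that s by blast
qed

lemma norm_closed_converges:
  assumes "norm_closed A S" "converges_to s l" "\<And>n. s n \<in> S"
  shows "l \<in> S"
proof -
  have "\<exists>y\<in>S. cnorm A (l \<ominus> y) < e" if "e > 0" for e
  proof -
    obtain n where "cnorm A (s n \<ominus> l) < e"
      using order_tendstoD(2)[OF converges_toD(3)[OF assms(2)] \<open>e > 0\<close>]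
      by (auto simp: eventually_sequentially)
    then show ?thesis using assms(3)[of n] cnorm_diff_commute[of "s n" l] converges_toD[OF assms(2)] by auto
  qed
  then show ?thesis using assms(1) converges_toD[OF assms(2)] by (auto simp: norm_closed_def)
qed

lemma closed_subalgebraD:
  assumes "closed_subalgebra S"
  shows "x \<in> S \<Longrightarrow> x \<in> carrier A" "\<zero> \<in> S" "x \<in> S \<Longrightarrow> c \<odot> x \<in> S"
    "x \<in> S \<Longrightarrow> y \<in> S \<Longrightarrow> x \<oplus> y \<in> S" "x \<in> S \<Longrightarrow> y \<in> S \<Longrightarrow> x \<otimes> y \<in> S" "norm_closed A S"
    "x \<in> S \<Longrightarrow> \<ominus> x \<in> S" "x \<in> S \<Longrightarrow> y \<in> S \<Longrightarrow> x \<ominus> y \<in> S"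
proof -
  have *: "x \<in> carrier A \<and> c \<odot> x \<in> S" if "x \<in> S" for x c
    using assms that by (auto simp: closed_subalgebra_def linear_subspace_def)
  then show n: "x \<in> S \<Longrightarrow> \<ominus> x \<in> S" for x by (metis smult_minus_one)
  have a: "x \<in> S \<Longrightarrow> y \<in> S \<Longrightarrow> x \<oplus> y \<in> S" for x y
    using assms by (auto simp: closed_subalgebra_def linear_subspace_def)
  show "x \<in> S \<Longrightarrow> y \<in> S \<Longrightarrow> x \<ominus> y \<in> S" using a n by (auto simp: minus_eq)
qed (use assms in \<open>auto simp: closed_subalgebra_def linear_subspace_def\<close>)

end

context cstar_algebra
begin

lemma converges_to_unique:
  assumes "converges_to s l" "converges_to s m"
  shows "l = m"
proof -
  note c = converges_toD[OF assms(1)] converges_toD[OF assms(2)]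
  have "(\<lambda>n. cnorm A (s n \<ominus> l) + cnorm A (s n \<ominus> m)) \<longlonglongrightarrow> 0 + 0"
    by (intro tendsto_add c)
  moreover have "cnorm A (l \<ominus> m) \<le> cnorm A (s n \<ominus> l) + cnorm A (s n \<ominus> m)" for n
    using cnorm_diff_triangle[of l "s n" m] cnorm_diff_commute[of "s n" l] c by simp
  ultimately have "cnorm A (l \<ominus> m) \<le> 0"
    using LIMSEQ_le_const[of "\<lambda>n. cnorm A (s n \<ominus> l) + cnorm A (s n \<ominus> m)" 0 "cnorm A (l \<ominus> m)"] by auto
  then have "cnorm A (l \<ominus> m) = 0" using c cnorm_nonneg[of "l \<ominus> m"] by (auto simp del: cnorm_nonneg intro: antisym)
  then show ?thesis using c by (simp add: cnorm_eq_0 diff_eq_zero)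
qed

lemma Cauchy_converges:
  assumes "\<And>n. s n \<in> carrier A"
    and "\<And>e. e > 0 \<Longrightarrow> \<exists>n\<^sub>0. \<forall>m\<ge>n\<^sub>0. \<forall>n\<ge>n\<^sub>0. cnorm A (s m \<ominus> s n) < e"
  shows "\<exists>l. converges_to s l"
  using complete assms unfolding complete_for_def converges_to_def by blast

text \<open>An element lying in every closed subalgebra that contains x therefore commutes with
  whatever x commutes with. This is how limits of the iteration and square roots inherit commutation
  relations.\<close>

lemma commutant_closed_subalgebra:
  assumes y: "y \<in> carrier A"
  shows "closed_subalgebra {x \<in> carrier A. x \<otimes> y = y \<otimes> x}"
  unfolding closed_subalgebra_def
proof (intro conjI ballI)
  show "linear_subspace A {x \<in> carrier A. x \<otimes> y = y \<otimes> x}"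
    using y by (auto simp: linear_subspace_def smult_mult_left smult_mult_right mult_add_left mult_add_right)
  show "norm_closed A {x \<in> carrier A. x \<otimes> y = y \<otimes> x}"
    unfolding norm_closed_def
  proof (intro ballI impI)
    fix x assume x: "x \<in> carrier A"
      and *: "\<forall>e>0. \<exists>z\<in>{x \<in> carrier A. x \<otimes> y = y \<otimes> x}. cnorm A (x \<ominus> z) < e"
    obtain s where s: "\<And>n. s n \<in> {x \<in> carrier A. x \<otimes> y = y \<otimes> x}" and c: "converges_to s x"
      using approximable_converges[OF _ x *] by blast
    then have "\<And>n. s n \<otimes> y = y \<otimes> s n" by blast
    show "x \<in> {x \<in> carrier A. x \<otimes> y = y \<otimes> x}"
      using converges_to_unique[OF converges_to_mult[OF c converges_to_const[OF y]], of "y \<otimes> x"]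
        converges_to_mult[OF converges_to_const[OF y] c] \<open>\<And>n. s n \<otimes> y = y \<otimes> s n\<close> x by simp
  qed
  fix a b assume "a \<in> {x \<in> carrier A. x \<otimes> y = y \<otimes> x}" "b \<in> {x \<in> carrier A. x \<otimes> y = y \<otimes> x}"
  then have "a \<otimes> y = y \<otimes> a" "b \<otimes> y = y \<otimes> b" "a \<in> carrier A" "b \<in> carrier A" by auto
  then show "a \<otimes> b \<in> {x \<in> carrier A. x \<otimes> y = y \<otimes> x}"
    using y by simp (metis mult_assoc)
qed

subsection \<open>Square roots by monotone iteration\<close>

text \<open>A fixed point w satisfies 2w = k + w^2, that is (1 - w)^2 = 1 - k once a unit is
  available. Formulated for w instead of the root 1 - w, the recursion makes sense in a nonunital
  algebra and produces polynomials in k without constant term.\<close>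

primrec sqrt_iter :: "'a \<Rightarrow> nat \<Rightarrow> 'a" where
  "sqrt_iter k 0 = \<zero>"
| "sqrt_iter k (Suc n) = (1/2) \<odot> (k \<oplus> sqrt_iter k n \<otimes> sqrt_iter k n)"

lemma sqrt_iter_closed [simp, intro]: "k \<in> carrier A \<Longrightarrow> sqrt_iter k n \<in> carrier A"
  by (induction n) auto

lemma sqrt_iter_in:
  assumes "closed_subalgebra S" "k \<in> S"
  shows "sqrt_iter k n \<in> S"
  by (induction n) (auto intro!: closed_subalgebraD[OF assms(1)] assms(2))

lemma star_sqrt_iter: "k \<in> carrier A \<Longrightarrow> star A k = k \<Longrightarrow> star A (sqrt_iter k n) = sqrt_iter k n"
  by (induction n) (auto simp: star_smult star_add star_mult)

lemma cnorm_sqrt_iter: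
  assumes k: "k \<in> carrier A" "cnorm A k \<le> 1"
  shows "cnorm A (sqrt_iter k n) \<le> sqrt_bound n"
proof (induction n)
  case (Suc n)
  let ?w = "sqrt_iter k n"
  have "cnorm A (k \<oplus> ?w \<otimes> ?w) \<le> cnorm A k + cnorm A ?w * cnorm A ?w"
    using cnorm_add[of k "?w \<otimes> ?w"] cnorm_mult[of ?w ?w] k by auto
  also have "\<dots> \<le> 1 + sqrt_bound n * sqrt_bound n"
    using Suc k by (intro add_mono mult_mono) auto
  finally show ?case using k by (simp add: cnorm_smult power2_eq_square)
qed auto

lemma cnorm_sqrt_iter_diff:
  assumes k: "k \<in> carrier A" "cnorm A k \<le> 1"
  shows "cnorm A (sqrt_iter k (Suc n) \<ominus> sqrt_iter k n) \<le> sqrt_bound (Suc n) - sqrt_bound n"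
proof (induction n)
  case 0
  then show ?case using k by (simp add: cnorm_smult)
next
  case (Suc n)
  define u where "u = sqrt_iter k n"
  define w where "w = sqrt_iter k (Suc n)"
  have c: "u \<in> carrier A" "w \<in> carrier A" using k by (auto simp: u_def w_def simp del: sqrt_iter.simps)
  have "sqrt_iter k (Suc (Suc n)) \<ominus> w = (1/2) \<odot> (k \<oplus> w \<otimes> w) \<ominus> (1/2) \<odot> (k \<oplus> u \<otimes> u)"
    by (simp add: u_def w_def)
  also have "\<dots> = (1/2) \<odot> ((k \<oplus> w \<otimes> w) \<ominus> (k \<oplus> u \<otimes> u))"
    using c k by (simp add: smult_diff_right)
  \<comment> \<open>The difference of squares is split without commuting w and u, so that the
    previous increment appears in both terms.\<close>
  also have "(k \<oplus> w \<otimes> w) \<ominus> (k \<oplus> u \<otimes> u) = w \<otimes> (w \<ominus> u) \<oplus> (w \<ominus> u) \<otimes> u"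
    using c k(1) by algebra
  finally have "cnorm A (sqrt_iter k (Suc (Suc n)) \<ominus> w) =
      cnorm A (w \<otimes> (w \<ominus> u) \<oplus> (w \<ominus> u) \<otimes> u) / 2"
    using c by (simp add: cnorm_smult)
  also have "\<dots> \<le> (cnorm A w * cnorm A (w \<ominus> u) + cnorm A (w \<ominus> u) * cnorm A u) / 2"
    using cnorm_add[of "w \<otimes> (w \<ominus> u)" "(w \<ominus> u) \<otimes> u"] cnorm_mult[of w "w \<ominus> u"]
      cnorm_mult[of "w \<ominus> u" u] c by auto
  also have "\<dots> \<le> (sqrt_bound (Suc n) * (sqrt_bound (Suc n) - sqrt_bound n) +
      (sqrt_bound (Suc n) - sqrt_bound n) * sqrt_bound n) / 2"
    using Suc cnorm_sqrt_iter[OF k, of n] cnorm_sqrt_iter[OF k, of "Suc n"] c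
    unfolding u_def[symmetric] w_def[symmetric]
    by (intro divide_right_mono add_mono mult_mono) (auto simp: sqrt_bound_mono simp del: sqrt_bound.simps)
  \<comment> \<open>With s for \<open>sqrt_bound\<close>, only the last of the five occurrences of
    s(n+1), the subtracted one, is expanded; both sides then equal (s(n+1)^2 - s(n)^2)/2.\<close>
  also have "\<dots> = sqrt_bound (Suc (Suc n)) - sqrt_bound (Suc n)"
    unfolding sqrt_bound.simps(2)[of "Suc n"]
    by (subst (5) sqrt_bound.simps(2)) (simp add: power2_eq_square field_simps del: sqrt_bound.simps)
  finally show ?case by (simp add: w_def)
qed

text \<open>The increments telescope against those of the convergent sequence
  \<open>sqrt_bound\<close>. Hence the iteration converges even for |k| = 1, where no geometric rate
  is available.\<close>

lemma sqrt_iter_converges: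
  assumes k: "k \<in> carrier A" "cnorm A k \<le> 1"
  obtains w where "converges_to (sqrt_iter k) w" "w \<oplus> w = k \<oplus> w \<otimes> w" "cnorm A w \<le> 1"
proof -
  have le: "cnorm A (sqrt_iter k (n + d) \<ominus> sqrt_iter k n) \<le> sqrt_bound (n + d) - sqrt_bound n" for n d
  proof (induction d)
    case (Suc d)
    then show ?case
      using cnorm_diff_triangle[of "sqrt_iter k (Suc (n + d))" "sqrt_iter k (n + d)" "sqrt_iter k n"]
        cnorm_sqrt_iter_diff[OF k, of "n + d"] k by (simp del: sqrt_bound.simps sqrt_iter.simps)
  qed (use k in simp)
  have "\<exists>n\<^sub>0. \<forall>m\<ge>n\<^sub>0. \<forall>n\<ge>n\<^sub>0. cnorm A (sqrt_iter k m \<ominus> sqrt_iter k n) < e" if "e > 0" for e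
  proof -
    have "Cauchy sqrt_bound" using LIMSEQ_imp_Cauchy[OF sqrt_bound_LIMSEQ] .
    then obtain N where N: "\<And>m n. m \<ge> N \<Longrightarrow> n \<ge> N \<Longrightarrow> \<bar>sqrt_bound m - sqrt_bound n\<bar> < e"
      using \<open>e > 0\<close> unfolding Cauchy_def dist_real_def by blast
    have "cnorm A (sqrt_iter k m \<ominus> sqrt_iter k n) < e" if "m \<ge> N" "n \<ge> N" for m n
    proof (cases "n \<le> m")
      case True
      then show ?thesis using le[of n "m - n"] N[OF that] by auto
    next
      case False
      then show ?thesis using le[of m "n - m"] N[OF that] k
          cnorm_diff_commute[of "sqrt_iter k m" "sqrt_iter k n"] by auto
    qed
    then show ?thesis by blast
  qed
  then obtain w where w: "converges_to (sqrt_iter k) w"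
    using Cauchy_converges[of "sqrt_iter k"] k by blast
  have wc: "w \<in> carrier A" using converges_toD[OF w] by simp
  have "w = (1/2) \<odot> (k \<oplus> w \<otimes> w)"
    using converges_to_unique[OF converges_to_Suc[OF w], of "(1/2) \<odot> (k \<oplus> w \<otimes> w)"]
      converges_to_smult[OF converges_to_add[OF converges_to_const[OF k(1)] converges_to_mult[OF w w]], of "1/2"]
    by simp
  then have "w \<oplus> w = (1/2) \<odot> (k \<oplus> w \<otimes> w) \<oplus> (1/2) \<odot> (k \<oplus> w \<otimes> w)" by simp
  also have "\<dots> = k \<oplus> w \<otimes> w" using smult_add_left[of "k \<oplus> w \<otimes> w" "1/2" "1/2"] k wc by simp
  finally have "w \<oplus> w = k \<oplus> w \<otimes> w" .
  moreover have "cnorm A w \<le> 1"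
    using LIMSEQ_le_const2[OF converges_to_cnorm[OF w], of 1] cnorm_sqrt_iter[OF k] sqrt_bound_le_1
    by (meson order_trans)
  ultimately show ?thesis using that w by blast
qed

lemma star_limit:
  assumes "converges_to s l" "\<And>n. star A (s n) = s n"
  shows "star A l = l"
  using converges_to_unique[OF converges_to_star[OF assms(1)]] assms by simp

text \<open>Put w = a + ib. Commutation gives w^* w = a^2 + b^2, and 2a = w + w^* gives |a| <= |w|.
  This stands in for monotonicity of the norm on positive elements until positivity has been
  developed.\<close>

lemma cnorm_commuting_squares:
  assumes "a \<in> carrier A" "b \<in> carrier A" "star A a = a" "star A b = b" "a \<otimes> b = b \<otimes> a"
  shows "(cnorm A a)\<^sup>2 \<le> cnorm A (a \<otimes> a \<oplus> b \<otimes> b)"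
proof -
  define w where "w = a \<oplus> \<i> \<odot> b"
  have w: "w \<in> carrier A" "star A w = a \<ominus> \<i> \<odot> b"
    using assms by (auto simp: w_def star_add star_smult smult_minus_left minus_eq)
  have "star A w \<otimes> w = (a \<ominus> \<i> \<odot> b) \<otimes> (a \<oplus> \<i> \<odot> b)"
    using w by (simp add: w_def)
  also have "\<dots> = a \<otimes> a \<oplus> a \<otimes> (\<i> \<odot> b) \<ominus> ((\<i> \<odot> b) \<otimes> a) \<ominus> (\<i> \<odot> b) \<otimes> (\<i> \<odot> b)"
    using assms(1,2) by algebra
  also have "a \<otimes> (\<i> \<odot> b) = (\<i> \<odot> b) \<otimes> a"
    using assms by (simp add: smult_mult_left smult_mult_right)
  also have "(\<i> \<odot> b) \<otimes> (\<i> \<odot> b) = \<ominus> (b \<otimes> b)"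
    using assms by (simp add: smult_mult_left smult_mult_right smult_smult smult_minus_one)
  also have "a \<otimes> a \<oplus> (\<i> \<odot> b) \<otimes> a \<ominus> (\<i> \<odot> b) \<otimes> a \<ominus> \<ominus> (b \<otimes> b) = a \<otimes> a \<oplus> b \<otimes> b"
    using assms(1,2) by algebra
  finally have *: "(cnorm A w)\<^sup>2 = cnorm A (a \<otimes> a \<oplus> b \<otimes> b)"
    using cstar_identity[of w] w by simp
  have aa: "a \<oplus> a = w \<oplus> star A w" using assms(1,2) unfolding w(2) unfolding w_def by algebra
  have "cnorm A (a \<oplus> a) \<le> 2 * cnorm A w"
    unfolding aa using cnorm_add[of w "star A w"] cnorm_star[of w] w(1) by simp
  moreover have "a \<oplus> a = 2 \<odot> a" using smult_add_left[of a 1 1] assms by simp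
  ultimately have "cnorm A a \<le> cnorm A w" using assms by (simp add: cnorm_smult)
  then show ?thesis using assms by (simp flip: * add: power_mono)
qed

end

section \<open>Positivity in unital C*-algebras\<close>

locale unital_cstar_algebra = cstar_algebra A for A :: "('a, 'z) cstar_scheme" (structure) +
  assumes one_closed [simp, intro]: "\<one> \<in> carrier A"
    and l_one [simp]: "x \<in> carrier A \<Longrightarrow> \<one> \<otimes> x = x"
    and r_one [simp]: "x \<in> carrier A \<Longrightarrow> x \<otimes> \<one> = x"
begin

lemmas one_simprules
  [algebra ring "zero A" "add A" "a_inv A" "a_minus A" "one A" "mult A"] =
  one_closed l_one r_one

lemma minus_eq_zero: "x \<in> carrier A \<Longrightarrow> \<ominus> x = \<zero> \<Longrightarrow> x = \<zero>"
  using r_neg[of x] by simp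

lemma diff_diff_self: "x \<in> carrier A \<Longrightarrow> y \<in> carrier A \<Longrightarrow> x \<ominus> (x \<ominus> y) = y"
  by algebra

lemma star_one [simp]: "star A \<one> = \<one>"
  using star_mult[of "star A \<one>" \<one>] by simp

lemma cnorm_one_le: "cnorm A \<one> \<le> 1"
proof -
  have "cnorm A \<one> = (cnorm A \<one>)\<^sup>2" using cnorm_selfadjoint_square[of \<one>] by simp
  then have "cnorm A \<one> = 0 \<or> cnorm A \<one> = 1" by (simp add: power2_eq_square)
  then show ?thesis by auto
qed

text \<open>The norm characterisation makes closure under sums immediate.\<close>

definition pos :: "'a \<Rightarrow> bool" where
  "pos h \<longleftrightarrow> h \<in> carrier A \<and> star A h = h \<and> (\<exists>t\<ge>0. cnorm A (complex_of_real t \<odot> \<one> \<ominus> h) \<le> t)"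

lemma pos_carrier: "pos h \<Longrightarrow> h \<in> carrier A" and pos_selfadjoint: "pos h \<Longrightarrow> star A h = h"
  by (auto simp: pos_def)

lemma pos_add:
  assumes "pos h" "pos k"
  shows "pos (h \<oplus> k)"
proof -
  obtain s t where s: "s \<ge> 0" "cnorm A (complex_of_real s \<odot> \<one> \<ominus> h) \<le> s"
    and t: "t \<ge> 0" "cnorm A (complex_of_real t \<odot> \<one> \<ominus> k) \<le> t"
    using assms by (auto simp: pos_def)
  note c = pos_carrier[OF assms(1)] pos_carrier[OF assms(2)]
  have "complex_of_real (s + t) \<odot> \<one> \<ominus> (h \<oplus> k) =
      (complex_of_real s \<odot> \<one> \<oplus> complex_of_real t \<odot> \<one>) \<ominus> (h \<oplus> k)"
    by (simp add: smult_add_left)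
  also have "\<dots> = (complex_of_real s \<odot> \<one> \<ominus> h) \<oplus> (complex_of_real t \<odot> \<one> \<ominus> k)"
    using c by algebra
  finally have "cnorm A (complex_of_real (s + t) \<odot> \<one> \<ominus> (h \<oplus> k)) \<le> s + t"
    using cnorm_add[of "complex_of_real s \<odot> \<one> \<ominus> h" "complex_of_real t \<odot> \<one> \<ominus> k"] s t c by simp
  then show ?thesis unfolding pos_def
    using s t c assms by (auto simp: star_add pos_selfadjoint intro!: exI[of _ "s + t"])
qed

lemma pos_smult:
  assumes "pos h" "r \<ge> 0"
  shows "pos (complex_of_real r \<odot> h)"
proof -
  obtain t where t: "t \<ge> 0" "cnorm A (complex_of_real t \<odot> \<one> \<ominus> h) \<le> t"
    using assms by (auto simp: pos_def)
  have "complex_of_real (r * t) \<odot> \<one> \<ominus> complex_of_real r \<odot> h =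
      complex_of_real r \<odot> (complex_of_real t \<odot> \<one> \<ominus> h)"
    using assms by (simp add: smult_diff_right smult_smult pos_carrier)
  then have "cnorm A (complex_of_real (r * t) \<odot> \<one> \<ominus> complex_of_real r \<odot> h) \<le> r * t"
    using t assms by (simp add: cnorm_smult pos_carrier mult_left_mono)
  then show ?thesis unfolding pos_def
    using t assms by (auto simp: star_smult pos_selfadjoint pos_carrier intro!: exI[of _ "r * t"])
qed

lemma pos_one_diff:
  assumes "h \<in> carrier A" "star A h = h" "cnorm A h \<le> t"
  shows "pos (complex_of_real t \<odot> \<one> \<ominus> h)"
proof -
  have "complex_of_real t \<odot> \<one> \<ominus> (complex_of_real t \<odot> \<one> \<ominus> h) = h"
    using assms(1) smult_closed[OF one_closed] by algebra
  moreover have "0 \<le> t" using assms cnorm_nonneg[of h] by linarith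
  ultimately show ?thesis using assms
    by (auto simp: pos_def star_diff star_smult intro!: exI[of _ t])
qed

text \<open>The iteration for a^2 produces a selfadjoint s with s^2 = 1 - a^2. Its limit stays in
  the commutant of a, so a and s commute and satisfy s^2 + a^2 = 1; hence |1 - a^2| = |s|^2 <=
  1.\<close>

lemma cnorm_one_diff_square:
  assumes "a \<in> carrier A" "star A a = a" "cnorm A a \<le> 1"
  shows "cnorm A (\<one> \<ominus> a \<otimes> a) \<le> 1"
proof -
  have k: "a \<otimes> a \<in> carrier A" "cnorm A (a \<otimes> a) \<le> 1"
    using assms by (auto simp: cnorm_selfadjoint_square power_le_one)
  obtain w where w: "converges_to (sqrt_iter (a \<otimes> a)) w" "w \<oplus> w = a \<otimes> a \<oplus> w \<otimes> w"
    using sqrt_iter_converges[OF k] by metis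
  have wc: "w \<in> carrier A" using converges_toD[OF w(1)] by simp
  have ws: "star A w = w"
    using star_limit[OF w(1)] star_sqrt_iter[OF k(1)] assms by (simp add: star_mult)
  have "a \<otimes> a \<in> {x \<in> carrier A. x \<otimes> a = a \<otimes> x}" using assms mult_assoc by auto
  from sqrt_iter_in[OF commutant_closed_subalgebra[OF assms(1)] this]
  have "w \<in> {x \<in> carrier A. x \<otimes> a = a \<otimes> x}"
    by (rule norm_closed_converges[OF closed_subalgebraD(6)[OF commutant_closed_subalgebra[OF assms(1)]] w(1)])
  then have com: "w \<otimes> a = a \<otimes> w" by simp
  define s where "s = \<one> \<ominus> w"
  have s: "s \<in> carrier A" "star A s = s" using wc ws by (auto simp: s_def star_diff)
  have "s \<otimes> s = \<one> \<ominus> (w \<oplus> w) \<oplus> w \<otimes> w" unfolding s_def using wc by algebra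
  also have "\<dots> = \<one> \<ominus> a \<otimes> a" unfolding w(2) using wc assms(1) by algebra
  finally have ss: "s \<otimes> s = \<one> \<ominus> a \<otimes> a" .
  have "s \<otimes> a = a \<otimes> s" unfolding s_def using wc assms(1) com by algebra
  then have "(cnorm A s)\<^sup>2 \<le> cnorm A (s \<otimes> s \<oplus> a \<otimes> a)"
    using cnorm_commuting_squares[of s a] s assms by simp
  also have "s \<otimes> s \<oplus> a \<otimes> a = \<one>" unfolding ss using assms(1) by algebra
  finally have "(cnorm A s)\<^sup>2 \<le> 1" using cnorm_one_le by simp
  then show ?thesis using cnorm_selfadjoint_square[OF s] ss by simp
qed

lemma pos_square:
  assumes "a \<in> carrier A" "star A a = a"
  shows "pos (a \<otimes> a)"
proof (cases "cnorm A a = 0")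
  case True
  then have "a = \<zero>" using assms cnorm_eq_0 by simp
  then show ?thesis by (auto simp: pos_def intro!: exI[of _ 0])
next
  case False
  define r where "r = cnorm A a"
  have r: "r > 0" using False cnorm_nonneg[OF assms(1)] unfolding r_def by linarith
  define b where "b = complex_of_real (1 / r) \<odot> a"
  have b: "b \<in> carrier A" "star A b = b" "cnorm A b \<le> 1"
    using assms r by (auto simp: b_def star_smult cnorm_smult r_def norm_divide)
  have "pos (b \<otimes> b)"
    using cnorm_one_diff_square[OF b] b by (auto simp: pos_def star_mult intro!: exI[of _ 1])
  then have "pos (complex_of_real (r\<^sup>2) \<odot> (b \<otimes> b))" by (rule pos_smult) simp
  also have "complex_of_real (r\<^sup>2) \<odot> (b \<otimes> b) = a \<otimes> a"
    using assms r by (simp add: b_def smult_mult_left smult_mult_right smult_smult power2_eq_square)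
  finally show ?thesis .
qed

text \<open>The root lies in every closed subalgebra containing \<open>h\<close>, even one without
  the unit. This yields commutation of the root with whatever commutes with \<open>h\<close>, and
  later allows the root to be pulled back from a unital extension.\<close>

lemma pos_sqrt:
  assumes h: "pos h"
  obtains c where "pos c" "c \<otimes> c = h" "\<And>S. closed_subalgebra S \<Longrightarrow> h \<in> S \<Longrightarrow> c \<in> S"
proof -
  obtain t where t: "t \<ge> 0" "cnorm A (complex_of_real t \<odot> \<one> \<ominus> h) \<le> t"
    using assms by (auto simp: pos_def)
  note hc = pos_carrier[OF h]
  \<comment> \<open>For k = 1 - h/r the element rk is the sum of 1 and an element of norm at most t,
    so |k| <= 1. Taking t + 1 keeps the divisor positive when t = 0.\<close>
  define r where "r = t + 1"
  have r: "r > 0" using t by (simp add: r_def)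
  define g where "g = complex_of_real (1 / r) \<odot> h"
  define k where "k = \<one> \<ominus> g"
  have g: "g \<in> carrier A" "star A g = g"
    using hc pos_selfadjoint[OF h] by (auto simp: g_def star_smult)
  then have k: "k \<in> carrier A" "star A k = k" by (auto simp: k_def star_diff)
  have "complex_of_real r \<odot> k = \<one> \<oplus> (complex_of_real t \<odot> \<one> \<ominus> h)"
  proof -
    have "complex_of_real r \<odot> k = complex_of_real r \<odot> \<one> \<ominus> h"
      using hc r by (simp add: k_def g_def smult_diff_right smult_smult)
    also have "complex_of_real r \<odot> \<one> = \<one> \<oplus> complex_of_real t \<odot> \<one>"
      using smult_add_left[of \<one> 1 "complex_of_real t"] by (simp add: r_def add.commute)
    also have "\<one> \<oplus> complex_of_real t \<odot> \<one> \<ominus> h = \<one> \<oplus> (complex_of_real t \<odot> \<one> \<ominus> h)"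
      using hc by algebra
    finally show ?thesis .
  qed
  then have "cnorm A (complex_of_real r \<odot> k) \<le> 1 + t"
    using cnorm_add[of \<one> "complex_of_real t \<odot> \<one> \<ominus> h"] cnorm_one_le t hc by simp
  moreover have "cnorm A (complex_of_real r \<odot> k) = r * cnorm A k" using r k by (simp add: cnorm_smult)
  ultimately have "r * cnorm A k \<le> r * 1" by (metis r_def add.commute mult.right_neutral)
  then have k1: "cnorm A k \<le> 1" using r by (simp only: mult_le_cancel_left_pos)
  obtain w where w: "converges_to (sqrt_iter k) w" "w \<oplus> w = k \<oplus> w \<otimes> w" "cnorm A w \<le> 1"
    using sqrt_iter_converges[OF k(1) k1] by metis
  have wc: "w \<in> carrier A" using converges_toD[OF w(1)] by simp
  have ws: "star A w = w" using star_limit[OF w(1)] star_sqrt_iter[OF k] by simp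
  define c where "c = \<one> \<ominus> w"
  have c: "c \<in> carrier A" "star A c = c" using wc ws by (auto simp: c_def star_diff)
  have "c \<otimes> c = \<one> \<ominus> (w \<oplus> w) \<oplus> w \<otimes> w" unfolding c_def using wc by algebra
  also have "\<dots> = \<one> \<ominus> k" unfolding w(2) using wc k(1) by algebra
  also have "\<dots> = g" unfolding k_def using g(1) by algebra
  finally have cc: "c \<otimes> c = g" .
  have "\<one> \<ominus> c = w" unfolding c_def using wc by algebra
  then have pc: "pos c" using c w(3) by (auto simp: pos_def intro!: exI[of _ 1])
  have cS: "c \<in> S" if S: "closed_subalgebra S" "h \<in> S" for S
  proof -
    note SD = closed_subalgebraD[OF S(1)]
    have gS: "g \<in> S" unfolding g_def by (rule SD(3)[OF S(2)])
    \<comment> \<open>The iterates for k = 1 - g contain the unit, which S need not contain.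
      Subtracting them from the scalar iterate times the unit removes exactly that part: with s =
      \<open>sqrt_bound n\<close>, the next d is (g + 2sd - d^2)/2, so d stays in S, and it
      converges to 1 - w.\<close>
    define d where "d n = complex_of_real (sqrt_bound n) \<odot> \<one> \<ominus> sqrt_iter k n" for n
    have dc: "d n \<in> carrier A" for n using k by (simp add: d_def)
    have dS: "d n \<in> S" for n
    proof (induction n)
      case 0
      then show ?case using SD by (simp add: d_def)
    next
      case (Suc n)
      let ?b = "complex_of_real (sqrt_bound n)"
      define u where "u = sqrt_iter k n"
      have uc: "u \<in> carrier A" using k by (simp add: u_def)
      have u: "u = ?b \<odot> \<one> \<ominus> d n" unfolding d_def u_def[symmetric] using uc smult_closed[OF one_closed] by algebra
      have "k \<oplus> u \<otimes> u = (\<one> \<ominus> g) \<oplus> (?b \<odot> \<one> \<ominus> d n) \<otimes> (?b \<odot> \<one> \<ominus> d n)"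
        by (simp add: k_def flip: u)
      also have "\<dots> = (\<one> \<ominus> g) \<oplus> ((?b \<odot> \<one>) \<otimes> (?b \<odot> \<one>) \<ominus> (?b \<odot> \<one>) \<otimes> d n \<ominus> d n \<otimes> (?b \<odot> \<one>) \<oplus> d n \<otimes> d n)"
        using dc[of n] smult_closed[OF one_closed, of ?b] by algebra
      also have "\<dots> = (\<one> \<ominus> g) \<oplus> ((?b * ?b) \<odot> \<one> \<ominus> ?b \<odot> d n \<ominus> ?b \<odot> d n \<oplus> d n \<otimes> d n)"
        using dc[of n] by (simp add: smult_mult_left smult_mult_right smult_smult)
      also have "\<dots> = (\<one> \<oplus> (?b * ?b) \<odot> \<one>) \<ominus> (g \<oplus> (?b \<odot> d n \<oplus> ?b \<odot> d n \<ominus> d n \<otimes> d n))"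
        using dc[of n] g(1) smult_closed[OF one_closed, of "?b * ?b"] by algebra
      finally have *: "k \<oplus> u \<otimes> u = (\<one> \<oplus> (?b * ?b) \<odot> \<one>) \<ominus> (g \<oplus> (?b \<odot> d n \<oplus> ?b \<odot> d n \<ominus> d n \<otimes> d n))" .
      let ?e = "g \<oplus> (?b \<odot> d n \<oplus> ?b \<odot> d n \<ominus> d n \<otimes> d n)"
      have e: "?e \<in> S" by (intro SD gS Suc)
      have "\<one> \<oplus> (?b * ?b) \<odot> \<one> = (1 + ?b * ?b) \<odot> \<one>" by (simp add: smult_add_left)
      then have "sqrt_iter k (Suc n) = (1/2) \<odot> ((1 + ?b * ?b) \<odot> \<one> \<ominus> ?e)"
        using * by (simp add: u_def)
      also have "\<dots> = (complex_of_real (sqrt_bound (Suc n))) \<odot> \<one> \<ominus> (1/2) \<odot> ?e"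
        using SD(1)[OF e] by (simp add: smult_diff_right smult_smult power2_eq_square)
      finally have "d (Suc n) = (1/2) \<odot> ?e"
        using diff_diff_self[OF smult_closed[OF one_closed] smult_closed[OF SD(1)[OF e]]]
        unfolding d_def[of "Suc n"] by metis
      then show ?case using SD(3)[OF e] by simp
    qed
    have "converges_to (\<lambda>n. complex_of_real (sqrt_bound n) \<odot> \<one>) (1 \<odot> \<one>)"
    proof (rule converges_toI[where g = "\<lambda>n. \<bar>sqrt_bound n - 1\<bar>"])
      show "cnorm A (complex_of_real (sqrt_bound n) \<odot> \<one> \<ominus> 1 \<odot> \<one>) \<le> \<bar>sqrt_bound n - 1\<bar>" for n
      proof -
        have "complex_of_real (sqrt_bound n) \<odot> \<one> \<ominus> 1 \<odot> \<one> = complex_of_real (sqrt_bound n - 1) \<odot> \<one>"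
          using smult_add_left[of \<one> "complex_of_real (sqrt_bound n)" "-1"]
          by (simp add: minus_eq smult_minus_one)
        then show ?thesis
          using cnorm_one_le mult_left_le[of "cnorm A \<one>" "\<bar>sqrt_bound n - 1\<bar>"]
          by (simp add: cnorm_smult del: of_real_diff)
      qed
      show "(\<lambda>n. \<bar>sqrt_bound n - 1\<bar>) \<longlonglongrightarrow> 0"
        using sqrt_bound_LIMSEQ by (simp add: LIM_zero tendsto_rabs_zero)
    qed auto
    from converges_to_add[OF this converges_to_smult[OF w(1), of "-1"]]
    have "converges_to d c"
      using k wc by (simp add: smult_minus_one d_def[abs_def] c_def minus_eq)
    then show ?thesis using norm_closed_converges[OF SD(6)] dS by blast
  qed
  define c' where "c' = complex_of_real (sqrt r) \<odot> c"
  have "c' \<otimes> c' = complex_of_real r \<odot> g"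
    using c r by (simp add: c'_def smult_mult_left smult_mult_right smult_smult cc g(1) flip: of_real_mult)
  also have "\<dots> = h" using r hc by (simp add: g_def smult_smult)
  finally have "c' \<otimes> c' = h" .
  moreover have "pos c'" unfolding c'_def by (rule pos_smult[OF pc]) (use r in simp)
  moreover have "c' \<in> S" if "closed_subalgebra S" "h \<in> S" for S
    unfolding c'_def using closed_subalgebraD(3)[OF that(1) cS[OF that]] .
  ultimately show ?thesis using that by blast
qed

section \<open>Antisymmetry of the cone and positivity of
  \<open>star A x \<otimes> x\<close>\<close>

lemma sqrt_commutes:
  assumes "\<And>S. closed_subalgebra S \<Longrightarrow> h \<in> S \<Longrightarrow> c \<in> S" "h \<in> carrier A" "y \<in> carrier A" "h \<otimes> y = y \<otimes> h"
  shows "c \<otimes> y = y \<otimes> c"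
  using assms(1)[OF commutant_closed_subalgebra[OF assms(3)]] assms by simp

text \<open>The roots c of h and d of -h commute, and c^2 + d^2 = 0 forces c = 0 by
  \<open>cnorm_commuting_squares\<close>.\<close>

lemma pos_antisym:
  assumes "pos h" "pos (\<ominus> h)"
  shows "h = \<zero>"
proof -
  note hc = pos_carrier[OF assms(1)]
  obtain c where c: "pos c" "c \<otimes> c = h" "\<And>S. closed_subalgebra S \<Longrightarrow> h \<in> S \<Longrightarrow> c \<in> S"
    using pos_sqrt[OF assms(1)] by metis
  obtain d where d: "pos d" "d \<otimes> d = \<ominus> h" "\<And>S. closed_subalgebra S \<Longrightarrow> \<ominus> h \<in> S \<Longrightarrow> d \<in> S"
    using pos_sqrt[OF assms(2)] by metis
  note cc = pos_carrier[OF c(1)] pos_carrier[OF d(1)]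
  have "c \<otimes> h = h \<otimes> c" by (rule sqrt_commutes[of h, OF c(3) hc hc]) auto
  then have "(\<ominus> h) \<otimes> c = c \<otimes> (\<ominus> h)" using hc cc by (simp add: l_minus r_minus)
  then have "d \<otimes> c = c \<otimes> d" using sqrt_commutes[OF d(3)] hc cc by simp
  then have "(cnorm A c)\<^sup>2 \<le> cnorm A (c \<otimes> c \<oplus> d \<otimes> d)"
    using cnorm_commuting_squares[of c d] cc pos_selfadjoint[OF c(1)] pos_selfadjoint[OF d(1)] by simp
  also have "c \<otimes> c \<oplus> d \<otimes> d = \<zero>" using c d hc by (simp add: r_neg)
  finally have "cnorm A c = 0" by simp
  then show ?thesis using cnorm_eq_0[of c] cc c(2) by auto
qed

text \<open>For the selfadjoint elements p = t + t^* and q = i t - i t^* one has p^2 + q^2 = 2 t t^*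
  + 2 t^* t. Adding 2 v^2 = -2 t^* t leaves 2 t t^* as a sum of squares of selfadjoint elements.
  This replaces the comparison of the spectra of t t^* and t^* t.\<close>

lemma pos_mult_star_of_neg:
  assumes t: "t \<in> carrier A" and v: "v \<in> carrier A" "star A v = v"
    and eq: "star A t \<otimes> t = \<ominus> (v \<otimes> v)"
  shows "pos (t \<otimes> star A t)"
proof -
  let ?s = "star A t"
  define p where "p = t \<oplus> ?s"
  define q where "q = \<i> \<odot> (t \<ominus> ?s)"
  have p: "p \<in> carrier A" "star A p = p" using t a_comm by (auto simp: p_def star_add)
  have q: "q \<in> carrier A" "star A q = q"
  proof -
    have "star A q = (- \<i>) \<odot> (?s \<ominus> t)" using t by (simp add: q_def star_smult star_diff)
    also have "?s \<ominus> t = \<ominus> (t \<ominus> ?s)" using t by algebra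
    finally show "star A q = q" using t by (simp add: q_def smult_minus_left smult_minus_right)
  qed (use t in \<open>simp add: q_def\<close>)
  have "q \<otimes> q = \<ominus> ((t \<ominus> ?s) \<otimes> (t \<ominus> ?s))"
    using t by (simp add: q_def smult_mult_left smult_mult_right smult_smult smult_minus_one)
  then have "p \<otimes> p \<oplus> q \<otimes> q = (t \<oplus> ?s) \<otimes> (t \<oplus> ?s) \<oplus> \<ominus> ((t \<ominus> ?s) \<otimes> (t \<ominus> ?s))"
    by (simp add: p_def)
  also have "\<dots> = (t \<otimes> ?s \<oplus> t \<otimes> ?s) \<oplus> (?s \<otimes> t \<oplus> ?s \<otimes> t)"
    using t by algebra
  also have "\<dots> \<oplus> (v \<otimes> v \<oplus> v \<otimes> v) = t \<otimes> ?s \<oplus> t \<otimes> ?s"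
    unfolding eq using t v(1) by algebra
  finally have "(p \<otimes> p \<oplus> q \<otimes> q) \<oplus> (v \<otimes> v \<oplus> v \<otimes> v) = 2 \<odot> (t \<otimes> ?s)"
    using smult_add_left[of "t \<otimes> ?s" 1 1] t by simp
  moreover have "pos ((p \<otimes> p \<oplus> q \<otimes> q) \<oplus> (v \<otimes> v \<oplus> v \<otimes> v))"
    by (intro pos_add pos_square p q v)
  ultimately have "pos (complex_of_real (1/2) \<odot> (2 \<odot> (t \<otimes> ?s)))" by (intro pos_smult) auto
  then show ?thesis using t by (simp add: smult_smult)
qed

text \<open>For w = v t^* the element w^* w is minus the square of t t^*, so
  \<open>pos_mult_star_of_neg\<close> makes w w^* = -v^4 positive. Since v^4 is positive as well,
  antisymmetry gives v^4 = 0, hence v = 0 and t = 0.\<close>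

lemma star_mult_self_neg_square_zero:
  assumes t: "t \<in> carrier A" and v: "v \<in> carrier A" "star A v = v"
    and eq: "star A t \<otimes> t = \<ominus> (v \<otimes> v)"
  shows "t = \<zero>"
proof -
  let ?s = "star A t"
  define w where "w = v \<otimes> ?s"
  have w: "w \<in> carrier A" "star A w = t \<otimes> v" using t v by (auto simp: w_def star_mult)
  have vv: "v \<otimes> v = \<ominus> (?s \<otimes> t)" using eq t v by simp
  have "star A w \<otimes> w = t \<otimes> (v \<otimes> v) \<otimes> ?s" unfolding w(2) unfolding w_def using t v(1) by algebra
  also have "\<dots> = \<ominus> ((t \<otimes> ?s) \<otimes> (t \<otimes> ?s))" unfolding vv using t by algebra
  finally have "pos (w \<otimes> star A w)"
    using pos_mult_star_of_neg[OF w(1), of "t \<otimes> ?s"] t by (simp add: star_mult)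
  also have "w \<otimes> star A w = v \<otimes> (?s \<otimes> t) \<otimes> v" unfolding w(2) unfolding w_def using t v(1) by algebra
  also have "\<dots> = \<ominus> ((v \<otimes> v) \<otimes> (v \<otimes> v))" unfolding eq using v(1) by algebra
  finally have "pos (\<ominus> ((v \<otimes> v) \<otimes> (v \<otimes> v)))" .
  moreover have "pos ((v \<otimes> v) \<otimes> (v \<otimes> v))" using pos_square[of "v \<otimes> v"] v by (simp add: star_mult)
  ultimately have "(v \<otimes> v) \<otimes> (v \<otimes> v) = \<zero>" using pos_antisym by blast
  then have "cnorm A ((v \<otimes> v) \<otimes> (v \<otimes> v)) = 0" by simp
  then have "cnorm A v = 0" using v by (simp add: cnorm_selfadjoint_square star_mult)
  then have "v = \<zero>" using v cnorm_eq_0 by simp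
  then have "cnorm A (?s \<otimes> t) = 0" using eq by simp
  then show ?thesis using t cstar_identity[of t] cnorm_eq_0[of t] by simp
qed

lemma selfadjoint_square_eq_zero:
  "x \<in> carrier A \<Longrightarrow> star A x = x \<Longrightarrow> x \<otimes> x = \<zero> \<Longrightarrow> x = \<zero>"
  using cnorm_selfadjoint_square[of x] cnorm_eq_0[of x] by simp

text \<open>For h = x^* x let c be the positive root of h^2, in the role of the absolute value, and
  n = c - h, twice the negative part. Then hn = -cn, so for t = xn and d the root of c one finds t^*
  t = nhn = -(dn)^2. By \<open>star_mult_self_neg_square_zero\<close> t = 0, so dn = 0, then cn = hn
  = 0 and n^2 = 0. Thus h = c, which is positive.\<close>

lemma pos_star_mult_self:
  assumes x: "x \<in> carrier A"
  shows "pos (star A x \<otimes> x)"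
proof -
  define h where "h = star A x \<otimes> x"
  have h: "h \<in> carrier A" "star A h = h" using x by (auto simp: h_def star_mult)
  have hh: "pos (h \<otimes> h)" by (rule pos_square[OF h])
  obtain c where c: "pos c" "c \<otimes> c = h \<otimes> h" "\<And>S. closed_subalgebra S \<Longrightarrow> h \<otimes> h \<in> S \<Longrightarrow> c \<in> S"
    using pos_sqrt[OF hh] by metis
  obtain d where d: "pos d" "d \<otimes> d = c" "\<And>S. closed_subalgebra S \<Longrightarrow> c \<in> S \<Longrightarrow> d \<in> S"
    using pos_sqrt[OF c(1)] by metis
  note cc = pos_carrier[OF c(1)] pos_carrier[OF d(1)]
  have ch: "c \<otimes> h = h \<otimes> c"
    by (rule sqrt_commutes[of "h \<otimes> h", OF c(3)]) (use h mult_assoc in auto)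
  have dh: "d \<otimes> h = h \<otimes> d" by (rule sqrt_commutes[of c, OF d(3)]) (use h cc ch in auto)
  have dc: "d \<otimes> c = c \<otimes> d" by (rule sqrt_commutes[of c, OF d(3)]) (use cc in auto)
  define n where "n = c \<ominus> h"
  have n: "n \<in> carrier A" "star A n = n"
    using h cc pos_selfadjoint[OF c(1)] by (auto simp: n_def star_diff)
  have hn: "h \<otimes> n = \<ominus> (c \<otimes> n)"
  proof -
    have "h \<otimes> n \<oplus> c \<otimes> n = h \<otimes> c \<ominus> h \<otimes> h \<oplus> c \<otimes> c \<ominus> c \<otimes> h"
      unfolding n_def using h(1) cc(1) by algebra
    also have "\<dots> = \<zero>" unfolding ch c(2) using h(1) cc(1) by algebra
    finally show ?thesis using h n cc by (metis minus_equality mult_closed)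
  qed
  have dn: "d \<otimes> n = n \<otimes> d" unfolding n_def using h(1) cc dh dc by algebra
  have cn: "c \<otimes> n = n \<otimes> c" unfolding n_def using h(1) cc ch by algebra
  define t where "t = x \<otimes> n"
  have t: "t \<in> carrier A" using x n by (simp add: t_def)
  have "star A t \<otimes> t = n \<otimes> (h \<otimes> n)" using x n by (simp add: t_def h_def star_mult mult_assoc)
  also have "\<dots> = \<ominus> (n \<otimes> (d \<otimes> d) \<otimes> n)" unfolding hn d(2) using n(1) cc(1) by algebra
  also have "n \<otimes> (d \<otimes> d) \<otimes> n = (d \<otimes> n) \<otimes> (d \<otimes> n)"
    using n(1) cc(2) dn by (metis mult_assoc mult_closed)
  finally have tt: "star A t \<otimes> t = \<ominus> ((d \<otimes> n) \<otimes> (d \<otimes> n))" .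
  have dns: "star A (d \<otimes> n) = d \<otimes> n" using n cc dn pos_selfadjoint[OF d(1)] by (simp add: star_mult)
  have "t = \<zero>" by (rule star_mult_self_neg_square_zero[OF t _ dns tt]) (use n cc in auto)
  then have 0: "\<ominus> ((d \<otimes> n) \<otimes> (d \<otimes> n)) = \<zero>" unfolding tt[symmetric] by simp
  have "(d \<otimes> n) \<otimes> (d \<otimes> n) = \<zero>" by (rule minus_eq_zero[OF _ 0]) (use n cc in simp)
  then have "d \<otimes> n = \<zero>" using selfadjoint_square_eq_zero dns n cc by simp
  then have "c \<otimes> n = \<zero>" using d(2) n cc using mult_assoc[of d d n] by simp
  moreover have "n \<otimes> n = c \<otimes> n \<ominus> h \<otimes> n" unfolding n_def using h(1) cc(1) by algebra
  ultimately have "n \<otimes> n = \<zero> \<ominus> \<ominus> \<zero>" using hn by simp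
  also have "\<dots> = \<zero>" by algebra
  finally have "n \<otimes> n = \<zero>" .
  then have "n = \<zero>" using selfadjoint_square_eq_zero n by simp
  then have "c = h" using n_def h cc by (simp add: diff_eq_zero)
  then show ?thesis using c(1) by (simp add: h_def)
qed

text \<open>With M the norm of h + k, the element M1 - h is positive, being the sum of M1 - (h + k)
  and k. Its root b commutes with the root a of h, and a^2 + b^2 = M1, so
  \<open>cnorm_commuting_squares\<close> bounds |a|^2 = |h| by M.\<close>

lemma pos_cnorm_mono:
  assumes "pos h" "pos k"
  shows "cnorm A h \<le> cnorm A (h \<oplus> k)"
proof -
  define M where "M = cnorm A (h \<oplus> k)"
  note c = pos_carrier[OF assms(1)] pos_carrier[OF assms(2)]
  define m where "m = complex_of_real M \<odot> \<one>"
  have mc: "m \<in> carrier A" by (simp add: m_def)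
  have "pos ((m \<ominus> (h \<oplus> k)) \<oplus> k)"
    unfolding m_def by (intro pos_add pos_one_diff assms)
      (use c pos_selfadjoint[OF assms(1)] pos_selfadjoint[OF assms(2)] in \<open>auto simp: M_def star_add\<close>)
  also have "(m \<ominus> (h \<oplus> k)) \<oplus> k = m \<ominus> h" using c mc by algebra
  finally have p: "pos (m \<ominus> h)" .
  obtain a where a: "pos a" "a \<otimes> a = h" "\<And>S. closed_subalgebra S \<Longrightarrow> h \<in> S \<Longrightarrow> a \<in> S"
    using pos_sqrt[OF assms(1)] by metis
  obtain b where b: "pos b" "b \<otimes> b = m \<ominus> h" "\<And>S. closed_subalgebra S \<Longrightarrow> m \<ominus> h \<in> S \<Longrightarrow> b \<in> S"
    using pos_sqrt[OF p] by metis
  note ab = pos_carrier[OF a(1)] pos_carrier[OF b(1)]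
  have "a \<otimes> h = h \<otimes> a" by (rule sqrt_commutes[of h, OF a(3)]) (use c in auto)
  moreover have "a \<otimes> m = m \<otimes> a" using ab by (simp add: m_def smult_mult_left smult_mult_right)
  ultimately have "(m \<ominus> h) \<otimes> a = a \<otimes> (m \<ominus> h)" using ab c mc by algebra
  then have "b \<otimes> a = a \<otimes> b" using sqrt_commutes[OF b(3)] c mc ab by simp
  then have "(cnorm A a)\<^sup>2 \<le> cnorm A (a \<otimes> a \<oplus> b \<otimes> b)"
    using cnorm_commuting_squares[of a b] ab pos_selfadjoint[OF a(1)] pos_selfadjoint[OF b(1)] by simp
  also have "a \<otimes> a \<oplus> b \<otimes> b = m" unfolding a(2) b(2) using c mc by algebra
  also have "cnorm A m \<le> M"
    using cnorm_one_le mult_left_le[of "cnorm A \<one>" M] c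
    by (simp add: m_def cnorm_smult M_def)
  finally show ?thesis
    using cnorm_selfadjoint_square[OF ab(1) pos_selfadjoint[OF a(1)]] a(2) by (simp add: M_def)
qed

end

section \<open>Separation and completion\<close>

lemma squeeze_zero:
  fixes f g :: "nat \<Rightarrow> real"
  assumes "g \<longlonglongrightarrow> 0" "\<And>n. 0 \<le> f n" "\<And>n. f n \<le> g n"
  shows "f \<longlonglongrightarrow> 0"
  by (rule tendsto_sandwich[OF _ _ tendsto_const assms(1)]) (use assms in auto)

text \<open>The quotient by the elements of seminorm zero, carried by the values of any map
  \<open>j\<close> whose fibres are the classes. With \<open>j\<close> injective on a genuine
  C*-algebra it only changes the carrier type, which is how copies on sets of reals are
  made.\<close>

definition separate :: "'a cstar \<Rightarrow> ('a \<Rightarrow> 'r) \<Rightarrow> 'r cstar" where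
  "separate A j = (let i = inv_into (carrier A) j in
    \<lparr>carrier = j ` carrier A, mult = (\<lambda>x y. j (i x \<otimes>\<^bsub>A\<^esub> i y)), one = j \<one>\<^bsub>A\<^esub>,
     zero = j \<zero>\<^bsub>A\<^esub>, add = (\<lambda>x y. j (i x \<oplus>\<^bsub>A\<^esub> i y)), smult = (\<lambda>c x. j (c \<odot>\<^bsub>A\<^esub> i x)),
     star = (\<lambda>x. j (star A (i x))), cnorm = (\<lambda>x. cnorm A (i x))\<rparr>)"

locale separation = pre_cstar_algebra A for A :: "'a cstar" (structure) +
  fixes j :: "'a \<Rightarrow> 'r"
  assumes j_eq_iff: "\<lbrakk>x \<in> carrier A; y \<in> carrier A\<rbrakk> \<Longrightarrow> j x = j y \<longleftrightarrow> cnorm A (x \<ominus> y) = 0"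
begin

abbreviation "rep \<equiv> inv_into (carrier A) j"

lemma rep [simp, intro]: "x \<in> carrier A \<Longrightarrow> rep (j x) \<in> carrier A"
  by (simp add: inv_into_into)

lemma cnorm_rep_diff: "x \<in> carrier A \<Longrightarrow> cnorm A (rep (j x) \<ominus> x) = 0"
  using j_eq_iff[of "rep (j x)" x] by (simp add: f_inv_into_f)

lemma separate_carrier: "carrier (separate A j) = j ` carrier A"
  by (simp add: separate_def Let_def)

lemma separate_one: "\<one>\<^bsub>separate A j\<^esub> = j \<one>"
  by (simp add: separate_def Let_def)

lemma separate_zero: "\<zero>\<^bsub>separate A j\<^esub> = j \<zero>"
  by (simp add: separate_def Let_def)

lemma j_eqI:
  assumes "x \<in> carrier A" "y \<in> carrier A" "cnorm A (x \<ominus> y) \<le> 0"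
  shows "j x = j y"
  using j_eq_iff assms cnorm_nonneg[of "x \<ominus> y"] by (simp del: cnorm_nonneg)

lemma separate_add:
  assumes "x \<in> carrier A" "y \<in> carrier A"
  shows "j x \<oplus>\<^bsub>separate A j\<^esub> j y = j (x \<oplus> y)"
proof -
  let ?x = "rep (j x)" and ?y = "rep (j y)"
  have c: "?x \<in> carrier A" "?y \<in> carrier A" using assms by auto
  have "(?x \<oplus> ?y) \<ominus> (x \<oplus> y) = (?x \<ominus> x) \<oplus> (?y \<ominus> y)" using assms c by algebra
  then have "cnorm A ((?x \<oplus> ?y) \<ominus> (x \<oplus> y)) \<le> 0"
    using cnorm_add[of "?x \<ominus> x" "?y \<ominus> y"] assms c by (simp add: cnorm_rep_diff)
  then show ?thesis using assms c by (auto simp: separate_def Let_def intro: j_eqI)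
qed

lemma separate_mult:
  assumes "x \<in> carrier A" "y \<in> carrier A"
  shows "j x \<otimes>\<^bsub>separate A j\<^esub> j y = j (x \<otimes> y)"
proof -
  let ?x = "rep (j x)" and ?y = "rep (j y)"
  have c: "?x \<in> carrier A" "?y \<in> carrier A" using assms by auto
  have "?x \<otimes> ?y \<ominus> x \<otimes> y = (?x \<ominus> x) \<otimes> ?y \<oplus> x \<otimes> (?y \<ominus> y)" using assms c by algebra
  then have "cnorm A (?x \<otimes> ?y \<ominus> x \<otimes> y) \<le> 0"
    using cnorm_add[of "(?x \<ominus> x) \<otimes> ?y" "x \<otimes> (?y \<ominus> y)"] cnorm_mult[of "?x \<ominus> x" ?y]
      cnorm_mult[of x "?y \<ominus> y"] assms c by (simp add: cnorm_rep_diff)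
  then show ?thesis using assms c by (auto simp: separate_def Let_def intro: j_eqI)
qed

lemma separate_smult:
  assumes "x \<in> carrier A"
  shows "c \<odot>\<^bsub>separate A j\<^esub> j x = j (c \<odot> x)"
  using assms j_eq_iff[of "c \<odot> rep (j x)" "c \<odot> x"]
  by (auto simp: separate_def Let_def cnorm_smult cnorm_rep_diff simp flip: smult_diff_right)

lemma separate_star:
  assumes "x \<in> carrier A"
  shows "star (separate A j) (j x) = j (star A x)"
  using assms j_eq_iff[of "star A (rep (j x))" "star A x"]
  by (auto simp: separate_def Let_def cnorm_rep_diff simp flip: star_diff)

lemma separate_cnorm:
  assumes "x \<in> carrier A"
  shows "cnorm (separate A j) (j x) = cnorm A x"
  using assms abs_cnorm_diff[of "rep (j x)" x] by (simp add: separate_def Let_def cnorm_rep_diff)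

lemmas separate_simps = separate_add separate_mult separate_smult separate_star separate_cnorm
  separate_zero separate_one separate_carrier

lemma star_hom_separate: "star_hom A (separate A j) j"
  by (auto simp: star_hom_def separate_simps)

lemma pre_cstar_separate: "pre_cstar_algebra (separate A j)"
proof (rule pre_cstar_algebra.intro)
  show "complex_vector_space (separate A j)"
    by (rule complex_vector_spaceI)
      (auto simp: separate_simps a_assoc smult_add_left smult_add_right smult_smult intro: arg_cong[where f = j, OF a_comm])
qed (auto simp: separate_simps mult_assoc mult_add_left mult_add_right smult_mult_left
  smult_mult_right star_add star_smult star_mult cnorm_add cnorm_smult cnorm_mult cstar_identity)

lemma separate_minus:
  assumes "x \<in> carrier A" "y \<in> carrier A"
  shows "j x \<ominus>\<^bsub>separate A j\<^esub> j y = j (x \<ominus> y)"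
proof -
  interpret S: pre_cstar_algebra "separate A j" by (rule pre_cstar_separate)
  have "j y \<in> carrier (separate A j)" using assms by (simp add: separate_simps)
  then have "\<ominus>\<^bsub>separate A j\<^esub> j y = j ((-1) \<odot> y)"
    using S.smult_minus_one[of "j y"] assms by (simp add: separate_simps)
  then show ?thesis using assms by (simp add: S.minus_eq minus_eq smult_minus_one separate_simps)
qed

end

lemma cstar_algebraI:
  fixes A (structure)
  assumes "pre_cstar_algebra A" "\<And>x. x \<in> carrier A \<Longrightarrow> cnorm A x = 0 \<Longrightarrow> x = \<zero>"
    "complete_for A (cnorm A)"
  shows "cstar_algebra A"
proof -
  interpret pre_cstar_algebra A by fact
  show ?thesis
    by (rule cstar_algebra.intro) (use assms(2,3) in \<open>auto intro: vector_space mult_assoc mult_add_left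
      mult_add_right smult_mult_left smult_mult_right star_add star_smult star_mult cnorm_add cnorm_smult
      cnorm_mult cstar_identity\<close>)
qed

context separation
begin

lemma cstar_separate:
  assumes complete: "complete_for A (cnorm A)"
  shows "cstar_algebra (separate A j)"
proof -
  show ?thesis
  proof (rule cstar_algebraI[OF pre_cstar_separate])
    fix x assume x: "x \<in> carrier (separate A j)" "cnorm (separate A j) x = 0"
    then obtain a where a: "a \<in> carrier A" "x = j a" by (auto simp: separate_carrier)
    show "x = \<zero>\<^bsub>separate A j\<^esub>"
      using a x j_eq_iff[of a \<zero>] by (simp add: separate_simps)
  next
    show "complete_for (separate A j) (cnorm (separate A j))"
      unfolding complete_for_def
    proof (intro allI impI)
      fix s :: "nat \<Rightarrow> 'r" assume s: "(\<forall>n. s n \<in> carrier (separate A j)) \<and>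
        (\<forall>e>0. \<exists>n\<^sub>0. \<forall>m\<ge>n\<^sub>0. \<forall>n\<ge>n\<^sub>0. cnorm (separate A j) (s m \<ominus>\<^bsub>separate A j\<^esub> s n) < e)"
      define t where "t n = rep (s n)" for n
      have t: "t n \<in> carrier A" "s n = j (t n)" for n
        using s by (auto simp: t_def separate_carrier f_inv_into_f inv_into_into)
      have "\<forall>e>0. \<exists>n\<^sub>0. \<forall>m\<ge>n\<^sub>0. \<forall>n\<ge>n\<^sub>0. cnorm A (t m \<ominus> t n) < e"
        using s t by (simp add: separate_minus separate_cnorm)
      then obtain l where l: "l \<in> carrier A" "(\<lambda>n. cnorm A (t n \<ominus> l)) \<longlonglongrightarrow> 0"
        using complete t unfolding complete_for_def by blast
      then show "\<exists>l\<in>carrier (separate A j). (\<lambda>n. cnorm (separate A j) (s n \<ominus>\<^bsub>separate A j\<^esub> l)) \<longlonglongrightarrow> 0"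
        using t by (auto simp: separate_carrier separate_minus separate_cnorm)
    qed
  qed
qed

end

section \<open>The completion as Cauchy sequences modulo null sequences\<close>

definition Cauchy_sequences :: "'a cstar \<Rightarrow> (nat \<Rightarrow> 'a) cstar" where
  "Cauchy_sequences A = \<lparr>carrier = {s. (\<forall>n. s n \<in> carrier A) \<and>
      (\<forall>e>0. \<exists>n\<^sub>0. \<forall>m\<ge>n\<^sub>0. \<forall>n\<ge>n\<^sub>0. cnorm A (s m \<ominus>\<^bsub>A\<^esub> s n) < e)},
     mult = (\<lambda>s t n. s n \<otimes>\<^bsub>A\<^esub> t n), one = (\<lambda>_. \<one>\<^bsub>A\<^esub>),
     zero = (\<lambda>_. \<zero>\<^bsub>A\<^esub>), add = (\<lambda>s t n. s n \<oplus>\<^bsub>A\<^esub> t n), smult = (\<lambda>c s n. c \<odot>\<^bsub>A\<^esub> s n),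
     star = (\<lambda>s n. star A (s n)), cnorm = (\<lambda>s. lim (\<lambda>n. cnorm A (s n)))\<rparr>"

context pre_cstar_algebra
begin

definition Cauchy_seq :: "(nat \<Rightarrow> 'a) \<Rightarrow> bool" where
  "Cauchy_seq s \<longleftrightarrow> (\<forall>n. s n \<in> carrier A) \<and> (\<forall>e>0. \<exists>N. \<forall>m\<ge>N. \<forall>n\<ge>N. cnorm A (s m \<ominus> s n) < e)"

lemma Cauchy_seq_carrier: "Cauchy_seq s \<Longrightarrow> s n \<in> carrier A"
  by (simp add: Cauchy_seq_def)

text \<open>A Lipschitz estimate against two Cauchy sequences covers all four operations; for the
  product, the constants are bounds for the factors.\<close>

lemma Cauchy_seqI2:
  assumes "\<And>n. s n \<in> carrier A"
    and s: "Cauchy_seq t" "Cauchy_seq u" and "C \<ge> 0" "D \<ge> 0"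
    and le: "\<And>m n. cnorm A (s m \<ominus> s n) \<le> C * cnorm A (t m \<ominus> t n) + D * cnorm A (u m \<ominus> u n)"
  shows "Cauchy_seq s"
  unfolding Cauchy_seq_def
proof (intro conjI allI impI assms(1))
  fix e :: real assume e: "e > 0"
  define d where "d = e / (C + D + 1)"
  have d: "d > 0" using e assms by (simp add: d_def)
  obtain N M where N: "\<forall>m\<ge>N. \<forall>n\<ge>N. cnorm A (t m \<ominus> t n) < d"
    and M: "\<forall>m\<ge>M. \<forall>n\<ge>M. cnorm A (u m \<ominus> u n) < d"
    using s d unfolding Cauchy_seq_def by metis
  show "\<exists>N. \<forall>m\<ge>N. \<forall>n\<ge>N. cnorm A (s m \<ominus> s n) < e"
  proof (intro exI allI impI)
    fix m n assume "max N M \<le> m" "max N M \<le> n"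
    then have "cnorm A (t m \<ominus> t n) \<le> d" "cnorm A (u m \<ominus> u n) \<le> d" using N M by (auto simp: less_imp_le)
    then have "C * cnorm A (t m \<ominus> t n) + D * cnorm A (u m \<ominus> u n) \<le> C * d + D * d"
      using assms by (intro add_mono mult_left_mono) auto
    also have "\<dots> < (C + D + 1) * d" using d by (simp add: algebra_simps)
    also have "\<dots> = e" using assms by (simp add: d_def)
    finally show "cnorm A (s m \<ominus> s n) < e" using le[of m n] by linarith
  qed
qed

lemma Cauchy_seq_bounded:
  assumes "Cauchy_seq s"
  obtains C where "C \<ge> 0" "\<And>n. cnorm A (s n) \<le> C"
proof -
  obtain N where N: "\<forall>m\<ge>N. \<forall>n\<ge>N. cnorm A (s m \<ominus> s n) < 1"
    using assms unfolding Cauchy_seq_def by (meson zero_less_one)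
  define C where "C = Max ((\<lambda>n. cnorm A (s n)) ` {..N}) + 1"
  have *: "cnorm A (s n) \<le> C - 1" if "n \<le> N" for n
    unfolding C_def using that by (auto intro: Max_ge)
  have "cnorm A (s n) \<le> C" for n
  proof (cases "n \<le> N")
    case False
    then have "cnorm A (s n \<ominus> s N) < 1" using N by auto
    then show ?thesis
      using abs_cnorm_diff[of "s n" "s N"] *[of N] Cauchy_seq_carrier[OF assms] by auto
  qed (use * in force)
  moreover have "C \<ge> 0" using *[of 0] cnorm_nonneg[OF Cauchy_seq_carrier[OF assms, of 0]] by linarith
  ultimately show ?thesis using that by blast
qed

lemma Cauchy_seq_cnorm_LIMSEQ:
  assumes "Cauchy_seq s"
  shows "(\<lambda>n. cnorm A (s n)) \<longlonglongrightarrow> lim (\<lambda>n. cnorm A (s n))"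
proof -
  have "Cauchy (\<lambda>n. cnorm A (s n))"
    unfolding Cauchy_def dist_real_def
  proof (intro allI impI)
    fix e :: real assume "e > 0"
    then obtain N where "\<forall>m\<ge>N. \<forall>n\<ge>N. cnorm A (s m \<ominus> s n) < e"
      using assms unfolding Cauchy_seq_def by blast
    then show "\<exists>N. \<forall>m\<ge>N. \<forall>n\<ge>N. \<bar>cnorm A (s m) - cnorm A (s n)\<bar> < e"
      using abs_cnorm_diff Cauchy_seq_carrier[OF assms] by (meson le_less_trans)
  qed
  then show ?thesis using Cauchy_convergent unfolding convergent_LIMSEQ_iff by blast
qed

lemma Cauchy_seq_const: "x \<in> carrier A \<Longrightarrow> Cauchy_seq (\<lambda>_. x)"
  by (simp add: Cauchy_seq_def)

lemma Cauchy_seq_add: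
  assumes "Cauchy_seq s" "Cauchy_seq t"
  shows "Cauchy_seq (\<lambda>n. s n \<oplus> t n)"
proof (rule Cauchy_seqI2[OF _ assms, of _ 1 1])
  note c = Cauchy_seq_carrier[OF assms(1)] Cauchy_seq_carrier[OF assms(2)]
  fix m n
  have "(s m \<oplus> t m) \<ominus> (s n \<oplus> t n) = (s m \<ominus> s n) \<oplus> (t m \<ominus> t n)"
    using c(1)[of m] c(1)[of n] c(2)[of m] c(2)[of n] by algebra
  then show "cnorm A ((s m \<oplus> t m) \<ominus> (s n \<oplus> t n)) \<le> 1 * cnorm A (s m \<ominus> s n) + 1 * cnorm A (t m \<ominus> t n)"
    using cnorm_add[of "s m \<ominus> s n" "t m \<ominus> t n"] c by simp
qed (use Cauchy_seq_carrier assms in auto)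

lemma Cauchy_seq_mult:
  assumes "Cauchy_seq s" "Cauchy_seq t"
  shows "Cauchy_seq (\<lambda>n. s n \<otimes> t n)"
proof -
  note c = Cauchy_seq_carrier[OF assms(1)] Cauchy_seq_carrier[OF assms(2)]
  obtain C where C: "C \<ge> 0" "\<And>n. cnorm A (t n) \<le> C" using Cauchy_seq_bounded[OF assms(2)] by blast
  obtain D where D: "D \<ge> 0" "\<And>n. cnorm A (s n) \<le> D" using Cauchy_seq_bounded[OF assms(1)] by blast
  show ?thesis
  proof (rule Cauchy_seqI2[OF _ assms, of _ C D])
    fix m n
    have "s m \<otimes> t m \<ominus> s n \<otimes> t n = (s m \<ominus> s n) \<otimes> t m \<oplus> s n \<otimes> (t m \<ominus> t n)"
      using c(1)[of m] c(1)[of n] c(2)[of m] c(2)[of n] by algebra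
    moreover have "cnorm A ((s m \<ominus> s n) \<otimes> t m) \<le> C * cnorm A (s m \<ominus> s n)"
      using cnorm_mult[of "s m \<ominus> s n" "t m"] mult_left_mono[OF C(2)[of m], of "cnorm A (s m \<ominus> s n)"] c
      by (simp add: mult.commute)
    moreover have "cnorm A (s n \<otimes> (t m \<ominus> t n)) \<le> D * cnorm A (t m \<ominus> t n)"
      using cnorm_mult[of "s n" "t m \<ominus> t n"] mult_right_mono[OF D(2)[of n], of "cnorm A (t m \<ominus> t n)"] c
      by simp
    ultimately show "cnorm A (s m \<otimes> t m \<ominus> s n \<otimes> t n) \<le> C * cnorm A (s m \<ominus> s n) + D * cnorm A (t m \<ominus> t n)"
      using cnorm_add[of "(s m \<ominus> s n) \<otimes> t m" "s n \<otimes> (t m \<ominus> t n)"] c by simp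
  qed (use c C D in auto)
qed

lemma Cauchy_seq_smult:
  assumes "Cauchy_seq s"
  shows "Cauchy_seq (\<lambda>n. c \<odot> s n)"
  by (rule Cauchy_seqI2[OF _ assms assms, of _ "cmod c" 0])
    (use Cauchy_seq_carrier[OF assms] in \<open>auto simp: cnorm_smult simp flip: smult_diff_right\<close>)

lemma Cauchy_seq_star:
  assumes "Cauchy_seq s"
  shows "Cauchy_seq (\<lambda>n. star A (s n))"
  by (rule Cauchy_seqI2[OF _ assms assms, of _ 1 0])
    (use Cauchy_seq_carrier[OF assms] in \<open>auto simp flip: star_diff\<close>)

end

locale completion = pre_cstar_algebra A for A :: "'a cstar" (structure)
begin

abbreviation "Seq \<equiv> Cauchy_sequences A"

lemma Seq_simps:
  "s \<in> carrier Seq \<longleftrightarrow> Cauchy_seq s" "s \<otimes>\<^bsub>Seq\<^esub> t = (\<lambda>n. s n \<otimes> t n)"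
  "s \<oplus>\<^bsub>Seq\<^esub> t = (\<lambda>n. s n \<oplus> t n)" "c \<odot>\<^bsub>Seq\<^esub> s = (\<lambda>n. c \<odot> s n)" "star Seq s = (\<lambda>n. star A (s n))"
  "\<zero>\<^bsub>Seq\<^esub> = (\<lambda>_. \<zero>)" "\<one>\<^bsub>Seq\<^esub> = (\<lambda>_. \<one>)"
  by (auto simp: Cauchy_sequences_def Cauchy_seq_def)

lemma cnorm_Seq: "cnorm Seq s = lim (\<lambda>n. cnorm A (s n))"
  by (simp add: Cauchy_sequences_def)

lemma cnorm_Seq_LIMSEQ: "Cauchy_seq s \<Longrightarrow> (\<lambda>n. cnorm A (s n)) \<longlonglongrightarrow> cnorm Seq s"
  by (simp add: cnorm_Seq Cauchy_seq_cnorm_LIMSEQ)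

lemma cnorm_Seq_const [simp]: "cnorm Seq (\<lambda>_. x) = cnorm A x"
  by (simp add: cnorm_Seq)

lemma cnorm_Seq_eqI: "(\<lambda>n. cnorm A (s n)) \<longlonglongrightarrow> l \<Longrightarrow> cnorm Seq s = l"
  by (simp add: cnorm_Seq limI)

lemma cnorm_Seq_le:
  assumes "Cauchy_seq s" "\<And>n. n \<ge> N \<Longrightarrow> cnorm A (s n) \<le> C"
  shows "cnorm Seq s \<le> C"
  using LIMSEQ_le_const2[OF cnorm_Seq_LIMSEQ[OF assms(1)]] assms(2) by blast

sublocale Seq: pre_cstar_algebra Seq
proof (rule pre_cstar_algebra.intro)
  note simps = Seq_simps fun_eq_iff Cauchy_seq_carrier
  show "complex_vector_space Seq"
    by (rule complex_vector_spaceI)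
      (auto simp: simps a_assoc smult_add_left smult_add_right smult_smult Cauchy_seq_const
        intro: a_comm Cauchy_seq_add Cauchy_seq_smult)
  fix x y z c
  show "x \<in> carrier Seq \<Longrightarrow> y \<in> carrier Seq \<Longrightarrow> x \<otimes>\<^bsub>Seq\<^esub> y \<in> carrier Seq"
    by (simp add: Seq_simps Cauchy_seq_mult)
  show "x \<in> carrier Seq \<Longrightarrow> star Seq x \<in> carrier Seq"
    by (simp add: Seq_simps Cauchy_seq_star)
  show "x \<in> carrier Seq \<Longrightarrow> 0 \<le> cnorm Seq x"
    using LIMSEQ_le_const[OF cnorm_Seq_LIMSEQ, of x 0] by (simp add: Seq_simps Cauchy_seq_carrier)
  show "cnorm Seq \<zero>\<^bsub>Seq\<^esub> = 0" by (simp add: Seq_simps)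
  show "x \<in> carrier Seq \<Longrightarrow> cnorm Seq (c \<odot>\<^bsub>Seq\<^esub> x) = cmod c * cnorm Seq x"
    using tendsto_mult_left[OF cnorm_Seq_LIMSEQ, of x "cmod c"]
    by (auto simp: Seq_simps Cauchy_seq_carrier cnorm_smult intro!: cnorm_Seq_eqI)
  show "cnorm Seq (x \<oplus>\<^bsub>Seq\<^esub> y) \<le> cnorm Seq x + cnorm Seq y" if "x \<in> carrier Seq" "y \<in> carrier Seq"
  proof (rule LIMSEQ_le)
    show "(\<lambda>n. cnorm A (x n \<oplus> y n)) \<longlonglongrightarrow> cnorm Seq (x \<oplus>\<^bsub>Seq\<^esub> y)"
      using cnorm_Seq_LIMSEQ[OF Cauchy_seq_add] that by (simp add: Seq_simps)
    show "(\<lambda>n. cnorm A (x n) + cnorm A (y n)) \<longlonglongrightarrow> cnorm Seq x + cnorm Seq y"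
      using that by (intro tendsto_add cnorm_Seq_LIMSEQ) (auto simp: Seq_simps)
  qed (use that in \<open>auto simp: Seq_simps Cauchy_seq_carrier cnorm_add\<close>)
  show "cnorm Seq (x \<otimes>\<^bsub>Seq\<^esub> y) \<le> cnorm Seq x * cnorm Seq y" if "x \<in> carrier Seq" "y \<in> carrier Seq"
  proof (rule LIMSEQ_le)
    show "(\<lambda>n. cnorm A (x n \<otimes> y n)) \<longlonglongrightarrow> cnorm Seq (x \<otimes>\<^bsub>Seq\<^esub> y)"
      using cnorm_Seq_LIMSEQ[OF Cauchy_seq_mult] that by (simp add: Seq_simps)
    show "(\<lambda>n. cnorm A (x n) * cnorm A (y n)) \<longlonglongrightarrow> cnorm Seq x * cnorm Seq y"
      using that by (intro tendsto_mult cnorm_Seq_LIMSEQ) (auto simp: Seq_simps)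
  qed (use that in \<open>auto simp: Seq_simps Cauchy_seq_carrier cnorm_mult\<close>)
  show "cnorm Seq (star Seq x \<otimes>\<^bsub>Seq\<^esub> x) = (cnorm Seq x)\<^sup>2" if "x \<in> carrier Seq"
    using tendsto_power[OF cnorm_Seq_LIMSEQ, of x 2] that
    by (auto simp: Seq_simps Cauchy_seq_carrier cstar_identity intro!: cnorm_Seq_eqI)
qed (simp_all add: Seq_simps Cauchy_seq_carrier mult_assoc mult_add_left mult_add_right
  smult_mult_left smult_mult_right star_add star_smult star_mult)

lemma Seq_minus: 
  assumes "Cauchy_seq s" "Cauchy_seq t"
  shows "s \<ominus>\<^bsub>Seq\<^esub> t = (\<lambda>n. s n \<ominus> t n)"
proof -
  have "\<ominus>\<^bsub>Seq\<^esub> t = (\<lambda>n. \<ominus> t n)"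
    using Seq.smult_minus_one[of t] assms by (simp add: Seq_simps smult_minus_one Cauchy_seq_carrier)
  then show ?thesis by (simp add: Seq.minus_eq minus_eq Seq_simps)
qed

lemma Cauchy_seq_minus: "Cauchy_seq s \<Longrightarrow> Cauchy_seq t \<Longrightarrow> Cauchy_seq (\<lambda>n. s n \<ominus> t n)"
  using Seq.minus_closed[of s t] by (simp add: Seq_simps Seq_minus)

text \<open>Each sequence \<open>s k\<close> lies within 1/(k+1) of the constant sequence with value
  \<open>l k\<close>, an entry of \<open>s k\<close> taken far enough out. The sequence
  \<open>l\<close> of these entries is Cauchy and is itself the limit sought. Completeness is
  obtained before null sequences are divided out and passes to the quotient by
  \<open>cstar_separate\<close>.\<close>

lemma complete_Seq: "complete_for Seq (cnorm Seq)"
  unfolding complete_for_def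
proof (intro allI impI, elim conjE)
  fix s :: "nat \<Rightarrow> nat \<Rightarrow> 'a"
  assume sc: "\<forall>n. s n \<in> carrier Seq"
    and cau: "\<forall>e>0. \<exists>n\<^sub>0. \<forall>m\<ge>n\<^sub>0. \<forall>n\<ge>n\<^sub>0. cnorm Seq (s m \<ominus>\<^bsub>Seq\<^esub> s n) < e"
  have sC: "Cauchy_seq (s k)" for k using sc by (simp add: Seq_simps)
  define r where "r k = inverse (real (Suc k))" for k
  have r: "r k > 0" for k by (simp add: r_def)
  have r0: "r \<longlonglongrightarrow> 0" unfolding r_def by (rule LIMSEQ_inverse_real_of_nat)
  have "\<exists>N. \<forall>n\<ge>N. cnorm A (s k n \<ominus> s k N) < r k" for k
    using sC[of k] r[of k] unfolding Cauchy_seq_def by (meson order_refl)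
  then obtain N where N: "\<And>k n. n \<ge> N k \<Longrightarrow> cnorm A (s k n \<ominus> s k (N k)) < r k" by metis
  define l where "l k = s k (N k)" for k
  have lc: "l k \<in> carrier A" for k by (simp add: l_def Cauchy_seq_carrier[OF sC])
  have near: "cnorm Seq (s k \<ominus>\<^bsub>Seq\<^esub> (\<lambda>_. l k)) \<le> r k" for k
    using sC[of k] lc[of k] N[of k]
    by (auto simp: Seq_minus Cauchy_seq_const l_def less_imp_le intro!: cnorm_Seq_le[of _ "N k"] Cauchy_seq_minus)
  have lcC: "(\<lambda>_. l k) \<in> carrier Seq" for k using lc by (simp add: Seq_simps Cauchy_seq_const)
  have lS: "Cauchy_seq l"
    unfolding Cauchy_seq_def
  proof (intro conjI allI impI lc)
    fix e :: real assume "e > 0"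
    then have e3: "e / 3 > 0" by simp
    obtain M where M: "\<And>m n. m \<ge> M \<Longrightarrow> n \<ge> M \<Longrightarrow> cnorm Seq (s m \<ominus>\<^bsub>Seq\<^esub> s n) < e / 3"
      using cau e3 by blast
    obtain K where K: "\<And>k. k \<ge> K \<Longrightarrow> r k < e / 3"
      using order_tendstoD(2)[OF r0 e3] by (auto simp: eventually_sequentially)
    show "\<exists>N. \<forall>m\<ge>N. \<forall>n\<ge>N. cnorm A (l m \<ominus> l n) < e"
    proof (intro exI allI impI)
      fix m n assume mn: "max M K \<le> m" "max M K \<le> n"
      have "cnorm A (l m \<ominus> l n) = cnorm Seq ((\<lambda>_. l m) \<ominus>\<^bsub>Seq\<^esub> (\<lambda>_. l n))"
        using lc by (simp add: Seq_minus Cauchy_seq_const)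
      also have "\<dots> \<le> cnorm Seq ((\<lambda>_. l m) \<ominus>\<^bsub>Seq\<^esub> s m) + (cnorm Seq (s m \<ominus>\<^bsub>Seq\<^esub> s n)
          + cnorm Seq (s n \<ominus>\<^bsub>Seq\<^esub> (\<lambda>_. l n)))"
        using Seq.cnorm_diff_triangle[of "\<lambda>_. l m" "s m" "\<lambda>_. l n"]
          Seq.cnorm_diff_triangle[of "s m" "s n" "\<lambda>_. l n"] lcC sc by (meson add_left_mono order_trans)
      also have "\<dots> < e / 3 + (e / 3 + e / 3)"
        using near[of m] near[of n] K[of m] K[of n] M[of m n] mn
          Seq.cnorm_diff_commute[of "\<lambda>_. l m" "s m"] lcC sc by simp
      finally show "cnorm A (l m \<ominus> l n) < e" by simp
    qed
  qed
  have "(\<lambda>k. cnorm Seq ((\<lambda>_. l k) \<ominus>\<^bsub>Seq\<^esub> l)) \<longlonglongrightarrow> 0"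
  proof (rule LIMSEQ_I)
    fix e :: real assume "e > 0"
    then have "e / 2 > 0" by simp
    then obtain M where M: "\<And>m n. m \<ge> M \<Longrightarrow> n \<ge> M \<Longrightarrow> cnorm A (l m \<ominus> l n) < e / 2"
      using lS unfolding Cauchy_seq_def by blast
    have "cnorm Seq ((\<lambda>_. l k) \<ominus>\<^bsub>Seq\<^esub> l) \<le> e / 2" if "k \<ge> M" for k
      unfolding Seq_minus[OF Cauchy_seq_const[OF lc] lS]
      using less_imp_le[OF M[OF that]]
      by (intro cnorm_Seq_le[of _ M] Cauchy_seq_minus Cauchy_seq_const lc lS)
    moreover have "cnorm Seq ((\<lambda>_. l k) \<ominus>\<^bsub>Seq\<^esub> l) \<ge> 0" for k
      using lcC lS by (intro Seq.cnorm_nonneg Seq.minus_closed) (auto simp: Seq_simps)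
    ultimately show "\<exists>M. \<forall>k\<ge>M. norm (cnorm Seq ((\<lambda>_. l k) \<ominus>\<^bsub>Seq\<^esub> l) - 0) < e"
      using \<open>e > 0\<close> by (intro exI[of _ M]) force
  qed
  from tendsto_add[OF r0 this]
  have "(\<lambda>k. r k + cnorm Seq ((\<lambda>_. l k) \<ominus>\<^bsub>Seq\<^esub> l)) \<longlonglongrightarrow> 0" by simp
  moreover have "0 \<le> cnorm Seq (s k \<ominus>\<^bsub>Seq\<^esub> l)" for k
    using sc lS by (intro Seq.cnorm_nonneg Seq.minus_closed) (auto simp: Seq_simps(1))
  moreover have "cnorm Seq (s k \<ominus>\<^bsub>Seq\<^esub> l) \<le> r k + cnorm Seq ((\<lambda>_. l k) \<ominus>\<^bsub>Seq\<^esub> l)" for k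
    using Seq.cnorm_diff_triangle[of "s k" "\<lambda>_. l k" l] near[of k] sc lcC lS by (simp add: Seq_simps(1))
  ultimately have "(\<lambda>k. cnorm Seq (s k \<ominus>\<^bsub>Seq\<^esub> l)) \<longlonglongrightarrow> 0"
    by (rule squeeze_zero)
  then show "\<exists>l\<in>carrier Seq. (\<lambda>n. cnorm Seq (s n \<ominus>\<^bsub>Seq\<^esub> l)) \<longlonglongrightarrow> 0"
    using lS by (auto simp: Seq_simps(1))
qed

definition null_class :: "(nat \<Rightarrow> 'a) \<Rightarrow> (nat \<Rightarrow> 'a) set" where
  "null_class s = {t \<in> carrier Seq. cnorm Seq (s \<ominus>\<^bsub>Seq\<^esub> t) = 0}"

sublocale sep: separation Seq null_class
proof
  fix x y assume xy: "x \<in> carrier Seq" "y \<in> carrier Seq"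
  show "null_class x = null_class y \<longleftrightarrow> cnorm Seq (x \<ominus>\<^bsub>Seq\<^esub> y) = 0"
  proof
    assume "null_class x = null_class y"
    moreover have "y \<in> null_class y" using xy by (simp add: null_class_def)
    ultimately show "cnorm Seq (x \<ominus>\<^bsub>Seq\<^esub> y) = 0" by (auto simp: null_class_def)
  next
    assume 0: "cnorm Seq (x \<ominus>\<^bsub>Seq\<^esub> y) = 0"
    have "cnorm Seq (x \<ominus>\<^bsub>Seq\<^esub> t) = 0 \<longleftrightarrow> cnorm Seq (y \<ominus>\<^bsub>Seq\<^esub> t) = 0" if t: "t \<in> carrier Seq" for t
    proof -
      have "cnorm Seq (x \<ominus>\<^bsub>Seq\<^esub> t) \<le> cnorm Seq (y \<ominus>\<^bsub>Seq\<^esub> t)"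
        "cnorm Seq (y \<ominus>\<^bsub>Seq\<^esub> t) \<le> cnorm Seq (x \<ominus>\<^bsub>Seq\<^esub> t)"
        using Seq.cnorm_diff_triangle[of x y t] Seq.cnorm_diff_triangle[of y x t]
          Seq.cnorm_diff_commute[of x y] 0 xy t by auto
      then show ?thesis by simp
    qed
    then show "null_class x = null_class y" by (auto simp: null_class_def)
  qed
qed

definition completed :: "(nat \<Rightarrow> 'a) set cstar" where
  "completed = separate Seq null_class"

definition embed :: "'a \<Rightarrow> (nat \<Rightarrow> 'a) set" where
  "embed x = null_class (\<lambda>_. x)"

lemma cstar_completed: "cstar_algebra completed"
  unfolding completed_def by (rule sep.cstar_separate[OF complete_Seq])

lemma star_hom_embed: "star_hom A completed embed"
proof -
  note * = sep.star_hom_separate[unfolded star_hom_def]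
  show ?thesis
    unfolding star_hom_def completed_def embed_def
    using * Cauchy_seq_const by (simp add: Seq_simps)
qed

lemma cnorm_embed: "x \<in> carrier A \<Longrightarrow> cnorm completed (embed x) = cnorm A x"
  unfolding completed_def embed_def
  by (subst sep.separate_cnorm) (auto simp: Seq_simps Cauchy_seq_const)

lemma embed_one:
  assumes "\<one> \<in> carrier A" "\<And>x. x \<in> carrier A \<Longrightarrow> \<one> \<otimes> x = x" "\<And>x. x \<in> carrier A \<Longrightarrow> x \<otimes> \<one> = x"
  shows "unital_cstar_algebra completed"
proof -
  interpret C: cstar_algebra completed by (rule cstar_completed)
  have *: "null_class (\<lambda>_. \<one>) \<in> carrier completed"
    using assms by (auto simp: completed_def sep.separate_carrier Seq_simps Cauchy_seq_const)
  show ?thesis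
    by unfold_locales
      (use assms * in \<open>auto simp: completed_def sep.separate_simps Seq_simps Cauchy_seq_const Cauchy_seq_carrier\<close>)
qed

end

section \<open>Adjointable operators\<close>

text \<open>Adjoints and operator norms rest on the Cauchy-Schwarz inequality alone, which is
  therefore an assumption. For an algebra over itself it is submultiplicativity of the norm; for
  columns it is derived in \<open>pre_hilbert_module\<close>.\<close>

locale inner_product_module = pre_cstar_algebra B for B :: "('b, 'w) cstar_scheme" +
  fixes Y :: "(complex, 'y, 'z) module_scheme" and ip :: "'y \<Rightarrow> 'y \<Rightarrow> 'b"
  assumes Y_vector_space: "complex_vector_space Y"
    and ip_closed [simp, intro]: "\<lbrakk>x \<in> carrier Y; y \<in> carrier Y\<rbrakk> \<Longrightarrow> ip x y \<in> carrier B"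
    and ip_add: "\<lbrakk>x \<in> carrier Y; y \<in> carrier Y; z \<in> carrier Y\<rbrakk> \<Longrightarrow> ip x (y \<oplus>\<^bsub>Y\<^esub> z) = ip x y \<oplus>\<^bsub>B\<^esub> ip x z"
    and ip_smult: "\<lbrakk>x \<in> carrier Y; y \<in> carrier Y\<rbrakk> \<Longrightarrow> ip x (c \<odot>\<^bsub>Y\<^esub> y) = c \<odot>\<^bsub>B\<^esub> ip x y"
    and ip_star: "\<lbrakk>x \<in> carrier Y; y \<in> carrier Y\<rbrakk> \<Longrightarrow> star B (ip x y) = ip y x"
    and ip_definite: "\<lbrakk>x \<in> carrier Y; cnorm B (ip x x) = 0\<rbrakk> \<Longrightarrow> x = \<zero>\<^bsub>Y\<^esub>"
    and ip_Cauchy_Schwarz: "\<lbrakk>x \<in> carrier Y; y \<in> carrier Y\<rbrakk>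
      \<Longrightarrow> cnorm B (ip x y) \<le> sqrt (cnorm B (ip x x)) * sqrt (cnorm B (ip y y))"
begin

sublocale Y: abelian_group Y
  using Y_vector_space by (simp add: module_def)

lemma Y_smult_closed [simp, intro]: "x \<in> carrier Y \<Longrightarrow> c \<odot>\<^bsub>Y\<^esub> x \<in> carrier Y"
  using module.smult_closed[OF Y_vector_space] by simp

lemma Y_smult_simps:
  assumes "x \<in> carrier Y"
  shows "(c + d) \<odot>\<^bsub>Y\<^esub> x = c \<odot>\<^bsub>Y\<^esub> x \<oplus>\<^bsub>Y\<^esub> d \<odot>\<^bsub>Y\<^esub> x"
    and "(c * d) \<odot>\<^bsub>Y\<^esub> x = c \<odot>\<^bsub>Y\<^esub> (d \<odot>\<^bsub>Y\<^esub> x)"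
    and "1 \<odot>\<^bsub>Y\<^esub> x = x" and "0 \<odot>\<^bsub>Y\<^esub> x = \<zero>\<^bsub>Y\<^esub>" and "c \<odot>\<^bsub>Y\<^esub> \<zero>\<^bsub>Y\<^esub> = \<zero>\<^bsub>Y\<^esub>"
    and "y \<in> carrier Y \<Longrightarrow> c \<odot>\<^bsub>Y\<^esub> (x \<oplus>\<^bsub>Y\<^esub> y) = c \<odot>\<^bsub>Y\<^esub> x \<oplus>\<^bsub>Y\<^esub> c \<odot>\<^bsub>Y\<^esub> y"
  using module.smult_l_distr[OF Y_vector_space, of c d x] module.smult_assoc1[OF Y_vector_space, of c d x]
    module.smult_one[OF Y_vector_space] module.smult_l_null[OF Y_vector_space]
    module.smult_r_null[OF Y_vector_space] module.smult_r_distr[OF Y_vector_space, of c x y] assms by auto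

lemma Y_smult_zero [simp]: "c \<odot>\<^bsub>Y\<^esub> \<zero>\<^bsub>Y\<^esub> = \<zero>\<^bsub>Y\<^esub>"
  by (rule Y_smult_simps(5)) (rule Y.zero_closed)

lemma Y_minus_one: "x \<in> carrier Y \<Longrightarrow> (-1) \<odot>\<^bsub>Y\<^esub> x = \<ominus>\<^bsub>Y\<^esub> x"
  using Y_smult_simps(1)[of x "-1" 1] by (simp add: Y.minus_equality Y_smult_simps)

lemma ip_minus: "x \<in> carrier Y \<Longrightarrow> y \<in> carrier Y \<Longrightarrow> z \<in> carrier Y \<Longrightarrow>
    ip x (y \<ominus>\<^bsub>Y\<^esub> z) = ip x y \<ominus>\<^bsub>B\<^esub> ip x z"
  using ip_smult[of x z "-1"] by (simp add: Y.minus_eq minus_eq ip_add Y_minus_one smult_minus_one)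

lemma ip_add_left: "\<lbrakk>x \<in> carrier Y; y \<in> carrier Y; z \<in> carrier Y\<rbrakk> \<Longrightarrow> ip (y \<oplus>\<^bsub>Y\<^esub> z) x = ip y x \<oplus>\<^bsub>B\<^esub> ip z x"
  using ip_add[of x y z] by (metis ip_star ip_closed star_add Y.a_closed)

lemma ip_smult_left: "\<lbrakk>x \<in> carrier Y; y \<in> carrier Y\<rbrakk> \<Longrightarrow> ip (c \<odot>\<^bsub>Y\<^esub> y) x = cnj c \<odot>\<^bsub>B\<^esub> ip y x"
  using ip_smult[of x y c] by (metis ip_star ip_closed star_smult Y_smult_closed)

lemma ip_nondegenerate:
  assumes "x \<in> carrier Y" "y \<in> carrier Y" "\<And>z. z \<in> carrier Y \<Longrightarrow> ip z x = ip z y"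
  shows "x = y"
proof -
  have "ip (x \<ominus>\<^bsub>Y\<^esub> y) (x \<ominus>\<^bsub>Y\<^esub> y) = \<zero>\<^bsub>B\<^esub>"
    using assms(1,2) assms(3)[of "x \<ominus>\<^bsub>Y\<^esub> y"] by (simp add: ip_minus)
  then have "x \<ominus>\<^bsub>Y\<^esub> y = \<zero>\<^bsub>Y\<^esub>" using assms ip_definite by simp
  moreover have "x = (x \<ominus>\<^bsub>Y\<^esub> y) \<oplus>\<^bsub>Y\<^esub> y"
    using assms(1,2) by (simp add: Y.minus_eq Y.a_assoc Y.l_neg)
  ultimately show ?thesis using assms(2) by simp
qed

definition nrm :: "'y \<Rightarrow> real" where
  "nrm x = sqrt (cnorm B (ip x x))"

lemma nrm_nonneg [simp]: "x \<in> carrier Y \<Longrightarrow> 0 \<le> nrm x"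
  by (simp add: nrm_def)

lemma nrm_square: "x \<in> carrier Y \<Longrightarrow> nrm x * nrm x = cnorm B (ip x x)"
  by (simp add: nrm_def)

lemma cnorm_ip: "x \<in> carrier Y \<Longrightarrow> y \<in> carrier Y \<Longrightarrow> cnorm B (ip x y) \<le> nrm x * nrm y"
  using ip_Cauchy_Schwarz by (simp add: nrm_def)

lemma nrm_zero [simp]: "nrm \<zero>\<^bsub>Y\<^esub> = 0"
proof -
  have "ip \<zero>\<^bsub>Y\<^esub> \<zero>\<^bsub>Y\<^esub> = \<zero>\<^bsub>B\<^esub>" using ip_smult[of "\<zero>\<^bsub>Y\<^esub>" "\<zero>\<^bsub>Y\<^esub>" 0] by simp
  then show ?thesis by (simp add: nrm_def)
qed

lemma nrm_add: 
  assumes "x \<in> carrier Y" "y \<in> carrier Y"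
  shows "nrm (x \<oplus>\<^bsub>Y\<^esub> y) \<le> nrm x + nrm y"
proof -
  have "ip (x \<oplus>\<^bsub>Y\<^esub> y) (x \<oplus>\<^bsub>Y\<^esub> y) = (ip x x \<oplus>\<^bsub>B\<^esub> ip x y) \<oplus>\<^bsub>B\<^esub> (ip y x \<oplus>\<^bsub>B\<^esub> ip y y)"
    using assms by (simp add: ip_add ip_add_left a_assoc a_lcomm)
  then have "cnorm B (ip (x \<oplus>\<^bsub>Y\<^esub> y) (x \<oplus>\<^bsub>Y\<^esub> y)) \<le> (cnorm B (ip x x) + cnorm B (ip x y)) + (cnorm B (ip y x) + cnorm B (ip y y))"
    using cnorm_add[of "ip x x \<oplus>\<^bsub>B\<^esub> ip x y" "ip y x \<oplus>\<^bsub>B\<^esub> ip y y"] cnorm_add[of "ip x x" "ip x y"]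
      cnorm_add[of "ip y x" "ip y y"] assms by simp
  also have "\<dots> \<le> (nrm x * nrm x + nrm x * nrm y) + (nrm y * nrm x + nrm y * nrm y)"
    by (intro add_mono cnorm_ip assms)
  also have "\<dots> = (nrm x + nrm y)\<^sup>2" by (simp add: power2_eq_square algebra_simps)
  finally have "nrm (x \<oplus>\<^bsub>Y\<^esub> y) \<le> sqrt ((nrm x + nrm y)\<^sup>2)"
    unfolding nrm_def[of "x \<oplus>\<^bsub>Y\<^esub> y"] by (rule real_sqrt_le_mono)
  then show ?thesis using assms by (simp add: add_nonneg_nonneg)
qed

lemma nrm_smult:
  assumes "x \<in> carrier Y"
  shows "nrm (c \<odot>\<^bsub>Y\<^esub> x) = cmod c * nrm x"
proof -
  have "ip (c \<odot>\<^bsub>Y\<^esub> x) (c \<odot>\<^bsub>Y\<^esub> x) = (c * cnj c) \<odot>\<^bsub>B\<^esub> ip x x"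
    using assms by (simp add: ip_smult ip_smult_left smult_smult mult.commute)
  then have "cnorm B (ip (c \<odot>\<^bsub>Y\<^esub> x) (c \<odot>\<^bsub>Y\<^esub> x)) = (cmod c)\<^sup>2 * cnorm B (ip x x)"
    using assms by (simp add: cnorm_smult norm_mult power2_eq_square)
  then show ?thesis unfolding nrm_def by (simp add: real_sqrt_mult)
qed

definition bounded_by :: "('y \<Rightarrow> 'y) \<Rightarrow> real \<Rightarrow> bool" where
  "bounded_by S C \<longleftrightarrow> 0 \<le> C \<and> (\<forall>y\<in>carrier Y. nrm (S y) \<le> C * nrm y)"

text \<open>An infimum of bounds is meaningful also on the zero module, where a supremum over unit
  vectors would range over the empty set.\<close>

definition opnorm :: "('y \<Rightarrow> 'y) \<Rightarrow> real" where
  "opnorm S = Inf {C. bounded_by S C}"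

lemma opnorm_le: "bounded_by S C \<Longrightarrow> opnorm S \<le> C"
  unfolding opnorm_def by (rule cInf_lower) (auto simp: bounded_by_def intro: bdd_belowI[of _ 0])

lemma opnorm_nonneg: "bounded_by S C \<Longrightarrow> 0 \<le> opnorm S"
  unfolding opnorm_def by (rule cInf_greatest) (auto simp: bounded_by_def)

lemma bounded_by_opnorm:
  assumes "bounded_by S C"
  shows "bounded_by S (opnorm S)"
  unfolding bounded_by_def
proof (intro conjI ballI)
  show "0 \<le> opnorm S" by (rule opnorm_nonneg[OF assms])
  fix y assume y: "y \<in> carrier Y"
  show "nrm (S y) \<le> opnorm S * nrm y"
  proof (cases "nrm y = 0")
    case True
    then show ?thesis using assms y by (auto simp: bounded_by_def)
  next
    case False
    then have p: "nrm y > 0" using nrm_nonneg[OF y] by linarith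
    have "nrm (S y) / nrm y \<le> opnorm S"
      unfolding opnorm_def
      by (rule cInf_greatest) (use assms y p in \<open>auto simp: bounded_by_def field_simps\<close>)
    then show ?thesis using p by (simp add: field_simps)
  qed
qed

definition adjoint_pair :: "('y \<Rightarrow> 'y) \<Rightarrow> ('y \<Rightarrow> 'y) \<Rightarrow> bool" where
  "adjoint_pair S T \<longleftrightarrow> (\<forall>y\<in>carrier Y. S y \<in> carrier Y \<and> T y \<in> carrier Y) \<and>
     (\<forall>y. y \<notin> carrier Y \<longrightarrow> S y = \<zero>\<^bsub>Y\<^esub> \<and> T y = \<zero>\<^bsub>Y\<^esub>) \<and>
     (\<forall>x\<in>carrier Y. \<forall>y\<in>carrier Y. ip x (S y) = ip (T x) y) \<and> (\<exists>C. bounded_by S C)"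

text \<open>Operators are recorded together with their adjoints and vanish off the carrier, so that the
  operations are pointwise and equality of operators is equality of pairs.\<close>

definition adjointable :: "(('y \<Rightarrow> 'y) \<times> ('y \<Rightarrow> 'y)) cstar" where
  "adjointable = \<lparr>carrier = {(S, T). adjoint_pair S T},
     mult = (\<lambda>(S, T) (S', T'). (\<lambda>y. S (S' y), \<lambda>y. T' (T y))),
     one = (\<lambda>y. if y \<in> carrier Y then y else \<zero>\<^bsub>Y\<^esub>, \<lambda>y. if y \<in> carrier Y then y else \<zero>\<^bsub>Y\<^esub>),
     zero = (\<lambda>_. \<zero>\<^bsub>Y\<^esub>, \<lambda>_. \<zero>\<^bsub>Y\<^esub>),
     add = (\<lambda>(S, T) (S', T'). (\<lambda>y. S y \<oplus>\<^bsub>Y\<^esub> S' y, \<lambda>y. T y \<oplus>\<^bsub>Y\<^esub> T' y)),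
     smult = (\<lambda>c (S, T). (\<lambda>y. c \<odot>\<^bsub>Y\<^esub> S y, \<lambda>y. cnj c \<odot>\<^bsub>Y\<^esub> T y)),
     star = (\<lambda>(S, T). (T, S)), cnorm = (\<lambda>(S, T). opnorm S)\<rparr>"

lemma adjointable_simps:
  "(S, T) \<in> carrier adjointable \<longleftrightarrow> adjoint_pair S T"
  "(S, T) \<otimes>\<^bsub>adjointable\<^esub> (S', T') = (\<lambda>y. S (S' y), \<lambda>y. T' (T y))"
  "(S, T) \<oplus>\<^bsub>adjointable\<^esub> (S', T') = (\<lambda>y. S y \<oplus>\<^bsub>Y\<^esub> S' y, \<lambda>y. T y \<oplus>\<^bsub>Y\<^esub> T' y)"
  "c \<odot>\<^bsub>adjointable\<^esub> (S, T) = (\<lambda>y. c \<odot>\<^bsub>Y\<^esub> S y, \<lambda>y. cnj c \<odot>\<^bsub>Y\<^esub> T y)"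
  "star adjointable (S, T) = (T, S)" "cnorm adjointable (S, T) = opnorm S"
  "\<zero>\<^bsub>adjointable\<^esub> = (\<lambda>_. \<zero>\<^bsub>Y\<^esub>, \<lambda>_. \<zero>\<^bsub>Y\<^esub>)"
  "\<one>\<^bsub>adjointable\<^esub> = (\<lambda>y. if y \<in> carrier Y then y else \<zero>\<^bsub>Y\<^esub>, \<lambda>y. if y \<in> carrier Y then y else \<zero>\<^bsub>Y\<^esub>)"
  by (auto simp: adjointable_def)

lemma adjoint_pairD:
  assumes "adjoint_pair S T"
  shows "S y \<in> carrier Y" "T y \<in> carrier Y" "y \<notin> carrier Y \<Longrightarrow> S y = \<zero>\<^bsub>Y\<^esub>"
    "y \<notin> carrier Y \<Longrightarrow> T y = \<zero>\<^bsub>Y\<^esub>"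
    "x \<in> carrier Y \<Longrightarrow> y \<in> carrier Y \<Longrightarrow> ip x (S y) = ip (T x) y"
    "x \<in> carrier Y \<Longrightarrow> y \<in> carrier Y \<Longrightarrow> ip x (T y) = ip (S x) y"
    "bounded_by S (opnorm S)" "y \<in> carrier Y \<Longrightarrow> nrm (S y) \<le> opnorm S * nrm y" "0 \<le> opnorm S"
proof -
  show c: "S y \<in> carrier Y" "T y \<in> carrier Y" for y
    using assms by (cases "y \<in> carrier Y"; auto simp: adjoint_pair_def)+
  show a: "x \<in> carrier Y \<Longrightarrow> y \<in> carrier Y \<Longrightarrow> ip x (S y) = ip (T x) y" for x y
    using assms by (auto simp: adjoint_pair_def)
  then show "x \<in> carrier Y \<Longrightarrow> y \<in> carrier Y \<Longrightarrow> ip x (T y) = ip (S x) y"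
    using a[of y x] ip_star c by metis
  show b: "bounded_by S (opnorm S)"
    using assms bounded_by_opnorm by (auto simp: adjoint_pair_def)
  then show "y \<in> carrier Y \<Longrightarrow> nrm (S y) \<le> opnorm S * nrm y" "0 \<le> opnorm S"
    by (auto simp: bounded_by_def)
qed (use assms in \<open>auto simp: adjoint_pair_def\<close>)

lemma adjoint_pairI:
  assumes "\<And>y. y \<in> carrier Y \<Longrightarrow> S y \<in> carrier Y" "\<And>y. y \<in> carrier Y \<Longrightarrow> T y \<in> carrier Y"
    and "\<And>y. y \<notin> carrier Y \<Longrightarrow> S y = \<zero>\<^bsub>Y\<^esub>" "\<And>y. y \<notin> carrier Y \<Longrightarrow> T y = \<zero>\<^bsub>Y\<^esub>"
    and "\<And>x y. x \<in> carrier Y \<Longrightarrow> y \<in> carrier Y \<Longrightarrow> ip x (S y) = ip (T x) y" "bounded_by S C"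
  shows "adjoint_pair S T"
  unfolding adjoint_pair_def
  by (intro conjI ballI allI impI assms exI[of _ C])

text \<open>An adjoint forces linearity: moved to the other side of the inner product, both
  expressions agree against every vector, and the inner product is nondegenerate.\<close>

lemma adjoint_linear:
  assumes "adjoint_pair S T"
  shows "x \<in> carrier Y \<Longrightarrow> y \<in> carrier Y \<Longrightarrow> S (x \<oplus>\<^bsub>Y\<^esub> y) = S x \<oplus>\<^bsub>Y\<^esub> S y"
    and "x \<in> carrier Y \<Longrightarrow> S (c \<odot>\<^bsub>Y\<^esub> x) = c \<odot>\<^bsub>Y\<^esub> S x"
    and "S \<zero>\<^bsub>Y\<^esub> = \<zero>\<^bsub>Y\<^esub>"
proof -
  note D = adjoint_pairD[OF assms]
  show "x \<in> carrier Y \<Longrightarrow> y \<in> carrier Y \<Longrightarrow> S (x \<oplus>\<^bsub>Y\<^esub> y) = S x \<oplus>\<^bsub>Y\<^esub> S y"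
    using D by (intro ip_nondegenerate) (auto simp: ip_add)
  show "x \<in> carrier Y \<Longrightarrow> S (c \<odot>\<^bsub>Y\<^esub> x) = c \<odot>\<^bsub>Y\<^esub> S x" for c x
    using D by (intro ip_nondegenerate) (auto simp: ip_smult)
  from this[of "\<zero>\<^bsub>Y\<^esub>" 0] show "S \<zero>\<^bsub>Y\<^esub> = \<zero>\<^bsub>Y\<^esub>" using D by (simp add: Y_smult_simps)
qed

text \<open>|Ty|^2 = |<y, STy>| <= |y| |S| |Ty|, and |Ty| cancels unless it is zero.\<close>

lemma adjoint_bounded:
  assumes "adjoint_pair S T"
  shows "bounded_by T (opnorm S)"
  unfolding bounded_by_def
proof (intro conjI ballI)
  note D = adjoint_pairD[OF assms]
  show "0 \<le> opnorm S" by (rule D)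
  fix y assume y: "y \<in> carrier Y"
  have "nrm (T y) * nrm (T y) = cnorm B (ip y (S (T y)))"
    using D(5)[of y "T y"] y D(2) by (simp add: nrm_square)
  also have "\<dots> \<le> nrm y * nrm (S (T y))" by (rule cnorm_ip[OF y D(1)])
  also have "\<dots> \<le> nrm y * (opnorm S * nrm (T y))"
    using D(8)[of "T y"] D(2) y by (intro mult_left_mono) auto
  finally have *: "nrm (T y) * nrm (T y) \<le> (opnorm S * nrm y) * nrm (T y)" by (simp add: algebra_simps)
  show "nrm (T y) \<le> opnorm S * nrm y"
  proof (cases "nrm (T y) = 0")
    case True
    then show ?thesis using y D(9) by simp
  next
    case False
    then have "nrm (T y) > 0" using nrm_nonneg[OF D(2)[of y]] by linarith
    then show ?thesis using * by simp
  qed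
qed

lemma adjoint_pair_swap: "adjoint_pair S T \<Longrightarrow> adjoint_pair T S"
  by (rule adjoint_pairI[where C = "opnorm S"])
    (simp_all add: adjoint_pairD(1-4)[of S T] adjoint_pairD(6)[of S T] adjoint_bounded[of S T])

lemma opnorm_adjoint_le: "adjoint_pair S T \<Longrightarrow> opnorm T \<le> opnorm S"
  by (rule opnorm_le[OF adjoint_bounded])

lemma adjoint_pair_add:
  assumes "adjoint_pair S T" "adjoint_pair S' T'"
  shows "adjoint_pair (\<lambda>y. S y \<oplus>\<^bsub>Y\<^esub> S' y) (\<lambda>y. T y \<oplus>\<^bsub>Y\<^esub> T' y)"
    and "opnorm (\<lambda>y. S y \<oplus>\<^bsub>Y\<^esub> S' y) \<le> opnorm S + opnorm S'"
proof -
  note D = adjoint_pairD[OF assms(1)] and D' = adjoint_pairD[OF assms(2)]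
  have b: "bounded_by (\<lambda>y. S y \<oplus>\<^bsub>Y\<^esub> S' y) (opnorm S + opnorm S')"
    unfolding bounded_by_def
  proof (intro conjI ballI)
    fix y assume "y \<in> carrier Y"
    then show "nrm (S y \<oplus>\<^bsub>Y\<^esub> S' y) \<le> (opnorm S + opnorm S') * nrm y"
      using nrm_add[of "S y" "S' y"] D(1)[of y] D'(1)[of y] D(8)[of y] D'(8)[of y]
      by (simp add: algebra_simps)
  qed (use D(9) D'(9) in simp)
  then show "adjoint_pair (\<lambda>y. S y \<oplus>\<^bsub>Y\<^esub> S' y) (\<lambda>y. T y \<oplus>\<^bsub>Y\<^esub> T' y)"
    by (intro adjoint_pairI) (simp_all add: D(1-5) D'(1-5) ip_add ip_add_left)
  show "opnorm (\<lambda>y. S y \<oplus>\<^bsub>Y\<^esub> S' y) \<le> opnorm S + opnorm S'" by (rule opnorm_le[OF b])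
qed

lemma adjoint_pair_smult:
  assumes "adjoint_pair S T"
  shows "adjoint_pair (\<lambda>y. c \<odot>\<^bsub>Y\<^esub> S y) (\<lambda>y. cnj c \<odot>\<^bsub>Y\<^esub> T y)"
    and "opnorm (\<lambda>y. c \<odot>\<^bsub>Y\<^esub> S y) \<le> cmod c * opnorm S"
proof -
  note D = adjoint_pairD[OF assms]
  have b: "bounded_by (\<lambda>y. c \<odot>\<^bsub>Y\<^esub> S y) (cmod c * opnorm S)"
    unfolding bounded_by_def
    using D(1,8,9) by (auto simp: nrm_smult mult.assoc intro: mult_left_mono)
  then show "adjoint_pair (\<lambda>y. c \<odot>\<^bsub>Y\<^esub> S y) (\<lambda>y. cnj c \<odot>\<^bsub>Y\<^esub> T y)"
    by (intro adjoint_pairI) (simp_all add: D(1-5) ip_smult ip_smult_left)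
  show "opnorm (\<lambda>y. c \<odot>\<^bsub>Y\<^esub> S y) \<le> cmod c * opnorm S" by (rule opnorm_le[OF b])
qed

lemma adjoint_pair_comp:
  assumes "adjoint_pair S T" "adjoint_pair S' T'"
  shows "adjoint_pair (\<lambda>y. S (S' y)) (\<lambda>y. T' (T y))"
    and "opnorm (\<lambda>y. S (S' y)) \<le> opnorm S * opnorm S'"
proof -
  note D = adjoint_pairD[OF assms(1)] and D' = adjoint_pairD[OF assms(2)]
  have b: "bounded_by (\<lambda>y. S (S' y)) (opnorm S * opnorm S')"
    unfolding bounded_by_def
  proof (intro conjI ballI)
    fix y assume y: "y \<in> carrier Y"
    have "nrm (S (S' y)) \<le> opnorm S * nrm (S' y)" by (rule D(8)[OF D'(1)])
    also have "\<dots> \<le> opnorm S * (opnorm S' * nrm y)" by (rule mult_left_mono[OF D'(8)[OF y] D(9)])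
    finally show "nrm (S (S' y)) \<le> opnorm S * opnorm S' * nrm y" by (simp add: mult.assoc)
  qed (use D(9) D'(9) in simp)
  have z: "T' \<zero>\<^bsub>Y\<^esub> = \<zero>\<^bsub>Y\<^esub>" by (rule adjoint_linear(3)[OF adjoint_pair_swap[OF assms(2)]])
  have "ip x (S (S' y)) = ip (T' (T x)) y" if "x \<in> carrier Y" "y \<in> carrier Y" for x y
    using D(5)[of x "S' y"] D'(5)[of "T x" y] D(2)[of x] D'(1)[of y] that by simp
  then show "adjoint_pair (\<lambda>y. S (S' y)) (\<lambda>y. T' (T y))"
    by (intro adjoint_pairI[OF _ _ _ _ _ b])
      (simp_all add: D(1-4) D'(1-4) z adjoint_linear(3)[OF assms(1)])
  show "opnorm (\<lambda>y. S (S' y)) \<le> opnorm S * opnorm S'" by (rule opnorm_le[OF b])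
qed

lemma adjoint_pair_zero: "adjoint_pair (\<lambda>_. \<zero>\<^bsub>Y\<^esub>) (\<lambda>_. \<zero>\<^bsub>Y\<^esub>)" and opnorm_zero: "opnorm (\<lambda>_. \<zero>\<^bsub>Y\<^esub>) = 0"
proof -
  have b: "bounded_by (\<lambda>_. \<zero>\<^bsub>Y\<^esub>) 0" by (simp add: bounded_by_def)
  have "ip x \<zero>\<^bsub>Y\<^esub> = \<zero>\<^bsub>B\<^esub>" "ip \<zero>\<^bsub>Y\<^esub> x = \<zero>\<^bsub>B\<^esub>" if "x \<in> carrier Y" for x
    using ip_smult[of x "\<zero>\<^bsub>Y\<^esub>" 0] ip_smult_left[of x "\<zero>\<^bsub>Y\<^esub>" 0] that by auto
  then show "adjoint_pair (\<lambda>_. \<zero>\<^bsub>Y\<^esub>) (\<lambda>_. \<zero>\<^bsub>Y\<^esub>)"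
    by (intro adjoint_pairI[OF _ _ _ _ _ b]) simp_all
  show "opnorm (\<lambda>_. \<zero>\<^bsub>Y\<^esub>) = 0" using opnorm_le[OF b] opnorm_nonneg[OF b] by simp
qed

text \<open>The nontrivial inequality comes from |Sy|^2 = |<y, TSy>| <= |TS| |y|^2.\<close>

lemma opnorm_cstar:
  assumes "adjoint_pair S T"
  shows "opnorm (\<lambda>y. T (S y)) = (opnorm S)\<^sup>2"
proof (rule antisym)
  note D = adjoint_pairD[OF assms]
  note c = adjoint_pair_comp[OF adjoint_pair_swap[OF assms] assms]
  have "opnorm (\<lambda>y. T (S y)) \<le> opnorm T * opnorm S" by (rule c)
  also have "\<dots> \<le> opnorm S * opnorm S"
    by (rule mult_right_mono[OF opnorm_adjoint_le[OF assms] D(9)])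
  finally show "opnorm (\<lambda>y. T (S y)) \<le> (opnorm S)\<^sup>2" by (simp add: power2_eq_square)
  let ?n = "opnorm (\<lambda>y. T (S y))"
  have n: "?n \<ge> 0" by (rule adjoint_pairD(9)[OF c(1)])
  have "bounded_by S (sqrt ?n)"
    unfolding bounded_by_def
  proof (intro conjI ballI)
    fix y assume y: "y \<in> carrier Y"
    have "nrm (S y) * nrm (S y) = cnorm B (ip y (T (S y)))"
      using D(6)[of y "S y"] y D(1) by (simp add: nrm_square)
    also have "\<dots> \<le> nrm y * nrm (T (S y))" by (rule cnorm_ip[OF y D(2)])
    also have "\<dots> \<le> nrm y * (?n * nrm y)"
      using adjoint_pairD(8)[OF c(1) y] y by (intro mult_left_mono) auto
    also have "\<dots> = (sqrt ?n * nrm y)\<^sup>2" using n by (simp add: power2_eq_square algebra_simps)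
    finally have "(nrm (S y))\<^sup>2 \<le> (sqrt ?n * nrm y)\<^sup>2" by (simp add: power2_eq_square)
    then show "nrm (S y) \<le> sqrt ?n * nrm y" by (rule power2_le_imp_le) (use n y in simp)
  qed (use n in simp)
  then have "opnorm S \<le> sqrt ?n" by (rule opnorm_le)
  then have "(opnorm S)\<^sup>2 \<le> (sqrt ?n)\<^sup>2" by (rule power_mono) (rule D(9))
  then show "(opnorm S)\<^sup>2 \<le> ?n" using n by simp
qed

lemma pre_cstar_adjointable: "pre_cstar_algebra adjointable"
proof (rule pre_cstar_algebra.intro)
  have pairs: "\<exists>S T. x = (S, T) \<and> adjoint_pair S T" if "x \<in> carrier adjointable" for x
    using that by (cases x) (auto simp: adjointable_simps)
  show "complex_vector_space adjointable"
  proof (rule complex_vector_spaceI)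
    fix x y z and c d :: complex
    assume "x \<in> carrier adjointable" "y \<in> carrier adjointable" "z \<in> carrier adjointable"
    then obtain S T S' T' S'' T'' where [simp]: "x = (S, T)" "y = (S', T')" "z = (S'', T'')"
      and ap: "adjoint_pair S T" "adjoint_pair S' T'" "adjoint_pair S'' T''"
      using pairs[of x] pairs[of y] pairs[of z] by blast
    note D = ap[THEN adjoint_pairD(1)] ap[THEN adjoint_pairD(2)]
    show "x \<oplus>\<^bsub>adjointable\<^esub> y \<in> carrier adjointable" "c \<odot>\<^bsub>adjointable\<^esub> x \<in> carrier adjointable"
      using adjoint_pair_add(1)[OF ap(1,2)] adjoint_pair_smult(1)[OF ap(1)] by (simp_all add: adjointable_simps)
    show "x \<oplus>\<^bsub>adjointable\<^esub> y = y \<oplus>\<^bsub>adjointable\<^esub> x"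
      by (simp add: adjointable_simps Y.a_comm[OF D(1) D(2)] Y.a_comm[OF D(4) D(5)])
    show "x \<oplus>\<^bsub>adjointable\<^esub> y \<oplus>\<^bsub>adjointable\<^esub> z = x \<oplus>\<^bsub>adjointable\<^esub> (y \<oplus>\<^bsub>adjointable\<^esub> z)"
      "\<zero>\<^bsub>adjointable\<^esub> \<oplus>\<^bsub>adjointable\<^esub> x = x"
      "(c + d) \<odot>\<^bsub>adjointable\<^esub> x = c \<odot>\<^bsub>adjointable\<^esub> x \<oplus>\<^bsub>adjointable\<^esub> d \<odot>\<^bsub>adjointable\<^esub> x"
      "c \<odot>\<^bsub>adjointable\<^esub> (x \<oplus>\<^bsub>adjointable\<^esub> y) = c \<odot>\<^bsub>adjointable\<^esub> x \<oplus>\<^bsub>adjointable\<^esub> c \<odot>\<^bsub>adjointable\<^esub> y"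
      "(c * d) \<odot>\<^bsub>adjointable\<^esub> x = c \<odot>\<^bsub>adjointable\<^esub> (d \<odot>\<^bsub>adjointable\<^esub> x)"
      "1 \<odot>\<^bsub>adjointable\<^esub> x = x" "0 \<odot>\<^bsub>adjointable\<^esub> x = \<zero>\<^bsub>adjointable\<^esub>"
      using D by (simp_all add: adjointable_simps Y_smult_simps Y.a_assoc)
  qed (auto simp: adjointable_simps adjoint_pair_zero)
  show "x \<otimes>\<^bsub>adjointable\<^esub> y \<in> carrier adjointable"
    if "x \<in> carrier adjointable" "y \<in> carrier adjointable" for x y
    using that by (cases x; cases y) (auto simp: adjointable_simps intro: adjoint_pair_comp)
  show "star adjointable x \<in> carrier adjointable" if "x \<in> carrier adjointable" for x
    using that by (cases x) (auto simp: adjointable_simps intro: adjoint_pair_swap)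
  show "cnorm adjointable (c \<odot>\<^bsub>adjointable\<^esub> x) = cmod c * cnorm adjointable x"
    if x: "x \<in> carrier adjointable" for x c
  proof -
    obtain S T where ST: "x = (S, T)" "adjoint_pair S T" using x by (cases x) (auto simp: adjointable_simps)
    show ?thesis
    proof (cases "c = 0")
      case True
      then show ?thesis using ST adjoint_pairD(1)[OF ST(2)]
        by (simp add: adjointable_simps Y_smult_simps opnorm_zero)
    next
      case False
      \<comment> \<open>Scaling back by 1/c turns the known upper bound into the reverse
        inequality.\<close>
      have "S = (\<lambda>y. (1 / c) \<odot>\<^bsub>Y\<^esub> (c \<odot>\<^bsub>Y\<^esub> S y))"
        using False adjoint_pairD(1)[OF ST(2)] by (simp flip: Y_smult_simps(2) add: Y_smult_simps(3))
      then have "opnorm S \<le> cmod (1 / c) * opnorm (\<lambda>y. c \<odot>\<^bsub>Y\<^esub> S y)"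
        using adjoint_pair_smult(2)[OF adjoint_pair_smult(1)[OF ST(2), of c], of "1 / c"] by simp
      then have "cmod c * opnorm S \<le> opnorm (\<lambda>y. c \<odot>\<^bsub>Y\<^esub> S y)"
        using False by (simp add: norm_divide field_simps)
      then show ?thesis using adjoint_pair_smult(2)[OF ST(2), of c] ST by (simp add: adjointable_simps)
    qed
  qed
  fix x y z c assume "x \<in> carrier adjointable" "y \<in> carrier adjointable" "z \<in> carrier adjointable"
  then obtain S T S' T' S'' T'' where [simp]: "x = (S, T)" "y = (S', T')" "z = (S'', T'')"
    and ap: "adjoint_pair S T" "adjoint_pair S' T'" "adjoint_pair S'' T''"
    by (cases x; cases y; cases z) (auto simp: adjointable_simps)
  note D = ap[THEN adjoint_pairD(1)] ap[THEN adjoint_pairD(2)]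
  note L = ap[THEN adjoint_linear(1)] ap[THEN adjoint_pair_swap, THEN adjoint_linear(1)]
    ap[THEN adjoint_linear(2)] ap[THEN adjoint_pair_swap, THEN adjoint_linear(2)]
  show "(x \<oplus>\<^bsub>adjointable\<^esub> y) \<otimes>\<^bsub>adjointable\<^esub> z =
      x \<otimes>\<^bsub>adjointable\<^esub> z \<oplus>\<^bsub>adjointable\<^esub> y \<otimes>\<^bsub>adjointable\<^esub> z"
    "x \<otimes>\<^bsub>adjointable\<^esub> (y \<oplus>\<^bsub>adjointable\<^esub> z) =
      x \<otimes>\<^bsub>adjointable\<^esub> y \<oplus>\<^bsub>adjointable\<^esub> x \<otimes>\<^bsub>adjointable\<^esub> z"
    "(c \<odot>\<^bsub>adjointable\<^esub> x) \<otimes>\<^bsub>adjointable\<^esub> y = c \<odot>\<^bsub>adjointable\<^esub> (x \<otimes>\<^bsub>adjointable\<^esub> y)"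
    "x \<otimes>\<^bsub>adjointable\<^esub> (c \<odot>\<^bsub>adjointable\<^esub> y) = c \<odot>\<^bsub>adjointable\<^esub> (x \<otimes>\<^bsub>adjointable\<^esub> y)"
    by (simp_all add: adjointable_simps D L)
  show "cnorm adjointable (star adjointable x \<otimes>\<^bsub>adjointable\<^esub> x) = (cnorm adjointable x)\<^sup>2"
    by (simp only: \<open>x = _\<close> adjointable_simps) (rule opnorm_cstar[OF ap(1)])
  show "cnorm adjointable (x \<oplus>\<^bsub>adjointable\<^esub> y) \<le> cnorm adjointable x + cnorm adjointable y"
    by (simp only: \<open>x = _\<close> \<open>y = _\<close> adjointable_simps) (rule adjoint_pair_add(2)[OF ap(1,2)])
  show "cnorm adjointable (x \<otimes>\<^bsub>adjointable\<^esub> y) \<le> cnorm adjointable x * cnorm adjointable y"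
    by (simp only: \<open>x = _\<close> \<open>y = _\<close> adjointable_simps) (rule adjoint_pair_comp(2)[OF ap(1,2)])
  show "0 \<le> cnorm adjointable x"
    by (simp only: \<open>x = _\<close> adjointable_simps) (rule adjoint_pairD(9)[OF ap(1)])
  show "(x \<otimes>\<^bsub>adjointable\<^esub> y) \<otimes>\<^bsub>adjointable\<^esub> z =
      x \<otimes>\<^bsub>adjointable\<^esub> (y \<otimes>\<^bsub>adjointable\<^esub> z)"
    "star adjointable (star adjointable x) = x"
    "star adjointable (x \<oplus>\<^bsub>adjointable\<^esub> y) = star adjointable x \<oplus>\<^bsub>adjointable\<^esub> star adjointable y"
    "star adjointable (c \<odot>\<^bsub>adjointable\<^esub> x) = cnj c \<odot>\<^bsub>adjointable\<^esub> star adjointable x"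
    "star adjointable (x \<otimes>\<^bsub>adjointable\<^esub> y) = star adjointable y \<otimes>\<^bsub>adjointable\<^esub> star adjointable x"
    by (simp_all add: adjointable_simps)
next
  show "cnorm adjointable \<zero>\<^bsub>adjointable\<^esub> = 0"
    by (simp add: adjointable_simps opnorm_zero)
qed

lemma adjointable_one:
  "\<one>\<^bsub>adjointable\<^esub> \<in> carrier adjointable"
  "x \<in> carrier adjointable \<Longrightarrow> \<one>\<^bsub>adjointable\<^esub> \<otimes>\<^bsub>adjointable\<^esub> x = x"
  "x \<in> carrier adjointable \<Longrightarrow> x \<otimes>\<^bsub>adjointable\<^esub> \<one>\<^bsub>adjointable\<^esub> = x"
proof -
  have "bounded_by (\<lambda>y. if y \<in> carrier Y then y else \<zero>\<^bsub>Y\<^esub>) 1" by (simp add: bounded_by_def)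
  then have "adjoint_pair (\<lambda>y. if y \<in> carrier Y then y else \<zero>\<^bsub>Y\<^esub>) (\<lambda>y. if y \<in> carrier Y then y else \<zero>\<^bsub>Y\<^esub>)"
    by (intro adjoint_pairI) simp_all
  then show "\<one>\<^bsub>adjointable\<^esub> \<in> carrier adjointable"
    by (simp add: adjointable_simps)
  assume "x \<in> carrier adjointable"
  then obtain S T where ST: "x = (S, T)" "adjoint_pair S T" by (cases x) (auto simp: adjointable_simps)
  note D = adjoint_pairD[OF ST(2)] adjoint_linear(3)[OF ST(2)] adjoint_linear(3)[OF adjoint_pair_swap[OF ST(2)]]
  show "\<one>\<^bsub>adjointable\<^esub> \<otimes>\<^bsub>adjointable\<^esub> x = x" "x \<otimes>\<^bsub>adjointable\<^esub> \<one>\<^bsub>adjointable\<^esub> = x"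
    using D by (auto simp: ST adjointable_simps fun_eq_iff)
qed

end

section \<open>Homomorphisms and positivity\<close>

text \<open>Infinite index sets are covered because both sums are then zero by convention.\<close>

lemma additive_finsum:
  assumes "abelian_group G" "abelian_group H"
    and "\<And>x. x \<in> carrier G \<Longrightarrow> f x \<in> carrier H" "f \<zero>\<^bsub>G\<^esub> = \<zero>\<^bsub>H\<^esub>"
    and "\<And>x y. x \<in> carrier G \<Longrightarrow> y \<in> carrier G \<Longrightarrow> f (x \<oplus>\<^bsub>G\<^esub> y) = f x \<oplus>\<^bsub>H\<^esub> f y"
    and "\<And>i. i \<in> I \<Longrightarrow> g i \<in> carrier G"
  shows "f (finsum G g I) = finsum H (\<lambda>i. f (g i)) I"
proof -
  interpret G: abelian_group G by fact
  interpret H: abelian_group H by fact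
  show ?thesis
    using assms(6)
  proof (induction I rule: infinite_finite_induct)
    case (insert i I)
    then have "finsum G g I \<in> carrier G" by (intro G.finsum_closed) auto
    then show ?case using insert assms(3,5) by (simp add: G.finsum_insert H.finsum_insert Pi_iff)
  qed (use assms in \<open>simp_all add: G.finsum_infinite H.finsum_infinite\<close>)
qed

context pre_cstar_algebra
begin

lemma finsum_mult_right:
  "x \<in> carrier A \<Longrightarrow> (\<And>i. i \<in> I \<Longrightarrow> g i \<in> carrier A) \<Longrightarrow> finsum A g I \<otimes> x = (\<Oplus>i\<in>I. g i \<otimes> x)"
  by (rule additive_finsum[of A A "\<lambda>y. y \<otimes> x"]) (auto simp: mult_add_left abelian_group_axioms)

lemma finsum_mult_left:
  "x \<in> carrier A \<Longrightarrow> (\<And>i. i \<in> I \<Longrightarrow> g i \<in> carrier A) \<Longrightarrow> x \<otimes> finsum A g I = (\<Oplus>i\<in>I. x \<otimes> g i)"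
  by (rule additive_finsum[of A A "\<lambda>y. x \<otimes> y"]) (auto simp: mult_add_right abelian_group_axioms)

lemma finsum_star:
  "(\<And>i. i \<in> I \<Longrightarrow> g i \<in> carrier A) \<Longrightarrow> star A (finsum A g I) = (\<Oplus>i\<in>I. star A (g i))"
  by (rule additive_finsum[of A A "star A"]) (auto simp: star_add abelian_group_axioms)

lemma finsum_in_subspace:
  assumes "linear_subspace A S" "\<And>i. i \<in> I \<Longrightarrow> g i \<in> S"
  shows "finsum A g I \<in> S"
  using assms(2)
proof (induction I rule: infinite_finite_induct)
  case (insert i I)
  then show ?case using assms(1) by (subst finsum_insert) (auto simp: linear_subspace_def)
qed (use assms(1) in \<open>auto simp: linear_subspace_def finsum_infinite\<close>)

end

locale star_homomorphism = A: pre_cstar_algebra A + B: pre_cstar_algebra B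
  for A :: "'a cstar" and B :: "'b cstar" +
  fixes \<phi> :: "'a \<Rightarrow> 'b"
  assumes star_hom: "star_hom A B \<phi>"
begin

lemma closed [simp, intro]: "x \<in> carrier A \<Longrightarrow> \<phi> x \<in> carrier B"
  and map_star: "x \<in> carrier A \<Longrightarrow> \<phi> (star A x) = star B (\<phi> x)"
  and map_smult: "x \<in> carrier A \<Longrightarrow> \<phi> (c \<odot>\<^bsub>A\<^esub> x) = c \<odot>\<^bsub>B\<^esub> \<phi> x"
  and map_add: "x \<in> carrier A \<Longrightarrow> y \<in> carrier A \<Longrightarrow> \<phi> (x \<oplus>\<^bsub>A\<^esub> y) = \<phi> x \<oplus>\<^bsub>B\<^esub> \<phi> y"
  and map_mult: "x \<in> carrier A \<Longrightarrow> y \<in> carrier A \<Longrightarrow> \<phi> (x \<otimes>\<^bsub>A\<^esub> y) = \<phi> x \<otimes>\<^bsub>B\<^esub> \<phi> y"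
  using star_hom by (auto simp: star_hom_def)

lemma map_zero [simp]: "\<phi> \<zero>\<^bsub>A\<^esub> = \<zero>\<^bsub>B\<^esub>"
  using map_smult[of "\<zero>\<^bsub>A\<^esub>" 0] by simp

lemma map_minus: "x \<in> carrier A \<Longrightarrow> \<phi> (\<ominus>\<^bsub>A\<^esub> x) = \<ominus>\<^bsub>B\<^esub> \<phi> x"
  using map_smult[of x "-1"] by (simp add: A.smult_minus_one B.smult_minus_one)

lemma map_diff: "x \<in> carrier A \<Longrightarrow> y \<in> carrier A \<Longrightarrow> \<phi> (x \<ominus>\<^bsub>A\<^esub> y) = \<phi> x \<ominus>\<^bsub>B\<^esub> \<phi> y"
  by (simp add: A.minus_eq B.minus_eq map_add map_minus)

lemma map_finsum: "(\<And>i. i \<in> I \<Longrightarrow> g i \<in> carrier A) \<Longrightarrow> \<phi> (finsum A g I) = finsum B (\<lambda>i. \<phi> (g i)) I"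
  by (rule additive_finsum) (auto simp: A.abelian_group_axioms B.abelian_group_axioms map_add)

end

locale isometric_homomorphism = star_homomorphism A B \<phi> + A: cstar_algebra A + B: cstar_algebra B
  for A :: "'a cstar" and B :: "'b cstar" and \<phi> +
  assumes isometric: "x \<in> carrier A \<Longrightarrow> cnorm B (\<phi> x) = cnorm A x"
begin

lemma injective: "x \<in> carrier A \<Longrightarrow> y \<in> carrier A \<Longrightarrow> \<phi> x = \<phi> y \<Longrightarrow> x = y"
  using isometric[of "x \<ominus>\<^bsub>A\<^esub> y"] A.cnorm_eq_0[of "x \<ominus>\<^bsub>A\<^esub> y"] by (simp add: map_diff A.diff_eq_zero)

lemma inj_on_carrier: "inj_on \<phi> (carrier A)"
  using injective by (auto simp: inj_on_def)

text \<open>By isometry, approximants in the image pull back to a Cauchy sequence, which converges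
  since \<open>A\<close> is complete, with limit in \<open>S\<close> since \<open>S\<close> is
  closed.\<close>

lemma norm_closed_image:
  assumes S: "S \<subseteq> carrier A" "norm_closed A S"
  shows "norm_closed B (\<phi> ` S)"
  unfolding norm_closed_def
proof (intro ballI impI)
  fix x assume x: "x \<in> carrier B" and ap: "\<forall>e>0. \<exists>y\<in>\<phi> ` S. cnorm B (x \<ominus>\<^bsub>B\<^esub> y) < e"
  have "\<phi> ` S \<subseteq> carrier B" using S(1) by auto
  then obtain t where t: "\<And>n. t n \<in> \<phi> ` S" "B.converges_to t x"
    using B.approximable_converges[OF _ x ap] by metis
  have "\<forall>n. \<exists>y. y \<in> S \<and> t n = \<phi> y" using t(1) by (auto simp: image_iff)
  then obtain s where s: "\<And>n. s n \<in> S" "\<And>n. t n = \<phi> (s n)" by metis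
  have sA: "s n \<in> carrier A" for n using s S by blast
  have "\<exists>n\<^sub>0. \<forall>m\<ge>n\<^sub>0. \<forall>n\<ge>n\<^sub>0. cnorm A (s m \<ominus>\<^bsub>A\<^esub> s n) < e" if "e > 0" for e
  proof -
    have "e / 2 > 0" using that by simp
    then obtain N where N: "\<And>n. n \<ge> N \<Longrightarrow> cnorm B (t n \<ominus>\<^bsub>B\<^esub> x) < e / 2"
      using order_tendstoD(2)[OF B.converges_toD(3)[OF t(2)]] unfolding eventually_sequentially by blast
    have "cnorm A (s m \<ominus>\<^bsub>A\<^esub> s n) < e" if "m \<ge> N" "n \<ge> N" for m n
    proof -
      have "cnorm A (s m \<ominus>\<^bsub>A\<^esub> s n) = cnorm B (t m \<ominus>\<^bsub>B\<^esub> t n)"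
        using isometric[of "s m \<ominus>\<^bsub>A\<^esub> s n"] sA s by (simp add: map_diff)
      also have "\<dots> \<le> cnorm B (t m \<ominus>\<^bsub>B\<^esub> x) + cnorm B (x \<ominus>\<^bsub>B\<^esub> t n)"
        using x sA s by (intro B.cnorm_diff_triangle) auto
      also have "\<dots> < e"
        using N[OF that(1)] N[OF that(2)] B.cnorm_diff_commute[of x "t n"] x sA s by simp
      finally show ?thesis .
    qed
    then show ?thesis by blast
  qed
  then obtain l where l: "A.converges_to s l" using A.Cauchy_converges[of s] sA by blast
  have lS: "l \<in> S" by (rule A.norm_closed_converges[OF S(2) l s(1)])
  have "B.converges_to t (\<phi> l)"
  proof (rule B.converges_toI[where g = "\<lambda>n. cnorm A (s n \<ominus>\<^bsub>A\<^esub> l)"])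
    show "cnorm B (t n \<ominus>\<^bsub>B\<^esub> \<phi> l) \<le> cnorm A (s n \<ominus>\<^bsub>A\<^esub> l)" for n
      using isometric[of "s n \<ominus>\<^bsub>A\<^esub> l"] sA A.converges_toD(2)[OF l] s by (simp add: map_diff)
  qed (use s sA A.converges_toD[OF l] in auto)
  then have "x = \<phi> l" by (rule B.converges_to_unique[OF t(2)])
  then show "x \<in> \<phi> ` S" using lS by blast
qed

lemma closed_subalgebra_image:
  assumes "A.closed_subalgebra S"
  shows "B.closed_subalgebra (\<phi> ` S)"
proof -
  note D = A.closed_subalgebraD[OF assms]
  have "\<zero>\<^bsub>B\<^esub> \<in> \<phi> ` S" using imageI[OF D(2), of \<phi>] by simp
  then have "linear_subspace B (\<phi> ` S)"
    unfolding linear_subspace_def by (auto simp: map_smult[symmetric] map_add[symmetric] D(1) intro: D(3,4))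
  moreover have "norm_closed B (\<phi> ` S)" by (rule norm_closed_image) (use D in auto)
  ultimately show ?thesis
    unfolding B.closed_subalgebra_def by (auto simp: map_mult[symmetric] D(1) intro: D(5))
qed

end

text \<open>The hypotheses say that s = 1 - v commutes with b and that b^2 + s^2 = 1. They are
  phrased without the unit so that a homomorphism can carry them over from a nonunital
  algebra.\<close>

lemma (in unital_cstar_algebra) cnorm_le_1_if_sqrt:
  assumes b: "b \<in> carrier A" "star A b = b" and v: "v \<in> carrier A" "star A v = v"
    and vb: "v \<otimes> b = b \<otimes> v" and vv: "v \<oplus> v = b \<otimes> b \<oplus> v \<otimes> v"
  shows "cnorm A b \<le> 1"
proof -
  define s where "s = \<one> \<ominus> v"
  have s: "s \<in> carrier A" "star A s = s" using v by (auto simp: s_def star_diff)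
  have "s \<otimes> s = \<one> \<ominus> (v \<oplus> v) \<oplus> v \<otimes> v" unfolding s_def using v(1) by algebra
  also have "b \<otimes> b \<oplus> \<dots> = \<one>" unfolding vv using b(1) v(1) by algebra
  finally have one: "b \<otimes> b \<oplus> s \<otimes> s = \<one>" .
  have "b \<otimes> s = s \<otimes> b" unfolding s_def using b(1) v(1) vb by algebra
  then have "(cnorm A b)\<^sup>2 \<le> 1\<^sup>2" using cnorm_commuting_squares[of b s] b s one cnorm_one_le by simp
  then show ?thesis by (rule power2_le_imp_le) simp
qed

section \<open>The left regular representation and a unital extension\<close>

locale cstar = cstar_algebra A for A :: "'a cstar" (structure)
begin

lemma cnorm_star_mult: "x \<in> carrier A \<Longrightarrow> sqrt (cnorm A (star A x \<otimes> x)) = cnorm A x"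
  by (simp add: cstar_identity)

sublocale M: inner_product_module A A "\<lambda>x y. star A x \<otimes> y"
proof (rule inner_product_module.intro[OF pre_cstar_algebra_axioms], rule inner_product_module_axioms.intro)
  show "complex_vector_space A" by (rule vector_space)
  fix x y assume xy: "x \<in> carrier A" "y \<in> carrier A"
  show "cnorm A (star A x \<otimes> y) \<le> sqrt (cnorm A (star A x \<otimes> x)) * sqrt (cnorm A (star A y \<otimes> y))"
    using xy cnorm_mult[of "star A x" y] by (simp add: cnorm_star_mult)
qed (auto simp: mult_add_right smult_mult_right star_mult cstar_identity cnorm_eq_0)

lemma M_nrm: "x \<in> carrier A \<Longrightarrow> M.nrm x = cnorm A x"
  by (simp add: M.nrm_def cnorm_star_mult)

definition left_mult :: "'a \<Rightarrow> ('a \<Rightarrow> 'a) \<times> ('a \<Rightarrow> 'a)" where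
  "left_mult a = (\<lambda>y. if y \<in> carrier A then a \<otimes> y else \<zero>, \<lambda>y. if y \<in> carrier A then star A a \<otimes> y else \<zero>)"

lemma left_mult_bounded:
  assumes a: "a \<in> carrier A"
  shows "M.bounded_by (\<lambda>y. if y \<in> carrier A then a \<otimes> y else \<zero>) (cnorm A a)"
  unfolding M.bounded_by_def using a by (auto simp: M_nrm cnorm_mult)

lemma left_mult_adjoint:
  assumes a: "a \<in> carrier A"
  shows "M.adjoint_pair (fst (left_mult a)) (snd (left_mult a))"
  unfolding left_mult_def fst_conv snd_conv
  by (rule M.adjoint_pairI[OF _ _ _ _ _ left_mult_bounded[OF a]])
    (use a in \<open>auto simp: star_mult mult_assoc\<close>)

text \<open>Evaluation at \<open>star A a\<close> attains the bound, since
  \<open>a \<otimes> star A a\<close> has norm |a|^2.\<close>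

lemma left_mult_opnorm:
  assumes a: "a \<in> carrier A"
  shows "M.opnorm (fst (left_mult a)) = cnorm A a"
proof (rule antisym)
  show "M.opnorm (fst (left_mult a)) \<le> cnorm A a"
    unfolding left_mult_def fst_conv by (rule M.opnorm_le[OF left_mult_bounded[OF a]])
  have "cnorm A (a \<otimes> star A a) \<le> M.opnorm (fst (left_mult a)) * cnorm A a"
    using M.adjoint_pairD(8)[OF left_mult_adjoint[OF a], of "star A a"] a
    by (simp add: left_mult_def M_nrm)
  moreover have "cnorm A (a \<otimes> star A a) = cnorm A a * cnorm A a"
    using cstar_identity[of "star A a"] a by (simp add: power2_eq_square)
  moreover have "M.opnorm (fst (left_mult a)) \<ge> 0"
    by (rule M.adjoint_pairD(9)[OF left_mult_adjoint[OF a]])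
  ultimately show "cnorm A a \<le> M.opnorm (fst (left_mult a))"
    using cnorm_nonneg[OF a] by (cases "cnorm A a = 0") auto
qed

lemma star_hom_left_mult: "star_hom A M.adjointable left_mult"
  unfolding star_hom_def
proof (intro ballI conjI allI)
  fix x assume x: "x \<in> carrier A"
  show "left_mult x \<in> carrier M.adjointable"
    using left_mult_adjoint[OF x] by (cases "left_mult x") (simp add: M.adjointable_simps)
  show "left_mult (star A x) = star M.adjointable (left_mult x)"
    using x by (simp add: left_mult_def M.adjointable_simps fun_eq_iff)
  show "left_mult (c \<odot> x) = c \<odot>\<^bsub>M.adjointable\<^esub> left_mult x" for c
    using x by (auto simp: left_mult_def M.adjointable_simps fun_eq_iff smult_mult_left star_smult)
  fix y assume y: "y \<in> carrier A"
  show "left_mult (x \<oplus> y) = left_mult x \<oplus>\<^bsub>M.adjointable\<^esub> left_mult y"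
    using x y by (auto simp: left_mult_def M.adjointable_simps fun_eq_iff mult_add_left star_add)
  show "left_mult (x \<otimes> y) = left_mult x \<otimes>\<^bsub>M.adjointable\<^esub> left_mult y"
    using x y by (auto simp: left_mult_def M.adjointable_simps fun_eq_iff mult_assoc star_mult)
qed

sublocale K: completion M.adjointable
  by (simp add: completion_def M.pre_cstar_adjointable)

text \<open>A unital C*-algebra containing \<open>A\<close>: the completed multiplier algebra.\<close>

definition \<iota> :: "'a \<Rightarrow> (nat \<Rightarrow> ('a \<Rightarrow> 'a) \<times> ('a \<Rightarrow> 'a)) set" where
  "\<iota> a = K.embed (left_mult a)"

sublocale E: unital_cstar_algebra K.completed
  by (rule K.embed_one) (simp_all add: M.adjointable_one)

sublocale \<iota>: isometric_homomorphism A K.completed \<iota>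
proof
  show "star_hom A K.completed \<iota>"
    using star_hom_left_mult K.star_hom_embed unfolding star_hom_def \<iota>_def by simp
  show "cnorm K.completed (\<iota> x) = cnorm A x" if "x \<in> carrier A" for x
  proof -
    have "cnorm M.adjointable (left_mult x) = cnorm A x"
      using left_mult_opnorm[OF that] by (cases "left_mult x") (simp add: M.adjointable_simps)
    moreover have "left_mult x \<in> carrier M.adjointable"
      using star_hom_left_mult that by (simp add: star_hom_def)
    ultimately show ?thesis by (simp add: \<iota>_def K.cnorm_embed)
  qed
qed

section \<open>The positive cone of a possibly nonunital algebra\<close>

lemma closed_subalgebra_carrier: "closed_subalgebra (carrier A)"
  by (auto simp: closed_subalgebra_def linear_subspace_def norm_closed_def)

lemma is_positive_carrier: "is_positive A h \<Longrightarrow> h \<in> carrier A"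
  by (auto simp: is_positive_def)

lemma is_positive_imp_pos: "is_positive A h \<Longrightarrow> E.pos (\<iota> h)"
  using E.pos_star_mult_self \<iota>.closed by (auto simp: is_positive_def \<iota>.map_mult \<iota>.map_star)

text \<open>The root is taken in the unital extension. It lies in every closed subalgebra containing
  the image of h, in particular in the image of \<open>A\<close> and in that of each such
  \<open>S\<close>, so it comes from an element of \<open>A\<close> with the same
  minimality.\<close>

lemma pos_root:
  assumes h: "h \<in> carrier A" "E.pos (\<iota> h)"
  obtains c where "c \<in> carrier A" "star A c = c" "c \<otimes> c = h" "\<And>S. closed_subalgebra S \<Longrightarrow> h \<in> S \<Longrightarrow> c \<in> S"
proof -
  obtain c' where c': "E.pos c'" "c' \<otimes>\<^bsub>K.completed\<^esub> c' = \<iota> h"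
    "\<And>S. E.closed_subalgebra S \<Longrightarrow> \<iota> h \<in> S \<Longrightarrow> c' \<in> S"
    using E.pos_sqrt[OF h(2)] by metis
  have "c' \<in> \<iota> ` carrier A"
    by (rule c'(3)[OF \<iota>.closed_subalgebra_image[OF closed_subalgebra_carrier]]) (use h in blast)
  then obtain c where c: "c \<in> carrier A" "c' = \<iota> c" by blast
  have "star A c = c"
    using E.pos_selfadjoint[OF c'(1)] c by (intro \<iota>.injective) (auto simp: \<iota>.map_star)
  moreover have "c \<otimes> c = h" using c'(2) c h by (intro \<iota>.injective) (auto simp: \<iota>.map_mult)
  moreover have "c \<in> S" if S: "closed_subalgebra S" "h \<in> S" for S
  proof -
    have "\<iota> c \<in> \<iota> ` S" using c'(3)[OF \<iota>.closed_subalgebra_image[OF S(1)]] S(2) c(2) by blast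
    then show ?thesis using \<iota>.injective c(1) closed_subalgebraD(1)[OF S(1)] by blast
  qed
  ultimately show ?thesis using that c by blast
qed

lemma is_positive_iff_pos: "h \<in> carrier A \<Longrightarrow> is_positive A h \<longleftrightarrow> E.pos (\<iota> h)"
  using pos_root is_positive_imp_pos unfolding is_positive_def by metis

lemma is_positive_star_mult: "x \<in> carrier A \<Longrightarrow> is_positive A (star A x \<otimes> x)"
  by (auto simp: is_positive_def)

text \<open>The norm criterion \<open>E.pos\<close> is additive, and \<open>pos_root\<close> leads
  back from it to an element of the form c^* c.\<close>

lemma is_positive_add:
  "is_positive A h \<Longrightarrow> is_positive A k \<Longrightarrow> is_positive A (h \<oplus> k)"
  using E.pos_add is_positive_imp_pos is_positive_carrier by (simp add: is_positive_iff_pos \<iota>.map_add)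

lemma is_positive_zero: "is_positive A \<zero>"
  by (auto simp: is_positive_def intro!: bexI[of _ \<zero>])

lemma is_positive_finsum:
  assumes "\<And>i. i \<in> I \<Longrightarrow> is_positive A (g i)"
  shows "is_positive A (finsum A g I)"
  using assms
proof (induction I rule: infinite_finite_induct)
  case (insert i I)
  then show ?case using is_positive_carrier
    by (subst finsum_insert) (auto intro: is_positive_add)
qed (simp_all add: is_positive_zero finsum_infinite)

lemma is_positive_cnorm_mono:
  assumes "is_positive A h" "is_positive A k"
  shows "cnorm A h \<le> cnorm A (h \<oplus> k)"
  using E.pos_cnorm_mono[OF is_positive_imp_pos[OF assms(1)] is_positive_imp_pos[OF assms(2)]]
    assms[THEN is_positive_carrier] by (simp add: \<iota>.isometric flip: \<iota>.map_add)

text \<open>The other summands being positive, each one is dominated in norm by the whole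
  sum.\<close>

lemma sum_star_mult_eq_zero:
  assumes "finite I" "\<And>i. i \<in> I \<Longrightarrow> z i \<in> carrier A" "(\<Oplus>i\<in>I. star A (z i) \<otimes> z i) = \<zero>" "i \<in> I"
  shows "z i = \<zero>"
proof -
  let ?r = "\<Oplus>i\<in>I - {i}. star A (z i) \<otimes> z i"
  have c: "(\<lambda>i. star A (z i) \<otimes> z i) \<in> I - {i} \<rightarrow> carrier A" using assms by auto
  have "is_positive A ?r" using assms by (intro is_positive_finsum is_positive_star_mult) auto
  then have "cnorm A (star A (z i) \<otimes> z i) \<le> cnorm A (star A (z i) \<otimes> z i \<oplus> ?r)"
    using assms by (intro is_positive_cnorm_mono is_positive_star_mult) auto
  also have "star A (z i) \<otimes> z i \<oplus> ?r = (\<Oplus>i\<in>I. star A (z i) \<otimes> z i)"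
    using finsum_insert[OF _ _ c, of i] assms by (simp add: insert_absorb)
  finally have "(cnorm A (z i))\<^sup>2 \<le> 0" using assms cstar_identity[of "z i"] by simp
  then show ?thesis using cnorm_eq_0[of "z i"] assms by simp
qed

text \<open>(CK4) says only that certain projections add up to a projection; this supplies their
  orthogonality. Both conclusions come from a vanishing sum of elements z^* z. With P the sum, z =
  p_i - p_i P first gives p_i = p_i P. Then p_j = p_j P p_j already contains the summand p_j, so the
  remaining terms, with z = p_i p_j for i different from j, add up to zero.\<close>

lemma projections_orthogonal:
  assumes I: "finite I" "\<And>i. i \<in> I \<Longrightarrow> is_projection A (p i)" and sum: "is_projection A (finsum A p I)"
  shows "i \<in> I \<Longrightarrow> finsum A p I \<otimes> p i = p i"
    and "i \<in> I \<Longrightarrow> j \<in> I \<Longrightarrow> i \<noteq> j \<Longrightarrow> p i \<otimes> p j = \<zero>"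
proof -
  define P where "P = finsum A p I"
  have P: "P \<in> carrier A" "star A P = P" "P \<otimes> P = P" using sum by (auto simp: P_def is_projection_def)
  have p: "p i \<in> carrier A" "star A (p i) = p i" "p i \<otimes> p i = p i" if "i \<in> I" for i
    using I(2)[OF that] by (auto simp: is_projection_def)
  have *: "P \<otimes> p i = p i" if i: "i \<in> I" for i
  proof -
    let ?z = "\<lambda>i. p i \<ominus> p i \<otimes> P"
    have "star A (?z i) \<otimes> ?z i = (p i \<ominus> P \<otimes> p i) \<ominus> (p i \<ominus> P \<otimes> p i) \<otimes> P" if "i \<in> I" for i
    proof -
      have "star A (?z i) \<otimes> ?z i = (p i \<ominus> P \<otimes> p i) \<otimes> (p i \<ominus> p i \<otimes> P)"
        using p[OF that] P by (simp add: star_diff star_mult)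
      also have "\<dots> = (p i \<otimes> p i \<ominus> P \<otimes> (p i \<otimes> p i)) \<ominus> (p i \<otimes> p i \<ominus> P \<otimes> (p i \<otimes> p i)) \<otimes> P"
        using p(1)[OF that] P(1) by algebra
      finally show ?thesis using p(3)[OF that] by simp
    qed
    then have "(\<Oplus>i\<in>I. star A (?z i) \<otimes> ?z i) = (\<Oplus>i\<in>I. (p i \<ominus> P \<otimes> p i) \<ominus> (p i \<ominus> P \<otimes> p i) \<otimes> P)"
      using p P by (intro finsum_cong') auto
    \<comment> \<open>The summand is an additive function of \<open>p i\<close>, so the sum is its
      value at P, which vanishes as P is idempotent.\<close>
    also have "\<dots> = (P \<ominus> P \<otimes> P) \<ominus> (P \<ominus> P \<otimes> P) \<otimes> P"
      unfolding P_def
      by (rule additive_finsum[of A A "\<lambda>x. (x \<ominus> P \<otimes> x) \<ominus> (x \<ominus> P \<otimes> x) \<otimes> P", unfolded P_def, symmetric])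
        (use p P abelian_group_axioms in \<open>auto simp: P_def[symmetric]\<close>, algebra)
    also have "\<dots> = \<zero>" using P by simp
    finally have "?z i = \<zero>" using p P i I by (intro sum_star_mult_eq_zero[of I ?z]) auto
    then have "p i = p i \<otimes> P" using p P i by (simp add: diff_eq_zero)
    then have "star A (p i) = star A (p i \<otimes> P)" by simp
    then show ?thesis using p P i by (simp add: star_mult)
  qed
  then show "i \<in> I \<Longrightarrow> finsum A p I \<otimes> p i = p i" by (simp add: P_def)
  show "p i \<otimes> p j = \<zero>" if ij: "i \<in> I" "j \<in> I" "i \<noteq> j"
  proof -
    let ?z = "\<lambda>i. p i \<otimes> p j"
    have sq: "star A (?z i) \<otimes> ?z i = p j \<otimes> p i \<otimes> p j" if "i \<in> I" for i
    proof -
      have "star A (?z i) \<otimes> ?z i = p j \<otimes> (p i \<otimes> p i) \<otimes> p j"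
        using p(1,2) that ij by (simp add: star_mult mult_assoc)
      then show ?thesis using p(3)[OF that] by simp
    qed
    have c: "(\<lambda>i. p j \<otimes> p i \<otimes> p j) \<in> I \<rightarrow> carrier A" using p ij by auto
    have "p j = p j \<otimes> P \<otimes> p j" using *[of j] p P ij by (simp add: mult_assoc)
    also have "\<dots> = (\<Oplus>i\<in>I. p j \<otimes> p i \<otimes> p j)"
      using p ij by (simp add: P_def finsum_mult_left finsum_mult_right)
    also have "\<dots> = (\<Oplus>i\<in>insert j (I - {j}). p j \<otimes> p i \<otimes> p j)" using ij by (simp add: insert_absorb)
    also have "\<dots> = p j \<oplus> (\<Oplus>i\<in>I - {j}. p j \<otimes> p i \<otimes> p j)"
      using I ij p c by (subst finsum_insert) (auto simp: p(3))
    finally have "p j = p j \<oplus> (\<Oplus>i\<in>I - {j}. p j \<otimes> p i \<otimes> p j)" .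
    moreover have "(\<Oplus>i\<in>I - {j}. p j \<otimes> p i \<otimes> p j) \<in> carrier A" using c by (intro finsum_closed) auto
    ultimately have "(\<Oplus>i\<in>I - {j}. p j \<otimes> p i \<otimes> p j) = \<zero>"
      using p(1)[OF ij(2)] add.l_cancel_one' by metis
    then have "(\<Oplus>i\<in>I - {j}. star A (?z i) \<otimes> ?z i) = \<zero>"
      using sq c by (subst finsum_cong'[where g = "\<lambda>i. p j \<otimes> p i \<otimes> p j"]) auto
    then show ?thesis using I p ij by (intro sum_star_mult_eq_zero[of "I - {j}" ?z]) auto
  qed
qed

end

text \<open>If \<open>a\<close> is selfadjoint of norm at most one, then \<open>1 - a\<^sup>2\<close> is the square of a selfadjoint
  element commuting with \<open>a\<close>; this is preserved by homomorphisms and bounds the norm of the image.\<close>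

lemma star_hom_selfadjoint_le_1:
  assumes "cstar A" "cstar B" "star_hom A B \<phi>"
    and a: "a \<in> carrier A" "star A a = a" "cnorm A a \<le> 1"
  shows "cnorm B (\<phi> a) \<le> 1"
proof -
  interpret A: cstar A by fact
  interpret B: cstar B by fact
  interpret \<phi>: star_homomorphism A B \<phi> by unfold_locales fact
  have k: "a \<otimes>\<^bsub>A\<^esub> a \<in> carrier A" "cnorm A (a \<otimes>\<^bsub>A\<^esub> a) \<le> 1" "star A (a \<otimes>\<^bsub>A\<^esub> a) = a \<otimes>\<^bsub>A\<^esub> a"
    using a by (auto simp: A.cnorm_selfadjoint_square A.star_mult power_le_one)
  obtain w where w: "A.converges_to (A.sqrt_iter (a \<otimes>\<^bsub>A\<^esub> a)) w"
      "w \<oplus>\<^bsub>A\<^esub> w = a \<otimes>\<^bsub>A\<^esub> a \<oplus>\<^bsub>A\<^esub> w \<otimes>\<^bsub>A\<^esub> w"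
    using A.sqrt_iter_converges[OF k(1,2)] by metis
  have wc: "w \<in> carrier A" using A.converges_toD[OF w(1)] by simp
  have ws: "star A w = w" using A.star_limit[OF w(1)] A.star_sqrt_iter[OF k(1,3)] by simp
  have "a \<otimes>\<^bsub>A\<^esub> a \<in> {x \<in> carrier A. x \<otimes>\<^bsub>A\<^esub> a = a \<otimes>\<^bsub>A\<^esub> x}" using a A.mult_assoc by auto
  from A.sqrt_iter_in[OF A.commutant_closed_subalgebra[OF a(1)] this]
  have "w \<in> {x \<in> carrier A. x \<otimes>\<^bsub>A\<^esub> a = a \<otimes>\<^bsub>A\<^esub> x}"
    by (rule A.norm_closed_converges[OF A.closed_subalgebraD(6)[OF A.commutant_closed_subalgebra[OF a(1)]] w(1)])
  then have com: "w \<otimes>\<^bsub>A\<^esub> a = a \<otimes>\<^bsub>A\<^esub> w" by simp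
  define b where "b = B.\<iota> (\<phi> a)"
  define v where "v = B.\<iota> (\<phi> w)"
  have b: "b \<in> carrier B.K.completed" "star B.K.completed b = b"
    using a by (auto simp: b_def simp flip: B.\<iota>.map_star \<phi>.map_star)
  have v: "v \<in> carrier B.K.completed" "star B.K.completed v = v"
    using wc ws by (auto simp: v_def simp flip: B.\<iota>.map_star \<phi>.map_star)
  have vb: "v \<otimes>\<^bsub>B.K.completed\<^esub> b = b \<otimes>\<^bsub>B.K.completed\<^esub> v"
    using a wc com by (simp add: b_def v_def flip: B.\<iota>.map_mult \<phi>.map_mult)
  have vv: "v \<oplus>\<^bsub>B.K.completed\<^esub> v = b \<otimes>\<^bsub>B.K.completed\<^esub> b \<oplus>\<^bsub>B.K.completed\<^esub> v \<otimes>\<^bsub>B.K.completed\<^esub> v"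
    using arg_cong[OF w(2), of "\<lambda>x. B.\<iota> (\<phi> x)"] a wc
    by (simp add: b_def v_def B.\<iota>.map_mult \<phi>.map_mult B.\<iota>.map_add \<phi>.map_add)
  have "cnorm B.K.completed b \<le> 1" by (rule B.E.cnorm_le_1_if_sqrt[OF b v vb vv])
  then show ?thesis using a by (simp add: b_def B.\<iota>.isometric)
qed

text \<open>Scaling extends the bound for selfadjoint elements of norm at most one to all
  selfadjoint elements, and the C*-identity extends it further by way of
  \<open>star A x \<otimes> x\<close>.\<close>

lemma star_hom_contractive:
  assumes "cstar A" "cstar B" "star_hom A B \<phi>" and x: "x \<in> carrier A"
  shows "cnorm B (\<phi> x) \<le> cnorm A x"
proof -
  interpret A: cstar A by fact
  interpret B: cstar B by fact
  interpret \<phi>: star_homomorphism A B \<phi> by unfold_locales fact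
  have sa: "cnorm B (\<phi> a) \<le> cnorm A a" if a: "a \<in> carrier A" "star A a = a" for a
  proof (cases "cnorm A a = 0")
    case True
    then have "a = \<zero>\<^bsub>A\<^esub>" using a A.cnorm_eq_0 by simp
    then show ?thesis by simp
  next
    case False
    then have r: "cnorm A a > 0" using A.cnorm_nonneg[OF a(1)] by linarith
    define b where "b = complex_of_real (1 / cnorm A a) \<odot>\<^bsub>A\<^esub> a"
    have "b \<in> carrier A" "star A b = b" "cnorm A b \<le> 1"
      using a r by (auto simp: b_def A.star_smult A.cnorm_smult norm_divide)
    then have "cnorm B (\<phi> b) \<le> 1" by (rule star_hom_selfadjoint_le_1[OF assms(1-3)])
    then show ?thesis using a r
      by (simp add: b_def \<phi>.map_smult B.cnorm_smult norm_divide field_simps)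
  qed
  have "cnorm B (\<phi> (star A x \<otimes>\<^bsub>A\<^esub> x)) \<le> cnorm A (star A x \<otimes>\<^bsub>A\<^esub> x)"
    using x by (intro sa) (auto simp: A.star_mult)
  then have "(cnorm B (\<phi> x))\<^sup>2 \<le> (cnorm A x)\<^sup>2"
    using x A.cstar_identity[of x] B.cstar_identity[of "\<phi> x"] by (simp add: \<phi>.map_mult \<phi>.map_star)
  then show ?thesis by (rule power2_le_imp_le) (use x in simp)
qed

section \<open>Matrix algebras\<close>

text \<open>The action \<open>ra\<close> serves to form the vector x<x,y> - y in the proof of the
  Cauchy-Schwarz inequality, where it enters only through inner products.\<close>

locale pre_hilbert_module = cstar B for B :: "'b cstar" +
  fixes Y :: "(complex, 'y, 'z) module_scheme" and ip :: "'y \<Rightarrow> 'y \<Rightarrow> 'b" and ra :: "'y \<Rightarrow> 'b \<Rightarrow> 'y"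
  assumes Y_vector_space: "complex_vector_space Y"
    and ip_closed [simp, intro]: "\<lbrakk>x \<in> carrier Y; y \<in> carrier Y\<rbrakk> \<Longrightarrow> ip x y \<in> carrier B"
    and ip_add: "\<lbrakk>x \<in> carrier Y; y \<in> carrier Y; z \<in> carrier Y\<rbrakk> \<Longrightarrow> ip x (y \<oplus>\<^bsub>Y\<^esub> z) = ip x y \<oplus>\<^bsub>B\<^esub> ip x z"
    and ip_smult: "\<lbrakk>x \<in> carrier Y; y \<in> carrier Y\<rbrakk> \<Longrightarrow> ip x (c \<odot>\<^bsub>Y\<^esub> y) = c \<odot>\<^bsub>B\<^esub> ip x y"
    and ip_star: "\<lbrakk>x \<in> carrier Y; y \<in> carrier Y\<rbrakk> \<Longrightarrow> star B (ip x y) = ip y x"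
    and ip_definite: "\<lbrakk>x \<in> carrier Y; cnorm B (ip x x) = 0\<rbrakk> \<Longrightarrow> x = \<zero>\<^bsub>Y\<^esub>"
    and ip_positive: "x \<in> carrier Y \<Longrightarrow> is_positive B (ip x x)"
    and ra_closed: "\<lbrakk>x \<in> carrier Y; b \<in> carrier B\<rbrakk> \<Longrightarrow> ra x b \<in> carrier Y"
    and ip_ra: "\<lbrakk>x \<in> carrier Y; y \<in> carrier Y; b \<in> carrier B\<rbrakk> \<Longrightarrow> ip x (ra y b) = ip x y \<otimes>\<^bsub>B\<^esub> b"
begin

text \<open>Put a = <x,y>, X = <x,x>, N = <y,y> and z = xa - y. Then N = a^* a + <z,z> + (a^* a -
  a^* X a). The bracket equals u^* u for u = a - wa, where w solves 2w = X + w^2; the bound |X| <= 1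
  is what provides w. All terms are positive, so |a|^2 <= |N|.\<close>

lemma cnorm_ip_le:
  assumes x: "x \<in> carrier Y" and y: "y \<in> carrier Y" and le: "cnorm B (ip x x) \<le> 1"
  shows "(cnorm B (ip x y))\<^sup>2 \<le> cnorm B (ip y y)"
proof -
  interpret Y: abelian_group Y using Y_vector_space by (simp add: module_def)
  define a X N where "a = ip x y" and "X = ip x x" and "N = ip y y"
  have c: "a \<in> carrier B" "X \<in> carrier B" "N \<in> carrier B" using x y by (auto simp: a_def X_def N_def)
  have sa: "star B X = X" "star B N = N" "star B a = ip y x" using x y by (auto simp: a_def X_def N_def ip_star)
  define z where "z = ra x a \<oplus>\<^bsub>Y\<^esub> (-1) \<odot>\<^bsub>Y\<^esub> y"
  have my: "(-1) \<odot>\<^bsub>Y\<^esub> y \<in> carrier Y" using module.smult_closed[OF Y_vector_space] y by simp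
  have z: "z \<in> carrier Y" unfolding z_def using x c my ra_closed by simp
  have ipz: "ip u z = ip u x \<otimes>\<^bsub>B\<^esub> a \<ominus>\<^bsub>B\<^esub> ip u y" if "u \<in> carrier Y" for u
    unfolding z_def using that x y c my
    by (simp add: ip_add ip_ra ra_closed ip_smult smult_minus_one minus_eq)
  have "ip z x = star B (X \<otimes>\<^bsub>B\<^esub> a \<ominus>\<^bsub>B\<^esub> a)"
    using ip_star[OF x z, symmetric] unfolding ipz[OF x] X_def[symmetric] a_def[symmetric] .
  then have zx: "ip z x = star B a \<otimes>\<^bsub>B\<^esub> X \<ominus>\<^bsub>B\<^esub> star B a"
    using c by (simp add: star_diff star_mult sa(1))
  have "ip z y = star B (star B a \<otimes>\<^bsub>B\<^esub> a \<ominus>\<^bsub>B\<^esub> N)"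
    using ip_star[OF y z, symmetric] unfolding ipz[OF y] N_def[symmetric] sa(3)[symmetric] .
  then have zy: "ip z y = star B a \<otimes>\<^bsub>B\<^esub> a \<ominus>\<^bsub>B\<^esub> N"
    using c by (simp add: star_diff star_mult sa(2))
  have zz: "ip z z = (star B a \<otimes>\<^bsub>B\<^esub> X \<ominus>\<^bsub>B\<^esub> star B a) \<otimes>\<^bsub>B\<^esub> a \<ominus>\<^bsub>B\<^esub> (star B a \<otimes>\<^bsub>B\<^esub> a \<ominus>\<^bsub>B\<^esub> N)"
    unfolding ipz[OF z] zx zy ..
  obtain w where w: "converges_to (sqrt_iter X) w" "w \<oplus>\<^bsub>B\<^esub> w = X \<oplus>\<^bsub>B\<^esub> w \<otimes>\<^bsub>B\<^esub> w"
    using sqrt_iter_converges[OF c(2)] le unfolding X_def by metis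
  have wc: "w \<in> carrier B" using converges_toD[OF w(1)] by simp
  have ws: "star B w = w" using star_limit[OF w(1)] star_sqrt_iter[OF c(2)] sa by simp
  define u where "u = a \<ominus>\<^bsub>B\<^esub> w \<otimes>\<^bsub>B\<^esub> a"
  have u: "u \<in> carrier B" using c wc by (simp add: u_def)
  have "star B u \<otimes>\<^bsub>B\<^esub> u = (star B a \<ominus>\<^bsub>B\<^esub> star B a \<otimes>\<^bsub>B\<^esub> w) \<otimes>\<^bsub>B\<^esub> (a \<ominus>\<^bsub>B\<^esub> w \<otimes>\<^bsub>B\<^esub> a)"
    using c wc by (simp add: u_def star_diff star_mult ws)
  also have "\<dots> = star B a \<otimes>\<^bsub>B\<^esub> a \<ominus>\<^bsub>B\<^esub> star B a \<otimes>\<^bsub>B\<^esub> ((w \<oplus>\<^bsub>B\<^esub> w) \<ominus>\<^bsub>B\<^esub> w \<otimes>\<^bsub>B\<^esub> w) \<otimes>\<^bsub>B\<^esub> a"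
    using c(1) wc by algebra
  also have "\<dots> = star B a \<otimes>\<^bsub>B\<^esub> a \<ominus>\<^bsub>B\<^esub> star B a \<otimes>\<^bsub>B\<^esub> X \<otimes>\<^bsub>B\<^esub> a"
    unfolding w(2) using c(1,2) wc by algebra
  finally have uu: "star B u \<otimes>\<^bsub>B\<^esub> u = star B a \<otimes>\<^bsub>B\<^esub> a \<ominus>\<^bsub>B\<^esub> star B a \<otimes>\<^bsub>B\<^esub> X \<otimes>\<^bsub>B\<^esub> a" .
  have "star B a \<otimes>\<^bsub>B\<^esub> a \<oplus>\<^bsub>B\<^esub> (ip z z \<oplus>\<^bsub>B\<^esub> star B u \<otimes>\<^bsub>B\<^esub> u) = N"
    unfolding zz uu using c by algebra
  moreover have "cnorm B (star B a \<otimes>\<^bsub>B\<^esub> a) \<le> cnorm B (star B a \<otimes>\<^bsub>B\<^esub> a \<oplus>\<^bsub>B\<^esub> (ip z z \<oplus>\<^bsub>B\<^esub> star B u \<otimes>\<^bsub>B\<^esub> u))"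
    using c z u by (intro is_positive_cnorm_mono is_positive_add is_positive_star_mult ip_positive)
  ultimately show ?thesis using c cstar_identity[of a] by (simp add: a_def N_def)
qed

text \<open>\<open>cnorm_ip_le\<close> is applied to x/t for every t above the norm of x, and t then
  decreases to it. This avoids dividing by the norm of x, which may vanish.\<close>

lemma ip_Cauchy_Schwarz:
  assumes x: "x \<in> carrier Y" and y: "y \<in> carrier Y"
  shows "cnorm B (ip x y) \<le> sqrt (cnorm B (ip x x)) * sqrt (cnorm B (ip y y))"
proof -
  define r n where "r = sqrt (cnorm B (ip x x))" and "n = sqrt (cnorm B (ip y y))"
  have n: "n \<ge> 0" and r: "r \<ge> 0" using x y by (auto simp: n_def r_def)
  have left: "ip (c \<odot>\<^bsub>Y\<^esub> x) u = cnj c \<odot>\<^bsub>B\<^esub> ip x u" if "u \<in> carrier Y" for c u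
    using ip_smult[of u x c] that x ip_star module.smult_closed[OF Y_vector_space, of c x]
    by (metis UNIV_I carrier_complex_ring ip_closed star_smult)
  have le: "cnorm B (ip x y) \<le> t * n" if t: "t > r" for t
  proof -
    have t0: "t > 0" using t r by linarith
    define v where "v = complex_of_real (1 / t) \<odot>\<^bsub>Y\<^esub> x"
    have v: "v \<in> carrier Y" using module.smult_closed[OF Y_vector_space] x by (simp add: v_def)
    have vv: "ip v v = complex_of_real (1 / t) \<odot>\<^bsub>B\<^esub> (complex_of_real (1 / t) \<odot>\<^bsub>B\<^esub> ip x x)"
      using left[OF v, of "complex_of_real (1 / t)"] ip_smult[OF x x] by (simp add: v_def)
    have vy: "ip v y = complex_of_real (1 / t) \<odot>\<^bsub>B\<^esub> ip x y"
      using left[OF y, of "complex_of_real (1 / t)"] by (simp add: v_def)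
    have "cnorm B (ip v v) = (r / t)\<^sup>2"
      unfolding vv using x t0 by (simp add: cnorm_smult norm_divide r_def power2_eq_square)
    also have "\<dots> \<le> 1" using t r t0 by (simp add: power_le_one)
    finally have "(cnorm B (ip v y))\<^sup>2 \<le> n\<^sup>2" using cnorm_ip_le[OF v y] y by (simp add: n_def)
    then have "cnorm B (ip v y) \<le> n" by (rule power2_le_imp_le[OF _ n])
    then show ?thesis unfolding vy using x y t0 by (simp add: cnorm_smult norm_divide field_simps)
  qed
  show ?thesis
  proof (cases "n = 0")
    case True
    then show ?thesis using le[of "r + 1"] by (simp add: n_def r_def)
  next
    case False
    then have n0: "n > 0" using n by linarith
    have "cnorm B (ip x y) / n \<le> r"
    proof (rule dense_ge)
      show "cnorm B (ip x y) / n \<le> t" if "r < t" for t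
        using le[OF that] n0 by (simp add: divide_le_eq)
    qed
    then have "cnorm B (ip x y) \<le> r * n" using n0 by (simp add: divide_le_eq)
    then show ?thesis by (simp add: n_def r_def)
  qed
qed

sublocale inner_product_module B Y ip
  by (rule inner_product_module.intro[OF pre_cstar_algebra_axioms inner_product_module_axioms.intro])
    (auto simp: Y_vector_space ip_add ip_smult ip_star ip_definite ip_Cauchy_Schwarz)

end

text \<open>Finite support makes inner products finite sums over any index type. These columns need
  not form a complete module; it is the algebra of operators that gets completed.\<close>

definition columns :: "'b cstar \<Rightarrow> (complex, 'i \<Rightarrow> 'b) module" where
  "columns B = \<lparr>carrier = {y. (\<forall>i. y i \<in> carrier B) \<and> finite {i. y i \<noteq> \<zero>\<^bsub>B\<^esub>}},
     mult = (\<lambda>_ _. undefined), one = undefined, zero = (\<lambda>_. \<zero>\<^bsub>B\<^esub>), add = (\<lambda>x y i. x i \<oplus>\<^bsub>B\<^esub> y i),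
     smult = (\<lambda>c y i. c \<odot>\<^bsub>B\<^esub> y i)\<rparr>"

definition column_inner :: "'b cstar \<Rightarrow> ('i \<Rightarrow> 'b) \<Rightarrow> ('i \<Rightarrow> 'b) \<Rightarrow> 'b" where
  "column_inner B x y = (\<Oplus>\<^bsub>B\<^esub>i\<in>{i. x i \<noteq> \<zero>\<^bsub>B\<^esub>}. star B (x i) \<otimes>\<^bsub>B\<^esub> y i)"

context cstar
begin

lemma columns_simps:
  "y \<in> carrier (columns A) \<longleftrightarrow> (\<forall>i. y i \<in> carrier A) \<and> finite {i. y i \<noteq> \<zero>}"
  "\<zero>\<^bsub>columns A\<^esub> = (\<lambda>_. \<zero>)" "x \<oplus>\<^bsub>columns A\<^esub> y = (\<lambda>i. x i \<oplus> y i)"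
  "c \<odot>\<^bsub>columns A\<^esub> y = (\<lambda>i. c \<odot> y i)"
  by (auto simp: columns_def)

text \<open>Terms outside either support vanish, so one may sum over any finite set containing one
  of the two supports. The definition singles out the first argument; this restores the
  symmetry.\<close>

lemma column_inner_eq:
  assumes "x \<in> carrier (columns A)" "y \<in> carrier (columns A)" "finite F"
    and "{i. x i \<noteq> \<zero>} \<subseteq> F \<or> {i. y i \<noteq> \<zero>} \<subseteq> F"
  shows "column_inner A x y = (\<Oplus>i\<in>F. star A (x i) \<otimes> y i)"
proof -
  have c: "x i \<in> carrier A" "y i \<in> carrier A" for i using assms by (auto simp: columns_simps)
  let ?s = "\<lambda>i. star A (x i) \<otimes> y i"
  let ?X = "{i. x i \<noteq> \<zero>}"
  have *: "column_inner A x y = finsum A ?s (?X \<union> F)"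
    unfolding column_inner_def using assms c
    by (intro add.finprod_mono_neutral_cong_left) (auto simp: columns_simps)
  also have "\<dots> = finsum A ?s F"
  proof -
    have "?s i = \<zero>" if "i \<notin> F" for i
    proof -
      have "x i = \<zero> \<or> y i = \<zero>" using assms(4) that by blast
      then show ?thesis using c by auto
    qed
    then show ?thesis using assms c by (intro add.finprod_mono_neutral_cong_right) (auto simp: columns_simps)
  qed
  finally show ?thesis .
qed

lemma finite_support_add:
  assumes "finite {i. x i \<noteq> \<zero>}" "finite {i. y i \<noteq> \<zero>}" "\<And>i. x i = \<zero> \<Longrightarrow> y i = \<zero> \<Longrightarrow> z i = \<zero>"
  shows "finite {i. z i \<noteq> \<zero>}"
  by (rule finite_subset[of _ "{i. x i \<noteq> \<zero>} \<union> {i. y i \<noteq> \<zero>}"]) (use assms in auto)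

sublocale col: pre_hilbert_module A "columns A" "column_inner A" "\<lambda>y b i. y i \<otimes> b"
proof (rule pre_hilbert_module.intro[OF cstar_axioms], rule pre_hilbert_module_axioms.intro)
  show "complex_vector_space (columns A :: (complex, 'i \<Rightarrow> 'a) module)"
  proof (rule complex_vector_spaceI)
    fix x y :: "'i \<Rightarrow> 'a" assume xy: "x \<in> carrier (columns A)" "y \<in> carrier (columns A)"
    show "x \<oplus>\<^bsub>columns A\<^esub> y \<in> carrier (columns A)"
      using finite_support_add[of x y "\<lambda>i. x i \<oplus> y i"] xy by (auto simp: columns_simps)
    show "x \<oplus>\<^bsub>columns A\<^esub> y = y \<oplus>\<^bsub>columns A\<^esub> x"
      using xy a_comm by (auto simp: columns_simps)
    show "c \<odot>\<^bsub>columns A\<^esub> x \<in> carrier (columns A)" for c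
      using finite_support_add[of x x "\<lambda>i. c \<odot> x i"] xy by (auto simp: columns_simps)
  qed (auto simp: columns_simps a_assoc smult_add_left smult_add_right smult_smult)
next
  fix x y z :: "'i \<Rightarrow> 'a" assume x: "x \<in> carrier (columns A)" and y: "y \<in> carrier (columns A)"
  note c = x[unfolded columns_simps] y[unfolded columns_simps]
  show "column_inner A x y \<in> carrier A"
    unfolding column_inner_def using c by (intro finsum_closed) auto
  show "column_inner A x (c \<odot>\<^bsub>columns A\<^esub> y) = c \<odot> column_inner A x y" for c
    unfolding column_inner_def columns_simps using c
    by (subst additive_finsum[of A A "\<lambda>x. c \<odot> x"])
      (auto simp: smult_add_right smult_mult_right abelian_group_axioms)
  show "star A (column_inner A x y) = column_inner A y x"
  proof -
    have "column_inner A x y = (\<Oplus>i\<in>{i. y i \<noteq> \<zero>}. star A (x i) \<otimes> y i)"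
      by (rule column_inner_eq[OF x y]) (use c in auto)
    then have "star A (column_inner A x y) = (\<Oplus>i\<in>{i. y i \<noteq> \<zero>}. star A (star A (x i) \<otimes> y i))"
      using c by (simp add: finsum_star)
    also have "\<dots> = column_inner A y x"
      unfolding column_inner_def using c by (intro finsum_cong') (auto simp: star_mult)
    finally show ?thesis .
  qed
  show "is_positive A (column_inner A x x)"
    unfolding column_inner_def using c by (intro is_positive_finsum is_positive_star_mult) auto
  show "x = \<zero>\<^bsub>columns A\<^esub>" if "cnorm A (column_inner A x x) = 0"
  proof -
    have "column_inner A x x \<in> carrier A"
      unfolding column_inner_def using c by (intro finsum_closed) auto
    then have "(\<Oplus>i\<in>{i. x i \<noteq> \<zero>}. star A (x i) \<otimes> x i) = \<zero>"
      using that cnorm_eq_0 by (simp add: column_inner_def)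
    from sum_star_mult_eq_zero[OF _ _ this] c show ?thesis by (auto simp: columns_simps)
  qed
  show "column_inner A x (\<lambda>i. y i \<otimes> b) = column_inner A x y \<otimes> b" "(\<lambda>i. x i \<otimes> b) \<in> carrier (columns A)"
    if b: "b \<in> carrier A" for b
    using b c finite_support_add[of x x "\<lambda>i. x i \<otimes> b"]
    by (auto simp: column_inner_def columns_simps finsum_mult_right mult_assoc intro!: finsum_cong')
  assume z: "z \<in> carrier (columns A)"
  show "column_inner A x (y \<oplus>\<^bsub>columns A\<^esub> z) = column_inner A x y \<oplus> column_inner A x z"
    unfolding column_inner_def columns_simps using c z[unfolded columns_simps]
    by (subst finsum_addf[symmetric]) (auto simp: mult_add_right intro!: finsum_cong')
qed

text \<open>The elementary matrix with entry \<open>b\<close> in row \<open>f\<close> and column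
  \<open>h\<close>, acting on columns.\<close>

definition matrix_op :: "'i \<Rightarrow> 'i \<Rightarrow> 'a \<Rightarrow> ('i \<Rightarrow> 'a) \<Rightarrow> 'i \<Rightarrow> 'a" where
  "matrix_op f h b y = (if y \<in> carrier (columns A) then (\<lambda>i. if i = f then b \<otimes> y h else \<zero>) else (\<lambda>_. \<zero>))"

lemma matrix_op_closed [simp]: "b \<in> carrier A \<Longrightarrow> matrix_op f h b y \<in> carrier (columns A)"
proof (cases "y \<in> carrier (columns A)")
  case True
  assume "b \<in> carrier A"
  moreover have "finite {i. (if i = f then b \<otimes> y h else \<zero>) \<noteq> \<zero>}"
    by (rule finite_subset[of _ "{f}"]) auto
  ultimately show ?thesis using True by (auto simp: matrix_op_def columns_simps)
qed (simp add: matrix_op_def columns_simps)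

lemma column_inner_matrix_op:
  assumes "b \<in> carrier A" "x \<in> carrier (columns A)" "y \<in> carrier (columns A)"
  shows "column_inner A x (matrix_op f h b y) = star A (x f) \<otimes> (b \<otimes> y h)"
proof -
  have c: "x i \<in> carrier A" "y i \<in> carrier A" for i using assms by (auto simp: columns_simps)
  have "column_inner A x (matrix_op f h b y) = (\<Oplus>i\<in>{f}. star A (x i) \<otimes> matrix_op f h b y i)"
    by (rule column_inner_eq[OF assms(2) matrix_op_closed[OF assms(1)]]) (auto simp: matrix_op_def)
  also have "\<dots> = star A (x f) \<otimes> (b \<otimes> y h)" using assms c by (simp add: matrix_op_def)
  finally show ?thesis .
qed

lemma matrix_op_bounded:
  fixes f h :: 'i
  assumes b: "b \<in> carrier A"
  shows "col.bounded_by (matrix_op f h b) (cnorm A b)"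
  unfolding col.bounded_by_def
proof (intro conjI ballI)
  fix y :: "'i \<Rightarrow> 'a" assume y: "y \<in> carrier (columns A)"
  have c: "y i \<in> carrier A" for i using y by (auto simp: columns_simps)
  have "matrix_op f h b y f = b \<otimes> y h" using y by (simp add: matrix_op_def)
  then have "column_inner A (matrix_op f h b y) (matrix_op f h b y) = star A (b \<otimes> y h) \<otimes> (b \<otimes> y h)"
    using column_inner_matrix_op[OF b matrix_op_closed[OF b, of f h y] y, of f h] by simp
  then have 1: "col.nrm (matrix_op f h b y) = cnorm A (b \<otimes> y h)"
    using b c by (simp add: col.nrm_def cnorm_star_mult)
  \<comment> \<open>The term of index h is one of the positive summands of the inner product of y
    with itself, hence dominated by it in norm.\<close>
  have "(cnorm A (y h))\<^sup>2 \<le> cnorm A (column_inner A y y)"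
  proof (cases "y h = \<zero>")
    case False
    let ?S = "{i. y i \<noteq> \<zero>}" and ?s = "\<lambda>i. star A (y i) \<otimes> y i"
    have "column_inner A y y = finsum A ?s (insert h (?S - {h}))"
      using False by (simp add: column_inner_def insert_absorb)
    also have "\<dots> = ?s h \<oplus> finsum A ?s (?S - {h})"
      using y c by (subst finsum_insert) (auto simp: columns_simps)
    finally show ?thesis
      using is_positive_cnorm_mono[of "?s h" "finsum A ?s (?S - {h})"] c cstar_identity[of "y h"]
      by (simp add: is_positive_finsum is_positive_star_mult)
  qed (use y col.ip_closed in simp)
  then have 2: "cnorm A (y h) \<le> col.nrm y" unfolding col.nrm_def by (rule real_le_rsqrt)
  show "col.nrm (matrix_op f h b y) \<le> cnorm A b * col.nrm y"
    unfolding 1 using cnorm_mult[of b "y h"] mult_left_mono[OF 2, of "cnorm A b"] b c by simp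
qed (use b in simp)

lemma matrix_op_adjoint:
  fixes f h :: 'i
  assumes b: "b \<in> carrier A"
  shows "col.adjoint_pair (matrix_op f h b) (matrix_op h f (star A b))"
proof (rule col.adjoint_pairI[OF _ _ _ _ _ matrix_op_bounded[OF b]])
  fix x y :: "'i \<Rightarrow> 'a" assume xy: "x \<in> carrier (columns A)" "y \<in> carrier (columns A)"
  have c: "x i \<in> carrier A" "y i \<in> carrier A" for i using xy by (auto simp: columns_simps)
  have "column_inner A (matrix_op h f (star A b) x) y = star A (column_inner A y (matrix_op h f (star A b) x))"
    using b xy by (simp add: col.ip_star)
  also have "\<dots> = star A (star A (y h) \<otimes> (star A b \<otimes> x f))"
    using b xy by (simp add: column_inner_matrix_op)
  also have "\<dots> = column_inner A x (matrix_op f h b y)"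
    using b xy c by (simp add: column_inner_matrix_op star_mult mult_assoc)
  finally show "column_inner A x (matrix_op f h b y) = column_inner A (matrix_op h f (star A b) x) y" by simp
qed (simp_all add: b, simp_all add: matrix_op_def columns_simps(2))

definition matrix_elem :: "'i \<Rightarrow> 'i \<Rightarrow> 'a \<Rightarrow> (('i \<Rightarrow> 'a) \<Rightarrow> ('i \<Rightarrow> 'a)) \<times> (('i \<Rightarrow> 'a) \<Rightarrow> ('i \<Rightarrow> 'a))" where
  "matrix_elem f h b = (matrix_op f h b, matrix_op h f (star A b))"

sublocale KM: completion "col.adjointable :: ((('i \<Rightarrow> 'a) \<Rightarrow> ('i \<Rightarrow> 'a)) \<times> (('i \<Rightarrow> 'a) \<Rightarrow> ('i \<Rightarrow> 'a))) cstar"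
  by (simp add: completion_def col.pre_cstar_adjointable)

definition matrix_alg :: "(nat \<Rightarrow> (('i \<Rightarrow> 'a) \<Rightarrow> ('i \<Rightarrow> 'a)) \<times> (('i \<Rightarrow> 'a) \<Rightarrow> ('i \<Rightarrow> 'a))) set cstar" where
  "matrix_alg = KM.completed"

text \<open>The elementary matrices inside the completed algebra; all matrices used later are finite
  sums of them.\<close>

definition \<theta> :: "'i \<Rightarrow> 'i \<Rightarrow> 'a \<Rightarrow> (nat \<Rightarrow> (('i \<Rightarrow> 'a) \<Rightarrow> ('i \<Rightarrow> 'a)) \<times> (('i \<Rightarrow> 'a) \<Rightarrow> ('i \<Rightarrow> 'a))) set" where
  "\<theta> f h b = KM.embed (matrix_elem f h b)"

lemma cstar_matrix_alg: "cstar matrix_alg"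
  by (simp add: cstar_def matrix_alg_def KM.cstar_completed)

lemma matrix_elem_closed: "b \<in> carrier A \<Longrightarrow> matrix_elem f h b \<in> carrier col.adjointable"
  by (simp add: matrix_elem_def col.adjointable_simps matrix_op_adjoint)

lemma matrix_op_zero: "matrix_op f h \<zero> = (\<lambda>_. \<zero>\<^bsub>columns A\<^esub>)"
  by (auto simp: matrix_op_def columns_simps fun_eq_iff)

lemma matrix_elem_simps:
  assumes "b \<in> carrier A" "c \<in> carrier A"
  shows "matrix_elem f h (b \<oplus> c) = matrix_elem f h b \<oplus>\<^bsub>col.adjointable\<^esub> matrix_elem f h c"
    and "matrix_elem h f (star A b) = star col.adjointable (matrix_elem f h b)"
    and "matrix_elem f h b \<otimes>\<^bsub>col.adjointable\<^esub> matrix_elem h' l c =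
      (if h = h' then matrix_elem f l (b \<otimes> c) else \<zero>\<^bsub>col.adjointable\<^esub>)"
    and "matrix_elem f h \<zero> = \<zero>\<^bsub>col.adjointable\<^esub>"
proof -
  show "matrix_elem f h (b \<oplus> c) = matrix_elem f h b \<oplus>\<^bsub>col.adjointable\<^esub> matrix_elem f h c"
    using assms
    by (auto simp: matrix_elem_def col.adjointable_simps matrix_op_def columns_simps fun_eq_iff mult_add_left star_add)
  show "matrix_elem h f (star A b) = star col.adjointable (matrix_elem f h b)"
    using assms by (simp add: matrix_elem_def col.adjointable_simps)
  show "matrix_elem f h \<zero> = \<zero>\<^bsub>col.adjointable\<^esub>"
    by (simp add: matrix_elem_def col.adjointable_simps matrix_op_zero)
  have *: "matrix_op f h b (matrix_op h' l c y) = (if h = h' then matrix_op f l (b \<otimes> c) y else (\<lambda>_. \<zero>))"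
    if "b \<in> carrier A" "c \<in> carrier A" for f h h' l :: 'i and b c y
  proof (cases "y \<in> carrier (columns A)")
    case True
    then have "y l \<in> carrier A" by (simp add: columns_simps)
    then show ?thesis using that True matrix_op_closed[OF that(2), of h' l y]
      by (auto simp: matrix_op_def fun_eq_iff mult_assoc)
  next
    case False
    then have "matrix_op h' l c y = (\<lambda>_. \<zero>)" by (simp add: matrix_op_def)
    then show ?thesis using that False by (auto simp: matrix_op_def fun_eq_iff columns_simps)
  qed
  show "matrix_elem f h b \<otimes>\<^bsub>col.adjointable\<^esub> matrix_elem h' l c =
      (if h = h' then matrix_elem f l (b \<otimes> c) else \<zero>\<^bsub>col.adjointable\<^esub>)"
    using assms by (auto simp: matrix_elem_def col.adjointable_simps * star_mult columns_simps fun_eq_iff)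
qed

lemma
  fixes f h h' l :: 'i
  shows \<theta>_closed [simp, intro]: "b \<in> carrier A \<Longrightarrow> \<theta> f h b \<in> carrier matrix_alg"
  and \<theta>_add: "b \<in> carrier A \<Longrightarrow> c \<in> carrier A \<Longrightarrow> \<theta> f h (b \<oplus> c) = \<theta> f h b \<oplus>\<^bsub>matrix_alg\<^esub> \<theta> f h c"
  and \<theta>_star: "b \<in> carrier A \<Longrightarrow> star matrix_alg (\<theta> f h b) = \<theta> h f (star A b)"
  and \<theta>_mult: "b \<in> carrier A \<Longrightarrow> c \<in> carrier A \<Longrightarrow> \<theta> f h b \<otimes>\<^bsub>matrix_alg\<^esub> \<theta> h' l c =
      (if h = h' then \<theta> f l (b \<otimes> c) else \<zero>\<^bsub>matrix_alg\<^esub>)"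
  and \<theta>_zero: "\<theta> f h \<zero> = \<zero>\<^bsub>matrix_alg\<^esub>"
proof -
  interpret C: cstar_algebra "KM.completed :: (nat \<Rightarrow> (('i \<Rightarrow> 'a) \<Rightarrow> ('i \<Rightarrow> 'a)) \<times> (('i \<Rightarrow> 'a) \<Rightarrow> ('i \<Rightarrow> 'a))) set cstar"
    by (rule KM.cstar_completed)
  interpret e: star_homomorphism
    "col.adjointable :: ((('i \<Rightarrow> 'a) \<Rightarrow> ('i \<Rightarrow> 'a)) \<times> (('i \<Rightarrow> 'a) \<Rightarrow> ('i \<Rightarrow> 'a))) cstar" KM.completed KM.embed
    by unfold_locales (rule KM.star_hom_embed)
  note m = matrix_elem_closed
  show "b \<in> carrier A \<Longrightarrow> \<theta> f h b \<in> carrier matrix_alg"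
    unfolding \<theta>_def matrix_alg_def by (intro e.closed m)
  show "\<theta> f h (b \<oplus> c) = \<theta> f h b \<oplus>\<^bsub>matrix_alg\<^esub> \<theta> f h c" if "b \<in> carrier A" "c \<in> carrier A"
    unfolding \<theta>_def matrix_alg_def matrix_elem_simps(1)[OF that] by (rule e.map_add[OF m m]) fact+
  show "star matrix_alg (\<theta> f h b) = \<theta> h f (star A b)" if "b \<in> carrier A"
    unfolding \<theta>_def matrix_alg_def matrix_elem_simps(2)[OF that that] by (rule e.map_star[OF m, symmetric]) fact
  show z: "\<theta> f h \<zero> = \<zero>\<^bsub>matrix_alg\<^esub>" for f h :: 'i
    unfolding \<theta>_def matrix_alg_def matrix_elem_simps(4)[OF zero_closed zero_closed] by simp
  show "\<theta> f h b \<otimes>\<^bsub>matrix_alg\<^esub> \<theta> h' l c = (if h = h' then \<theta> f l (b \<otimes> c) else \<zero>\<^bsub>matrix_alg\<^esub>)"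
    if "b \<in> carrier A" "c \<in> carrier A"
    unfolding \<theta>_def matrix_alg_def
    by (subst e.map_mult[symmetric]) (use that in \<open>auto simp: m matrix_elem_simps(3)\<close>)
qed

text \<open>Evaluation at the column whose single entry is \<open>star A b\<close>, in place h,
  yields an element of norm |b|^2. Thus a copy of an element in one matrix position loses no norm,
  which is what makes it possible to recover norms from the matrix algebra.\<close>

lemma cnorm_\<theta>_ge:
  fixes f h :: 'i
  assumes b: "b \<in> carrier A"
  shows "cnorm A b \<le> cnorm matrix_alg (\<theta> f h b)"
proof -
  define y where "y = (\<lambda>i. if i = h then star A b else \<zero>)"
  have fin: "finite {i. y i \<noteq> \<zero>}" by (rule finite_subset[of _ "{h}"]) (auto simp: y_def)
  then have y: "y \<in> carrier (columns A)" using b by (auto simp: columns_simps y_def)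
  have ny: "col.nrm y = cnorm A b"
  proof -
    have "column_inner A y y = (\<Oplus>i\<in>{h}. star A (y i) \<otimes> y i)"
      by (rule column_inner_eq[OF y y]) (auto simp: y_def)
    then have "column_inner A y y = b \<otimes> star A b" using b by (simp add: y_def)
    then show ?thesis using cstar_identity[of "star A b"] b by (simp add: col.nrm_def)
  qed
  have "matrix_op f h b y f = b \<otimes> y h" using y by (simp add: matrix_op_def)
  then have "column_inner A (matrix_op f h b y) (matrix_op f h b y) = star A (b \<otimes> y h) \<otimes> (b \<otimes> y h)"
    using column_inner_matrix_op[OF b matrix_op_closed[OF b, of f h y] y, of f h] by simp
  then have 1: "col.nrm (matrix_op f h b y) = cnorm A (b \<otimes> star A b)"
    using b by (simp add: col.nrm_def cnorm_star_mult y_def)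
  have n: "cnorm matrix_alg (\<theta> f h b) = col.opnorm (matrix_op f h b)"
    unfolding matrix_alg_def \<theta>_def
    by (subst KM.cnorm_embed) (use matrix_elem_closed[OF b, of f h] in \<open>auto simp: matrix_elem_def col.adjointable_simps\<close>)
  have "cnorm A b * cnorm A b \<le> col.opnorm (matrix_op f h b) * cnorm A b"
    using col.adjoint_pairD(8)[OF matrix_op_adjoint[OF b] y, of f h] b cstar_identity[of "star A b"]
    by (simp add: 1 ny power2_eq_square)
  moreover have "0 \<le> col.opnorm (matrix_op f h b)" by (rule col.adjoint_pairD(9)[OF matrix_op_adjoint[OF b]])
  ultimately show ?thesis unfolding n using cnorm_nonneg[OF b] by (cases "cnorm A b = 0") auto
qed

end

lemma (in cstar) \<theta>_smult:
  fixes f h :: 'i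
  assumes b: "b \<in> carrier A"
  shows "\<theta> f h (c \<odot> b) = c \<odot>\<^bsub>matrix_alg\<^esub> \<theta> f h b"
proof -
  interpret C: cstar_algebra "KM.completed :: (nat \<Rightarrow> (('i \<Rightarrow> 'a) \<Rightarrow> ('i \<Rightarrow> 'a)) \<times> (('i \<Rightarrow> 'a) \<Rightarrow> ('i \<Rightarrow> 'a))) set cstar"
    by (rule KM.cstar_completed)
  interpret e: star_homomorphism
    "col.adjointable :: ((('i \<Rightarrow> 'a) \<Rightarrow> ('i \<Rightarrow> 'a)) \<times> (('i \<Rightarrow> 'a) \<Rightarrow> ('i \<Rightarrow> 'a))) cstar" KM.completed KM.embed
    by unfold_locales (rule KM.star_hom_embed)
  have "matrix_elem f h (c \<odot> b) = c \<odot>\<^bsub>col.adjointable\<^esub> matrix_elem f h b"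
    using b by (simp add: matrix_elem_def col.adjointable_simps matrix_op_def columns_simps fun_eq_iff
      smult_mult_left star_smult)
  then show ?thesis unfolding \<theta>_def matrix_alg_def using e.map_smult[OF matrix_elem_closed[OF b]] by simp
qed

section \<open>The universal property for arbitrary targets\<close>

lemma star_hom_compose:
  "star_hom A B \<phi> \<Longrightarrow> star_hom B C \<psi> \<Longrightarrow> star_hom A C (\<lambda>x. \<psi> (\<phi> x))"
  unfolding star_hom_def by simp

lemma is_projection_map:
  assumes "star_hom A B \<phi>" "is_projection A p"
  shows "is_projection B (\<phi> p)"
  using assms unfolding star_hom_def is_projection_def by metis

lemma ck_familyD:
  assumes "ck_family \<Lambda> A P T"
  shows "v \<in> vertices \<Lambda> \<Longrightarrow> is_projection A (P v)"
    and "f \<in> edges \<Lambda> \<Longrightarrow> is_partial_isometry A (T f)"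
    and "v \<in> vertices \<Lambda> \<Longrightarrow> w \<in> vertices \<Lambda> \<Longrightarrow> v \<noteq> w \<Longrightarrow> P v \<otimes>\<^bsub>A\<^esub> P w = \<zero>\<^bsub>A\<^esub>"
    and "\<lbrakk>a \<in> edges \<Lambda>; b \<in> edges \<Lambda>; f \<in> edges \<Lambda>; g \<in> edges \<Lambda>; src \<Lambda> a = rng \<Lambda> f;
      src \<Lambda> g = rng \<Lambda> b; cmp \<Lambda> a f = cmp \<Lambda> g b\<rbrakk> \<Longrightarrow> T a \<otimes>\<^bsub>A\<^esub> T f = T g \<otimes>\<^bsub>A\<^esub> T b"
    and "f \<in> edges \<Lambda> \<Longrightarrow> star A (T f) \<otimes>\<^bsub>A\<^esub> T f = P (src \<Lambda> f)"
    and "v \<in> vertices \<Lambda> \<Longrightarrow>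
      P v = (\<Oplus>\<^bsub>A\<^esub>f\<in>{f \<in> edges \<Lambda>. rng \<Lambda> f = v \<and> deg \<Lambda> f = axis i 1}. T f \<otimes>\<^bsub>A\<^esub> star A (T f))"
    and "v \<in> vertices \<Lambda> \<Longrightarrow> P v \<in> carrier A" and "f \<in> edges \<Lambda> \<Longrightarrow> T f \<in> carrier A"
proof -
  note ck = assms[unfolded ck_family_def]
  show p: "v \<in> vertices \<Lambda> \<Longrightarrow> is_projection A (P v)" for v using ck by blast
  show t: "f \<in> edges \<Lambda> \<Longrightarrow> is_partial_isometry A (T f)" for f using ck by blast
  show "v \<in> vertices \<Lambda> \<Longrightarrow> P v \<in> carrier A" using p by (simp add: is_projection_def)
  show "f \<in> edges \<Lambda> \<Longrightarrow> T f \<in> carrier A" using t by (simp add: is_partial_isometry_def)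
qed (use assms[unfolded ck_family_def] in \<open>(elim conjE, blast)+\<close>)

lemma ck_familyI:
  assumes "\<And>v. v \<in> vertices \<Lambda> \<Longrightarrow> is_projection A (P v)"
    and "\<And>f. f \<in> edges \<Lambda> \<Longrightarrow> is_partial_isometry A (T f)"
    and "\<And>v w. v \<in> vertices \<Lambda> \<Longrightarrow> w \<in> vertices \<Lambda> \<Longrightarrow> v \<noteq> w \<Longrightarrow> P v \<otimes>\<^bsub>A\<^esub> P w = \<zero>\<^bsub>A\<^esub>"
    and "\<And>a b f g. \<lbrakk>a \<in> edges \<Lambda>; b \<in> edges \<Lambda>; f \<in> edges \<Lambda>; g \<in> edges \<Lambda>; src \<Lambda> a = rng \<Lambda> f;
      src \<Lambda> g = rng \<Lambda> b; cmp \<Lambda> a f = cmp \<Lambda> g b\<rbrakk> \<Longrightarrow> T a \<otimes>\<^bsub>A\<^esub> T f = T g \<otimes>\<^bsub>A\<^esub> T b"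
    and "\<And>f. f \<in> edges \<Lambda> \<Longrightarrow> star A (T f) \<otimes>\<^bsub>A\<^esub> T f = P (src \<Lambda> f)"
    and "\<And>v i. v \<in> vertices \<Lambda> \<Longrightarrow>
      P v = (\<Oplus>\<^bsub>A\<^esub>f\<in>{f \<in> edges \<Lambda>. rng \<Lambda> f = v \<and> deg \<Lambda> f = axis i 1}. T f \<otimes>\<^bsub>A\<^esub> star A (T f))"
  shows "ck_family \<Lambda> A P T"
  unfolding ck_family_def
  by (intro conjI ballI allI impI) (erule conjE | rule assms | assumption)+

lemma ck_family_map:
  assumes "pre_cstar_algebra A" "pre_cstar_algebra B" "star_hom A B \<phi>" and ck: "ck_family \<Lambda> A P T"
  shows "ck_family \<Lambda> B (\<lambda>v. \<phi> (P v)) (\<lambda>f. \<phi> (T f))"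
proof -
  interpret A: pre_cstar_algebra A by fact
  interpret B: pre_cstar_algebra B by fact
  interpret \<phi>: star_homomorphism A B \<phi> by unfold_locales fact
  note D = ck_familyD[OF ck]
  note P = D(7) and T = D(8)
  show ?thesis
  proof (rule ck_familyI)
    show "is_projection B (\<phi> (P v))" if "v \<in> vertices \<Lambda>" for v
      by (rule is_projection_map[OF assms(3) D(1)[OF that]])
    show "is_partial_isometry B (\<phi> (T f))" if f: "f \<in> edges \<Lambda>" for f
    proof -
      have "T f \<otimes>\<^bsub>A\<^esub> star A (T f) \<otimes>\<^bsub>A\<^esub> T f = T f"
        using D(2)[OF f] by (simp add: is_partial_isometry_def)
      then have "\<phi> (T f \<otimes>\<^bsub>A\<^esub> star A (T f) \<otimes>\<^bsub>A\<^esub> T f) = \<phi> (T f)" by simp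
      then show ?thesis using T[OF f] by (simp add: is_partial_isometry_def \<phi>.map_mult \<phi>.map_star)
    qed
    show "\<phi> (P v) \<otimes>\<^bsub>B\<^esub> \<phi> (P w) = \<zero>\<^bsub>B\<^esub>" if "v \<in> vertices \<Lambda>" "w \<in> vertices \<Lambda>" "v \<noteq> w" for v w
      using D(3)[OF that] \<phi>.map_mult[OF P[OF that(1)] P[OF that(2)]] by simp
    show "\<phi> (T a) \<otimes>\<^bsub>B\<^esub> \<phi> (T f) = \<phi> (T g) \<otimes>\<^bsub>B\<^esub> \<phi> (T b)"
      if "a \<in> edges \<Lambda>" "b \<in> edges \<Lambda>" "f \<in> edges \<Lambda>" "g \<in> edges \<Lambda>"
        "src \<Lambda> a = rng \<Lambda> f" "src \<Lambda> g = rng \<Lambda> b" "cmp \<Lambda> a f = cmp \<Lambda> g b" for a b f g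
      using arg_cong[OF D(4)[OF that], of \<phi>] \<phi>.map_mult[OF T[OF that(1)] T[OF that(3)]]
        \<phi>.map_mult[OF T[OF that(4)] T[OF that(2)]] by simp
    show "star B (\<phi> (T f)) \<otimes>\<^bsub>B\<^esub> \<phi> (T f) = \<phi> (P (src \<Lambda> f))" if f: "f \<in> edges \<Lambda>" for f
      using arg_cong[OF D(5)[OF f], of \<phi>] T[OF f] by (simp add: \<phi>.map_mult \<phi>.map_star)
    show "\<phi> (P v) = (\<Oplus>\<^bsub>B\<^esub>f\<in>{f \<in> edges \<Lambda>. rng \<Lambda> f = v \<and> deg \<Lambda> f = axis i 1}. \<phi> (T f) \<otimes>\<^bsub>B\<^esub> star B (\<phi> (T f)))"
      if v: "v \<in> vertices \<Lambda>" for v i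
    proof -
      let ?E = "{f \<in> edges \<Lambda>. rng \<Lambda> f = v \<and> deg \<Lambda> f = axis i 1}"
      have "\<phi> (P v) = \<phi> (\<Oplus>\<^bsub>A\<^esub>f\<in>?E. T f \<otimes>\<^bsub>A\<^esub> star A (T f))" using arg_cong[OF D(6)[OF v], of \<phi>] .
      also have "\<dots> = (\<Oplus>\<^bsub>B\<^esub>f\<in>?E. \<phi> (T f \<otimes>\<^bsub>A\<^esub> star A (T f)))" by (rule \<phi>.map_finsum) (simp add: T)
      also have "\<dots> = (\<Oplus>\<^bsub>B\<^esub>f\<in>?E. \<phi> (T f) \<otimes>\<^bsub>B\<^esub> star B (\<phi> (T f)))"
        by (intro B.finsum_cong') (simp_all add: T \<phi>.map_mult \<phi>.map_star)
      finally show ?thesis .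
    qed
  qed
qed

section \<open>Replacing a target algebra by a separable subalgebra\<close>

lemma restrict_subalgebra:
  fixes D :: "'d cstar"
  assumes "cstar_algebra D" and S: "cstar_subalgebra D S"
  shows cstar_restrict: "cstar_algebra (D\<lparr>carrier := S\<rparr>)"
    and star_hom_restrict: "star_hom (D\<lparr>carrier := S\<rparr>) D (\<lambda>x. x)"
    and minus_restrict: "\<And>x y. x \<in> S \<Longrightarrow> y \<in> S \<Longrightarrow> x \<ominus>\<^bsub>D\<lparr>carrier := S\<rparr>\<^esub> y = x \<ominus>\<^bsub>D\<^esub> y"
proof -
  interpret D: cstar_algebra D by fact
  let ?R = "D\<lparr>carrier := S\<rparr>"
  have sub: "x \<in> S \<Longrightarrow> x \<in> carrier D" for x
    using S by (auto simp: cstar_subalgebra_def linear_subspace_def)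
  have cl: "\<zero>\<^bsub>D\<^esub> \<in> S" "x \<in> S \<Longrightarrow> c \<odot>\<^bsub>D\<^esub> x \<in> S" "x \<in> S \<Longrightarrow> y \<in> S \<Longrightarrow> x \<oplus>\<^bsub>D\<^esub> y \<in> S"
    "x \<in> S \<Longrightarrow> y \<in> S \<Longrightarrow> x \<otimes>\<^bsub>D\<^esub> y \<in> S" "x \<in> S \<Longrightarrow> star D x \<in> S" for x y c
    using S by (auto simp: cstar_subalgebra_def linear_subspace_def)
  have pre: "pre_cstar_algebra ?R"
  proof (rule pre_cstar_algebra.intro)
    show "complex_vector_space ?R"
      by (rule complex_vector_spaceI)
        (auto simp: sub cl D.a_assoc D.smult_add_left D.smult_add_right D.smult_smult intro: D.a_comm)
  qed (auto simp: sub cl D.mult_assoc D.mult_add_left D.mult_add_right D.smult_mult_left D.smult_mult_right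
    D.star_add D.star_smult D.star_mult D.cnorm_add D.cnorm_smult D.cnorm_mult D.cstar_identity)
  interpret R: pre_cstar_algebra ?R by (rule pre)
  show minus: "x \<ominus>\<^bsub>?R\<^esub> y = x \<ominus>\<^bsub>D\<^esub> y" if "x \<in> S" "y \<in> S" for x y
    using R.smult_minus_one[of y] D.smult_minus_one[of y] that sub by (simp add: R.minus_eq D.minus_eq)
  show "cstar_algebra ?R"
  proof (rule cstar_algebraI[OF pre])
    show "x = \<zero>\<^bsub>?R\<^esub>" if "x \<in> carrier ?R" "cnorm ?R x = 0" for x
      using that D.cnorm_eq_0[of x] sub by simp
    show "complete_for ?R (cnorm ?R)"
      unfolding complete_for_def
    proof (intro allI impI, elim conjE)
      fix s :: "nat \<Rightarrow> 'd"
      assume s: "\<forall>n. s n \<in> carrier ?R"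
        and cau: "\<forall>e>0. \<exists>n\<^sub>0. \<forall>m\<ge>n\<^sub>0. \<forall>n\<ge>n\<^sub>0. cnorm ?R (s m \<ominus>\<^bsub>?R\<^esub> s n) < e"
      have sS: "s n \<in> S" for n using s by simp
      obtain l where l: "D.converges_to s l"
        using D.Cauchy_converges[of s] cau sS sub by (auto simp: minus)
      have "norm_closed D S" using S by (simp add: cstar_subalgebra_def)
      then have "l \<in> S" by (rule D.norm_closed_converges[OF _ l sS])
      then show "\<exists>l\<in>carrier ?R. (\<lambda>n. cnorm ?R (s n \<ominus>\<^bsub>?R\<^esub> l)) \<longlonglongrightarrow> 0"
        using D.converges_toD(3)[OF l] by (auto simp: minus sS)
    qed
  qed
  show "star_hom ?R D (\<lambda>x. x)" by (auto simp: star_hom_def sub)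
qed

lemma ck_family_restrict:
  assumes "cstar_algebra D" and S: "cstar_subalgebra D S" and ck: "ck_family \<Lambda> D Q U"
    and QU: "\<And>v. v \<in> vertices \<Lambda> \<Longrightarrow> Q v \<in> S" "\<And>f. f \<in> edges \<Lambda> \<Longrightarrow> U f \<in> S"
  shows "ck_family \<Lambda> (D\<lparr>carrier := S\<rparr>) Q U"
proof -
  let ?R = "D\<lparr>carrier := S\<rparr>"
  interpret D: cstar_algebra D by fact
  interpret R: cstar_algebra ?R by (rule cstar_restrict[OF assms(1) S])
  interpret i: star_homomorphism ?R D "\<lambda>x. x" by unfold_locales (rule star_hom_restrict[OF assms(1) S])
  have cl: "U f \<otimes>\<^bsub>D\<^esub> star D (U f) \<in> S" if "f \<in> edges \<Lambda>" for f
    using S QU(2)[OF that] by (auto simp: cstar_subalgebra_def)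
  have fs: "finsum ?R (\<lambda>f. U f \<otimes>\<^bsub>D\<^esub> star D (U f)) {f \<in> edges \<Lambda>. rng \<Lambda> f = v \<and> deg \<Lambda> f = axis i 1} =
      finsum D (\<lambda>f. U f \<otimes>\<^bsub>D\<^esub> star D (U f)) {f \<in> edges \<Lambda>. rng \<Lambda> f = v \<and> deg \<Lambda> f = axis i 1}" for v i
    by (rule i.map_finsum) (use cl in auto)
  note C = ck_familyD[OF ck]
  show ?thesis
  proof (rule ck_familyI)
    show "is_projection ?R (Q v)" if "v \<in> vertices \<Lambda>" for v
      using C(1)[OF that] QU(1)[OF that] by (simp add: is_projection_def)
    show "is_partial_isometry ?R (U f)" if "f \<in> edges \<Lambda>" for f
      using C(2)[OF that] QU(2)[OF that] by (simp add: is_partial_isometry_def)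
    show "Q v \<otimes>\<^bsub>?R\<^esub> Q w = \<zero>\<^bsub>?R\<^esub>" if "v \<in> vertices \<Lambda>" "w \<in> vertices \<Lambda>" "v \<noteq> w" for v w
      using C(3)[OF that] by simp
    show "U a \<otimes>\<^bsub>?R\<^esub> U f = U g \<otimes>\<^bsub>?R\<^esub> U b"
      if "a \<in> edges \<Lambda>" "b \<in> edges \<Lambda>" "f \<in> edges \<Lambda>" "g \<in> edges \<Lambda>"
        "src \<Lambda> a = rng \<Lambda> f" "src \<Lambda> g = rng \<Lambda> b" "cmp \<Lambda> a f = cmp \<Lambda> g b" for a b f g
      using C(4)[OF that] by simp
    show "star ?R (U f) \<otimes>\<^bsub>?R\<^esub> U f = Q (src \<Lambda> f)" if "f \<in> edges \<Lambda>" for f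
      using C(5)[OF that] by simp
    show "Q v = (\<Oplus>\<^bsub>?R\<^esub>f\<in>{f \<in> edges \<Lambda>. rng \<Lambda> f = v \<and> deg \<Lambda> f = axis i 1}. U f \<otimes>\<^bsub>?R\<^esub> star ?R (U f))"
      if "v \<in> vertices \<Lambda>" for v i
      using C(6)[OF that, of i] fs[of v i] by simp
  qed
qed

text \<open>A countable dense set of scalars: closing a countable set under the algebra operations
  with these scalars keeps it countable.\<close>

definition gaussian_rationals :: "complex set" where
  "gaussian_rationals = {c. Re c \<in> \<rat> \<and> Im c \<in> \<rat>}"

lemma countable_gaussian_rationals: "countable gaussian_rationals"
proof -
  have "gaussian_rationals \<subseteq> (\<lambda>(a, b). Complex a b) ` (\<rat> \<times> \<rat>)"
    by (auto simp: gaussian_rationals_def image_iff) (metis complex.collapse)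
  then show ?thesis by (rule countable_subset) (intro countable_image countable_SIGMA countable_rat)
qed

lemma gaussian_rationals_dense:
  obtains q where "\<And>n. q n \<in> gaussian_rationals" "q \<longlonglongrightarrow> c"
proof -
  have rat: "\<exists>r\<in>\<rat>. \<bar>r - x\<bar> < inverse (real (Suc n))" for x :: real and n
  proof -
    obtain r where "r \<in> \<rat>" "x < r" "r < x + inverse (real (Suc n))"
      using Rats_dense_in_real[of x "x + inverse (real (Suc n))"] by auto
    then show ?thesis by (intro bexI[of _ r]) auto
  qed
  have *: "\<exists>q. (\<forall>n. q n \<in> \<rat>) \<and> q \<longlonglongrightarrow> x" for x :: real
  proof -
    obtain q where q: "\<And>n. q n \<in> \<rat>" "\<And>n. \<bar>q n - x\<bar> < inverse (real (Suc n))" using rat by metis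
    have "(\<lambda>n. \<bar>q n - x\<bar>) \<longlonglongrightarrow> 0"
      by (rule squeeze_zero[OF LIMSEQ_inverse_real_of_nat]) (use q less_imp_le in auto)
    then have "q \<longlonglongrightarrow> x" by (simp add: LIM_zero_iff tendsto_rabs_zero_iff)
    then show ?thesis using q by blast
  qed
  obtain a b where ab: "\<And>n. a n \<in> \<rat>" "a \<longlonglongrightarrow> Re c" "\<And>n. b n \<in> \<rat>" "b \<longlonglongrightarrow> Im c"
    using *[of "Re c"] *[of "Im c"] by blast
  have "(\<lambda>n. Complex (a n) (b n)) \<longlonglongrightarrow> Complex (Re c) (Im c)"
    by (rule tendsto_Complex[OF ab(2,4)])
  moreover have "\<And>n. Complex (a n) (b n) \<in> gaussian_rationals"
    using ab by (simp add: gaussian_rationals_def)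
  ultimately show ?thesis using that[of "\<lambda>n. Complex (a n) (b n)"] by simp
qed

context cstar
begin

definition seq_closure :: "'a set \<Rightarrow> 'a set" where
  "seq_closure W = {x. \<exists>s. (\<forall>n. s n \<in> W) \<and> converges_to s x}"

lemma seq_closureI: "(\<And>n. s n \<in> W) \<Longrightarrow> converges_to s x \<Longrightarrow> x \<in> seq_closure W"
  unfolding seq_closure_def by (intro CollectI exI[of _ s]) simp

lemma seq_closureE:
  assumes "x \<in> seq_closure W"
  obtains s where "\<And>n. s n \<in> W" "converges_to s x"
proof -
  from assms have "\<exists>s. (\<forall>n. s n \<in> W) \<and> converges_to s x" by (simp add: seq_closure_def)
  then show ?thesis
  proof (rule exE)
    fix s assume s: "(\<forall>n. s n \<in> W) \<and> converges_to s x"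
    show ?thesis by (rule that[of s]) (use s in auto)
  qed
qed

text \<open>A complex multiple cx is the limit of q_n s_n, with Gaussian rationals q_n tending to c
  and elements s_n of \<open>W\<close> tending to x. The lemma thus serves countable sets closed
  under Gaussian rational scalars as well as genuine subspaces.\<close>

lemma cstar_subalgebra_seq_closure:
  assumes W: "W \<subseteq> carrier A" "\<zero> \<in> W"
    and smult: "\<And>c x. c \<in> gaussian_rationals \<Longrightarrow> x \<in> W \<Longrightarrow> c \<odot> x \<in> W"
    and add: "\<And>x y. x \<in> W \<Longrightarrow> y \<in> W \<Longrightarrow> x \<oplus> y \<in> W"
    and mult: "\<And>x y. x \<in> W \<Longrightarrow> y \<in> W \<Longrightarrow> x \<otimes> y \<in> W"
    and star: "\<And>x. x \<in> W \<Longrightarrow> star A x \<in> W"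
  shows "cstar_subalgebra A (seq_closure W)" and "W \<subseteq> seq_closure W"
proof -
  show sub: "W \<subseteq> seq_closure W"
  proof
    fix x assume x: "x \<in> W"
    then have "converges_to (\<lambda>_. x) x" using W by (intro converges_to_const) auto
    with x show "x \<in> seq_closure W" by (rule seq_closureI)
  qed
  have c: "seq_closure W \<subseteq> carrier A" by (auto elim!: seq_closureE intro: converges_toD(2))
  have cl_smult: "c \<odot> x \<in> seq_closure W" if x: "x \<in> seq_closure W" for c x
  proof -
    obtain s where s: "\<And>n. s n \<in> W" "converges_to s x" by (rule seq_closureE[OF x]) (rule that)
    obtain q where q: "\<And>n. q n \<in> gaussian_rationals" "q \<longlonglongrightarrow> c" using gaussian_rationals_dense by blast
    note sc = converges_toD[OF s(2)]
    have "converges_to (\<lambda>n. q n \<odot> s n) (c \<odot> x)"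
    proof (rule converges_toI[where g = "\<lambda>n. cmod (q n - c) * cnorm A (s n) + cmod c * cnorm A (s n \<ominus> x)"])
      fix n
      have "q n \<odot> s n = (q n - c) \<odot> s n \<oplus> c \<odot> s n"
        using smult_add_left[of "s n" "q n - c" c] sc by simp
      then have "q n \<odot> s n \<ominus> c \<odot> x = ((q n - c) \<odot> s n \<oplus> c \<odot> s n) \<ominus> c \<odot> x" by simp
      also have "\<dots> = (q n - c) \<odot> s n \<oplus> (c \<odot> s n \<ominus> c \<odot> x)"
        unfolding minus_eq by (rule a_assoc) (use sc in auto)
      finally have "q n \<odot> s n \<ominus> c \<odot> x = (q n - c) \<odot> s n \<oplus> c \<odot> (s n \<ominus> x)"
        using sc by (simp add: smult_diff_right)
      then show "cnorm A (q n \<odot> s n \<ominus> c \<odot> x) \<le> cmod (q n - c) * cnorm A (s n) + cmod c * cnorm A (s n \<ominus> x)"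
        using cnorm_add[of "(q n - c) \<odot> s n" "c \<odot> (s n \<ominus> x)"] sc by (simp add: cnorm_smult)
    next
      have "(\<lambda>n. cmod (q n - c) * cnorm A (s n) + cmod c * cnorm A (s n \<ominus> x)) \<longlonglongrightarrow> 0 * cnorm A x + cmod c * 0"
        using q(2) by (intro tendsto_intros sc converges_to_cnorm[OF s(2)]) (simp add: LIM_zero tendsto_norm_zero)
      then show "(\<lambda>n. cmod (q n - c) * cnorm A (s n) + cmod c * cnorm A (s n \<ominus> x)) \<longlonglongrightarrow> 0" by simp
    qed (use sc in auto)
    then show ?thesis by (rule seq_closureI[rotated]) (rule smult[OF q(1) s(1)])
  qed
  have ops: "x \<oplus> y \<in> seq_closure W" "x \<otimes> y \<in> seq_closure W" "star A x \<in> seq_closure W"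
    if x: "x \<in> seq_closure W" and y: "y \<in> seq_closure W" for x y
  proof -
    obtain s where s: "\<And>n. s n \<in> W" "converges_to s x" by (rule seq_closureE[OF x]) (rule that)
    obtain t where t: "\<And>n. t n \<in> W" "converges_to t y" by (rule seq_closureE[OF y]) (rule that)
    show "x \<oplus> y \<in> seq_closure W"
      by (rule seq_closureI[OF _ converges_to_add[OF s(2) t(2)]]) (rule add[OF s(1) t(1)])
    show "x \<otimes> y \<in> seq_closure W"
      by (rule seq_closureI[OF _ converges_to_mult[OF s(2) t(2)]]) (rule mult[OF s(1) t(1)])
    show "star A x \<in> seq_closure W"
      by (rule seq_closureI[OF _ converges_to_star[OF s(2)]]) (rule star[OF s(1)])
  qed
  have "norm_closed A (seq_closure W)"
    unfolding norm_closed_def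
  proof (intro ballI impI)
    fix x assume x: "x \<in> carrier A" and ap: "\<forall>e>0. \<exists>y\<in>seq_closure W. cnorm A (x \<ominus> y) < e"
    have "\<exists>w\<in>W. cnorm A (x \<ominus> w) < e" if "e > 0" for e
    proof -
      have e2: "e / 2 > 0" using that by simp
      then obtain y where y: "y \<in> seq_closure W" "cnorm A (x \<ominus> y) < e / 2" using ap by blast
      obtain s where s: "\<And>n. s n \<in> W" "converges_to s y" by (rule seq_closureE[OF y(1)]) (rule that)
      obtain n where n: "cnorm A (s n \<ominus> y) < e / 2"
        using order_tendstoD(2)[OF converges_toD(3)[OF s(2)] e2] unfolding eventually_sequentially by blast
      have "cnorm A (x \<ominus> s n) \<le> cnorm A (x \<ominus> y) + cnorm A (y \<ominus> s n)"
        by (rule cnorm_diff_triangle) (use x converges_toD[OF s(2)] in auto)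
      also have "\<dots> < e" using y(2) n cnorm_diff_commute[of y "s n"] converges_toD[OF s(2)] by simp
      finally show ?thesis using s(1) by blast
    qed
    then have "\<forall>e>0. \<exists>w\<in>W. cnorm A (x \<ominus> w) < e" by blast
    then obtain s where "\<And>n. s n \<in> W" "converges_to s x"
      using approximable_converges[OF W(1) x] by metis
    then show "x \<in> seq_closure W" by (rule seq_closureI)
  qed
  then show "cstar_subalgebra A (seq_closure W)"
    unfolding cstar_subalgebra_def linear_subspace_def
    by (intro conjI ballI allI c subsetD[OF sub W(2)] cl_smult ops)
qed

text \<open>The induction principle for generated C*-algebras: a property is established on a
  star-closed subalgebra containing the generators and then extended by limits.\<close>

lemma generated_dense:
  assumes gen: "generated_by A G"
    and R: "linear_subspace A R" "G \<subseteq> R" "\<And>x y. x \<in> R \<Longrightarrow> y \<in> R \<Longrightarrow> x \<otimes> y \<in> R" "\<And>x. x \<in> R \<Longrightarrow> star A x \<in> R"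
    and x: "x \<in> carrier A"
  obtains s where "\<And>n. s n \<in> R" "converges_to s x"
proof -
  have RA: "R \<subseteq> carrier A" "\<zero> \<in> R" "\<And>x c. x \<in> R \<Longrightarrow> c \<odot> x \<in> R" "\<And>x y. x \<in> R \<Longrightarrow> y \<in> R \<Longrightarrow> x \<oplus> y \<in> R"
    using R(1) by (auto simp: linear_subspace_def)
  have "cstar_subalgebra A (seq_closure R)" "R \<subseteq> seq_closure R"
    by (rule cstar_subalgebra_seq_closure[OF RA(1,2) RA(3) RA(4) R(3,4)]; assumption)+
  then have "seq_closure R = carrier A" using gen R(2) unfolding generated_by_def by blast
  then have "x \<in> seq_closure R" using x by simp
  then show ?thesis by (rule seq_closureE) (rule that)
qed

primrec rational_stage :: "'a set \<Rightarrow> nat \<Rightarrow> 'a set" where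
  "rational_stage G 0 = insert \<zero> G"
| "rational_stage G (Suc n) = rational_stage G n \<union>
     (\<lambda>(x, y). x \<oplus> y) ` (rational_stage G n \<times> rational_stage G n) \<union>
     (\<lambda>(x, y). x \<otimes> y) ` (rational_stage G n \<times> rational_stage G n) \<union>
     star A ` rational_stage G n \<union> (\<lambda>(c, x). c \<odot> x) ` (gaussian_rationals \<times> rational_stage G n)"

text \<open>The closure of a countable W has at most continuum many elements: x is determined by the
  set of pairs (w, n) for which w in W has distance less than 1/(n+1) from x. This is a subset of a
  countable set, so it can be coded by a real number.\<close>

lemma exists_separable_subalgebra:
  assumes G: "countable G" "G \<subseteq> carrier A"
  obtains S and j :: "'a \<Rightarrow> real" where "cstar_subalgebra A S" "G \<subseteq> S" "inj_on j S"
proof -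
  define W where "W = (\<Union>n. rational_stage G n)"
  have "countable (rational_stage G n)" for n
    by (induction n) (use G in \<open>auto intro!: countable_gaussian_rationals\<close>)
  then have cW: "countable W" by (simp add: W_def)
  have mono: "rational_stage G m \<subseteq> rational_stage G (m + d)" for m d
    by (induction d) auto
  have pair: "\<exists>n. x \<in> rational_stage G n \<and> y \<in> rational_stage G n" if "x \<in> W" "y \<in> W" for x y
  proof -
    obtain m where "x \<in> rational_stage G m" using \<open>x \<in> W\<close> unfolding W_def by (meson UN_E)
    moreover obtain n where "y \<in> rational_stage G n" using \<open>y \<in> W\<close> unfolding W_def by (meson UN_E)
    ultimately have "x \<in> rational_stage G (m + n)" "y \<in> rational_stage G (m + n)"
      using mono[of m n] mono[of n m] by (auto simp: add.commute)
    then show ?thesis by blast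
  qed
  have "rational_stage G n \<subseteq> carrier A" for n
    by (induction n) (use G in auto)
  then have WA: "W \<subseteq> carrier A" by (auto simp: W_def)
  have "G \<subseteq> rational_stage G 0" "\<zero> \<in> rational_stage G 0" by auto
  then have GW: "G \<subseteq> W" "\<zero> \<in> W" unfolding W_def by blast+
  have cl: "x \<oplus> y \<in> W" "x \<otimes> y \<in> W" "star A x \<in> W" "c \<in> gaussian_rationals \<Longrightarrow> c \<odot> x \<in> W"
    if xy: "x \<in> W" "y \<in> W" for x y c
  proof -
    obtain n where n: "x \<in> rational_stage G n" "y \<in> rational_stage G n" using pair[OF xy] by blast
    have "x \<oplus> y \<in> rational_stage G (Suc n)" "x \<otimes> y \<in> rational_stage G (Suc n)"
      "star A x \<in> rational_stage G (Suc n)" "c \<in> gaussian_rationals \<Longrightarrow> c \<odot> x \<in> rational_stage G (Suc n)"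
      using n by (auto simp: image_iff)
    then show "x \<oplus> y \<in> W" "x \<otimes> y \<in> W" "star A x \<in> W" "c \<in> gaussian_rationals \<Longrightarrow> c \<odot> x \<in> W"
      unfolding W_def by blast+
  qed
  have S: "cstar_subalgebra A (seq_closure W)" "W \<subseteq> seq_closure W"
    by (rule cstar_subalgebra_seq_closure[OF WA GW(2) cl(4) cl(1) cl(2) cl(3)]; assumption)+
  have SA: "seq_closure W \<subseteq> carrier A" using S by (simp add: cstar_subalgebra_def linear_subspace_def)
  define near where "near x = {(w, n). w \<in> W \<and> cnorm A (x \<ominus> w) < inverse (real (Suc n))}" for x
  have inj_near: "inj_on near (seq_closure W)"
  proof (rule inj_onI)
    fix x y assume xy: "x \<in> seq_closure W" "y \<in> seq_closure W" and eq: "near x = near y"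
    have xyA: "x \<in> carrier A" "y \<in> carrier A" using xy SA by auto
    obtain s where s: "\<And>n. s n \<in> W" "converges_to s x" by (rule seq_closureE[OF xy(1)]) (rule that)
    have sA: "s m \<in> carrier A" for m using s(1) WA by blast
    have "cnorm A (x \<ominus> y) \<le> e" if e: "e > 0" for e
    proof -
      have e2: "e / 2 > 0" using e by simp
      obtain n where n: "inverse (real (Suc n)) < e / 2" using reals_Archimedean[OF e2] by blast
      have "inverse (real (Suc n)) > 0" by simp
      from order_tendstoD(2)[OF converges_toD(3)[OF s(2)] this]
      obtain m where m: "cnorm A (s m \<ominus> x) < inverse (real (Suc n))"
        unfolding eventually_sequentially by blast
      then have mx: "cnorm A (x \<ominus> s m) < inverse (real (Suc n))"
        using cnorm_diff_commute[OF xyA(1) sA[of m]] by simp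
      then have "(s m, n) \<in> near x" using s(1) by (simp add: near_def)
      then have "(s m, n) \<in> near y" unfolding eq .
      then have my: "cnorm A (y \<ominus> s m) < inverse (real (Suc n))" by (simp add: near_def)
      have "cnorm A (x \<ominus> y) \<le> cnorm A (x \<ominus> s m) + cnorm A (s m \<ominus> y)"
        by (rule cnorm_diff_triangle[OF xyA(1) sA xyA(2)])
      also have "\<dots> \<le> e" using mx my n cnorm_diff_commute[OF xyA(2) sA[of m]] by linarith
      finally show ?thesis .
    qed
    from this[of "cnorm A (x \<ominus> y) / 2"] have "cnorm A (x \<ominus> y) \<le> 0" by linarith
    then have "cnorm A (x \<ominus> y) = 0" using cnorm_nonneg[OF minus_closed[OF xyA]] by linarith
    then show "x = y" using cnorm_eq_0[of "x \<ominus> y"] xyA by (simp add: diff_eq_zero)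
  qed
  define N where "N = W \<times> (UNIV :: nat set)"
  have cN: "countable N" using cW by (simp add: N_def)
  obtain k :: "nat set \<Rightarrow> real" where k: "inj k"
    using nat_sets_lepoll_reals01 unfolding lepoll_def by blast
  define j where "j x = k (to_nat_on N ` near x)" for x
  have "inj_on j (seq_closure W)"
  proof (rule inj_onI)
    fix x y assume xy: "x \<in> seq_closure W" "y \<in> seq_closure W" "j x = j y"
    then have "to_nat_on N ` near x = to_nat_on N ` near y" using k by (simp add: j_def inj_def)
    moreover have "near x \<subseteq> N" "near y \<subseteq> N" by (auto simp: near_def N_def)
    ultimately have "near x = near y" using inj_on_image_eq_iff[OF inj_on_to_nat_on[OF cN]] by blast
    then show "x = y" using inj_onD[OF inj_near] xy by blast
  qed
  then show ?thesis using that S GW by blast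
qed

end

text \<open>The countable family lies in a separable subalgebra \<open>S\<close>, and the copy of
  \<open>S\<close> on a set of reals is an admissible target of the universal property. Decoding and
  including \<open>S\<close> in \<open>D\<close> give the required map.\<close>

lemma universal_ck:
  fixes D :: "'d cstar"
  assumes univ: "is_universal_ck \<Lambda> A P T" and D: "cstar_algebra D" and ck: "ck_family \<Lambda> D Q U"
    and count: "countable (Q ` vertices \<Lambda>)" "countable (U ` edges \<Lambda>)"
  obtains \<phi> where "star_hom A D \<phi>" "\<And>v. v \<in> vertices \<Lambda> \<Longrightarrow> \<phi> (P v) = Q v" "\<And>f. f \<in> edges \<Lambda> \<Longrightarrow> \<phi> (T f) = U f"
proof -
  interpret D: cstar D using D by (simp add: cstar_def)
  have "Q ` vertices \<Lambda> \<union> U ` edges \<Lambda> \<subseteq> carrier D"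
    using ck by (auto simp: ck_family_def is_projection_def is_partial_isometry_def)
  then obtain S and j :: "'d \<Rightarrow> real" where S: "cstar_subalgebra D S" "Q ` vertices \<Lambda> \<union> U ` edges \<Lambda> \<subseteq> S" "inj_on j S"
    using D.exists_separable_subalgebra[of "Q ` vertices \<Lambda> \<union> U ` edges \<Lambda>"] count by auto
  let ?R = "D\<lparr>carrier := S\<rparr>"
  interpret R: cstar_algebra ?R by (rule cstar_restrict[OF D S(1)])
  have ckR: "ck_family \<Lambda> ?R Q U" using ck_family_restrict[OF D S(1) ck] S(2) by blast
  interpret sep: separation ?R j
  proof
    fix x y assume xy: "x \<in> carrier ?R" "y \<in> carrier ?R"
    have "j x = j y \<longleftrightarrow> x = y" using inj_onD[OF S(3)] xy by auto
    also have "\<dots> \<longleftrightarrow> x \<ominus>\<^bsub>?R\<^esub> y = \<zero>\<^bsub>?R\<^esub>" by (rule R.diff_eq_zero[OF xy, symmetric])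
    also have "\<dots> \<longleftrightarrow> cnorm ?R (x \<ominus>\<^bsub>?R\<^esub> y) = 0" by (rule R.cnorm_eq_0[OF R.minus_closed[OF xy], symmetric])
    finally show "j x = j y \<longleftrightarrow> cnorm ?R (x \<ominus>\<^bsub>?R\<^esub> y) = 0" .
  qed
  let ?D' = "separate ?R j"
  have D': "cstar_algebra ?D'" by (rule sep.cstar_separate[OF R.complete])
  have ck': "ck_family \<Lambda> ?D' (\<lambda>v. j (Q v)) (\<lambda>f. j (U f))"
    by (rule ck_family_map[OF R.pre_cstar_algebra_axioms sep.pre_cstar_separate sep.star_hom_separate ckR])
  obtain \<phi>' where \<phi>': "star_hom A ?D' \<phi>'" "\<And>v. v \<in> vertices \<Lambda> \<Longrightarrow> \<phi>' (P v) = j (Q v)"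
    "\<And>f. f \<in> edges \<Lambda> \<Longrightarrow> \<phi>' (T f) = j (U f)"
    using univ D' ck' unfolding is_universal_ck_def by blast
  define i where "i = inv_into S j"
  have i: "i (j x) = x" if "x \<in> S" for x using S(3) that by (simp add: i_def)
  have Sc: "S \<subseteq> carrier D" using S(1) by (auto simp: cstar_subalgebra_def linear_subspace_def)
  have cl: "x \<in> S \<Longrightarrow> c \<odot>\<^bsub>D\<^esub> x \<in> S" "x \<in> S \<Longrightarrow> y \<in> S \<Longrightarrow> x \<oplus>\<^bsub>D\<^esub> y \<in> S"
    "x \<in> S \<Longrightarrow> y \<in> S \<Longrightarrow> x \<otimes>\<^bsub>D\<^esub> y \<in> S" "x \<in> S \<Longrightarrow> star D x \<in> S" for x y c
    using S(1) by (auto simp: cstar_subalgebra_def linear_subspace_def)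
  have "star_hom ?D' D i"
    unfolding star_hom_def using sep.separate_add sep.separate_mult sep.separate_smult sep.separate_star
    by (auto simp: sep.separate_carrier i cl subsetD[OF Sc])
  from star_hom_compose[OF \<phi>'(1) this] show ?thesis
  proof (rule that)
    show "i (\<phi>' (P v)) = Q v" if "v \<in> vertices \<Lambda>" for v
      unfolding \<phi>'(2)[OF that] by (rule i) (use S(2) that in blast)
    show "i (\<phi>' (T f)) = U f" if "f \<in> edges \<Lambda>" for f
      unfolding \<phi>'(3)[OF that] by (rule i) (use S(2) that in blast)
  qed
qed

section \<open>Isomorphic k-graphs\<close>

text \<open>Serves to exchange \<open>delete_sink\<close>, whose morphisms are sets of paths, for a
  subgraph consisting of the original morphisms.\<close>

locale kgraph_iso =
  fixes M :: "('m, 'k::finite, 'y) kgraph_data_scheme" and N :: "('n, 'k, 'z) kgraph_data_scheme"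
    and k :: "'m \<Rightarrow> 'n"
  assumes bij: "bij_betw k (mor M) (mor N)"
    and rng_closed: "x \<in> mor M \<Longrightarrow> rng M x \<in> mor M" and src_closed: "x \<in> mor M \<Longrightarrow> src M x \<in> mor M"
    and map_rng: "x \<in> mor M \<Longrightarrow> rng N (k x) = k (rng M x)"
    and map_src: "x \<in> mor M \<Longrightarrow> src N (k x) = k (src M x)"
    and map_deg: "x \<in> mor M \<Longrightarrow> deg N (k x) = deg M x"
    and cmp_closed: "\<lbrakk>x \<in> mor M; y \<in> mor M; src M x = rng M y\<rbrakk> \<Longrightarrow> cmp M x y \<in> mor M"
    and map_cmp: "\<lbrakk>x \<in> mor M; y \<in> mor M; src M x = rng M y\<rbrakk> \<Longrightarrow> cmp N (k x) (k y) = k (cmp M x y)"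
begin

lemma inj: "x \<in> mor M \<Longrightarrow> y \<in> mor M \<Longrightarrow> k x = k y \<Longrightarrow> x = y"
  using bij by (auto simp: bij_betw_def inj_on_def)

lemma mor_image: "mor N = k ` mor M"
  using bij by (simp add: bij_betw_def)

lemma vertices_image: "vertices N = k ` vertices M"
  unfolding vertices_def of_degree_def mor_image using map_deg by auto

lemma edges_image: "edges N = k ` edges M"
  unfolding edges_def mor_image using map_deg by auto

lemma in_mor: "v \<in> vertices M \<Longrightarrow> v \<in> mor M" "f \<in> edges M \<Longrightarrow> f \<in> mor M"
  by (auto simp: vertices_def of_degree_def edges_def)

lemma ck_family_pullback:
  assumes "pre_cstar_algebra D" and ck: "ck_family N D Q U"
  shows "ck_family M D (\<lambda>v. Q (k v)) (\<lambda>f. U (k f))"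
proof (rule ck_familyI)
  interpret D: pre_cstar_algebra D by fact
  note C = ck_familyD[OF ck]
  have V: "k v \<in> vertices N" if "v \<in> vertices M" for v using that vertices_image by blast
  have E: "k f \<in> edges N" if "f \<in> edges M" for f using that edges_image by blast
  show "is_projection D (Q (k v))" if "v \<in> vertices M" for v by (rule C(1)[OF V[OF that]])
  show "is_partial_isometry D (U (k f))" if "f \<in> edges M" for f by (rule C(2)[OF E[OF that]])
  show "Q (k v) \<otimes>\<^bsub>D\<^esub> Q (k w) = \<zero>\<^bsub>D\<^esub>" if "v \<in> vertices M" "w \<in> vertices M" "v \<noteq> w" for v w
    using C(3)[OF V[OF that(1)] V[OF that(2)]] inj[OF in_mor(1)[OF that(1)] in_mor(1)[OF that(2)]] that(3) by blast
  show "U (k a) \<otimes>\<^bsub>D\<^esub> U (k f) = U (k g) \<otimes>\<^bsub>D\<^esub> U (k b)"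
    if e: "a \<in> edges M" "b \<in> edges M" "f \<in> edges M" "g \<in> edges M"
      and c: "src M a = rng M f" "src M g = rng M b" "cmp M a f = cmp M g b" for a b f g
  proof (rule C(4)[OF E[OF e(1)] E[OF e(2)] E[OF e(3)] E[OF e(4)]])
    show "src N (k a) = rng N (k f)" "src N (k g) = rng N (k b)"
      using c e in_mor(2) map_src map_rng by simp_all
    show "cmp N (k a) (k f) = cmp N (k g) (k b)"
      using map_cmp[OF in_mor(2)[OF e(1)] in_mor(2)[OF e(3)] c(1)] map_cmp[OF in_mor(2)[OF e(4)] in_mor(2)[OF e(2)] c(2)] c(3)
      by simp
  qed
  show "star D (U (k f)) \<otimes>\<^bsub>D\<^esub> U (k f) = Q (k (src M f))" if "f \<in> edges M" for f
    using C(5)[OF E[OF that]] map_src[OF in_mor(2)[OF that]] by simp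
  show "Q (k v) = (\<Oplus>\<^bsub>D\<^esub>f\<in>{f \<in> edges M. rng M f = v \<and> deg M f = axis i 1}. U (k f) \<otimes>\<^bsub>D\<^esub> star D (U (k f)))"
    if v: "v \<in> vertices M" for v i
  proof -
    let ?E = "{f \<in> edges M. rng M f = v \<and> deg M f = axis i 1}"
    have Em: "?E \<subseteq> mor M" using in_mor by blast
    have img: "{f \<in> edges N. rng N f = k v \<and> deg N f = axis i 1} = k ` ?E"
    proof (intro equalityI subsetI)
      fix f assume "f \<in> {f \<in> edges N. rng N f = k v \<and> deg N f = axis i 1}"
      then obtain e where e: "e \<in> edges M" "f = k e" "rng N (k e) = k v" "deg N (k e) = axis i 1"
        unfolding edges_image by blast
      note em = in_mor(2)[OF e(1)]
      have "k (rng M e) = k v" using e(3) map_rng[OF em] by (rule subst[rotated])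
      then have "rng M e = v" by (rule inj[OF rng_closed[OF em] in_mor(1)[OF v]])
      moreover have "deg M e = axis i 1" using e(4) map_deg[OF em] by (rule subst[rotated])
      ultimately show "f \<in> k ` ?E" unfolding e(2) using e(1) by (intro imageI) simp
    next
      fix f assume "f \<in> k ` ?E"
      then obtain e where e: "e \<in> edges M" "rng M e = v" "deg M e = axis i 1" "f = k e" by blast
      show "f \<in> {f \<in> edges N. rng N f = k v \<and> deg N f = axis i 1}"
        using E[OF e(1)] map_rng[OF in_mor(2)[OF e(1)]] map_deg[OF in_mor(2)[OF e(1)]] e by simp
    qed
    have "inj_on k ?E" using inj Em by (auto simp: inj_on_def)
    moreover have "U (k f) \<otimes>\<^bsub>D\<^esub> star D (U (k f)) \<in> carrier D" if "f \<in> ?E" for f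
      using C(8)[OF E] that by auto
    ultimately show ?thesis
      unfolding C(6)[OF V[OF v], of i] img by (subst D.finsum_reindex) auto
  qed
qed

lemma inverse: "kgraph_iso N M (inv_into (mor M) k)"
proof -
  let ?i = "inv_into (mor M) k"
  have i: "?i (k x) = x" if "x \<in> mor M" for x
    using bij that by (simp add: bij_betw_def)
  show ?thesis
  proof
    show "bij_betw ?i (mor N) (mor M)" by (rule bij_betw_inv_into[OF bij])
    fix y assume "y \<in> mor N"
    then obtain x where x: "x \<in> mor M" "y = k x" unfolding mor_image by blast
    note xx = rng_closed[OF x(1)] src_closed[OF x(1)]
    show "rng N y \<in> mor N" "src N y \<in> mor N"
      unfolding mor_image x(2) map_rng[OF x(1)] map_src[OF x(1)] using xx by blast+
    show "rng M (?i y) = ?i (rng N y)" "src M (?i y) = ?i (src N y)" "deg M (?i y) = deg N y"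
      using x xx by (simp_all add: i map_rng map_src map_deg)
    fix z assume z: "z \<in> mor N" "src N y = rng N z"
    then obtain w where w: "w \<in> mor M" "z = k w" unfolding mor_image by blast
    have c: "src M x = rng M w"
      using z(2) x w map_src[OF x(1)] map_rng[OF w(1)] inj[OF src_closed[OF x(1)] rng_closed[OF w(1)]] by simp
    show "cmp N y z \<in> mor N"
      unfolding mor_image x(2) w(2) map_cmp[OF x(1) w(1) c] using cmp_closed[OF x(1) w(1) c] by blast
    show "cmp M (?i y) (?i z) = ?i (cmp N y z)"
      unfolding x(2) w(2) map_cmp[OF x(1) w(1) c] using cmp_closed[OF x(1) w(1) c] x w by (simp add: i)
  qed
qed

text \<open>The universal family is pulled back along \<open>k\<close>, while a competing family on
  \<open>M\<close> is pulled back to \<open>N\<close> along the inverse before universality is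
  invoked.\<close>

lemma is_universal_ck_transfer:
  assumes "is_universal_ck N A P T"
  shows "is_universal_ck M A (\<lambda>v. P (k v)) (\<lambda>f. T (k f))"
proof -
  have A: "cstar_algebra A" and ck: "ck_family N A P T" and gen: "generated_by A (P ` vertices N \<union> T ` edges N)"
    and univ: "\<And>(D :: real cstar) Q U. cstar_algebra D \<and> ck_family N D Q U \<Longrightarrow>
        (\<exists>\<phi>. star_hom A D \<phi> \<and> (\<forall>v\<in>vertices N. \<phi> (P v) = Q v) \<and> (\<forall>f\<in>edges N. \<phi> (T f) = U f))"
    using assms unfolding is_universal_ck_def by blast+
  interpret A: cstar_algebra A by (rule A)
  interpret i: kgraph_iso N M "inv_into (mor M) k" by (rule inverse)
  have inv: "inv_into (mor M) k (k x) = x" if "x \<in> mor M" for x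
    using bij that by (simp add: bij_betw_def)
  show ?thesis
    unfolding is_universal_ck_def
  proof (intro conjI allI impI A)
    show "ck_family M A (\<lambda>v. P (k v)) (\<lambda>f. T (k f))"
      by (rule ck_family_pullback[OF A.pre_cstar_algebra_axioms ck])
    show "generated_by A ((\<lambda>v. P (k v)) ` vertices M \<union> (\<lambda>f. T (k f)) ` edges M)"
      using gen by (simp add: vertices_image edges_image image_image)
    fix D :: "real cstar" and Q U
    assume D: "cstar_algebra D \<and> ck_family M D Q U"
    interpret D: cstar_algebra D using D by blast
    have "ck_family N D (\<lambda>v. Q (inv_into (mor M) k v)) (\<lambda>f. U (inv_into (mor M) k f))"
      using i.ck_family_pullback[OF D.pre_cstar_algebra_axioms] D by blast
    then obtain \<phi> where \<phi>: "star_hom A D \<phi>" "\<forall>v\<in>vertices N. \<phi> (P v) = Q (inv_into (mor M) k v)"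
      "\<forall>f\<in>edges N. \<phi> (T f) = U (inv_into (mor M) k f)"
      using univ D by metis
    show "\<exists>\<phi>. star_hom A D \<phi> \<and> (\<forall>v\<in>vertices M. \<phi> (P (k v)) = Q v) \<and> (\<forall>f\<in>edges M. \<phi> (T (k f)) = U f)"
    proof (intro exI conjI ballI)
      show "star_hom A D \<phi>" by (rule \<phi>(1))
      show "\<phi> (P (k v)) = Q v" if "v \<in> vertices M" for v
        using \<phi>(2) that inv[OF in_mor(1)[OF that]] vertices_image by auto
      show "\<phi> (T (k f)) = U f" if "f \<in> edges M" for f
        using \<phi>(3) that inv[OF in_mor(2)[OF that]] edges_image by auto
    qed
  qed
qed

end

section \<open>Sink deletion\<close>

context k_graph
begin

lemma src_deg: "x \<in> mor \<Lambda> \<Longrightarrow> deg \<Lambda> (src \<Lambda> x) = 0"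
  using deg_ident[OF src_mor] rng_src by metis

lemma in_vertices: "v \<in> vertices \<Lambda> \<longleftrightarrow> v \<in> mor \<Lambda> \<and> deg \<Lambda> v = 0"
  by (simp add: vertices_def of_degree_def)

lemma vertex_ends: "x \<in> mor \<Lambda> \<Longrightarrow> rng \<Lambda> x \<in> vertices \<Lambda>" "x \<in> mor \<Lambda> \<Longrightarrow> src \<Lambda> x \<in> vertices \<Lambda>"
  by (simp_all add: in_vertices rng_mor src_mor deg_ident src_deg)

lemma factorization_unique:
  assumes "p \<in> mor \<Lambda>" "q \<in> mor \<Lambda>" "src \<Lambda> p = rng \<Lambda> q" "p' \<in> mor \<Lambda>" "q' \<in> mor \<Lambda>" "src \<Lambda> p' = rng \<Lambda> q'"
    and "deg \<Lambda> p = deg \<Lambda> p'" "deg \<Lambda> q = deg \<Lambda> q'" "cmp \<Lambda> p q = cmp \<Lambda> p' q'"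
  shows "p = p'" "q = q'"
proof -
  have "deg \<Lambda> (cmp \<Lambda> p q) = deg \<Lambda> q + deg \<Lambda> p" using assms deg_cmp by (simp add: add.commute)
  note u = factorization[OF cmp_mor[OF assms(1,2,3)] this]
  have ex1_eq: "a = b" if "\<exists>!x. F x" "F a" "F b" for F and a b :: "'m \<times> 'm"
    using that by blast
  have "(p, q) = (p', q')" by (rule ex1_eq[OF u]) (use assms in auto)
  then show "p = p'" "q = q'" by auto
qed

lemma factorization_exists:
  assumes "x \<in> mor \<Lambda>" "deg \<Lambda> x = m + n"
  obtains p q where "p \<in> mor \<Lambda>" "q \<in> mor \<Lambda>" "deg \<Lambda> p = m" "deg \<Lambda> q = n" "src \<Lambda> p = rng \<Lambda> q" "x = cmp \<Lambda> p q"
  using factorization[OF assms(1), of n m] assms(2) by (auto simp: add.commute)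

text \<open>A morphism v of degree 0 factors both as r(v) v and as v s(v), with all factors of
  degree 0, and uniqueness identifies the factors.\<close>

lemma vertex_rng: "v \<in> vertices \<Lambda> \<Longrightarrow> rng \<Lambda> v = v" and vertex_src: "v \<in> vertices \<Lambda> \<Longrightarrow> src \<Lambda> v = v"
proof -
  assume "v \<in> vertices \<Lambda>"
  then have v: "v \<in> mor \<Lambda>" "deg \<Lambda> v = 0" by (auto simp: in_vertices)
  show "rng \<Lambda> v = v"
    by (rule factorization_unique(1)[of _ v _ "src \<Lambda> v"])
      (use v in \<open>simp_all add: rng_mor src_mor src_rng rng_src deg_ident src_deg rng_cmp_self cmp_src_self\<close>)
  show "src \<Lambda> v = v"
    by (rule factorization_unique(2)[of "rng \<Lambda> v" v v "src \<Lambda> v", symmetric])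
      (use v in \<open>simp_all add: rng_mor src_mor src_rng rng_src deg_ident src_deg rng_cmp_self cmp_src_self\<close>)
qed

lemma edge_mor: "f \<in> edges \<Lambda> \<Longrightarrow> f \<in> mor \<Lambda>"
  by (simp add: edges_def)

lemma in_edges: "f \<in> edges \<Lambda> \<longleftrightarrow> f \<in> mor \<Lambda> \<and> (\<exists>i. deg \<Lambda> f = axis i 1)"
proof -
  have "(\<Sum>i\<in>UNIV. n $ i) = 1 \<longleftrightarrow> (\<exists>i. n = axis i 1)" for n :: "nat ^ 'k"
  proof
    assume "(\<Sum>i\<in>UNIV. n $ i) = 1"
    then obtain i where i: "n $ i = 1" "\<forall>j. i \<noteq> j \<longrightarrow> n $ j = 0"
      by (auto simp: sum_eq_Suc0_iff)
    then have "n = axis i 1" by (auto simp: vec_eq_iff axis_def)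
    then show "\<exists>i. n = axis i 1" ..
  next
    assume "\<exists>i. n = axis i 1"
    then show "(\<Sum>i\<in>UNIV. n $ i) = 1" by (auto simp: axis_def)
  qed
  then show ?thesis by (simp add: edges_def)
qed

definition commuting_square :: "'m \<Rightarrow> 'm \<Rightarrow> 'm \<times> 'm" where
  "commuting_square g h = (SOME (p, q). p \<in> mor \<Lambda> \<and> q \<in> mor \<Lambda> \<and> deg \<Lambda> p = deg \<Lambda> h \<and> deg \<Lambda> q = deg \<Lambda> g \<and>
     src \<Lambda> p = rng \<Lambda> q \<and> cmp \<Lambda> g h = cmp \<Lambda> p q)"

definition lf :: "'m \<Rightarrow> 'm \<Rightarrow> 'm" where "lf g h = fst (commuting_square g h)"
definition rg :: "'m \<Rightarrow> 'm \<Rightarrow> 'm" where "rg g h = snd (commuting_square g h)"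

lemma square:
  assumes gh: "g \<in> mor \<Lambda>" "h \<in> mor \<Lambda>" "src \<Lambda> g = rng \<Lambda> h"
  shows "lf g h \<in> mor \<Lambda>" "rg g h \<in> mor \<Lambda>" "deg \<Lambda> (lf g h) = deg \<Lambda> h" "deg \<Lambda> (rg g h) = deg \<Lambda> g"
    "src \<Lambda> (lf g h) = rng \<Lambda> (rg g h)" "cmp \<Lambda> (lf g h) (rg g h) = cmp \<Lambda> g h"
    "rng \<Lambda> (lf g h) = rng \<Lambda> g" "src \<Lambda> (rg g h) = src \<Lambda> h"
proof -
  have "deg \<Lambda> (cmp \<Lambda> g h) = deg \<Lambda> h + deg \<Lambda> g" using deg_cmp[OF gh] by (simp add: add.commute)
  from factorization_exists[OF cmp_mor[OF gh] this] obtain p q where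
    "p \<in> mor \<Lambda>" "q \<in> mor \<Lambda>" "deg \<Lambda> p = deg \<Lambda> h" "deg \<Lambda> q = deg \<Lambda> g" "src \<Lambda> p = rng \<Lambda> q" "cmp \<Lambda> g h = cmp \<Lambda> p q"
    by metis
  then have "\<exists>pq. case pq of (p, q) \<Rightarrow> p \<in> mor \<Lambda> \<and> q \<in> mor \<Lambda> \<and> deg \<Lambda> p = deg \<Lambda> h \<and> deg \<Lambda> q = deg \<Lambda> g \<and>
     src \<Lambda> p = rng \<Lambda> q \<and> cmp \<Lambda> g h = cmp \<Lambda> p q" by (intro exI[of _ "(p, q)"]) simp
  from someI_ex[OF this] have *: "lf g h \<in> mor \<Lambda> \<and> rg g h \<in> mor \<Lambda> \<and> deg \<Lambda> (lf g h) = deg \<Lambda> h \<and>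
     deg \<Lambda> (rg g h) = deg \<Lambda> g \<and> src \<Lambda> (lf g h) = rng \<Lambda> (rg g h) \<and> cmp \<Lambda> g h = cmp \<Lambda> (lf g h) (rg g h)"
    unfolding commuting_square_def[symmetric] lf_def rg_def by (simp add: case_prod_beta)
  then show "lf g h \<in> mor \<Lambda>" "rg g h \<in> mor \<Lambda>" "deg \<Lambda> (lf g h) = deg \<Lambda> h" "deg \<Lambda> (rg g h) = deg \<Lambda> g"
    "src \<Lambda> (lf g h) = rng \<Lambda> (rg g h)" "cmp \<Lambda> (lf g h) (rg g h) = cmp \<Lambda> g h" by auto
  then show "rng \<Lambda> (lf g h) = rng \<Lambda> g" "src \<Lambda> (rg g h) = src \<Lambda> h"
    using rng_cmp[of "lf g h" "rg g h"] src_cmp[of "lf g h" "rg g h"] rng_cmp[OF gh] src_cmp[OF gh] by auto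
qed

lemma square_unique:
  assumes "g \<in> mor \<Lambda>" "h \<in> mor \<Lambda>" "src \<Lambda> g = rng \<Lambda> h"
    and "p \<in> mor \<Lambda>" "q \<in> mor \<Lambda>" "src \<Lambda> p = rng \<Lambda> q" "deg \<Lambda> p = deg \<Lambda> h" "deg \<Lambda> q = deg \<Lambda> g" "cmp \<Lambda> p q = cmp \<Lambda> g h"
  shows "lf g h = p" "rg g h = q"
  using factorization_unique[of "lf g h" "rg g h" p q] square[OF assms(1-3)] assms by simp_all

lemma square_involution:
  assumes "g \<in> mor \<Lambda>" "h \<in> mor \<Lambda>" "src \<Lambda> g = rng \<Lambda> h"
  shows "lf (lf g h) (rg g h) = g" "rg (lf g h) (rg g h) = h"
  using square_unique[of "lf g h" "rg g h" g h] square[OF assms] assms by simp_all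

end

section \<open>A concrete model of the sink-deleted graph\<close>

locale sink_deletion = k_graph \<Lambda> for \<Lambda> :: "('m, 'k::finite) kgraph_data" +
  fixes v :: 'm
begin

abbreviation "G \<equiv> sink_deleted_graph \<Lambda> v"

definition remaining :: "'m set" where
  "remaining = {w \<in> vertices \<Lambda>. \<not> reachable_from \<Lambda> v w}"

text \<open>It suffices to restrict the ranges: a morphism whose range remains also has a remaining
  source, by \<open>hereditary_edge\<close> along the edges composing it.\<close>

definition remaining_graph :: "('m, 'k) kgraph_data" where
  "remaining_graph = \<Lambda>\<lparr>mor := {x \<in> mor \<Lambda>. rng \<Lambda> x \<in> remaining}\<rparr>"

lemma remaining_graph_simps [simp]:
  "mor remaining_graph = {x \<in> mor \<Lambda>. rng \<Lambda> x \<in> remaining}" "rng remaining_graph = rng \<Lambda>"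
  "src remaining_graph = src \<Lambda>" "cmp remaining_graph = cmp \<Lambda>" "deg remaining_graph = deg \<Lambda>"
  by (simp_all add: remaining_graph_def)

lemma G_simps:
  "gverts G = remaining" "gedges G = {f \<in> edges \<Lambda>. rng \<Lambda> f \<in> remaining}"
  "grng G = rng \<Lambda>" "gsrc G = src \<Lambda>" "gdeg G = deg \<Lambda>"
  using vertex_ends(1)[OF edge_mor] by (auto simp: sink_deleted_graph_def remaining_def)

lemma remaining_vertex: "w \<in> remaining \<Longrightarrow> w \<in> vertices \<Lambda>"
  by (simp add: remaining_def)

text \<open>A path from v to the source of f, prolonged by f, would reach the range of f.\<close>

lemma hereditary_edge:
  assumes f: "f \<in> edges \<Lambda>" "rng \<Lambda> f \<in> remaining"
  shows "src \<Lambda> f \<in> remaining"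
proof -
  have "\<not> reachable_from \<Lambda> v (src \<Lambda> f)"
  proof
    assume "reachable_from \<Lambda> v (src \<Lambda> f)"
    then obtain fs where fs: "is_path (skeleton \<Lambda>) (src \<Lambda> f) fs" "path_src (skeleton \<Lambda>) (src \<Lambda> f, fs) = v"
      by (auto simp: reachable_from_def paths_def path_rng_def)
    have "is_path (skeleton \<Lambda>) (rng \<Lambda> f) (f # fs)"
      using fs(1) f(1) vertex_ends(1)[OF edge_mor[OF f(1)]] by (simp add: skeleton_def)
    moreover have "path_src (skeleton \<Lambda>) (rng \<Lambda> f, f # fs) = v"
      using fs(2) by (simp add: path_src_def skeleton_def split: if_splits)
    ultimately have "reachable_from \<Lambda> v (rng \<Lambda> f)"
      unfolding reachable_from_def paths_def path_rng_def by (intro bexI[of _ "(rng \<Lambda> f, f # fs)"]) auto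
    then show False using f(2) by (simp add: remaining_def)
  qed
  then show ?thesis using vertex_ends(2)[OF edge_mor[OF f(1)]] by (simp add: remaining_def)
qed

lemma compose_path:
  assumes "is_path G w fs"
  shows "compose_list \<Lambda> w fs \<in> mor \<Lambda>" "rng \<Lambda> (compose_list \<Lambda> w fs) = w"
    "src \<Lambda> (compose_list \<Lambda> w fs) = path_src G (w, fs)" "deg \<Lambda> (compose_list \<Lambda> w fs) = path_deg G (w, fs)"
    "w \<in> remaining" "path_src G (w, fs) \<in> remaining"
proof -
  have "compose_list \<Lambda> w fs \<in> mor \<Lambda> \<and> rng \<Lambda> (compose_list \<Lambda> w fs) = w \<and>
    src \<Lambda> (compose_list \<Lambda> w fs) = path_src G (w, fs) \<and> deg \<Lambda> (compose_list \<Lambda> w fs) = path_deg G (w, fs) \<and>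
    w \<in> remaining \<and> path_src G (w, fs) \<in> remaining"
    using assms
  proof (induction fs arbitrary: w)
    case Nil
    then have "w \<in> remaining" "w \<in> vertices \<Lambda>" by (auto simp: G_simps remaining_def)
    then show ?case by (simp add: path_src_def path_deg_def in_vertices vertex_rng vertex_src)
  next
    case (Cons f fs)
    then have f: "f \<in> edges \<Lambda>" "rng \<Lambda> f = w" "w \<in> remaining" and p: "is_path G (src \<Lambda> f) fs"
      by (auto simp: G_simps)
    note IH = Cons.IH[OF p]
    have fm: "f \<in> mor \<Lambda>" by (rule edge_mor[OF f(1)])
    have s: "src \<Lambda> f = rng \<Lambda> (compose_list \<Lambda> (src \<Lambda> f) fs)" using IH by simp
    have "path_src G (w, f # fs) = path_src G (src \<Lambda> f, fs)" by (simp add: path_src_def G_simps)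
    then show ?case
      using IH f cmp_mor[OF fm _ s] rng_cmp[OF fm _ s] src_cmp[OF fm _ s] deg_cmp[OF fm _ s]
      by (simp add: path_deg_def G_simps)
  qed
  then show "compose_list \<Lambda> w fs \<in> mor \<Lambda>" "rng \<Lambda> (compose_list \<Lambda> w fs) = w"
    "src \<Lambda> (compose_list \<Lambda> w fs) = path_src G (w, fs)" "deg \<Lambda> (compose_list \<Lambda> w fs) = path_deg G (w, fs)"
    "w \<in> remaining" "path_src G (w, fs) \<in> remaining" by auto
qed

lemma compose_concat:
  assumes "is_path G w fs" "is_path G (path_src G (w, fs)) gs"
  shows "is_path G w (fs @ gs) \<and>
    compose_list \<Lambda> w (fs @ gs) = cmp \<Lambda> (compose_list \<Lambda> w fs) (compose_list \<Lambda> (path_src G (w, fs)) gs)"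
  using assms
proof (induction fs arbitrary: w)
  case Nil
  then have p: "is_path G w gs" by (simp add: path_src_def)
  show ?case using p rng_cmp_self[OF compose_path(1)[OF p]] compose_path(2)[OF p] by (simp add: path_src_def)
next
  case (Cons f fs)
  then have f: "f \<in> edges \<Lambda>" "rng \<Lambda> f = w" "w \<in> remaining" and p: "is_path G (src \<Lambda> f) fs"
    by (auto simp: G_simps)
  have eq: "path_src G (w, f # fs) = path_src G (src \<Lambda> f, fs)" by (simp add: path_src_def G_simps)
  have q: "is_path G (path_src G (src \<Lambda> f, fs)) gs" using Cons.prems(2) unfolding eq .
  note IH = Cons.IH[OF p q]
  note c = compose_path[OF p] compose_path[OF q]
  show ?case
    unfolding eq using IH f c edge_mor[OF f(1)] cmp_assoc[OF edge_mor[OF f(1)] c(1) c(7)] by (simp add: G_simps)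
qed

text \<open>An edge is split off on the left. Its source remains by \<open>hereditary_edge\<close>,
  so the induction on the total degree never leaves the sink-deleted graph.\<close>

lemma path_exists:
  assumes "x \<in> mor \<Lambda>" "rng \<Lambda> x \<in> remaining"
  shows "\<exists>fs. is_path G (rng \<Lambda> x) fs \<and> compose_list \<Lambda> (rng \<Lambda> x) fs = x"
  using assms
proof (induction "\<Sum>i\<in>UNIV. deg \<Lambda> x $ i" arbitrary: x rule: less_induct)
  case less
  show ?case
  proof (cases "deg \<Lambda> x = 0")
    case True
    then have "rng \<Lambda> x = x" using less.prems by (intro vertex_rng) (simp add: in_vertices)
    then show ?thesis using less.prems by (intro exI[of _ "[]"]) (simp add: G_simps)
  next
    case False
    then obtain i where i: "deg \<Lambda> x $ i \<noteq> 0" by (auto simp: vec_eq_iff)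
    define n where "n = deg \<Lambda> x - axis i 1"
    have d: "deg \<Lambda> x = axis i 1 + n" using i by (auto simp: n_def vec_eq_iff axis_def)
    obtain p q where pq: "p \<in> mor \<Lambda>" "q \<in> mor \<Lambda>" "deg \<Lambda> p = axis i 1" "deg \<Lambda> q = n"
      "src \<Lambda> p = rng \<Lambda> q" "x = cmp \<Lambda> p q"
      using factorization_exists[OF less.prems(1) d] by metis
    have pe: "p \<in> edges \<Lambda>" using pq by (auto simp: in_edges)
    have pr: "rng \<Lambda> p = rng \<Lambda> x" using pq rng_cmp by simp
    then have qr: "rng \<Lambda> q \<in> remaining" using hereditary_edge[OF pe] less.prems pq by simp
    have "(\<Sum>j\<in>UNIV. deg \<Lambda> x $ j) = (\<Sum>j\<in>UNIV. axis i (1::nat) $ j) + (\<Sum>j\<in>UNIV. deg \<Lambda> q $ j)"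
      unfolding d pq(4) by (simp add: sum.distrib)
    moreover have "(\<Sum>j\<in>UNIV. axis i (1::nat) $ j) = 1" by (simp add: axis_def)
    ultimately obtain fs where fs: "is_path G (rng \<Lambda> q) fs" "compose_list \<Lambda> (rng \<Lambda> q) fs = q"
      using less.hyps[OF _ pq(2) qr] by auto
    have "is_path G (rng \<Lambda> x) (p # fs)" "compose_list \<Lambda> (rng \<Lambda> x) (p # fs) = x"
      using fs pe pr pq less.prems(2) by (auto simp: G_simps)
    then show ?thesis by blast
  qed
qed

text \<open>By \<open>sink_rel_image\<close> the nonempty fibres of \<open>path_class\<close> are
  exactly the equivalence classes that \<open>delete_sink\<close> uses as morphisms.\<close>

definition path_set :: "'m \<Rightarrow> ('m \<times> 'm list) set" where
  "path_set x = {p \<in> paths G. path_class \<Lambda> p = x}"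

lemma in_paths: "(w, fs) \<in> paths G \<longleftrightarrow> is_path G w fs"
  by (simp add: paths_def)

lemma path_set_nonempty:
  assumes "x \<in> mor remaining_graph"
  obtains p where "p \<in> path_set x"
proof -
  obtain fs where "is_path G (rng \<Lambda> x) fs" "compose_list \<Lambda> (rng \<Lambda> x) fs = x"
    using path_exists assms by auto
  then have "(rng \<Lambda> x, fs) \<in> path_set x" by (simp add: path_set_def in_paths path_class_def)
  then show ?thesis by (rule that)
qed

lemma path_set_props:
  assumes "p \<in> path_set x"
  shows "x \<in> mor \<Lambda>" "fst p = rng \<Lambda> x" "path_src G p = src \<Lambda> x" "path_deg G p = deg \<Lambda> x" "rng \<Lambda> x \<in> remaining"
    "src \<Lambda> x \<in> remaining" "p \<in> paths G" "is_path G (fst p) (snd p)" "path_class \<Lambda> p = x"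
proof -
  obtain w fs where p: "p = (w, fs)" by (cases p)
  have 1: "is_path G w fs" "compose_list \<Lambda> w fs = x" using assms by (auto simp: path_set_def p in_paths path_class_def)
  note c = compose_path[OF 1(1), unfolded 1(2)]
  show "x \<in> mor \<Lambda>" "fst p = rng \<Lambda> x" "path_src G p = src \<Lambda> x" "path_deg G p = deg \<Lambda> x" "rng \<Lambda> x \<in> remaining"
    "src \<Lambda> x \<in> remaining" "is_path G (fst p) (snd p)"
    using c 1 by (simp_all add: p)
  show "p \<in> paths G" "path_class \<Lambda> p = x" using assms by (simp_all add: path_set_def)
qed

lemma sink_rel_image: "p \<in> paths G \<Longrightarrow> sink_rel \<Lambda> v `` {p} = path_set (path_class \<Lambda> p)"
  by (auto simp: sink_rel_def path_set_def)

lemma vertex_path: "w \<in> remaining \<Longrightarrow> (w, []) \<in> paths G \<and> path_class \<Lambda> (w, []) = w"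
  by (simp add: in_paths G_simps path_class_def)

text \<open>The operations of \<open>delete_sink\<close> are unions over all representatives. Every
  representative contributes the same class, so each union is that class.\<close>

sublocale iso: kgraph_iso remaining_graph "delete_sink \<Lambda> v" path_set
proof
  let ?M = "delete_sink \<Lambda> v"
  have inj: "x = y" if x: "x \<in> mor remaining_graph" and eq: "path_set x = path_set y" for x y
  proof -
    obtain p where p: "p \<in> path_set x" using path_set_nonempty[OF x] by blast
    then have "p \<in> path_set y" using eq by simp
    then show ?thesis using path_set_props(9)[OF p] path_set_props(9) by metis
  qed
  have "mor ?M = path_set ` mor remaining_graph"
  proof (intro equalityI subsetI)
    fix X assume "X \<in> mor ?M"
    then obtain p where p: "p \<in> paths G" "X = sink_rel \<Lambda> v `` {p}"
      by (auto simp: delete_sink_def quotient_def)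
    then have X: "X = path_set (path_class \<Lambda> p)" by (simp add: sink_rel_image)
    moreover have "p \<in> path_set (path_class \<Lambda> p)" using p by (simp add: path_set_def)
    from path_set_props(1,5)[OF this] have "path_class \<Lambda> p \<in> mor remaining_graph" by simp
    ultimately show "X \<in> path_set ` mor remaining_graph" by blast
  next
    fix X assume "X \<in> path_set ` mor remaining_graph"
    then obtain x where x: "x \<in> mor remaining_graph" "X = path_set x" by blast
    obtain p where p: "p \<in> path_set x" using path_set_nonempty[OF x(1)] by blast
    have "X = sink_rel \<Lambda> v `` {p}" using x(2) sink_rel_image[OF path_set_props(7)[OF p]] path_set_props(9)[OF p] by simp
    then show "X \<in> mor ?M" using path_set_props(7)[OF p] by (auto simp: delete_sink_def quotient_def)
  qed
  then show "bij_betw path_set (mor remaining_graph) (mor ?M)"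
    using inj by (auto simp: bij_betw_def inj_on_def)
  fix x assume x: "x \<in> mor remaining_graph"
  obtain p where p: "p \<in> path_set x" using path_set_nonempty[OF x] by blast
  note P = path_set_props[OF p]
  show "rng remaining_graph x \<in> mor remaining_graph" "src remaining_graph x \<in> mor remaining_graph"
    using P by (simp_all add: rng_mor src_mor rng_rng rng_src)
  have r: "sink_rel \<Lambda> v `` {(path_rng q, [])} = path_set (rng \<Lambda> x)" if "q \<in> path_set x" for q
    using path_set_props(2,5)[OF that] vertex_path[of "rng \<Lambda> x"] sink_rel_image[of "(rng \<Lambda> x, [])"] by (simp add: path_rng_def)
  show "rng ?M (path_set x) = path_set (rng remaining_graph x)"
    using r p by (auto simp: delete_sink_def)
  have s: "sink_rel \<Lambda> v `` {(path_src G q, [])} = path_set (src \<Lambda> x)" if "q \<in> path_set x" for q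
    using path_set_props(3,6)[OF that] vertex_path[of "src \<Lambda> x"] sink_rel_image[of "(src \<Lambda> x, [])"] by simp
  show "src ?M (path_set x) = path_set (src remaining_graph x)"
    using s p by (auto simp: delete_sink_def)
  have "path_deg G ` path_set x = (\<lambda>_. deg \<Lambda> x) ` path_set x"
    by (rule image_cong[OF refl]) (rule path_set_props(4))
  also have "\<dots> = {deg \<Lambda> x}" by (rule image_constant[OF p])
  finally show "deg ?M (path_set x) = deg remaining_graph x" by (simp add: delete_sink_def)
  fix y assume y: "y \<in> mor remaining_graph" and xy: "src remaining_graph x = rng remaining_graph y"
  then have ym: "y \<in> mor \<Lambda>" and c: "src \<Lambda> x = rng \<Lambda> y" by auto
  show "cmp remaining_graph x y \<in> mor remaining_graph"
    using cmp_mor[OF P(1) ym c] rng_cmp[OF P(1) ym c] P(5) by simp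
  obtain q where q: "q \<in> path_set y" using path_set_nonempty[OF y] by blast
  have "sink_rel \<Lambda> v `` {path_concat p' q'} = path_set (cmp \<Lambda> x y)" if p': "p' \<in> path_set x" and q': "q' \<in> path_set y" for p' q'
  proof -
    note P' = path_set_props[OF p'] and Q' = path_set_props[OF q']
    have fq: "fst q' = path_src G (fst p', snd p')" using P'(3) Q'(2) c by simp
    have "is_path G (path_src G (fst p', snd p')) (snd q')" using Q'(8) unfolding fq .
    from compose_concat[OF P'(8) this] have "path_concat p' q' \<in> paths G \<and> path_class \<Lambda> (path_concat p' q') = cmp \<Lambda> x y"
      using P'(9) Q'(9) fq by (simp add: path_concat_def in_paths path_class_def)
    then show ?thesis using sink_rel_image by simp
  qed
  then show "cmp ?M (path_set x) (path_set y) = path_set (cmp remaining_graph x y)"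
    using p q by (auto simp: delete_sink_def)
qed

lemma vertices_remaining_graph: "vertices remaining_graph = remaining"
  using vertex_rng remaining_vertex by (auto simp: vertices_def of_degree_def)

lemma edges_remaining_graph: "edges remaining_graph = {f \<in> edges \<Lambda>. rng \<Lambda> f \<in> remaining}"
  by (auto simp: edges_def)

lemma sink_reaches_sinks:
  assumes sink: "{x \<in> of_degree \<Lambda> (axis i 1). src \<Lambda> x = v} = {}" and w: "reachable_from \<Lambda> v w"
    and h: "h \<in> mor \<Lambda>" "deg \<Lambda> h = axis i 1"
  shows "src \<Lambda> h \<noteq> w"
proof -
  obtain fs where fs: "is_path (skeleton \<Lambda>) w fs" "path_src (skeleton \<Lambda>) (w, fs) = v"
    using w by (auto simp: reachable_from_def paths_def path_rng_def)
  then show ?thesis using h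
  proof (induction fs arbitrary: w h)
    case Nil
    then have "w = v" by (simp add: path_src_def)
    then show ?case using sink Nil by (auto simp: of_degree_def)
  next
    case (Cons f fs)
    then have f: "f \<in> edges \<Lambda>" "rng \<Lambda> f = w" and p: "is_path (skeleton \<Lambda>) (src \<Lambda> f) fs" by (auto simp: skeleton_def)
    have p2: "path_src (skeleton \<Lambda>) (src \<Lambda> f, fs) = v"
      using Cons.prems(2) by (simp add: path_src_def skeleton_def split: if_splits)
    show ?case
    proof
      assume "src \<Lambda> h = w"
      then have c: "src \<Lambda> h = rng \<Lambda> f" using f by simp
      note sq = square[OF Cons.prems(3) edge_mor[OF f(1)] c]
      have "deg \<Lambda> (rg h f) = axis i 1" using sq(4) Cons.prems(4) by simp
      from Cons.IH[OF p p2 sq(2) this] sq(8) show False by simp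
    qed
  qed
qed

end

section \<open>Cuntz-Krieger families\<close>

context pre_cstar_algebra
begin

lemma finsum_single:
  assumes "finite I" "i \<in> I" "\<And>j. j \<in> I \<Longrightarrow> j \<noteq> i \<Longrightarrow> g j = \<zero>" "g i \<in> carrier A"
  shows "finsum A g I = g i"
proof -
  have "g j \<in> carrier A" if "j \<in> I" for j
    using assms(3)[OF that] assms(4) by (cases "j = i") auto
  then have "finsum A g {i} = finsum A g I"
    using assms by (intro add.finprod_mono_neutral_cong_left) auto
  then show ?thesis using assms(4) by simp
qed

text \<open>Made for matrix products: each term on the left meets at most one term on the right,
  selected by \<open>m\<close>, so the double sum collapses. The next lemma is the same with the
  sides exchanged.\<close>

lemma finsum_mult_match_left:
  assumes "finite J" "\<And>i. i \<in> I \<Longrightarrow> f i \<in> carrier A" "\<And>j. j \<in> J \<Longrightarrow> g j \<in> carrier A"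
    and m: "\<And>i. i \<in> I \<Longrightarrow> m i \<in> J"
    and 0: "\<And>i j. i \<in> I \<Longrightarrow> j \<in> J \<Longrightarrow> j \<noteq> m i \<Longrightarrow> f i \<otimes> g j = \<zero>"
  shows "finsum A f I \<otimes> finsum A g J = (\<Oplus>i\<in>I. f i \<otimes> g (m i))"
proof -
  have gc: "finsum A g J \<in> carrier A" using assms(3) by (intro finsum_closed) auto
  have "finsum A f I \<otimes> finsum A g J = (\<Oplus>i\<in>I. f i \<otimes> finsum A g J)"
    by (rule finsum_mult_right[OF gc assms(2)])
  also have "\<dots> = (\<Oplus>i\<in>I. f i \<otimes> g (m i))"
  proof (rule finsum_cong'[OF refl])
    show "f i \<otimes> finsum A g J = f i \<otimes> g (m i)" if i: "i \<in> I" for i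
    proof -
      have "f i \<otimes> finsum A g J = (\<Oplus>j\<in>J. f i \<otimes> g j)" by (rule finsum_mult_left[OF assms(2)[OF i] assms(3)])
      also have "\<dots> = f i \<otimes> g (m i)"
        by (rule finsum_single[OF assms(1) m[OF i] 0[OF i]]) (use assms(2,3) m i in auto)
      finally show ?thesis .
    qed
  qed (use assms m in auto)
  finally show ?thesis .
qed

lemma finsum_mult_match_right:
  assumes "finite I" "\<And>i. i \<in> I \<Longrightarrow> f i \<in> carrier A" "\<And>j. j \<in> J \<Longrightarrow> g j \<in> carrier A"
    and m: "\<And>j. j \<in> J \<Longrightarrow> m j \<in> I"
    and 0: "\<And>i j. i \<in> I \<Longrightarrow> j \<in> J \<Longrightarrow> i \<noteq> m j \<Longrightarrow> f i \<otimes> g j = \<zero>"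
  shows "finsum A f I \<otimes> finsum A g J = (\<Oplus>j\<in>J. f (m j) \<otimes> g j)"
proof -
  have fc: "finsum A f I \<in> carrier A" using assms(2) by (intro finsum_closed) auto
  have "finsum A f I \<otimes> finsum A g J = (\<Oplus>j\<in>J. finsum A f I \<otimes> g j)"
    by (rule finsum_mult_left[OF fc assms(3)])
  also have "\<dots> = (\<Oplus>j\<in>J. f (m j) \<otimes> g j)"
  proof (rule finsum_cong'[OF refl])
    show "finsum A f I \<otimes> g j = f (m j) \<otimes> g j" if j: "j \<in> J" for j
    proof -
      have "finsum A f I \<otimes> g j = (\<Oplus>i\<in>I. f i \<otimes> g j)" by (rule finsum_mult_right[OF assms(3)[OF j] assms(2)])
      also have "\<dots> = f (m j) \<otimes> g j"
        by (rule finsum_single[OF assms(1) m[OF j]]) (use 0 j assms(2,3) m in auto)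
      finally show ?thesis .
    qed
  qed (use assms m in auto)
  finally show ?thesis .
qed

lemma finsum_Sigma:
  assumes "finite I" "\<And>i. i \<in> I \<Longrightarrow> finite (J i)" "\<And>i j. i \<in> I \<Longrightarrow> j \<in> J i \<Longrightarrow> g i j \<in> carrier A"
  shows "(\<Oplus>i\<in>I. \<Oplus>j\<in>J i. g i j) = (\<Oplus>p\<in>Sigma I J. g (fst p) (snd p))"
  using assms
proof (induction I rule: finite_induct)
  case (insert i I)
  have c: "(\<lambda>i. \<Oplus>j\<in>J i. g i j) \<in> I \<rightarrow> carrier A" using insert.prems by (auto intro!: finsum_closed)
  have "(\<Oplus>j\<in>J i. g i j) = (\<Oplus>p\<in>{i} \<times> J i. g (fst p) (snd p))"
  proof -
    have "{i} \<times> J i = Pair i ` J i" by auto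
    moreover have "(\<Oplus>p\<in>Pair i ` J i. g (fst p) (snd p)) = (\<Oplus>j\<in>J i. g (fst (i, j)) (snd (i, j)))"
      by (rule finsum_reindex) (use insert.prems in \<open>auto simp: inj_on_def\<close>)
    ultimately show ?thesis by simp
  qed
  moreover have "Sigma (insert i I) J = ({i} \<times> J i) \<union> Sigma I J" by auto
  moreover have "(\<Oplus>p\<in>({i} \<times> J i) \<union> Sigma I J. g (fst p) (snd p)) =
      (\<Oplus>p\<in>{i} \<times> J i. g (fst p) (snd p)) \<oplus> (\<Oplus>p\<in>Sigma I J. g (fst p) (snd p))"
    by (rule finsum_Un_disjoint) (use insert in auto)
  moreover have "(\<Oplus>j\<in>J i. g i j) \<in> carrier A" using insert.prems by (auto intro!: finsum_closed)
  ultimately show ?case using insert c by (simp add: finsum_insert)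
qed simp

end

text \<open>The graph enters only through facts about vertices and edges, so that the locale applies
  both to \<open>\<Lambda>\<close> and to \<open>remaining_graph\<close>; the latter is never shown
  to be a \<open>k_graph\<close>.\<close>

locale ck_representation = cstar A for A :: "'a cstar" (structure) +
  fixes \<Lambda> :: "('m, 'k::finite) kgraph_data" and P T :: "'m \<Rightarrow> 'a"
  assumes ck: "ck_family \<Lambda> A P T"
    and rng_edge: "f \<in> edges \<Lambda> \<Longrightarrow> rng \<Lambda> f \<in> vertices \<Lambda>"
    and src_edge: "f \<in> edges \<Lambda> \<Longrightarrow> src \<Lambda> f \<in> vertices \<Lambda>"
    and deg_edge: "f \<in> edges \<Lambda> \<Longrightarrow> \<exists>j. deg \<Lambda> f = axis j 1"
    and finite_row: "w \<in> vertices \<Lambda> \<Longrightarrow> finite {f \<in> edges \<Lambda>. rng \<Lambda> f = w \<and> deg \<Lambda> f = axis j 1}"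
begin

definition row :: "'m \<Rightarrow> 'k \<Rightarrow> 'm set" where
  "row w j = {f \<in> edges \<Lambda>. rng \<Lambda> f = w \<and> deg \<Lambda> f = axis j 1}"

lemma P_closed [simp, intro]: "w \<in> vertices \<Lambda> \<Longrightarrow> P w \<in> carrier A"
  and T_closed [simp, intro]: "f \<in> edges \<Lambda> \<Longrightarrow> T f \<in> carrier A"
  and T_star_T: "f \<in> edges \<Lambda> \<Longrightarrow> star A (T f) \<otimes> T f = P (src \<Lambda> f)"
  by (rule ck_familyD[OF ck]; assumption)+

lemma P_sum: "w \<in> vertices \<Lambda> \<Longrightarrow> P w = (\<Oplus>f\<in>row w j. T f \<otimes> star A (T f))"
  unfolding row_def by (rule ck_familyD(6)[OF ck])

lemma P_star: "w \<in> vertices \<Lambda> \<Longrightarrow> star A (P w) = P w"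
  and P_idem: "w \<in> vertices \<Lambda> \<Longrightarrow> P w \<otimes> P w = P w"
  using ck_familyD(1)[OF ck] by (auto simp: is_projection_def)

lemma P_mult: "w \<in> vertices \<Lambda> \<Longrightarrow> u \<in> vertices \<Lambda> \<Longrightarrow> P w \<otimes> P u = (if w = u then P w else \<zero>)"
  using P_idem ck_familyD(3)[OF ck] by auto

lemma T_T_star_T: "f \<in> edges \<Lambda> \<Longrightarrow> T f \<otimes> star A (T f) \<otimes> T f = T f"
  using ck_familyD(2)[OF ck] by (auto simp: is_partial_isometry_def)

lemma T_P_src: "f \<in> edges \<Lambda> \<Longrightarrow> T f \<otimes> P (src \<Lambda> f) = T f"
  using T_T_star_T[of f] T_star_T[of f] by (simp add: mult_assoc)

lemma is_projection_range: "f \<in> edges \<Lambda> \<Longrightarrow> is_projection A (T f \<otimes> star A (T f))"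
  using T_T_star_T[of f] by (simp add: is_projection_def star_mult flip: mult_assoc)

lemma row_in: "f \<in> row w j \<Longrightarrow> f \<in> edges \<Lambda>" "f \<in> row w j \<Longrightarrow> rng \<Lambda> f = w" "f \<in> row w j \<Longrightarrow> deg \<Lambda> f = axis j 1"
  by (auto simp: row_def)

lemma finite_row' [simp]: "w \<in> vertices \<Lambda> \<Longrightarrow> finite (row w j)"
  unfolding row_def by (rule finite_row)

text \<open>By (CK4) the range projections of the edges of one colour into w add up to the
  projection \<open>P w\<close>, so \<open>projections_orthogonal\<close> applies.\<close>

lemma row_projections:
  assumes "w \<in> vertices \<Lambda>"
  shows "f \<in> row w j \<Longrightarrow> P w \<otimes> (T f \<otimes> star A (T f)) = T f \<otimes> star A (T f)"
    and "f \<in> row w j \<Longrightarrow> h \<in> row w j \<Longrightarrow> f \<noteq> h \<Longrightarrow> (T f \<otimes> star A (T f)) \<otimes> (T h \<otimes> star A (T h)) = \<zero>"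
proof -
  have p: "\<And>i. i \<in> row w j \<Longrightarrow> is_projection A (T i \<otimes> star A (T i))"
    by (rule is_projection_range) (rule row_in)
  have s: "is_projection A (\<Oplus>f\<in>row w j. T f \<otimes> star A (T f))"
    unfolding P_sum[OF assms, of j, symmetric] by (rule ck_familyD(1)[OF ck assms])
  note * = projections_orthogonal[OF finite_row'[OF assms] p s]
  show "f \<in> row w j \<Longrightarrow> P w \<otimes> (T f \<otimes> star A (T f)) = T f \<otimes> star A (T f)"
    unfolding P_sum[OF assms, of j] by (rule *(1))
  show "f \<in> row w j \<Longrightarrow> h \<in> row w j \<Longrightarrow> f \<noteq> h \<Longrightarrow> (T f \<otimes> star A (T f)) \<otimes> (T h \<otimes> star A (T h)) = \<zero>"
    by (rule *(2))
qed

lemma P_rng_T: 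
  assumes f: "f \<in> edges \<Lambda>"
  shows "P (rng \<Lambda> f) \<otimes> T f = T f"
proof -
  obtain j where j: "deg \<Lambda> f = axis j 1" using deg_edge[OF f] by blast
  have "P (rng \<Lambda> f) \<otimes> (T f \<otimes> star A (T f)) = T f \<otimes> star A (T f)"
    by (rule row_projections(1)[OF rng_edge[OF f], of _ j]) (use f j in \<open>simp add: row_def\<close>)
  then have "P (rng \<Lambda> f) \<otimes> (T f \<otimes> star A (T f)) \<otimes> T f = T f \<otimes> star A (T f) \<otimes> T f" by simp
  then show ?thesis using T_T_star_T[OF f] f rng_edge[OF f] by (simp add: mult_assoc)
qed

lemma P_T:
  assumes "w \<in> vertices \<Lambda>" "f \<in> edges \<Lambda>"
  shows "P w \<otimes> T f = (if w = rng \<Lambda> f then T f else \<zero>)"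
proof -
  have "P w \<otimes> T f = P w \<otimes> P (rng \<Lambda> f) \<otimes> T f"
    using P_rng_T[OF assms(2)] assms rng_edge[OF assms(2)] by (simp add: mult_assoc)
  then show ?thesis using assms rng_edge[OF assms(2)] by (simp add: P_mult P_rng_T)
qed

lemma T_P:
  assumes "w \<in> vertices \<Lambda>" "f \<in> edges \<Lambda>"
  shows "T f \<otimes> P w = (if w = src \<Lambda> f then T f else \<zero>)"
proof -
  have "T f \<otimes> P w = T f \<otimes> P (src \<Lambda> f) \<otimes> P w" using T_P_src[OF assms(2)] by simp
  also have "\<dots> = T f \<otimes> (P (src \<Lambda> f) \<otimes> P w)" using assms src_edge by (intro mult_assoc) auto
  finally show ?thesis using assms src_edge[OF assms(2)] by (simp add: P_mult T_P_src)
qed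

lemma star_T_P:
  assumes "w \<in> vertices \<Lambda>" "f \<in> edges \<Lambda>"
  shows "star A (T f) \<otimes> P w = (if w = rng \<Lambda> f then star A (T f) else \<zero>)"
  using arg_cong[OF P_T[OF assms], of "star A"] assms by (simp add: star_mult P_star split: if_splits)

text \<open>Distinct edges of one colour with a common range have orthogonal range projections by
  \<open>row_projections\<close>; edges with different ranges are separated by orthogonal vertex
  projections.\<close>

lemma star_T_T_same_deg:
  assumes f: "f \<in> edges \<Lambda>" and h: "h \<in> edges \<Lambda>" and d: "deg \<Lambda> f = deg \<Lambda> h"
  shows "star A (T f) \<otimes> T h = (if f = h then P (src \<Lambda> f) else \<zero>)"
proof (cases "f = h")
  case True
  then show ?thesis using T_star_T f by simp
next
  case False
  have fc: "star A (T f) = star A (T f) \<otimes> (T f \<otimes> star A (T f))"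
    using T_T_star_T[OF f] f by (metis T_closed mult_assoc mult_closed star_closed star_mult star_star)
  have "star A (T f) \<otimes> T h = \<zero>"
  proof (cases "rng \<Lambda> f = rng \<Lambda> h")
    case True
    obtain j where j: "deg \<Lambda> f = axis j 1" using deg_edge[OF f] by blast
    have 0: "(T f \<otimes> star A (T f)) \<otimes> (T h \<otimes> star A (T h)) = \<zero>"
      by (rule row_projections(2)[OF rng_edge[OF f], of _ j]) (use f h j d True False in \<open>simp_all add: row_def\<close>)
    have "star A (T f) \<otimes> T h = star A (T f) \<otimes> (T f \<otimes> star A (T f)) \<otimes> (T h \<otimes> star A (T h) \<otimes> T h)"
      using fc T_T_star_T[OF h] by simp
    also have "\<dots> = star A (T f) \<otimes> ((T f \<otimes> star A (T f)) \<otimes> (T h \<otimes> star A (T h))) \<otimes> T h"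
      using f h by (simp add: mult_assoc)
    also have "\<dots> = \<zero>" unfolding 0 using f h by simp
    finally show ?thesis .
  next
    case ne: False
    have "star A (T f) \<otimes> T h = star A (T f) \<otimes> P (rng \<Lambda> f) \<otimes> T h"
      using star_T_P[OF rng_edge[OF f] f] by simp
    also have "\<dots> = star A (T f) \<otimes> (P (rng \<Lambda> f) \<otimes> T h)" using f h rng_edge[OF f] by (intro mult_assoc) auto
    also have "\<dots> = \<zero>" using P_T[OF rng_edge[OF f] h] ne f by simp
    finally show ?thesis .
  qed
  then show ?thesis using False by simp
qed

end

section \<open>The family of matrices\<close>

locale sink_setup = sink_deletion \<Lambda> v for \<Lambda> :: "('m, 'k::finite) kgraph_data" and v :: 'm +
  fixes i :: 'k
  assumes row_finite: "row_finite \<Lambda>"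
    and sink: "{x \<in> of_degree \<Lambda> (axis i 1). src \<Lambda> x = v} = {}"
begin

definition colour_edges :: "'m \<Rightarrow> 'm set" where
  "colour_edges w = {h \<in> edges \<Lambda>. rng \<Lambda> h = w \<and> deg \<Lambda> h = axis i 1}"

lemma colour_edgesD:
  assumes "h \<in> colour_edges w"
  shows "h \<in> edges \<Lambda>" "h \<in> mor \<Lambda>" "rng \<Lambda> h = w" "deg \<Lambda> h = axis i 1" "src \<Lambda> h \<in> remaining"
proof -
  show h: "h \<in> edges \<Lambda>" "rng \<Lambda> h = w" "deg \<Lambda> h = axis i 1" using assms by (auto simp: colour_edges_def)
  then show hm: "h \<in> mor \<Lambda>" by (simp add: edge_mor)
  have "\<not> reachable_from \<Lambda> v (src \<Lambda> h)" using sink_reaches_sinks[OF sink _ hm h(3)] by blast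
  then show "src \<Lambda> h \<in> remaining" using vertex_ends(2)[OF hm] by (simp add: remaining_def)
qed

lemma finite_edges:
  assumes "w \<in> vertices \<Lambda>"
  shows "finite {f \<in> edges \<Lambda>. rng \<Lambda> f = w \<and> deg \<Lambda> f = axis j 1}"
proof -
  have "{f \<in> edges \<Lambda>. rng \<Lambda> f = w \<and> deg \<Lambda> f = axis j 1} \<subseteq> {x \<in> of_degree \<Lambda> (axis j 1). rng \<Lambda> x = w}"
    by (auto simp: of_degree_def edge_mor)
  then show ?thesis using row_finite assms unfolding row_finite_def by (meson finite_subset)
qed

lemma finite_colour_edges [simp]: "w \<in> vertices \<Lambda> \<Longrightarrow> finite (colour_edges w)"
  unfolding colour_edges_def by (rule finite_edges)

text \<open>The origin of the matrices below: if gh = h'g', then (CK2) gives T_g T_h = T_h' T_g', so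
  T_g compressed by edges of colour i has in column h the single nonzero entry T_g', in row h'. The
  edge g' remains because its range is the source of h', an edge of colour i.\<close>

lemma edge_square:
  assumes g: "g \<in> edges \<Lambda>" and h: "h \<in> colour_edges (src \<Lambda> g)"
  shows "lf g h \<in> colour_edges (rng \<Lambda> g)" "rg g h \<in> edges remaining_graph" "deg \<Lambda> (rg g h) = deg \<Lambda> g"
    "src \<Lambda> (lf g h) = rng \<Lambda> (rg g h)" "cmp \<Lambda> (lf g h) (rg g h) = cmp \<Lambda> g h" "src \<Lambda> (rg g h) = src \<Lambda> h"
proof -
  note H = colour_edgesD[OF h]
  note sq = square[OF edge_mor[OF g] H(2) H(3)[symmetric]]
  show l: "lf g h \<in> colour_edges (rng \<Lambda> g)"
    using sq H(4) by (auto simp: colour_edges_def in_edges)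
  show "deg \<Lambda> (rg g h) = deg \<Lambda> g" "src \<Lambda> (lf g h) = rng \<Lambda> (rg g h)"
    "cmp \<Lambda> (lf g h) (rg g h) = cmp \<Lambda> g h" "src \<Lambda> (rg g h) = src \<Lambda> h" using sq by simp_all
  show "rg g h \<in> edges remaining_graph"
    using sq g colour_edgesD(5)[OF l] by (auto simp: edges_remaining_graph in_edges)
qed

lemma edge_square_involution:
  assumes g: "g \<in> edges \<Lambda>" and h: "h \<in> colour_edges (src \<Lambda> g)"
  shows "lf (lf g h) (rg g h) = g" "rg (lf g h) (rg g h) = h"
  using square_involution[OF edge_mor[OF g] colour_edgesD(2)[OF h]] colour_edgesD(3)[OF h] by simp_all

end

locale matrix_family = sink_setup \<Lambda> v i for \<Lambda> :: "('m, 'k::finite) kgraph_data" and v i +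
  fixes B :: "'b cstar" and Q U :: "'m \<Rightarrow> 'b"
  assumes B: "cstar_algebra B" and ckB: "ck_family remaining_graph B Q U"
begin

sublocale B: ck_representation B remaining_graph Q U
proof (rule ck_representation.intro)
  show "cstar B" using B by (simp add: cstar_def)
  show "ck_representation_axioms B remaining_graph Q U"
  proof
    show "ck_family remaining_graph B Q U" by (rule ckB)
    show "\<exists>j. deg remaining_graph f = axis j 1" if "f \<in> edges remaining_graph" for f
      using that by (auto simp: edges_remaining_graph in_edges)
    show "finite {f \<in> edges remaining_graph. rng remaining_graph f = w \<and> deg remaining_graph f = axis j 1}"
      if "w \<in> vertices remaining_graph" for w j
      by (rule finite_subset[OF _ finite_edges[of w j]])
        (use that remaining_vertex in \<open>auto simp: edges_remaining_graph vertices_remaining_graph\<close>)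
  qed (use hereditary_edge in \<open>auto simp: edges_remaining_graph vertices_remaining_graph\<close>)
qed

abbreviation D :: "(nat \<Rightarrow> (('m option \<Rightarrow> 'b) \<Rightarrow> ('m option \<Rightarrow> 'b)) \<times> (('m option \<Rightarrow> 'b) \<Rightarrow> ('m option \<Rightarrow> 'b))) set cstar"
  where "D \<equiv> B.matrix_alg"

sublocale D: cstar "B.matrix_alg :: (nat \<Rightarrow> (('m option \<Rightarrow> 'b) \<Rightarrow> ('m option \<Rightarrow> 'b)) \<times> (('m option \<Rightarrow> 'b) \<Rightarrow> ('m option \<Rightarrow> 'b))) set cstar"
  by (rule B.cstar_matrix_alg)

text \<open>The \<open>(f, h)\<close> entries of \<open>PD w\<close> and \<open>TD g\<close> are what \<open>T\<^sub>f\<^sup>* P\<^sub>w T\<^sub>h\<close> and \<open>T\<^sub>f\<^sup>* T\<^sub>g T\<^sub>h\<close> evaluate to. The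
  additional index \<open>None\<close> leaves room for a copy of \<open>B\<close>.\<close>

definition PD where
  "PD w = (\<Oplus>\<^bsub>D\<^esub>h\<in>colour_edges w. B.\<theta> (Some h) (Some h) (Q (src \<Lambda> h)))"

definition TD where
  "TD g = (\<Oplus>\<^bsub>D\<^esub>h\<in>colour_edges (src \<Lambda> g). B.\<theta> (Some (lf g h)) (Some h) (U (rg g h)))"

lemma Q_closed [simp, intro]: "w \<in> remaining \<Longrightarrow> Q w \<in> carrier B"
  using B.P_closed by (simp add: vertices_remaining_graph)

lemma U_closed [simp, intro]: "f \<in> edges remaining_graph \<Longrightarrow> U f \<in> carrier B"
  by (rule B.T_closed)

lemma PD_closed: "PD w \<in> carrier D"
  unfolding PD_def using colour_edgesD(5) by (intro D.finsum_closed) auto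

lemma TD_term_closed: "g \<in> edges \<Lambda> \<Longrightarrow> h \<in> colour_edges (src \<Lambda> g) \<Longrightarrow>
    B.\<theta> (Some (lf g h)) (Some h) (U (rg g h)) \<in> carrier D"
  using edge_square(2) by blast

lemma TD_closed: "g \<in> edges \<Lambda> \<Longrightarrow> TD g \<in> carrier D"
  unfolding TD_def using TD_term_closed by (intro D.finsum_closed) auto

lemma TD_star:
  assumes g: "g \<in> edges \<Lambda>"
  shows "star D (TD g) = (\<Oplus>\<^bsub>D\<^esub>h\<in>colour_edges (src \<Lambda> g). B.\<theta> (Some h) (Some (lf g h)) (star B (U (rg g h))))"
proof -
  have "star D (TD g) = (\<Oplus>\<^bsub>D\<^esub>h\<in>colour_edges (src \<Lambda> g). star D (B.\<theta> (Some (lf g h)) (Some h) (U (rg g h))))"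
    unfolding TD_def by (rule D.finsum_star[OF TD_term_closed[OF g]])
  also have "\<dots> = (\<Oplus>\<^bsub>D\<^esub>h\<in>colour_edges (src \<Lambda> g). B.\<theta> (Some h) (Some (lf g h)) (star B (U (rg g h))))"
    using edge_square(2)[OF g] by (intro D.finsum_cong') (auto simp: B.\<theta>_star)
  finally show ?thesis .
qed

lemma src_in: "g \<in> edges \<Lambda> \<Longrightarrow> src \<Lambda> g \<in> vertices \<Lambda>" and rng_in: "g \<in> edges \<Lambda> \<Longrightarrow> rng \<Lambda> g \<in> vertices \<Lambda>"
  using vertex_ends edge_mor by blast+

lemma PD_mult:
  assumes w: "w \<in> vertices \<Lambda>" and u: "u \<in> vertices \<Lambda>"
  shows "PD w \<otimes>\<^bsub>D\<^esub> PD u = (if w = u then PD w else \<zero>\<^bsub>D\<^esub>)"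
proof (cases "w = u")
  case True
  have "PD w \<otimes>\<^bsub>D\<^esub> PD w = (\<Oplus>\<^bsub>D\<^esub>h\<in>colour_edges w. B.\<theta> (Some h) (Some h) (Q (src \<Lambda> h)) \<otimes>\<^bsub>D\<^esub> B.\<theta> (Some h) (Some h) (Q (src \<Lambda> h)))"
    unfolding PD_def
    by (rule D.finsum_mult_match_left) (use w colour_edgesD(5) in \<open>auto simp: B.\<theta>_mult\<close>)
  also have "\<dots> = PD w"
    unfolding PD_def
    by (intro D.finsum_cong') (use colour_edgesD(5) B.P_idem in \<open>auto simp: B.\<theta>_mult vertices_remaining_graph\<close>)
  finally show ?thesis using True by simp
next
  case False
  have "PD w \<otimes>\<^bsub>D\<^esub> PD u = (\<Oplus>\<^bsub>D\<^esub>h\<in>colour_edges w. B.\<theta> (Some h) (Some h) (Q (src \<Lambda> h)) \<otimes>\<^bsub>D\<^esub> PD u)"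
    unfolding PD_def[of w] using colour_edgesD(5) PD_closed by (intro D.finsum_mult_right) auto
  also have "\<dots> = (\<Oplus>\<^bsub>D\<^esub>h\<in>colour_edges w. \<zero>\<^bsub>D\<^esub>)"
  proof (rule D.finsum_cong'[OF refl])
    fix h assume h: "h \<in> colour_edges w"
    have "B.\<theta> (Some h) (Some h) (Q (src \<Lambda> h)) \<otimes>\<^bsub>D\<^esub> PD u = (\<Oplus>\<^bsub>D\<^esub>h'\<in>colour_edges u. B.\<theta> (Some h) (Some h) (Q (src \<Lambda> h)) \<otimes>\<^bsub>D\<^esub> B.\<theta> (Some h') (Some h') (Q (src \<Lambda> h')))"
      unfolding PD_def using colour_edgesD(5) h by (intro D.finsum_mult_left) auto
    also have "\<dots> = (\<Oplus>\<^bsub>D\<^esub>h'\<in>colour_edges u. \<zero>\<^bsub>D\<^esub>)"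
    proof (rule D.finsum_cong'[OF refl])
      fix h' assume h': "h' \<in> colour_edges u"
      have "h \<noteq> h'" using colour_edgesD(3)[OF h] colour_edgesD(3)[OF h'] False by auto
      then show "B.\<theta> (Some h) (Some h) (Q (src \<Lambda> h)) \<otimes>\<^bsub>D\<^esub> B.\<theta> (Some h') (Some h') (Q (src \<Lambda> h')) = \<zero>\<^bsub>D\<^esub>"
        using colour_edgesD(5)[OF h] colour_edgesD(5)[OF h'] by (simp add: B.\<theta>_mult)
    qed auto
    finally show "B.\<theta> (Some h) (Some h) (Q (src \<Lambda> h)) \<otimes>\<^bsub>D\<^esub> PD u = \<zero>\<^bsub>D\<^esub>" by (simp add: D.finsum_zero)
  qed auto
  finally show ?thesis using False by (simp add: D.finsum_zero)
qed

lemma PD_projection: "w \<in> vertices \<Lambda> \<Longrightarrow> is_projection D (PD w)"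
proof -
  assume w: "w \<in> vertices \<Lambda>"
  have "star D (PD w) = (\<Oplus>\<^bsub>D\<^esub>h\<in>colour_edges w. star D (B.\<theta> (Some h) (Some h) (Q (src \<Lambda> h))))"
    unfolding PD_def using colour_edgesD(5) by (intro D.finsum_star) auto
  also have "\<dots> = PD w"
    unfolding PD_def
    by (intro D.finsum_cong') (use colour_edgesD(5) B.P_star in \<open>auto simp: B.\<theta>_star vertices_remaining_graph\<close>)
  finally show ?thesis using PD_mult[OF w w] PD_closed by (simp add: is_projection_def)
qed

lemma TD_star_TD:
  assumes g: "g \<in> edges \<Lambda>"
  shows "star D (TD g) \<otimes>\<^bsub>D\<^esub> TD g = PD (src \<Lambda> g)"
proof -
  let ?E = "colour_edges (src \<Lambda> g)"
  have "star D (TD g) \<otimes>\<^bsub>D\<^esub> TD g = (\<Oplus>\<^bsub>D\<^esub>h\<in>?E. B.\<theta> (Some h) (Some (lf g h)) (star B (U (rg g h))) \<otimes>\<^bsub>D\<^esub> B.\<theta> (Some (lf g h)) (Some h) (U (rg g h)))"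
    unfolding TD_star[OF g] unfolding TD_def
  proof (rule D.finsum_mult_match_left)
    fix h h' assume h: "h \<in> ?E" and h': "h' \<in> ?E" "h' \<noteq> h"
    note E = edge_square[OF g h] edge_square[OF g h'(1)]
    show "B.\<theta> (Some h) (Some (lf g h)) (star B (U (rg g h))) \<otimes>\<^bsub>D\<^esub> B.\<theta> (Some (lf g h')) (Some h') (U (rg g h')) = \<zero>\<^bsub>D\<^esub>"
    proof (cases "lf g h = lf g h'")
      \<comment> \<open>If the rows coincide, the involution forces the edges \<open>rg g h\<close>
        and \<open>rg g h'\<close> to be distinct. Both have the degree of g, so their product in
        \<open>B\<close> vanishes.\<close>
      case True
      then have "rg g h \<noteq> rg g h'"
        using edge_square_involution(2)[OF g h] edge_square_involution(2)[OF g h'(1)] h'(2) by metis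
      then have "star B (U (rg g h)) \<otimes>\<^bsub>B\<^esub> U (rg g h') = \<zero>\<^bsub>B\<^esub>"
        using B.star_T_T_same_deg[OF E(2) E(8)] E(3,9) by simp
      then show ?thesis using E(2,8) by (simp add: B.\<theta>_mult B.\<theta>_zero)
    qed (use E(2,8) in \<open>simp add: B.\<theta>_mult\<close>)
  qed (use g src_in edge_square(2)[OF g] in auto)
  also have "\<dots> = PD (src \<Lambda> g)"
    unfolding PD_def
  proof (rule D.finsum_cong'[OF refl])
    fix h assume h: "h \<in> ?E"
    note E = edge_square[OF g h]
    show "B.\<theta> (Some h) (Some (lf g h)) (star B (U (rg g h))) \<otimes>\<^bsub>D\<^esub> B.\<theta> (Some (lf g h)) (Some h) (U (rg g h)) = B.\<theta> (Some h) (Some h) (Q (src \<Lambda> h))"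
      using E(2,6) B.T_star_T[OF E(2)] by (simp add: B.\<theta>_mult)
  qed (use colour_edgesD(5) in auto)
  finally show ?thesis .
qed

lemma TD_PD:
  assumes g: "g \<in> edges \<Lambda>"
  shows "TD g \<otimes>\<^bsub>D\<^esub> PD (src \<Lambda> g) = TD g"
proof -
  let ?E = "colour_edges (src \<Lambda> g)"
  have "TD g \<otimes>\<^bsub>D\<^esub> PD (src \<Lambda> g) = (\<Oplus>\<^bsub>D\<^esub>h\<in>?E. B.\<theta> (Some (lf g h)) (Some h) (U (rg g h)) \<otimes>\<^bsub>D\<^esub> B.\<theta> (Some h) (Some h) (Q (src \<Lambda> h)))"
    unfolding TD_def PD_def
    by (rule D.finsum_mult_match_left)
      (use g src_in edge_square(2)[OF g] colour_edgesD(5) in \<open>auto simp: B.\<theta>_mult\<close>)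
  also have "\<dots> = TD g"
    unfolding TD_def
  proof (rule D.finsum_cong'[OF refl])
    fix h assume h: "h \<in> ?E"
    note E = edge_square[OF g h]
    show "B.\<theta> (Some (lf g h)) (Some h) (U (rg g h)) \<otimes>\<^bsub>D\<^esub> B.\<theta> (Some h) (Some h) (Q (src \<Lambda> h)) = B.\<theta> (Some (lf g h)) (Some h) (U (rg g h))"
      using E(2,6) B.T_P_src[OF E(2)] colour_edgesD(5)[OF h] by (simp add: B.\<theta>_mult)
  qed (use TD_term_closed[OF g] in auto)
  finally show ?thesis .
qed

lemma TD_mult:
  assumes a: "a \<in> edges \<Lambda>" and f: "f \<in> edges \<Lambda>" and c: "src \<Lambda> a = rng \<Lambda> f"
  shows "TD a \<otimes>\<^bsub>D\<^esub> TD f = (\<Oplus>\<^bsub>D\<^esub>h\<in>colour_edges (src \<Lambda> f).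
    B.\<theta> (Some (lf a (lf f h))) (Some h) (U (rg a (lf f h)) \<otimes>\<^bsub>B\<^esub> U (rg f h)))"
proof -
  let ?E = "colour_edges (src \<Lambda> f)"
  have l: "lf f h \<in> colour_edges (src \<Lambda> a)" if "h \<in> ?E" for h
    using edge_square(1)[OF f that] c by simp
  have "TD a \<otimes>\<^bsub>D\<^esub> TD f = (\<Oplus>\<^bsub>D\<^esub>h\<in>?E. B.\<theta> (Some (lf a (lf f h))) (Some (lf f h)) (U (rg a (lf f h))) \<otimes>\<^bsub>D\<^esub> B.\<theta> (Some (lf f h)) (Some h) (U (rg f h)))"
    unfolding TD_def
  proof (rule D.finsum_mult_match_right[where m = "lf f"])
    show "B.\<theta> (Some (lf a k)) (Some k) (U (rg a k)) \<otimes>\<^bsub>D\<^esub> B.\<theta> (Some (lf f h)) (Some h) (U (rg f h)) = \<zero>\<^bsub>D\<^esub>"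
      if "k \<in> colour_edges (src \<Lambda> a)" "h \<in> ?E" "k \<noteq> lf f h" for k h
      using edge_square(2)[OF a that(1)] edge_square(2)[OF f that(2)] that(3) by (simp add: B.\<theta>_mult)
  qed (use a f l src_in TD_term_closed in auto)
  also have "\<dots> = (\<Oplus>\<^bsub>D\<^esub>h\<in>?E. B.\<theta> (Some (lf a (lf f h))) (Some h) (U (rg a (lf f h)) \<otimes>\<^bsub>B\<^esub> U (rg f h)))"
    using edge_square(2)[OF a l] edge_square(2)[OF f] by (intro D.finsum_cong') (auto simp: B.\<theta>_mult)
  finally show ?thesis .
qed

text \<open>In column h both products are read off from the same morphism afh = gbh, factored as an
  edge of colour i times a morphism of the degree of af. Unique factorization identifies the rows
  and the remaining products of two edges, and (CK2) in \<open>B\<close> identifies the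
  entries.\<close>

lemma TD_commute:
  assumes e: "a \<in> edges \<Lambda>" "b \<in> edges \<Lambda>" "f \<in> edges \<Lambda>" "g \<in> edges \<Lambda>"
    and c: "src \<Lambda> a = rng \<Lambda> f" "src \<Lambda> g = rng \<Lambda> b" "cmp \<Lambda> a f = cmp \<Lambda> g b"
  shows "TD a \<otimes>\<^bsub>D\<^esub> TD f = TD g \<otimes>\<^bsub>D\<^esub> TD b"
proof -
  note m = e[THEN edge_mor]
  have s: "src \<Lambda> b = src \<Lambda> f" using src_cmp[OF m(1,3) c(1)] src_cmp[OF m(4,2) c(2)] c(3) by simp
  have key: "lf a (lf f h) = lf g (lf b h) \<and> U (rg a (lf f h)) \<otimes>\<^bsub>B\<^esub> U (rg f h) = U (rg g (lf b h)) \<otimes>\<^bsub>B\<^esub> U (rg b h)"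
    if h: "h \<in> colour_edges (src \<Lambda> f)" for h
  proof -
    have hb: "h \<in> colour_edges (src \<Lambda> b)" using h s by simp
    note H = colour_edgesD[OF h]
    note F = edge_square[OF e(3) h] and G = edge_square[OF e(2) hb]
    have lf1: "lf f h \<in> colour_edges (src \<Lambda> a)" using F(1) c(1) by simp
    have lb1: "lf b h \<in> colour_edges (src \<Lambda> g)" using G(1) c(2) by simp
    note F2 = edge_square[OF e(1) lf1] and G2 = edge_square[OF e(4) lb1]
    have mm: "lf f h \<in> mor \<Lambda>" "lf b h \<in> mor \<Lambda>" "lf a (lf f h) \<in> mor \<Lambda>" "lf g (lf b h) \<in> mor \<Lambda>"
      using colour_edgesD(2) F(1) G(1) F2(1) G2(1) by blast+
    have rm: "rg f h \<in> mor \<Lambda>" "rg b h \<in> mor \<Lambda>" "rg a (lf f h) \<in> mor \<Lambda>" "rg g (lf b h) \<in> mor \<Lambda>"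
      using F(2) G(2) F2(2) G2(2) edge_mor by (auto simp: edges_remaining_graph)
    have c1: "src \<Lambda> (rg a (lf f h)) = rng \<Lambda> (rg f h)" using F2(6) F(4) by simp
    have c2: "src \<Lambda> (rg g (lf b h)) = rng \<Lambda> (rg b h)" using G2(6) G(4) by simp
    have x1: "cmp \<Lambda> (lf a (lf f h)) (cmp \<Lambda> (rg a (lf f h)) (rg f h)) = cmp \<Lambda> (cmp \<Lambda> a f) h"
    proof -
      have "cmp \<Lambda> (lf a (lf f h)) (cmp \<Lambda> (rg a (lf f h)) (rg f h)) = cmp \<Lambda> (cmp \<Lambda> a (lf f h)) (rg f h)"
        using cmp_assoc[OF mm(3) rm(3) rm(1) F2(4) c1] F2(5) by simp
      also have "\<dots> = cmp \<Lambda> a (cmp \<Lambda> f h)"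
        using cmp_assoc[OF m(1) mm(1) rm(1) _ F(4)] colour_edgesD(3)[OF lf1] F(5) by simp
      also have "\<dots> = cmp \<Lambda> (cmp \<Lambda> a f) h" using cmp_assoc[OF m(1,3) H(2) c(1)] H(3) by simp
      finally show ?thesis .
    qed
    have x2: "cmp \<Lambda> (lf g (lf b h)) (cmp \<Lambda> (rg g (lf b h)) (rg b h)) = cmp \<Lambda> (cmp \<Lambda> g b) h"
    proof -
      have "cmp \<Lambda> (lf g (lf b h)) (cmp \<Lambda> (rg g (lf b h)) (rg b h)) = cmp \<Lambda> (cmp \<Lambda> g (lf b h)) (rg b h)"
        using cmp_assoc[OF mm(4) rm(4) rm(2) G2(4) c2] G2(5) by simp
      also have "\<dots> = cmp \<Lambda> g (cmp \<Lambda> b h)"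
        using cmp_assoc[OF m(4) mm(2) rm(2) _ G(4)] colour_edgesD(3)[OF lb1] G(5) by simp
      also have "\<dots> = cmp \<Lambda> (cmp \<Lambda> g b) h" using cmp_assoc[OF m(4,2) H(2) c(2)] H(3) s by simp
      finally show ?thesis .
    qed
    have d: "deg \<Lambda> (cmp \<Lambda> (rg a (lf f h)) (rg f h)) = deg \<Lambda> (cmp \<Lambda> (rg g (lf b h)) (rg b h))"
      using deg_cmp[OF rm(3,1) c1] deg_cmp[OF rm(4,2) c2] F(3) G(3) F2(3) G2(3)
        deg_cmp[OF m(1,3) c(1)] deg_cmp[OF m(4,2) c(2)] c(3) by simp
    have dl: "deg \<Lambda> (lf a (lf f h)) = deg \<Lambda> (lf g (lf b h))"
      using colour_edgesD(4)[OF F2(1)] colour_edgesD(4)[OF G2(1)] by simp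
    have r1: "src \<Lambda> (lf a (lf f h)) = rng \<Lambda> (cmp \<Lambda> (rg a (lf f h)) (rg f h))"
      using rng_cmp[OF rm(3,1) c1] F2(4) by simp
    have r2: "src \<Lambda> (lf g (lf b h)) = rng \<Lambda> (cmp \<Lambda> (rg g (lf b h)) (rg b h))"
      using rng_cmp[OF rm(4,2) c2] G2(4) by simp
    have "cmp \<Lambda> (lf a (lf f h)) (cmp \<Lambda> (rg a (lf f h)) (rg f h)) = cmp \<Lambda> (lf g (lf b h)) (cmp \<Lambda> (rg g (lf b h)) (rg b h))"
      unfolding x1 x2 c(3) ..
    note u = factorization_unique[OF mm(3) cmp_mor[OF rm(3,1) c1] r1 mm(4) cmp_mor[OF rm(4,2) c2] r2 dl d this]
    have "U (rg a (lf f h)) \<otimes>\<^bsub>B\<^esub> U (rg f h) = U (rg g (lf b h)) \<otimes>\<^bsub>B\<^esub> U (rg b h)"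
      by (rule ck_familyD(4)[OF ckB F2(2) G(2) F(2) G2(2)]) (use c1 c2 u(2) in simp_all)
    then show ?thesis using u(1) by simp
  qed
  show ?thesis
    unfolding TD_mult[OF e(1,3) c(1)] TD_mult[OF e(4,2) c(2)] s
  proof (rule D.finsum_cong'[OF refl])
    fix h assume h: "h \<in> colour_edges (src \<Lambda> f)"
    then have hb: "h \<in> colour_edges (src \<Lambda> b)" using s by simp
    show "B.\<theta> (Some (lf a (lf f h))) (Some h) (U (rg a (lf f h)) \<otimes>\<^bsub>B\<^esub> U (rg f h)) = B.\<theta> (Some (lf g (lf b h))) (Some h) (U (rg g (lf b h)) \<otimes>\<^bsub>B\<^esub> U (rg b h))"
      using key[OF h] by simp
  next
    have "U (rg g (lf b h)) \<otimes>\<^bsub>B\<^esub> U (rg b h) \<in> carrier B" if h: "h \<in> colour_edges (src \<Lambda> f)" for h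
    proof -
      have hb: "h \<in> colour_edges (src \<Lambda> b)" using h s by simp
      have "lf b h \<in> colour_edges (src \<Lambda> g)" using edge_square(1)[OF e(2) hb] c(2) by simp
      from edge_square(2)[OF e(4) this] edge_square(2)[OF e(2) hb] show ?thesis by auto
    qed
    then show "(\<lambda>h. B.\<theta> (Some (lf g (lf b h))) (Some h) (U (rg g (lf b h)) \<otimes>\<^bsub>B\<^esub> U (rg b h))) \<in> colour_edges (src \<Lambda> f) \<rightarrow> carrier D"
      by auto
  qed
qed

lemma TD_TD_star:
  assumes g: "g \<in> edges \<Lambda>"
  shows "TD g \<otimes>\<^bsub>D\<^esub> star D (TD g) = (\<Oplus>\<^bsub>D\<^esub>h\<in>colour_edges (src \<Lambda> g).
    B.\<theta> (Some (lf g h)) (Some (lf g h)) (U (rg g h) \<otimes>\<^bsub>B\<^esub> star B (U (rg g h))))"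
proof -
  let ?E = "colour_edges (src \<Lambda> g)"
  have "TD g \<otimes>\<^bsub>D\<^esub> star D (TD g) = (\<Oplus>\<^bsub>D\<^esub>h\<in>?E. B.\<theta> (Some (lf g h)) (Some h) (U (rg g h)) \<otimes>\<^bsub>D\<^esub> B.\<theta> (Some h) (Some (lf g h)) (star B (U (rg g h))))"
    unfolding TD_star[OF g] unfolding TD_def
  proof (rule D.finsum_mult_match_left)
    show "B.\<theta> (Some (lf g h)) (Some h) (U (rg g h)) \<otimes>\<^bsub>D\<^esub> B.\<theta> (Some h') (Some (lf g h')) (star B (U (rg g h'))) = \<zero>\<^bsub>D\<^esub>"
      if "h \<in> ?E" "h' \<in> ?E" "h' \<noteq> h" for h h'
      using edge_square(2)[OF g that(1)] edge_square(2)[OF g that(2)] that(3) by (simp add: B.\<theta>_mult)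
  qed (use g src_in edge_square(2)[OF g] in auto)
  also have "\<dots> = (\<Oplus>\<^bsub>D\<^esub>h\<in>?E. B.\<theta> (Some (lf g h)) (Some (lf g h)) (U (rg g h) \<otimes>\<^bsub>B\<^esub> star B (U (rg g h))))"
    using edge_square(2)[OF g] by (intro D.finsum_cong') (auto simp: B.\<theta>_mult)
  finally show ?thesis .
qed

text \<open>The exchange of factors is an involution on composable pairs, so the same formula serves
  as its own inverse.\<close>

lemma square_bij:
  fixes j :: 'k
  assumes w: "w \<in> vertices \<Lambda>"
  defines "E \<equiv> {g \<in> edges \<Lambda>. rng \<Lambda> g = w \<and> deg \<Lambda> g = axis j 1}"
  shows "bij_betw (\<lambda>p. (lf (fst p) (snd p), rg (fst p) (snd p)))
    (Sigma E (\<lambda>g. colour_edges (src \<Lambda> g))) (Sigma (colour_edges w) (\<lambda>f. B.row (src \<Lambda> f) j))"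
proof (rule bij_betw_byWitness[where f' = "\<lambda>p. (lf (fst p) (snd p), rg (fst p) (snd p))"])
  show "\<forall>a\<in>Sigma E (\<lambda>g. colour_edges (src \<Lambda> g)).
      (lf (fst (lf (fst a) (snd a), rg (fst a) (snd a))) (snd (lf (fst a) (snd a), rg (fst a) (snd a))),
       rg (fst (lf (fst a) (snd a), rg (fst a) (snd a))) (snd (lf (fst a) (snd a), rg (fst a) (snd a)))) = a"
    using edge_square_involution by (auto simp: E_def)
  show "(\<lambda>p. (lf (fst p) (snd p), rg (fst p) (snd p))) ` Sigma E (\<lambda>g. colour_edges (src \<Lambda> g))
      \<subseteq> Sigma (colour_edges w) (\<lambda>f. B.row (src \<Lambda> f) j)"
    using edge_square(1-4) by (auto simp: E_def B.row_def)
  have bk: "f \<in> mor \<Lambda>" "g \<in> mor \<Lambda>" "src \<Lambda> f = rng \<Lambda> g" "g \<in> edges \<Lambda>" "deg \<Lambda> g = axis j 1"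
    if "f \<in> colour_edges w" "g \<in> B.row (src \<Lambda> f) j" for f g
    using that colour_edgesD(2)[OF that(1)] B.row_in[OF that(2)] edge_mor by (auto simp: edges_remaining_graph)
  show "\<forall>a\<in>Sigma (colour_edges w) (\<lambda>f. B.row (src \<Lambda> f) j).
      (lf (fst (lf (fst a) (snd a), rg (fst a) (snd a))) (snd (lf (fst a) (snd a), rg (fst a) (snd a))),
       rg (fst (lf (fst a) (snd a), rg (fst a) (snd a))) (snd (lf (fst a) (snd a), rg (fst a) (snd a)))) = a"
    using square_involution[OF bk(1-3)] by auto
  show "(\<lambda>p. (lf (fst p) (snd p), rg (fst p) (snd p))) ` Sigma (colour_edges w) (\<lambda>f. B.row (src \<Lambda> f) j)
      \<subseteq> Sigma E (\<lambda>g. colour_edges (src \<Lambda> g))"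
  proof (clarsimp, intro conjI)
    fix f g assume fg: "f \<in> colour_edges w" "g \<in> B.row (src \<Lambda> f) j"
    note b = bk[OF fg] and H = colour_edgesD[OF fg(1)]
    note sq = square[OF b(1-3)]
    show "lf f g \<in> E" using sq(1,3,7) b(5) H(3) by (auto simp: E_def in_edges)
    show "rg f g \<in> colour_edges (src \<Lambda> (lf f g))" using sq(2,4,5) H(4) by (auto simp: colour_edges_def in_edges)
  qed
qed

text \<open>Each diagonal entry \<open>Q (src \<Lambda> f)\<close> is expanded by (CK4) in
  \<open>B\<close> for the colour j. The resulting pairs (f, g') are regrouped through
  \<open>square_bij\<close>: with fg' = gh they are indexed by g and h, and summing over h gives the
  term of g.\<close>

lemma PD_sum:
  assumes w: "w \<in> vertices \<Lambda>"
  shows "PD w = (\<Oplus>\<^bsub>D\<^esub>g\<in>{g \<in> edges \<Lambda>. rng \<Lambda> g = w \<and> deg \<Lambda> g = axis j 1}. TD g \<otimes>\<^bsub>D\<^esub> star D (TD g))"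
proof -
  let ?E = "{g \<in> edges \<Lambda>. rng \<Lambda> g = w \<and> deg \<Lambda> g = axis j 1}"
  let ?\<tau> = "\<lambda>f g. B.\<theta> (Some f) (Some f) (U g \<otimes>\<^bsub>B\<^esub> star B (U g)) :: (nat \<Rightarrow> (('m option \<Rightarrow> 'b) \<Rightarrow> ('m option \<Rightarrow> 'b)) \<times> (('m option \<Rightarrow> 'b) \<Rightarrow> ('m option \<Rightarrow> 'b))) set"
  let ?sq = "\<lambda>p. (lf (fst p) (snd p), rg (fst p) (snd p))"
  let ?S1 = "Sigma ?E (\<lambda>g. colour_edges (src \<Lambda> g))" and ?S2 = "Sigma (colour_edges w) (\<lambda>f. B.row (src \<Lambda> f) j)"
  have rv: "src \<Lambda> f \<in> vertices remaining_graph" if "f \<in> colour_edges w" for f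
    using colour_edgesD(5)[OF that] by (simp add: vertices_remaining_graph)
  have \<tau>c: "?\<tau> f g \<in> carrier D" if "g \<in> edges remaining_graph" for f g using that by auto
  have "PD w = (\<Oplus>\<^bsub>D\<^esub>f\<in>colour_edges w. \<Oplus>\<^bsub>D\<^esub>g\<in>B.row (src \<Lambda> f) j. ?\<tau> f g)"
    unfolding PD_def
  proof (rule D.finsum_cong'[OF refl])
    fix f assume f: "f \<in> colour_edges w"
    have "B.\<theta> (Some f) (Some f) (Q (src \<Lambda> f)) = B.\<theta> (Some f) (Some f) (\<Oplus>\<^bsub>B\<^esub>g\<in>B.row (src \<Lambda> f) j. U g \<otimes>\<^bsub>B\<^esub> star B (U g))"
      using B.P_sum[OF rv[OF f], of j] by simp
    also have "\<dots> = (\<Oplus>\<^bsub>D\<^esub>g\<in>B.row (src \<Lambda> f) j. ?\<tau> f g)"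
      by (rule additive_finsum[OF B.abelian_group_axioms D.abelian_group_axioms])
        (use B.row_in(1) in \<open>auto simp: B.\<theta>_zero B.\<theta>_add\<close>)
    finally show "B.\<theta> (Some f) (Some f) (Q (src \<Lambda> f)) = (\<Oplus>\<^bsub>D\<^esub>g\<in>B.row (src \<Lambda> f) j. ?\<tau> f g)" .
  qed (use \<tau>c B.row_in(1) in \<open>auto intro!: D.finsum_closed\<close>)
  also have "\<dots> = (\<Oplus>\<^bsub>D\<^esub>p\<in>?S2. ?\<tau> (fst p) (snd p))"
    by (rule D.finsum_Sigma) (use w rv \<tau>c B.row_in(1) in auto)
  also have "?S2 = ?sq ` ?S1" using square_bij[OF w, of j] by (simp add: bij_betw_def)
  also have "(\<Oplus>\<^bsub>D\<^esub>p\<in>?sq ` ?S1. ?\<tau> (fst p) (snd p)) = (\<Oplus>\<^bsub>D\<^esub>p\<in>?S1. ?\<tau> (fst (?sq p)) (snd (?sq p)))"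
  proof (rule D.finsum_reindex)
    show "inj_on ?sq ?S1" using square_bij[OF w, of j] by (simp add: bij_betw_def)
    show "(\<lambda>p. ?\<tau> (fst p) (snd p)) \<in> ?sq ` ?S1 \<rightarrow> carrier D"
      using edge_square(2) \<tau>c by auto
  qed
  also have "\<dots> = (\<Oplus>\<^bsub>D\<^esub>g\<in>?E. \<Oplus>\<^bsub>D\<^esub>h\<in>colour_edges (src \<Lambda> g). ?\<tau> (lf g h) (rg g h))"
    unfolding fst_conv snd_conv
    by (rule D.finsum_Sigma[symmetric]) (use finite_edges[OF w] src_in edge_square(2) \<tau>c in auto)
  also have "\<dots> = (\<Oplus>\<^bsub>D\<^esub>g\<in>?E. TD g \<otimes>\<^bsub>D\<^esub> star D (TD g))"
    by (rule D.finsum_cong'[OF refl]) (use TD_TD_star TD_closed in auto)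
  finally show ?thesis .
qed

lemma ck_family_matrices: "ck_family \<Lambda> D PD TD"
proof (rule ck_familyI)
  show "is_partial_isometry D (TD f)" if "f \<in> edges \<Lambda>" for f
    using TD_closed[OF that] TD_star_TD[OF that] TD_PD[OF that] by (simp add: is_partial_isometry_def D.mult_assoc)
  show "PD w \<otimes>\<^bsub>D\<^esub> PD u = \<zero>\<^bsub>D\<^esub>" if "w \<in> vertices \<Lambda>" "u \<in> vertices \<Lambda>" "w \<noteq> u" for w u
    using PD_mult[OF that(1,2)] that(3) by simp
qed (rule PD_projection TD_commute TD_star_TD PD_sum; assumption)+

end

section \<open>Approximate units\<close>

context cstar
begin

lemma cnorm_projection_le_1:
  assumes "is_projection A p"
  shows "cnorm A p \<le> 1"
proof -
  have p: "p \<in> carrier A" "star A p = p" "p \<otimes> p = p" using assms by (auto simp: is_projection_def)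
  have "cnorm A p * cnorm A p = cnorm A p"
    using cnorm_selfadjoint_square[OF p(1,2)] p(3) by (simp add: power2_eq_square)
  then show ?thesis by auto
qed

end

context ck_representation
begin

definition vertex_sum :: "'m set \<Rightarrow> 'a" where
  "vertex_sum F = (\<Oplus>w\<in>F. P w)"

lemma vertex_sum_closed [simp, intro]: "F \<subseteq> vertices \<Lambda> \<Longrightarrow> vertex_sum F \<in> carrier A"
  unfolding vertex_sum_def by (intro finsum_closed) auto

lemma vertex_sum_P:
  assumes "finite F" "F \<subseteq> vertices \<Lambda>" "w \<in> vertices \<Lambda>"
  shows "vertex_sum F \<otimes> P w = (if w \<in> F then P w else \<zero>)"
proof -
  have "vertex_sum F \<otimes> P w = (\<Oplus>u\<in>F. P u \<otimes> P w)"
    unfolding vertex_sum_def using assms by (intro finsum_mult_right) auto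
  also have "\<dots> = (if w \<in> F then P w else \<zero>)"
  proof (cases "w \<in> F")
    case True
    have "(\<Oplus>u\<in>F. P u \<otimes> P w) = P w \<otimes> P w"
      by (rule finsum_single) (use assms True in \<open>auto simp: P_mult\<close>)
    then show ?thesis using True assms by (simp add: P_idem)
  next
    case False
    have "(\<Oplus>u\<in>F. P u \<otimes> P w) = (\<Oplus>u\<in>F. \<zero>)"
      by (rule finsum_cong'[OF refl]) (use assms False in \<open>auto simp: P_mult\<close>)
    then show ?thesis using False by (simp add: finsum_zero)
  qed
  finally show ?thesis .
qed

lemma star_vertex_sum: "F \<subseteq> vertices \<Lambda> \<Longrightarrow> star A (vertex_sum F) = vertex_sum F"
proof -
  assume F: "F \<subseteq> vertices \<Lambda>"
  have "star A (vertex_sum F) = (\<Oplus>w\<in>F. star A (P w))"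
    unfolding vertex_sum_def by (rule finsum_star) (use F in auto)
  also have "\<dots> = vertex_sum F"
    unfolding vertex_sum_def by (rule finsum_cong'[OF refl]) (use F P_star in auto)
  finally show ?thesis .
qed

lemma P_vertex_sum:
  assumes "finite F" "F \<subseteq> vertices \<Lambda>" "w \<in> vertices \<Lambda>"
  shows "P w \<otimes> vertex_sum F = (if w \<in> F then P w else \<zero>)"
  using arg_cong[OF vertex_sum_P[OF assms], of "star A"] assms
  by (simp add: star_mult P_star star_vertex_sum split: if_splits)

lemma vertex_sum_mult:
  assumes "finite F" "F \<subseteq> vertices \<Lambda>" "finite H" "H \<subseteq> vertices \<Lambda>"
  shows "vertex_sum F \<otimes> vertex_sum H = vertex_sum (F \<inter> H)"
proof -
  have "vertex_sum F \<otimes> vertex_sum H = (\<Oplus>w\<in>F. P w \<otimes> vertex_sum H)"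
    unfolding vertex_sum_def[of F] using assms by (intro finsum_mult_right) auto
  also have "\<dots> = (\<Oplus>w\<in>F. if w \<in> H then P w else \<zero>)"
    by (rule finsum_cong'[OF refl]) (use assms P_vertex_sum in auto)
  also have "\<dots> = vertex_sum (F \<inter> H)"
    unfolding vertex_sum_def
    by (intro add.finprod_mono_neutral_cong_right) (use assms in auto)
  finally show ?thesis .
qed

lemma is_projection_vertex_sum: "finite F \<Longrightarrow> F \<subseteq> vertices \<Lambda> \<Longrightarrow> is_projection A (vertex_sum F)"
  by (simp add: is_projection_def star_vertex_sum vertex_sum_mult)

lemma T_vertex_sum:
  assumes "finite F" "F \<subseteq> vertices \<Lambda>" "f \<in> edges \<Lambda>"
  shows "T f \<otimes> vertex_sum F = (if src \<Lambda> f \<in> F then T f else \<zero>)"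
proof -
  have "T f \<otimes> vertex_sum F = T f \<otimes> P (src \<Lambda> f) \<otimes> vertex_sum F" using T_P_src[OF assms(3)] by simp
  also have "\<dots> = T f \<otimes> (P (src \<Lambda> f) \<otimes> vertex_sum F)" using assms src_edge by (intro mult_assoc) auto
  finally show ?thesis using assms src_edge[OF assms(3)] by (simp add: P_vertex_sum T_P_src)
qed

lemma vertex_sum_T:
  assumes "finite F" "F \<subseteq> vertices \<Lambda>" "f \<in> edges \<Lambda>"
  shows "vertex_sum F \<otimes> T f = (if rng \<Lambda> f \<in> F then T f else \<zero>)"
proof -
  have "vertex_sum F \<otimes> T f = vertex_sum F \<otimes> (P (rng \<Lambda> f) \<otimes> T f)" using P_rng_T[OF assms(3)] by simp
  also have "\<dots> = vertex_sum F \<otimes> P (rng \<Lambda> f) \<otimes> T f" using assms rng_edge by (intro mult_assoc[symmetric]) auto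
  finally show ?thesis using assms rng_edge[OF assms(3)] by (simp add: vertex_sum_P P_rng_T)
qed

definition supported_on :: "'m set \<Rightarrow> 'a set" where
  "supported_on F = {a \<in> carrier A. vertex_sum F \<otimes> a = a \<and> a \<otimes> vertex_sum F = a}"

lemma supported_on_mono:
  assumes "F \<subseteq> H" "finite H" "H \<subseteq> vertices \<Lambda>"
  shows "supported_on F \<subseteq> supported_on H"
proof
  fix a assume "a \<in> supported_on F"
  then have a: "a \<in> carrier A" "vertex_sum F \<otimes> a = a" "a \<otimes> vertex_sum F = a" by (auto simp: supported_on_def)
  have F: "finite F" "F \<subseteq> vertices \<Lambda>" "H \<inter> F = F" "F \<inter> H = F" using assms finite_subset by auto
  have "vertex_sum H \<otimes> a = vertex_sum H \<otimes> (vertex_sum F \<otimes> a)" using a by simp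
  also have "\<dots> = vertex_sum H \<otimes> vertex_sum F \<otimes> a" using F assms a by (intro mult_assoc[symmetric]) auto
  also have "\<dots> = a" using F assms a by (simp add: vertex_sum_mult)
  finally have l: "vertex_sum H \<otimes> a = a" .
  have "a \<otimes> vertex_sum H = (a \<otimes> vertex_sum F) \<otimes> vertex_sum H" using a by simp
  also have "\<dots> = a \<otimes> (vertex_sum F \<otimes> vertex_sum H)" using F assms a by (intro mult_assoc) auto
  also have "\<dots> = a" using F assms a by (simp add: vertex_sum_mult)
  finally show "a \<in> supported_on H" using l a by (simp add: supported_on_def)
qed

lemma supported_on_closed:
  assumes "F \<subseteq> vertices \<Lambda>"
  shows "a \<in> supported_on F \<Longrightarrow> c \<odot> a \<in> supported_on F"
    "a \<in> supported_on F \<Longrightarrow> b \<in> supported_on F \<Longrightarrow> a \<oplus> b \<in> supported_on F"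
    "a \<in> supported_on F \<Longrightarrow> b \<in> supported_on F \<Longrightarrow> a \<otimes> b \<in> supported_on F"
    "a \<in> supported_on F \<Longrightarrow> star A a \<in> supported_on F"
    "\<zero> \<in> supported_on F"
proof -
  note p = vertex_sum_closed[OF assms] star_vertex_sum[OF assms]
  show "a \<in> supported_on F \<Longrightarrow> c \<odot> a \<in> supported_on F"
    "a \<in> supported_on F \<Longrightarrow> b \<in> supported_on F \<Longrightarrow> a \<oplus> b \<in> supported_on F"
    "\<zero> \<in> supported_on F"
    using p by (auto simp: supported_on_def smult_mult_left smult_mult_right mult_add_left mult_add_right)
  show "a \<otimes> b \<in> supported_on F" if "a \<in> supported_on F" "b \<in> supported_on F"
    using that p mult_assoc[of "vertex_sum F" a b] mult_assoc[of a b "vertex_sum F"] by (auto simp: supported_on_def)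
  show "star A a \<in> supported_on F" if "a \<in> supported_on F"
    using that p star_mult[of a "vertex_sum F"] star_mult[of "vertex_sum F" a] by (auto simp: supported_on_def)
qed

lemma P_supported: "w \<in> vertices \<Lambda> \<Longrightarrow> P w \<in> supported_on {w}"
  by (auto simp: supported_on_def vertex_sum_P P_vertex_sum)

lemma T_supported: "f \<in> edges \<Lambda> \<Longrightarrow> T f \<in> supported_on {rng \<Lambda> f, src \<Lambda> f}"
  using rng_edge src_edge by (auto simp: supported_on_def vertex_sum_T T_vertex_sum)

text \<open>Elements supported on finitely many vertices form a star-closed subalgebra containing
  the generators, hence are dense. If such s_n tend to x and p_n is the projection onto the support
  of s_n, then |x p_n - s_n| = |(x - s_n) p_n| <= |x - s_n|. The sets obtained depend on x.\<close>

lemma approximate_unit: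
  assumes gen: "generated_by A (P ` vertices \<Lambda> \<union> T ` edges \<Lambda>)" and x: "x \<in> carrier A"
  obtains F where "\<And>n. finite (F n)" "\<And>n. F n \<subseteq> vertices \<Lambda>" "converges_to (\<lambda>n. x \<otimes> vertex_sum (F n)) x"
proof -
  define R where "R = {a. \<exists>F. finite F \<and> F \<subseteq> vertices \<Lambda> \<and> a \<in> supported_on F}"
  have RI: "a \<in> R" if "finite F" "F \<subseteq> vertices \<Lambda>" "a \<in> supported_on F" for a F
    using that by (auto simp: R_def)
  have two: "\<exists>F. finite F \<and> F \<subseteq> vertices \<Lambda> \<and> a \<in> supported_on F \<and> b \<in> supported_on F" if "a \<in> R" "b \<in> R" for a b
  proof -
    obtain F where F: "finite F" "F \<subseteq> vertices \<Lambda>" "a \<in> supported_on F" using \<open>a \<in> R\<close> by (auto simp: R_def)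
    obtain H where H: "finite H" "H \<subseteq> vertices \<Lambda>" "b \<in> supported_on H" using \<open>b \<in> R\<close> by (auto simp: R_def)
    have "a \<in> supported_on (F \<union> H)" "b \<in> supported_on (F \<union> H)"
      using supported_on_mono[of F "F \<union> H"] supported_on_mono[of H "F \<union> H"] F H by auto
    then show ?thesis using F H by (intro exI[of _ "F \<union> H"]) auto
  qed
  have cl: "c \<odot> a \<in> R" "a \<oplus> b \<in> R" "a \<otimes> b \<in> R" "star A a \<in> R" if ab: "a \<in> R" "b \<in> R" for a b c
  proof -
    obtain F where F: "finite F" "F \<subseteq> vertices \<Lambda>" "a \<in> supported_on F" "b \<in> supported_on F"
      using two[OF ab] by blast
    note S = supported_on_closed[OF F(2)]
    show "c \<odot> a \<in> R" "a \<oplus> b \<in> R" "a \<otimes> b \<in> R" "star A a \<in> R"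
      by (rule RI[OF F(1,2)], rule S, (rule F(3,4))+)+
  qed
  have lin: "linear_subspace A R"
    unfolding linear_subspace_def
  proof (intro conjI ballI allI)
    show "\<zero> \<in> R" by (rule RI[of "{}"]) (use supported_on_closed(5)[of "{}"] in auto)
    show "R \<subseteq> carrier A" by (auto simp: R_def supported_on_def)
  qed (auto intro: cl)
  have "P ` vertices \<Lambda> \<union> T ` edges \<Lambda> \<subseteq> R"
  proof -
    have "P w \<in> R" if "w \<in> vertices \<Lambda>" for w
      by (rule RI[OF _ _ P_supported[OF that]]) (use that in auto)
    moreover have "T f \<in> R" if "f \<in> edges \<Lambda>" for f
      by (rule RI[OF _ _ T_supported[OF that]]) (use that rng_edge src_edge in auto)
    ultimately show ?thesis by auto
  qed
  then obtain s where s: "\<And>n. s n \<in> R" "converges_to s x"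
    by (rule generated_dense[OF gen lin _ _ _ x]) (assumption | erule (1) cl(3) | (rule cl(4); assumption) | rule that)+
  have "\<forall>n. \<exists>F. finite F \<and> F \<subseteq> vertices \<Lambda> \<and> s n \<in> supported_on F" using s(1) by (simp add: R_def)
  then obtain F where F: "\<And>n. finite (F n)" "\<And>n. F n \<subseteq> vertices \<Lambda>" "\<And>n. s n \<in> supported_on (F n)"
    by (auto dest!: choice)
  note c = converges_toD[OF s(2)]
  have "converges_to (\<lambda>n. x \<otimes> vertex_sum (F n)) x"
  proof (rule converges_toI[where g = "\<lambda>n. cnorm A (s n \<ominus> x) + cnorm A (s n \<ominus> x)"])
    fix n
    let ?p = "vertex_sum (F n)"
    have p: "?p \<in> carrier A" using F(2) by auto
    have sp: "s n \<otimes> ?p = s n" using F(3) by (auto simp: supported_on_def)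
    have "cnorm A (x \<otimes> ?p \<ominus> s n) = cnorm A (s n \<ominus> x \<otimes> ?p)" using c p by (intro cnorm_diff_commute) auto
    also have "s n \<ominus> x \<otimes> ?p = s n \<otimes> ?p \<ominus> x \<otimes> ?p" by (simp add: sp)
    also have "\<dots> = (s n \<ominus> x) \<otimes> ?p" using c(1)[of n] c(2) p by algebra
    also have "cnorm A \<dots> \<le> cnorm A (s n \<ominus> x) * cnorm A ?p" using c p by (intro cnorm_mult) auto
    also have "\<dots> \<le> cnorm A (s n \<ominus> x)"
      using cnorm_projection_le_1[OF is_projection_vertex_sum[OF F(1,2)[of n]]] c p by (intro mult_right_le_one_le) auto
    finally show "cnorm A (x \<otimes> ?p \<ominus> x) \<le> cnorm A (s n \<ominus> x) + cnorm A (s n \<ominus> x)"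
      using cnorm_diff_triangle[of "x \<otimes> ?p" "s n" x] c p by auto
  next
    show "(\<lambda>n. cnorm A (s n \<ominus> x) + cnorm A (s n \<ominus> x)) \<longlonglongrightarrow> 0" by (intro tendsto_add_zero c)
  qed (use c F in auto)
  then show ?thesis using that F by blast
qed

end

section \<open>Isometry of the canonical map\<close>

context matrix_family
begin

definition columns_over :: "'m set \<Rightarrow> 'm set" where
  "columns_over W = (\<Union>w\<in>W. colour_edges w)"

text \<open>A truncation of the column with entries \<open>U\<^sub>l\<^sup>*\<close>, where l runs
  over the edges of colour i into \<open>W\<close>. Finiteness of \<open>W\<close> matters:
  \<open>finsum\<close> over an infinite set is zero by convention.\<close>

definition corner :: "'m set \<Rightarrow> (nat \<Rightarrow> (('m option \<Rightarrow> 'b) \<Rightarrow> ('m option \<Rightarrow> 'b)) \<times> (('m option \<Rightarrow> 'b) \<Rightarrow> ('m option \<Rightarrow> 'b))) set" where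
  "corner W = (\<Oplus>\<^bsub>D\<^esub>l\<in>columns_over W. B.\<theta> (Some l) None (star B (U l)))"

context
  fixes W :: "'m set"
  assumes W: "finite W" "W \<subseteq> remaining"
begin

lemma finite_columns_over: "finite (columns_over W)"
  using W remaining_vertex by (auto simp: columns_over_def)

lemma columns_overD:
  assumes "l \<in> columns_over W"
  shows "l \<in> edges remaining_graph" "src \<Lambda> l \<in> remaining" "rng \<Lambda> l \<in> W" "deg \<Lambda> l = axis i 1"
  using assms W colour_edgesD by (auto simp: columns_over_def edges_remaining_graph)

lemma U_column [simp, intro]: "l \<in> columns_over W \<Longrightarrow> U l \<in> carrier B"
  using columns_overD by blast

lemma corner_closed: "corner W \<in> carrier D"
  unfolding corner_def by (intro D.finsum_closed) auto

lemma star_corner: "star D (corner W) = (\<Oplus>\<^bsub>D\<^esub>l\<in>columns_over W. B.\<theta> None (Some l) (U l))"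
proof -
  have "star D (corner W) = (\<Oplus>\<^bsub>D\<^esub>l\<in>columns_over W. star D (B.\<theta> (Some l) None (star B (U l))))"
    unfolding corner_def by (rule D.finsum_star) auto
  also have "\<dots> = (\<Oplus>\<^bsub>D\<^esub>l\<in>columns_over W. B.\<theta> None (Some l) (U l))"
    by (rule D.finsum_cong'[OF refl]) (auto simp: B.\<theta>_star)
  finally show ?thesis .
qed

text \<open>Row times matrix times column leaves only the position (None, None), that is, a copy of
  an element of \<open>B\<close>.\<close>

lemma compress_to_corner:
  assumes I: "\<And>k. k \<in> I \<Longrightarrow> a k \<in> columns_over W" "\<And>k. k \<in> I \<Longrightarrow> b k \<in> columns_over W"
    and x: "\<And>k. k \<in> I \<Longrightarrow> x k \<in> carrier B"
  shows "star D (corner W) \<otimes>\<^bsub>D\<^esub> (\<Oplus>\<^bsub>D\<^esub>k\<in>I. B.\<theta> (Some (a k)) (Some (b k)) (x k)) \<otimes>\<^bsub>D\<^esub> corner W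
    = B.\<theta> None None (\<Oplus>\<^bsub>B\<^esub>k\<in>I. U (a k) \<otimes>\<^bsub>B\<^esub> x k \<otimes>\<^bsub>B\<^esub> star B (U (b k)))"
proof -
  have "star D (corner W) \<otimes>\<^bsub>D\<^esub> (\<Oplus>\<^bsub>D\<^esub>k\<in>I. B.\<theta> (Some (a k)) (Some (b k)) (x k))
      = (\<Oplus>\<^bsub>D\<^esub>k\<in>I. B.\<theta> None (Some (a k)) (U (a k)) \<otimes>\<^bsub>D\<^esub> B.\<theta> (Some (a k)) (Some (b k)) (x k))"
    unfolding star_corner
    by (rule D.finsum_mult_match_right) (use I x finite_columns_over in \<open>auto simp: B.\<theta>_mult\<close>)
  also have "\<dots> = (\<Oplus>\<^bsub>D\<^esub>k\<in>I. B.\<theta> None (Some (b k)) (U (a k) \<otimes>\<^bsub>B\<^esub> x k))"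
    by (rule D.finsum_cong'[OF refl]) (use I x in \<open>auto simp: B.\<theta>_mult\<close>)
  also have "\<dots> \<otimes>\<^bsub>D\<^esub> corner W = (\<Oplus>\<^bsub>D\<^esub>k\<in>I. B.\<theta> None (Some (b k)) (U (a k) \<otimes>\<^bsub>B\<^esub> x k)
      \<otimes>\<^bsub>D\<^esub> B.\<theta> (Some (b k)) None (star B (U (b k))))"
    unfolding corner_def
    by (rule D.finsum_mult_match_left) (use I x finite_columns_over in \<open>auto simp: B.\<theta>_mult\<close>)
  also have "\<dots> = (\<Oplus>\<^bsub>D\<^esub>k\<in>I. B.\<theta> None None (U (a k) \<otimes>\<^bsub>B\<^esub> x k \<otimes>\<^bsub>B\<^esub> star B (U (b k))))"
    by (rule D.finsum_cong'[OF refl]) (use I x in \<open>auto simp: B.\<theta>_mult\<close>)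
  also have "\<dots> = B.\<theta> None None (\<Oplus>\<^bsub>B\<^esub>k\<in>I. U (a k) \<otimes>\<^bsub>B\<^esub> x k \<otimes>\<^bsub>B\<^esub> star B (U (b k)))"
    by (rule additive_finsum[OF B.abelian_group_axioms D.abelian_group_axioms, symmetric])
      (use I x in \<open>auto simp: B.\<theta>_zero B.\<theta>_add\<close>)
  finally show ?thesis .
qed

text \<open>What remains is the sum of U_h U_h^* over the edges of colour i into u, which (CK4) in
  \<open>B\<close> identifies as \<open>Q u\<close>.\<close>

lemma compress_PD:
  assumes u: "u \<in> W"
  shows "star D (corner W) \<otimes>\<^bsub>D\<^esub> PD u \<otimes>\<^bsub>D\<^esub> corner W = B.\<theta> None None (Q u)"
proof -
  have ur: "u \<in> remaining" using u W by blast
  have in_col: "h \<in> columns_over W" if "h \<in> colour_edges u" for h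
    using that u by (auto simp: columns_over_def)
  have "star D (corner W) \<otimes>\<^bsub>D\<^esub> PD u \<otimes>\<^bsub>D\<^esub> corner W =
      B.\<theta> None None (\<Oplus>\<^bsub>B\<^esub>h\<in>colour_edges u. U h \<otimes>\<^bsub>B\<^esub> Q (src \<Lambda> h) \<otimes>\<^bsub>B\<^esub> star B (U h))"
    unfolding PD_def by (rule compress_to_corner) (use in_col colour_edgesD(5) in auto)
  also have "(\<Oplus>\<^bsub>B\<^esub>h\<in>colour_edges u. U h \<otimes>\<^bsub>B\<^esub> Q (src \<Lambda> h) \<otimes>\<^bsub>B\<^esub> star B (U h)) =
      (\<Oplus>\<^bsub>B\<^esub>h\<in>colour_edges u. U h \<otimes>\<^bsub>B\<^esub> star B (U h))"
    by (rule B.finsum_cong'[OF refl])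
      (use in_col columns_overD B.T_P_src in auto)
  also have "colour_edges u = B.row u i"
    using ur by (auto simp: colour_edges_def B.row_def edges_remaining_graph)
  also have "(\<Oplus>\<^bsub>B\<^esub>h\<in>B.row u i. U h \<otimes>\<^bsub>B\<^esub> star B (U h)) = Q u"
    by (rule B.P_sum[symmetric]) (simp add: vertices_remaining_graph ur)
  finally show ?thesis .
qed

text \<open>The squares gh = h'g' give U_h' U_g' = U_g U_h, so the compression is U_g times the sum
  of all U_h U_h^* over the edges h of colour i into the source of g. By (CK4) that sum is
  \<open>Q (src \<Lambda> g)\<close>, which U_g absorbs.\<close>

lemma compress_TD:
  assumes g: "g \<in> edges remaining_graph" and gW: "rng \<Lambda> g \<in> W" "src \<Lambda> g \<in> W"
  shows "star D (corner W) \<otimes>\<^bsub>D\<^esub> TD g \<otimes>\<^bsub>D\<^esub> corner W = B.\<theta> None None (U g)"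
proof -
  have ge: "g \<in> edges \<Lambda>" using g by (simp add: edges_remaining_graph)
  have sr: "src \<Lambda> g \<in> remaining" using gW W by blast
  have in_col: "h \<in> columns_over W" "lf g h \<in> columns_over W" if "h \<in> colour_edges (src \<Lambda> g)" for h
    using that gW edge_square(1)[OF ge that] by (auto simp: columns_over_def)
  note sq = edge_square[OF ge]
  have "star D (corner W) \<otimes>\<^bsub>D\<^esub> TD g \<otimes>\<^bsub>D\<^esub> corner W =
      B.\<theta> None None (\<Oplus>\<^bsub>B\<^esub>h\<in>colour_edges (src \<Lambda> g). U (lf g h) \<otimes>\<^bsub>B\<^esub> U (rg g h) \<otimes>\<^bsub>B\<^esub> star B (U h))"
    unfolding TD_def by (rule compress_to_corner) (use in_col sq(2) in auto)
  also have "(\<Oplus>\<^bsub>B\<^esub>h\<in>colour_edges (src \<Lambda> g). U (lf g h) \<otimes>\<^bsub>B\<^esub> U (rg g h) \<otimes>\<^bsub>B\<^esub> star B (U h)) =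
      (\<Oplus>\<^bsub>B\<^esub>h\<in>colour_edges (src \<Lambda> g). U g \<otimes>\<^bsub>B\<^esub> (U h \<otimes>\<^bsub>B\<^esub> star B (U h)))"
  proof (rule B.finsum_cong'[OF refl])
    fix h assume h: "h \<in> colour_edges (src \<Lambda> g)"
    have "U (lf g h) \<otimes>\<^bsub>B\<^esub> U (rg g h) = U g \<otimes>\<^bsub>B\<^esub> U h"
      by (rule ck_familyD(4)[OF ckB])
        (use g sq(2,4,5)[OF h] in_col[OF h] columns_overD(1) colour_edgesD(3)[OF h] in auto)
    then show "U (lf g h) \<otimes>\<^bsub>B\<^esub> U (rg g h) \<otimes>\<^bsub>B\<^esub> star B (U h) = U g \<otimes>\<^bsub>B\<^esub> (U h \<otimes>\<^bsub>B\<^esub> star B (U h))"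
      using g in_col[OF h] by (simp add: B.mult_assoc U_closed)
  qed (use g in_col in auto)
  also have "\<dots> = U g \<otimes>\<^bsub>B\<^esub> (\<Oplus>\<^bsub>B\<^esub>h\<in>colour_edges (src \<Lambda> g). U h \<otimes>\<^bsub>B\<^esub> star B (U h))"
    by (rule B.finsum_mult_left[symmetric]) (use g in_col in auto)
  also have "colour_edges (src \<Lambda> g) = B.row (src \<Lambda> g) i"
    using sr by (auto simp: colour_edges_def B.row_def edges_remaining_graph)
  also have "(\<Oplus>\<^bsub>B\<^esub>h\<in>B.row (src \<Lambda> g) i. U h \<otimes>\<^bsub>B\<^esub> star B (U h)) = Q (src \<Lambda> g)"
    by (rule B.P_sum[symmetric]) (simp add: vertices_remaining_graph sr)
  also have "U g \<otimes>\<^bsub>B\<^esub> Q (src \<Lambda> g) = U g" using B.T_P_src[OF g] by simp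
  finally show ?thesis .
qed

text \<open>The off-diagonal entries vanish since distinct edges of one colour have orthogonal
  ranges. The result is a projection acting as a unit on elements supported on \<open>W\<close>,
  which makes the compression multiplicative there and bounds the norm of the column by 1.\<close>

lemma corner_star_corner: "corner W \<otimes>\<^bsub>D\<^esub> star D (corner W) = (\<Oplus>\<^bsub>D\<^esub>w\<in>W. PD w)"
proof -
  have dis: "colour_edges x \<inter> colour_edges y = {}" if "x \<noteq> y" for x y
    using that by (auto simp: colour_edges_def)
  have "corner W \<otimes>\<^bsub>D\<^esub> star D (corner W) =
      (\<Oplus>\<^bsub>D\<^esub>l\<in>columns_over W. B.\<theta> (Some l) None (star B (U l)) \<otimes>\<^bsub>D\<^esub> B.\<theta> None (Some l) (U l))"
    unfolding star_corner unfolding corner_def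
  proof (rule D.finsum_mult_match_left)
    fix l l' assume l: "l \<in> columns_over W" "l' \<in> columns_over W" "l' \<noteq> l"
    have "star B (U l) \<otimes>\<^bsub>B\<^esub> U l' = \<zero>\<^bsub>B\<^esub>"
      using B.star_T_T_same_deg[OF columns_overD(1)[OF l(1)] columns_overD(1)[OF l(2)]]
        columns_overD(4)[OF l(1)] columns_overD(4)[OF l(2)] l(3) by simp
    then show "B.\<theta> (Some l) None (star B (U l)) \<otimes>\<^bsub>D\<^esub> B.\<theta> None (Some l') (U l') = \<zero>\<^bsub>D\<^esub>"
      using l by (simp add: B.\<theta>_mult B.\<theta>_zero U_column)
  qed (use finite_columns_over in auto)
  also have "\<dots> = (\<Oplus>\<^bsub>D\<^esub>l\<in>columns_over W. B.\<theta> (Some l) (Some l) (Q (src \<Lambda> l)))"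
    by (rule D.finsum_cong'[OF refl])
      (use columns_overD B.T_star_T in \<open>auto simp: B.\<theta>_mult\<close>)
  also have "\<dots> = (\<Oplus>\<^bsub>D\<^esub>w\<in>W. PD w)"
    unfolding columns_over_def PD_def
    by (rule D.add.finprod_UN_disjoint)
      (use W remaining_vertex colour_edgesD(5) in \<open>auto simp: pairwise_def disjnt_def dis\<close>)
  finally show ?thesis .
qed

end

text \<open>The left inverse at work, with \<open>\<sigma>\<close> later the composite of
  \<open>\<phi>\<close> and \<open>\<psi>\<close>. For b in a dense set, compressing
  \<open>\<sigma> b\<close> by a column of norm at most 1 returns b, so |b| <=
  |\<open>\<sigma> b\<close>|; contractivity of \<open>\<sigma>\<close> carries the inequality to
  limits.\<close>

lemma cnorm_le_of_family_hom:
  assumes gen: "generated_by B (Q ` vertices remaining_graph \<union> U ` edges remaining_graph)"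
    and hom: "star_hom B D \<sigma>" "\<And>w. w \<in> remaining \<Longrightarrow> \<sigma> (Q w) = PD w"
      "\<And>f. f \<in> edges remaining_graph \<Longrightarrow> \<sigma> (U f) = TD f"
    and x: "x \<in> carrier B"
  shows "cnorm B x \<le> cnorm D (\<sigma> x)"
proof -
  interpret \<sigma>: star_homomorphism B D \<sigma> by unfold_locales (rule hom(1))
  \<comment> \<open>The identity is required for all sufficiently large finite W, so that two
    elements of R can be compared over a common W. The support condition is what makes products
    work.\<close>
  define R where "R = {b. \<exists>V. finite V \<and> V \<subseteq> remaining \<and> (\<forall>W. finite W \<and> V \<subseteq> W \<and> W \<subseteq> remaining \<longrightarrow>
    b \<in> B.supported_on W \<and> star D (corner W) \<otimes>\<^bsub>D\<^esub> \<sigma> b \<otimes>\<^bsub>D\<^esub> corner W = B.\<theta> None None b)}"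
  have RI: "b \<in> R" if "finite V" "V \<subseteq> remaining" and
      "\<And>W. finite W \<Longrightarrow> V \<subseteq> W \<Longrightarrow> W \<subseteq> remaining \<Longrightarrow> b \<in> B.supported_on W"
      "\<And>W. finite W \<Longrightarrow> V \<subseteq> W \<Longrightarrow> W \<subseteq> remaining \<Longrightarrow>
        star D (corner W) \<otimes>\<^bsub>D\<^esub> \<sigma> b \<otimes>\<^bsub>D\<^esub> corner W = B.\<theta> None None b" for b V
    using that unfolding R_def by (intro CollectI exI[of _ V]) auto
  have RE: "\<exists>V. finite V \<and> V \<subseteq> remaining \<and> (\<forall>W. finite W \<and> V \<subseteq> W \<and> W \<subseteq> remaining \<longrightarrow>
    b \<in> B.supported_on W \<and> star D (corner W) \<otimes>\<^bsub>D\<^esub> \<sigma> b \<otimes>\<^bsub>D\<^esub> corner W = B.\<theta> None None b)" if "b \<in> R" for b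
    using that unfolding R_def by (rule CollectD)
  have R_carrier: "b \<in> carrier B" if "b \<in> R" for b
    using RE[OF that] by (auto simp: B.supported_on_def)
  have sv: "W \<subseteq> vertices remaining_graph" if "W \<subseteq> remaining" for W using that by (simp add: vertices_remaining_graph)
  have smult: "c \<odot>\<^bsub>B\<^esub> b \<in> R" and star: "star B b \<in> R" if b: "b \<in> R" for b c
  proof -
    have bB: "b \<in> carrier B" by (rule R_carrier[OF b])
    obtain V where V: "finite V" "V \<subseteq> remaining"
      "\<And>W. finite W \<Longrightarrow> V \<subseteq> W \<Longrightarrow> W \<subseteq> remaining \<Longrightarrow> b \<in> B.supported_on W"
      "\<And>W. finite W \<Longrightarrow> V \<subseteq> W \<Longrightarrow> W \<subseteq> remaining \<Longrightarrow>
        star D (corner W) \<otimes>\<^bsub>D\<^esub> \<sigma> b \<otimes>\<^bsub>D\<^esub> corner W = B.\<theta> None None b"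
      using RE[OF b] by auto
    show "c \<odot>\<^bsub>B\<^esub> b \<in> R"
    proof (rule RI[OF V(1,2)])
      fix W assume W: "finite W" "V \<subseteq> W" "W \<subseteq> remaining"
      show "c \<odot>\<^bsub>B\<^esub> b \<in> B.supported_on W" by (rule B.supported_on_closed[OF sv]) (use W V in auto)
      have "star D (corner W) \<otimes>\<^bsub>D\<^esub> \<sigma> (c \<odot>\<^bsub>B\<^esub> b) \<otimes>\<^bsub>D\<^esub> corner W =
          c \<odot>\<^bsub>D\<^esub> (star D (corner W) \<otimes>\<^bsub>D\<^esub> \<sigma> b \<otimes>\<^bsub>D\<^esub> corner W)"
        using bB corner_closed[OF W(1,3)] by (simp add: \<sigma>.map_smult D.smult_mult_left D.smult_mult_right)
      then show "star D (corner W) \<otimes>\<^bsub>D\<^esub> \<sigma> (c \<odot>\<^bsub>B\<^esub> b) \<otimes>\<^bsub>D\<^esub> corner W = B.\<theta> None None (c \<odot>\<^bsub>B\<^esub> b)"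
        using V(4)[OF W] bB by (simp add: B.\<theta>_smult)
    qed
    show "star B b \<in> R"
    proof (rule RI[OF V(1,2)])
      fix W assume W: "finite W" "V \<subseteq> W" "W \<subseteq> remaining"
      show "star B b \<in> B.supported_on W" by (rule B.supported_on_closed[OF sv]) (use W V in auto)
      have "star D (corner W) \<otimes>\<^bsub>D\<^esub> \<sigma> (star B b) \<otimes>\<^bsub>D\<^esub> corner W =
          star D (star D (corner W) \<otimes>\<^bsub>D\<^esub> \<sigma> b \<otimes>\<^bsub>D\<^esub> corner W)"
        using bB corner_closed[OF W(1,3)] by (simp add: \<sigma>.map_star D.star_mult D.mult_assoc)
      then show "star D (corner W) \<otimes>\<^bsub>D\<^esub> \<sigma> (star B b) \<otimes>\<^bsub>D\<^esub> corner W = B.\<theta> None None (star B b)"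
        using V(4)[OF W] bB by (simp add: B.\<theta>_star)
    qed
  qed
  have add: "a \<oplus>\<^bsub>B\<^esub> b \<in> R" and mult: "a \<otimes>\<^bsub>B\<^esub> b \<in> R" if ab: "a \<in> R" "b \<in> R" for a b
  proof -
    note c = R_carrier[OF ab(1)] R_carrier[OF ab(2)]
    obtain V1 where V1: "finite V1" "V1 \<subseteq> remaining"
      "\<And>W. finite W \<Longrightarrow> V1 \<subseteq> W \<Longrightarrow> W \<subseteq> remaining \<Longrightarrow> a \<in> B.supported_on W"
      "\<And>W. finite W \<Longrightarrow> V1 \<subseteq> W \<Longrightarrow> W \<subseteq> remaining \<Longrightarrow>
        star D (corner W) \<otimes>\<^bsub>D\<^esub> \<sigma> a \<otimes>\<^bsub>D\<^esub> corner W = B.\<theta> None None a"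
      using RE[OF ab(1)] by auto
    obtain V2 where V2: "finite V2" "V2 \<subseteq> remaining"
      "\<And>W. finite W \<Longrightarrow> V2 \<subseteq> W \<Longrightarrow> W \<subseteq> remaining \<Longrightarrow> b \<in> B.supported_on W"
      "\<And>W. finite W \<Longrightarrow> V2 \<subseteq> W \<Longrightarrow> W \<subseteq> remaining \<Longrightarrow>
        star D (corner W) \<otimes>\<^bsub>D\<^esub> \<sigma> b \<otimes>\<^bsub>D\<^esub> corner W = B.\<theta> None None b"
      using RE[OF ab(2)] by auto
    have V: "finite (V1 \<union> V2)" "V1 \<union> V2 \<subseteq> remaining" using V1 V2 by auto
    show "a \<oplus>\<^bsub>B\<^esub> b \<in> R"
    proof (rule RI[OF V])
      fix W assume W: "finite W" "V1 \<union> V2 \<subseteq> W" "W \<subseteq> remaining"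
      show "a \<oplus>\<^bsub>B\<^esub> b \<in> B.supported_on W" by (rule B.supported_on_closed[OF sv]) (use W V1 V2 in auto)
      have "star D (corner W) \<otimes>\<^bsub>D\<^esub> \<sigma> (a \<oplus>\<^bsub>B\<^esub> b) \<otimes>\<^bsub>D\<^esub> corner W =
          star D (corner W) \<otimes>\<^bsub>D\<^esub> \<sigma> a \<otimes>\<^bsub>D\<^esub> corner W \<oplus>\<^bsub>D\<^esub> star D (corner W) \<otimes>\<^bsub>D\<^esub> \<sigma> b \<otimes>\<^bsub>D\<^esub> corner W"
        using c corner_closed[OF W(1,3)] by (simp add: \<sigma>.map_add D.mult_add_left D.mult_add_right)
      then show "star D (corner W) \<otimes>\<^bsub>D\<^esub> \<sigma> (a \<oplus>\<^bsub>B\<^esub> b) \<otimes>\<^bsub>D\<^esub> corner W = B.\<theta> None None (a \<oplus>\<^bsub>B\<^esub> b)"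
        using V1(4)[of W] V2(4)[of W] W c by (simp add: B.\<theta>_add)
    qed
    show "a \<otimes>\<^bsub>B\<^esub> b \<in> R"
    proof (rule RI[OF V])
      fix W assume W: "finite W" "V1 \<union> V2 \<subseteq> W" "W \<subseteq> remaining"
      show "a \<otimes>\<^bsub>B\<^esub> b \<in> B.supported_on W" by (rule B.supported_on_closed[OF sv]) (use W V1 V2 in auto)
      let ?w = "corner W"
      note wc = corner_closed[OF W(1,3)]
      have "\<sigma> (B.vertex_sum W) = (\<Oplus>\<^bsub>D\<^esub>w\<in>W. \<sigma> (Q w))"
        unfolding B.vertex_sum_def by (rule \<sigma>.map_finsum) (use W in auto)
      also have "\<dots> = (\<Oplus>\<^bsub>D\<^esub>w\<in>W. PD w)"
        by (rule D.finsum_cong'[OF refl]) (use W hom(2) PD_closed in auto)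
      also have "\<dots> = ?w \<otimes>\<^bsub>D\<^esub> star D ?w" by (rule corner_star_corner[OF W(1,3), symmetric])
      finally have ww: "?w \<otimes>\<^bsub>D\<^esub> star D ?w = \<sigma> (B.vertex_sum W)" by simp
      have "a \<otimes>\<^bsub>B\<^esub> B.vertex_sum W = a"
        using V1(3)[of W] W by (auto simp: B.supported_on_def)
      then have a: "\<sigma> a \<otimes>\<^bsub>D\<^esub> (?w \<otimes>\<^bsub>D\<^esub> star D ?w) = \<sigma> a"
        unfolding ww using c B.vertex_sum_closed[OF sv[OF W(3)]] by (simp flip: \<sigma>.map_mult)
      \<comment> \<open>As a is supported on W, the projection \<open>?w \<otimes> star D ?w\<close>
        can be inserted between the two factors, which splits the compression of the
        product.\<close>
      have "star D ?w \<otimes>\<^bsub>D\<^esub> \<sigma> (a \<otimes>\<^bsub>B\<^esub> b) \<otimes>\<^bsub>D\<^esub> ?w =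
          star D ?w \<otimes>\<^bsub>D\<^esub> (\<sigma> a \<otimes>\<^bsub>D\<^esub> (?w \<otimes>\<^bsub>D\<^esub> star D ?w)) \<otimes>\<^bsub>D\<^esub> \<sigma> b \<otimes>\<^bsub>D\<^esub> ?w"
        unfolding a using c wc by (simp add: \<sigma>.map_mult D.mult_assoc)
      also have "\<dots> = (star D ?w \<otimes>\<^bsub>D\<^esub> \<sigma> a \<otimes>\<^bsub>D\<^esub> ?w) \<otimes>\<^bsub>D\<^esub> (star D ?w \<otimes>\<^bsub>D\<^esub> \<sigma> b \<otimes>\<^bsub>D\<^esub> ?w)"
        using c wc by (simp add: D.mult_assoc)
      also have "\<dots> = B.\<theta> None None (a \<otimes>\<^bsub>B\<^esub> b)"
        using V1(4)[of W] V2(4)[of W] W c by (simp add: B.\<theta>_mult)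
      finally show "star D ?w \<otimes>\<^bsub>D\<^esub> \<sigma> (a \<otimes>\<^bsub>B\<^esub> b) \<otimes>\<^bsub>D\<^esub> ?w = B.\<theta> None None (a \<otimes>\<^bsub>B\<^esub> b)" .
    qed
  qed
  have "\<zero>\<^bsub>B\<^esub> \<in> R"
  proof (rule RI[of "{}"])
    fix W assume W: "finite W" "W \<subseteq> remaining"
    show "\<zero>\<^bsub>B\<^esub> \<in> B.supported_on W" by (rule B.supported_on_closed[OF sv[OF W(2)]])
    show "star D (corner W) \<otimes>\<^bsub>D\<^esub> \<sigma> \<zero>\<^bsub>B\<^esub> \<otimes>\<^bsub>D\<^esub> corner W = B.\<theta> None None \<zero>\<^bsub>B\<^esub>"
      using corner_closed[OF W] by (simp add: B.\<theta>_zero)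
  qed auto
  then have lin: "linear_subspace B R"
    unfolding linear_subspace_def by (intro conjI ballI allI subsetI smult add R_carrier)
  have Q: "Q u \<in> R" if u: "u \<in> remaining" for u
  proof (rule RI[of "{u}"])
    fix W assume W: "finite W" "{u} \<subseteq> W" "W \<subseteq> remaining"
    have uv: "u \<in> vertices remaining_graph" using u by (simp add: vertices_remaining_graph)
    show "Q u \<in> B.supported_on W"
      using B.supported_on_mono[OF W(2,1) sv[OF W(3)]] B.P_supported[OF uv] by blast
    show "star D (corner W) \<otimes>\<^bsub>D\<^esub> \<sigma> (Q u) \<otimes>\<^bsub>D\<^esub> corner W = B.\<theta> None None (Q u)"
      unfolding hom(2)[OF u] by (rule compress_PD[OF W(1,3)]) (use W in auto)
  qed (use u in auto)
  have U: "U g \<in> R" if g: "g \<in> edges remaining_graph" for g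
  proof (rule RI[of "{rng \<Lambda> g, src \<Lambda> g}"])
    fix W assume W: "finite W" "{rng \<Lambda> g, src \<Lambda> g} \<subseteq> W" "W \<subseteq> remaining"
    show "U g \<in> B.supported_on W"
      using B.supported_on_mono[OF W(2,1) sv[OF W(3)]] B.T_supported[OF g] by auto
    show "star D (corner W) \<otimes>\<^bsub>D\<^esub> \<sigma> (U g) \<otimes>\<^bsub>D\<^esub> corner W = B.\<theta> None None (U g)"
      unfolding hom(3)[OF g] by (rule compress_TD[OF W(1,3) g]) (use W in auto)
  qed (use g hereditary_edge in \<open>auto simp: edges_remaining_graph\<close>)
  have gens: "Q ` vertices remaining_graph \<union> U ` edges remaining_graph \<subseteq> R"
    using Q U by (auto simp: vertices_remaining_graph)
  have le: "cnorm B b \<le> cnorm D (\<sigma> b)" if b: "b \<in> R" for b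
  proof -
    obtain V where V: "finite V" "V \<subseteq> remaining" "star D (corner V) \<otimes>\<^bsub>D\<^esub> \<sigma> b \<otimes>\<^bsub>D\<^esub> corner V = B.\<theta> None None b"
      using RE[OF b] by auto
    let ?w = "corner V"
    have wc: "?w \<in> carrier D" by (rule corner_closed[OF V(1,2)])
    have bc: "\<sigma> b \<in> carrier D" using R_carrier[OF b] by blast
    have "\<sigma> (B.vertex_sum V) = (\<Oplus>\<^bsub>D\<^esub>w\<in>V. \<sigma> (Q w))"
      unfolding B.vertex_sum_def by (rule \<sigma>.map_finsum) (use V in auto)
    also have "\<dots> = (\<Oplus>\<^bsub>D\<^esub>w\<in>V. PD w)"
      by (rule D.finsum_cong'[OF refl]) (use V hom(2) PD_closed in auto)
    also have "\<dots> = ?w \<otimes>\<^bsub>D\<^esub> star D ?w" by (rule corner_star_corner[OF V(1,2), symmetric])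
    finally have ww: "?w \<otimes>\<^bsub>D\<^esub> star D ?w = \<sigma> (B.vertex_sum V)" by simp
    \<comment> \<open>The column times its adjoint is the image of a vertex projection, so by the
      C*-identity the column has norm at most 1.\<close>
    have "is_projection D (?w \<otimes>\<^bsub>D\<^esub> star D ?w)"
      unfolding ww by (rule is_projection_map[OF hom(1) B.is_projection_vertex_sum[OF V(1) sv[OF V(2)]]])
    then have "(cnorm D ?w)\<^sup>2 \<le> 1"
      using D.cnorm_projection_le_1[of "?w \<otimes>\<^bsub>D\<^esub> star D ?w"] D.cstar_identity[of "star D ?w"] wc by simp
    then have w1: "cnorm D ?w \<le> 1"
      using abs_le_square_iff[of "cnorm D ?w" 1] D.cnorm_nonneg[OF wc] by simp
    have "cnorm B b \<le> cnorm D (star D ?w \<otimes>\<^bsub>D\<^esub> \<sigma> b \<otimes>\<^bsub>D\<^esub> ?w)"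
      unfolding V(3) by (rule B.cnorm_\<theta>_ge[OF R_carrier[OF b]])
    also have "\<dots> \<le> cnorm D (star D ?w \<otimes>\<^bsub>D\<^esub> \<sigma> b) * cnorm D ?w" using wc bc by (intro D.cnorm_mult) auto
    also have "\<dots> \<le> cnorm D (star D ?w \<otimes>\<^bsub>D\<^esub> \<sigma> b)" using w1 wc bc by (intro mult_right_le_one_le) auto
    also have "\<dots> \<le> cnorm D (star D ?w) * cnorm D (\<sigma> b)" using wc bc by (intro D.cnorm_mult) auto
    also have "\<dots> \<le> cnorm D (\<sigma> b)" using w1 wc bc by (intro mult_left_le_one_le) auto
    finally show ?thesis .
  qed
  obtain s where s: "\<And>n. s n \<in> R" "B.converges_to s x"
    by (rule B.generated_dense[OF gen lin gens _ _ x]) (assumption | erule (1) mult | (rule star; assumption) | rule that)+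
  note sc = B.converges_toD[OF s(2)]
  have "D.converges_to (\<lambda>n. \<sigma> (s n)) (\<sigma> x)"
  proof (rule D.converges_toI[OF _ _ _ sc(3)])
    show "cnorm D (\<sigma> (s n) \<ominus>\<^bsub>D\<^esub> \<sigma> x) \<le> cnorm B (s n \<ominus>\<^bsub>B\<^esub> x)" for n
      using star_hom_contractive[OF B.cstar_axioms D.cstar_axioms hom(1), of "s n \<ominus>\<^bsub>B\<^esub> x"] sc
      by (simp add: \<sigma>.map_diff)
  qed (use sc in auto)
  then have "(\<lambda>n. cnorm D (\<sigma> (s n))) \<longlonglongrightarrow> cnorm D (\<sigma> x)" by (rule D.converges_to_cnorm)
  then show ?thesis by (rule LIMSEQ_le[OF B.converges_to_cnorm[OF s(2)]]) (use le s(1) in auto)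
qed

end

section \<open>The imprimitivity bimodule\<close>

lemma (in pre_cstar_algebra) closed_subalgebra_subspace: "closed_subalgebra S \<Longrightarrow> linear_subspace A S"
  by (simp add: closed_subalgebra_def)

locale corner_embedding = matrix_family \<Lambda> v i B Q U + A: ck_representation A \<Lambda> P T +
    \<phi>: isometric_homomorphism B A \<phi>
  for \<Lambda> :: "('m, 'k::finite) kgraph_data" and v i and B :: "'b cstar" and Q U
    and A :: "'a cstar" and P T and \<phi> +
  assumes genB: "generated_by B (Q ` vertices remaining_graph \<union> U ` edges remaining_graph)"
    and genA: "generated_by A (P ` vertices \<Lambda> \<union> T ` edges \<Lambda>)"
    and \<phi>_Q: "w \<in> remaining \<Longrightarrow> \<phi> (Q w) = P w"
    and \<phi>_U: "f \<in> edges remaining_graph \<Longrightarrow> \<phi> (U f) = T f"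
begin

section \<open>The image of \<open>B\<close> as a corner of \<open>A\<close>\<close>

abbreviation B0 :: "'a set" where "B0 \<equiv> \<phi> ` carrier B"

lemma B0: "A.closed_subalgebra B0"
  by (rule \<phi>.closed_subalgebra_image[OF B.closed_subalgebra_carrier])

lemmas B0D = A.closed_subalgebraD[OF B0]

lemma B0_star: "z \<in> B0 \<Longrightarrow> star A z \<in> B0"
  by (auto simp flip: \<phi>.map_star)

lemma P_in_B0: "w \<in> remaining \<Longrightarrow> P w \<in> B0"
  using \<phi>_Q[of w] by (metis Q_closed imageI)

lemma T_in_B0: "f \<in> edges remaining_graph \<Longrightarrow> T f \<in> B0"
  using \<phi>_U[of f] by (metis U_closed imageI)

lemma colour_edges_row: "colour_edges w = A.row w i"
  by (simp add: colour_edges_def A.row_def)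

lemma columns_edge: "l \<in> columns_over F \<Longrightarrow> l \<in> edges \<Lambda>"
  using colour_edgesD by (auto simp: columns_over_def)

lemma columns_over_remaining: "F \<subseteq> remaining \<Longrightarrow> l \<in> columns_over F \<Longrightarrow> l \<in> edges remaining_graph"
  using colour_edgesD by (auto simp: columns_over_def edges_remaining_graph)

lemma vertex_sum_columns:
  assumes F: "finite F" "F \<subseteq> vertices \<Lambda>"
  shows "A.vertex_sum F = (\<Oplus>\<^bsub>A\<^esub>l\<in>columns_over F. T l \<otimes>\<^bsub>A\<^esub> star A (T l))"
proof -
  have dis: "colour_edges x \<inter> colour_edges y = {}" if "x \<noteq> y" for x y
    using that by (auto simp: colour_edges_def)
  have "A.vertex_sum F = (\<Oplus>\<^bsub>A\<^esub>w\<in>F. \<Oplus>\<^bsub>A\<^esub>l\<in>colour_edges w. T l \<otimes>\<^bsub>A\<^esub> star A (T l))"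
    unfolding A.vertex_sum_def
    by (rule A.finsum_cong'[OF refl])
      (use F A.P_sum[of _ i] colour_edgesD in \<open>auto simp: colour_edges_row[symmetric] intro!: A.finsum_closed\<close>)
  also have "\<dots> = (\<Oplus>\<^bsub>A\<^esub>l\<in>columns_over F. T l \<otimes>\<^bsub>A\<^esub> star A (T l))"
    unfolding columns_over_def
    by (rule A.add.finprod_UN_disjoint[symmetric])
      (use F colour_edgesD in \<open>auto simp: pairwise_def disjnt_def dis\<close>)
  finally show ?thesis .
qed

lemma insert_vertex_sum:
  assumes F: "finite F" "F \<subseteq> vertices \<Lambda>" and ab: "a \<in> carrier A" "b \<in> carrier A"
  shows "a \<otimes>\<^bsub>A\<^esub> A.vertex_sum F \<otimes>\<^bsub>A\<^esub> b = (\<Oplus>\<^bsub>A\<^esub>l\<in>columns_over F. (a \<otimes>\<^bsub>A\<^esub> T l) \<otimes>\<^bsub>A\<^esub> (star A (T l) \<otimes>\<^bsub>A\<^esub> b))"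
proof -
  have "a \<otimes>\<^bsub>A\<^esub> A.vertex_sum F \<otimes>\<^bsub>A\<^esub> b = (\<Oplus>\<^bsub>A\<^esub>l\<in>columns_over F. a \<otimes>\<^bsub>A\<^esub> (T l \<otimes>\<^bsub>A\<^esub> star A (T l)) \<otimes>\<^bsub>A\<^esub> b)"
    unfolding vertex_sum_columns[OF F] using columns_edge ab
    by (subst A.finsum_mult_left A.finsum_mult_right; auto)+
  also have "\<dots> = (\<Oplus>\<^bsub>A\<^esub>l\<in>columns_over F. (a \<otimes>\<^bsub>A\<^esub> T l) \<otimes>\<^bsub>A\<^esub> (star A (T l) \<otimes>\<^bsub>A\<^esub> b))"
    by (rule A.finsum_cong'[OF refl]) (use columns_edge ab in \<open>auto simp: A.mult_assoc\<close>)
  finally show ?thesis .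
qed

text \<open>The condition \<open>f \<in> colour_edges (rng \<Lambda> f)\<close> just says that f is
  an edge of colour i, with any range.\<close>

definition compressible :: "'a set" where
  "compressible = {a \<in> carrier A. \<forall>f h. f \<in> colour_edges (rng \<Lambda> f) \<longrightarrow> h \<in> colour_edges (rng \<Lambda> h) \<longrightarrow>
     star A (T f) \<otimes>\<^bsub>A\<^esub> a \<otimes>\<^bsub>A\<^esub> T h \<in> B0}"

lemma compressibleI:
  assumes "a \<in> carrier A" "\<And>f h. f \<in> colour_edges (rng \<Lambda> f) \<Longrightarrow> h \<in> colour_edges (rng \<Lambda> h) \<Longrightarrow>
     star A (T f) \<otimes>\<^bsub>A\<^esub> a \<otimes>\<^bsub>A\<^esub> T h \<in> B0"
  shows "a \<in> compressible"
  using assms by (simp add: compressible_def)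

lemma compressibleD:
  assumes "a \<in> compressible"
  shows "a \<in> carrier A" "f \<in> colour_edges (rng \<Lambda> f) \<Longrightarrow> h \<in> colour_edges (rng \<Lambda> h) \<Longrightarrow>
     star A (T f) \<otimes>\<^bsub>A\<^esub> a \<otimes>\<^bsub>A\<^esub> T h \<in> B0"
  using assms by (simp_all add: compressible_def)

lemma P_compressible:
  assumes w: "w \<in> vertices \<Lambda>"
  shows "P w \<in> compressible"
proof (rule compressibleI)
  fix f h assume fh: "f \<in> colour_edges (rng \<Lambda> f)" "h \<in> colour_edges (rng \<Lambda> h)"
  note F = colour_edgesD[OF fh(1)] and H = colour_edgesD[OF fh(2)]
  have "star A (T f) \<otimes>\<^bsub>A\<^esub> P w \<otimes>\<^bsub>A\<^esub> T h = (if w = rng \<Lambda> h then star A (T f) \<otimes>\<^bsub>A\<^esub> T h else \<zero>\<^bsub>A\<^esub>)"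
    using A.P_T[OF w H(1)] F(1) H(1) w by (simp add: A.mult_assoc)
  also have "\<dots> = (if w = rng \<Lambda> h \<and> f = h then P (src \<Lambda> f) else \<zero>\<^bsub>A\<^esub>)"
    using A.star_T_T_same_deg[OF F(1) H(1)] F(4) H(4) by auto
  also have "\<dots> \<in> B0" using P_in_B0[OF F(5)] B0D(2) by auto
  finally show "star A (T f) \<otimes>\<^bsub>A\<^esub> P w \<otimes>\<^bsub>A\<^esub> T h \<in> B0" .
qed (use w in auto)

text \<open>For gh = h'g' one has T_g T_h = T_h' T_g'. Multiplying by the adjoint of T_f leaves T_g'
  if f = h' and zero otherwise, and g' is an edge of the remaining graph. If g and h are not
  composable, the product is already zero.\<close>

lemma T_compressible:
  assumes g: "g \<in> edges \<Lambda>"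
  shows "T g \<in> compressible"
proof (rule compressibleI)
  fix f h assume fh: "f \<in> colour_edges (rng \<Lambda> f)" "h \<in> colour_edges (rng \<Lambda> h)"
  note F = colour_edgesD[OF fh(1)] and H = colour_edgesD[OF fh(2)]
  show "star A (T f) \<otimes>\<^bsub>A\<^esub> T g \<otimes>\<^bsub>A\<^esub> T h \<in> B0"
  proof (cases "src \<Lambda> g = rng \<Lambda> h")
    case True
    then have h: "h \<in> colour_edges (src \<Lambda> g)" using fh(2) by simp
    note sq = edge_square[OF g h] and L = colour_edgesD[OF edge_square(1)[OF g h]]
    have re: "rg g h \<in> edges \<Lambda>" using sq(2) by (simp add: edges_remaining_graph)
    have "T g \<otimes>\<^bsub>A\<^esub> T h = T (lf g h) \<otimes>\<^bsub>A\<^esub> T (rg g h)"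
      by (rule ck_familyD(4)[OF A.ck]) (use g H(1) L(1) re True sq in auto)
    then have "star A (T f) \<otimes>\<^bsub>A\<^esub> T g \<otimes>\<^bsub>A\<^esub> T h = star A (T f) \<otimes>\<^bsub>A\<^esub> T (lf g h) \<otimes>\<^bsub>A\<^esub> T (rg g h)"
      using F(1) g H(1) L(1) re by (simp add: A.mult_assoc)
    also have "\<dots> = (if f = lf g h then T (rg g h) else \<zero>\<^bsub>A\<^esub>)"
      using A.star_T_T_same_deg[OF F(1) L(1)] F(4) L(4) A.P_rng_T[OF re] sq(4) re by auto
    also have "\<dots> \<in> B0" using T_in_B0[OF sq(2)] B0D(2) by auto
    finally show ?thesis .
  next
    case False
    have "T g \<otimes>\<^bsub>A\<^esub> T h = T g \<otimes>\<^bsub>A\<^esub> (P (rng \<Lambda> h) \<otimes>\<^bsub>A\<^esub> T h)" using A.P_rng_T[OF H(1)] by simp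
    also have "\<dots> = T g \<otimes>\<^bsub>A\<^esub> P (rng \<Lambda> h) \<otimes>\<^bsub>A\<^esub> T h"
      using g H(1) rng_in[OF H(1)] by (intro A.mult_assoc[symmetric]) auto
    also have "\<dots> = \<zero>\<^bsub>A\<^esub>" using A.T_P[OF rng_in[OF H(1)] g] False H(1) by simp
    finally show ?thesis using F(1) g H(1) B0D(2) by (simp add: A.mult_assoc)
  qed
qed (use g in auto)

lemma compressible_subspace: "linear_subspace A compressible"
  unfolding linear_subspace_def
proof (intro conjI ballI allI)
  show "compressible \<subseteq> carrier A" by (auto simp: compressible_def)
  show "\<zero>\<^bsub>A\<^esub> \<in> compressible"
    by (rule compressibleI) (use colour_edgesD(1) B0D(2) in auto)
  fix a assume a: "a \<in> compressible"
  note aD = compressibleD[OF a]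
  show "c \<odot>\<^bsub>A\<^esub> a \<in> compressible" for c
  proof (rule compressibleI)
    fix f h assume fh: "f \<in> colour_edges (rng \<Lambda> f)" "h \<in> colour_edges (rng \<Lambda> h)"
    have "star A (T f) \<otimes>\<^bsub>A\<^esub> (c \<odot>\<^bsub>A\<^esub> a) \<otimes>\<^bsub>A\<^esub> T h = c \<odot>\<^bsub>A\<^esub> (star A (T f) \<otimes>\<^bsub>A\<^esub> a \<otimes>\<^bsub>A\<^esub> T h)"
      using aD(1) colour_edgesD(1)[OF fh(1)] colour_edgesD(1)[OF fh(2)] by (simp add: A.smult_mult_left A.smult_mult_right)
    then show "star A (T f) \<otimes>\<^bsub>A\<^esub> (c \<odot>\<^bsub>A\<^esub> a) \<otimes>\<^bsub>A\<^esub> T h \<in> B0" using B0D(3)[OF aD(2)[OF fh]] by simp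
  qed (use aD in auto)
  fix b assume b: "b \<in> compressible"
  note bD = compressibleD[OF b]
  show "a \<oplus>\<^bsub>A\<^esub> b \<in> compressible"
  proof (rule compressibleI)
    fix f h assume fh: "f \<in> colour_edges (rng \<Lambda> f)" "h \<in> colour_edges (rng \<Lambda> h)"
    have "star A (T f) \<otimes>\<^bsub>A\<^esub> (a \<oplus>\<^bsub>A\<^esub> b) \<otimes>\<^bsub>A\<^esub> T h =
        star A (T f) \<otimes>\<^bsub>A\<^esub> a \<otimes>\<^bsub>A\<^esub> T h \<oplus>\<^bsub>A\<^esub> star A (T f) \<otimes>\<^bsub>A\<^esub> b \<otimes>\<^bsub>A\<^esub> T h"
      using aD(1) bD(1) colour_edgesD(1)[OF fh(1)] colour_edgesD(1)[OF fh(2)] by (simp add: A.mult_add_left A.mult_add_right)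
    then show "star A (T f) \<otimes>\<^bsub>A\<^esub> (a \<oplus>\<^bsub>A\<^esub> b) \<otimes>\<^bsub>A\<^esub> T h \<in> B0" using B0D(4)[OF aD(2)[OF fh] bD(2)[OF fh]] by simp
  qed (use aD bD in auto)
qed

lemma star_compressible:
  assumes a: "a \<in> compressible"
  shows "star A a \<in> compressible"
proof (rule compressibleI)
  note aD = compressibleD[OF a]
  fix f h assume fh: "f \<in> colour_edges (rng \<Lambda> f)" "h \<in> colour_edges (rng \<Lambda> h)"
  have "star A (T f) \<otimes>\<^bsub>A\<^esub> star A a \<otimes>\<^bsub>A\<^esub> T h = star A (star A (T h) \<otimes>\<^bsub>A\<^esub> a \<otimes>\<^bsub>A\<^esub> T f)"
    using aD(1) colour_edgesD(1)[OF fh(1)] colour_edgesD(1)[OF fh(2)] by (simp add: A.star_mult A.mult_assoc)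
  then show "star A (T f) \<otimes>\<^bsub>A\<^esub> star A a \<otimes>\<^bsub>A\<^esub> T h \<in> B0" using B0_star[OF aD(2)[OF fh(2,1)]] by simp
qed (use compressibleD(1)[OF a] in auto)

text \<open>Between the factors the vertex projection of F is inserted and expanded as the sum of
  T_l T_l^* over edges l of colour i, which turns the compression of ab into a finite sum of
  products of compressions. The finite support of a is what allows the insertion.\<close>

lemma mult_compressible:
  assumes a: "a \<in> compressible" and b: "b \<in> compressible"
    and F: "finite F" "F \<subseteq> vertices \<Lambda>" "a \<otimes>\<^bsub>A\<^esub> A.vertex_sum F = a"
  shows "a \<otimes>\<^bsub>A\<^esub> b \<in> compressible"
proof (rule compressibleI)
  note aD = compressibleD[OF a] and bD = compressibleD[OF b]
  fix f h assume fh: "f \<in> colour_edges (rng \<Lambda> f)" "h \<in> colour_edges (rng \<Lambda> h)"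
  have fe: "f \<in> edges \<Lambda>" "h \<in> edges \<Lambda>" using colour_edgesD(1)[OF fh(1)] colour_edgesD(1)[OF fh(2)] by auto
  have p: "A.vertex_sum F \<in> carrier A" using F by auto
  have "star A (T f) \<otimes>\<^bsub>A\<^esub> (a \<otimes>\<^bsub>A\<^esub> b) \<otimes>\<^bsub>A\<^esub> T h =
      star A (T f) \<otimes>\<^bsub>A\<^esub> ((a \<otimes>\<^bsub>A\<^esub> A.vertex_sum F) \<otimes>\<^bsub>A\<^esub> b) \<otimes>\<^bsub>A\<^esub> T h" by (simp add: F)
  also have "\<dots> = (star A (T f) \<otimes>\<^bsub>A\<^esub> a) \<otimes>\<^bsub>A\<^esub> A.vertex_sum F \<otimes>\<^bsub>A\<^esub> (b \<otimes>\<^bsub>A\<^esub> T h)"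
    using aD(1) bD(1) fe p by (simp add: A.mult_assoc)
  also have "\<dots> = (\<Oplus>\<^bsub>A\<^esub>l\<in>columns_over F. (star A (T f) \<otimes>\<^bsub>A\<^esub> a \<otimes>\<^bsub>A\<^esub> T l) \<otimes>\<^bsub>A\<^esub> (star A (T l) \<otimes>\<^bsub>A\<^esub> (b \<otimes>\<^bsub>A\<^esub> T h)))"
    by (rule insert_vertex_sum[OF F(1,2)]) (use aD(1) bD(1) fe in auto)
  also have "\<dots> \<in> B0"
  proof (rule A.finsum_in_subspace[OF A.closed_subalgebra_subspace[OF B0]])
    fix l assume "l \<in> columns_over F"
    then have l: "l \<in> colour_edges (rng \<Lambda> l)" by (auto simp: columns_over_def colour_edges_def)
    have "star A (T l) \<otimes>\<^bsub>A\<^esub> (b \<otimes>\<^bsub>A\<^esub> T h) = star A (T l) \<otimes>\<^bsub>A\<^esub> b \<otimes>\<^bsub>A\<^esub> T h"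
      using colour_edgesD(1)[OF l] bD(1) fe by (simp add: A.mult_assoc)
    then show "(star A (T f) \<otimes>\<^bsub>A\<^esub> a \<otimes>\<^bsub>A\<^esub> T l) \<otimes>\<^bsub>A\<^esub> (star A (T l) \<otimes>\<^bsub>A\<^esub> (b \<otimes>\<^bsub>A\<^esub> T h)) \<in> B0"
      using B0D(5)[OF aD(2)[OF fh(1) l] bD(2)[OF l fh(2)]] by simp
  qed
  finally show "star A (T f) \<otimes>\<^bsub>A\<^esub> (a \<otimes>\<^bsub>A\<^esub> b) \<otimes>\<^bsub>A\<^esub> T h \<in> B0" .
qed (use compressibleD(1)[OF a] compressibleD(1)[OF b] in auto)

text \<open>The induction over generated elements carries finite support along, as required by
  \<open>mult_compressible\<close>. The limit is harmless because each compression is continuous and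
  \<open>B0\<close> is closed.\<close>

lemma compressible_all:
  assumes x: "x \<in> carrier A"
  shows "x \<in> compressible"
proof -
  define R where "R = {a \<in> compressible. \<exists>F. finite F \<and> F \<subseteq> vertices \<Lambda> \<and> a \<in> A.supported_on F}"
  have RI: "a \<in> R" if "a \<in> compressible" "finite F" "F \<subseteq> vertices \<Lambda>" "a \<in> A.supported_on F" for a F
    using that by (auto simp: R_def)
  have RE: "a \<in> compressible" "\<exists>F. finite F \<and> F \<subseteq> vertices \<Lambda> \<and> a \<in> A.supported_on F" if "a \<in> R" for a
    using that by (auto simp: R_def)
  have cl: "c \<odot>\<^bsub>A\<^esub> a \<in> R" "a \<oplus>\<^bsub>A\<^esub> b \<in> R" "a \<otimes>\<^bsub>A\<^esub> b \<in> R" "star A a \<in> R" if ab: "a \<in> R" "b \<in> R" for a b c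
  proof -
    obtain F where F: "finite F" "F \<subseteq> vertices \<Lambda>" "a \<in> A.supported_on F" using RE(2)[OF ab(1)] by blast
    obtain H where H: "finite H" "H \<subseteq> vertices \<Lambda>" "b \<in> A.supported_on H" using RE(2)[OF ab(2)] by blast
    have FH: "finite (F \<union> H)" "F \<union> H \<subseteq> vertices \<Lambda>" using F H by auto
    have s: "a \<in> A.supported_on (F \<union> H)" "b \<in> A.supported_on (F \<union> H)"
      using A.supported_on_mono[of F "F \<union> H"] A.supported_on_mono[of H "F \<union> H"] F H by auto
    note S = A.supported_on_closed[OF FH(2)]
    note lin = compressible_subspace[unfolded linear_subspace_def] RE(1)[OF ab(1)] RE(1)[OF ab(2)]
    show "c \<odot>\<^bsub>A\<^esub> a \<in> R" by (rule RI[OF _ FH S(1)[OF s(1)]]) (use lin in auto)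
    show "a \<oplus>\<^bsub>A\<^esub> b \<in> R" by (rule RI[OF _ FH S(2)[OF s]]) (use lin in auto)
    show "star A a \<in> R" by (rule RI[OF star_compressible FH S(4)[OF s(1)]]) (use lin in auto)
    show "a \<otimes>\<^bsub>A\<^esub> b \<in> R"
      by (rule RI[OF mult_compressible[OF lin(2,3) FH] FH S(3)[OF s]]) (use s(1) in \<open>simp add: A.supported_on_def\<close>)
  qed
  have "\<zero>\<^bsub>A\<^esub> \<in> R"
    by (rule RI[of _ "{}"]) (use compressible_subspace A.supported_on_closed(5)[of "{}"] in \<open>auto simp: linear_subspace_def\<close>)
  moreover have "R \<subseteq> carrier A" using compressibleD(1) by (auto simp: R_def)
  ultimately have lin: "linear_subspace A R"
    unfolding linear_subspace_def by (intro conjI ballI allI cl)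
  have "P w \<in> R" if "w \<in> vertices \<Lambda>" for w
    by (rule RI[OF P_compressible[OF that] _ _ A.P_supported[OF that]]) (use that in auto)
  moreover have "T f \<in> R" if "f \<in> edges \<Lambda>" for f
    by (rule RI[OF T_compressible[OF that] _ _ A.T_supported[OF that]]) (use that rng_in src_in in auto)
  ultimately have gens: "P ` vertices \<Lambda> \<union> T ` edges \<Lambda> \<subseteq> R" by auto
  obtain s where s: "\<And>n. s n \<in> R" "A.converges_to s x"
    by (rule A.generated_dense[OF genA lin gens _ _ x]) (assumption | erule (1) cl(3) | (rule cl(4); assumption) | rule that)+
  show ?thesis
  proof (rule compressibleI[OF x])
    fix f h assume fh: "f \<in> colour_edges (rng \<Lambda> f)" "h \<in> colour_edges (rng \<Lambda> h)"
    have fe: "f \<in> edges \<Lambda>" "h \<in> edges \<Lambda>" using colour_edgesD(1)[OF fh(1)] colour_edgesD(1)[OF fh(2)] by auto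
    have "A.converges_to (\<lambda>n. star A (T f) \<otimes>\<^bsub>A\<^esub> s n \<otimes>\<^bsub>A\<^esub> T h) (star A (T f) \<otimes>\<^bsub>A\<^esub> x \<otimes>\<^bsub>A\<^esub> T h)"
      by (intro A.converges_to_mult A.converges_to_const s(2)) (use fe in auto)
    then show "star A (T f) \<otimes>\<^bsub>A\<^esub> x \<otimes>\<^bsub>A\<^esub> T h \<in> B0"
      by (rule A.norm_closed_converges[OF B0D(6)]) (rule compressibleD(2)[OF RE(1)[OF s(1)] fh])
  qed
qed

text \<open>Both vertex sums are expanded over edges of colour i into remaining vertices. In T_f
  (T_f^* a T_h) T_h^* the inner factor lies in \<open>B0\<close> by compressibility, and T_f, T_h do
  since f and h belong to the remaining graph.\<close>

lemma corner_in_B0: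
  assumes F: "finite F" "F \<subseteq> remaining" and H: "finite H" "H \<subseteq> remaining" and a: "a \<in> carrier A"
  shows "A.vertex_sum F \<otimes>\<^bsub>A\<^esub> a \<otimes>\<^bsub>A\<^esub> A.vertex_sum H \<in> B0"
proof -
  have Fv: "F \<subseteq> vertices \<Lambda>" "H \<subseteq> vertices \<Lambda>" using F H remaining_vertex by auto
  have p: "A.vertex_sum F \<in> carrier A" "A.vertex_sum H \<in> carrier A" using Fv by auto
  have in_col: "l \<in> colour_edges (rng \<Lambda> l)" if "l \<in> columns_over W" for l W
    using that by (auto simp: columns_over_def colour_edges_def)
  have "A.vertex_sum F \<otimes>\<^bsub>A\<^esub> a \<otimes>\<^bsub>A\<^esub> A.vertex_sum H =
      (\<Oplus>\<^bsub>A\<^esub>f\<in>columns_over F. T f \<otimes>\<^bsub>A\<^esub> star A (T f)) \<otimes>\<^bsub>A\<^esub> (a \<otimes>\<^bsub>A\<^esub> A.vertex_sum H)"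
    using a p by (simp add: A.mult_assoc vertex_sum_columns[OF F(1) Fv(1)])
  also have "\<dots> = (\<Oplus>\<^bsub>A\<^esub>f\<in>columns_over F. T f \<otimes>\<^bsub>A\<^esub> star A (T f) \<otimes>\<^bsub>A\<^esub> (a \<otimes>\<^bsub>A\<^esub> A.vertex_sum H))"
    using a p columns_edge by (intro A.finsum_mult_right) auto
  also have "\<dots> \<in> B0"
  proof (rule A.finsum_in_subspace[OF A.closed_subalgebra_subspace[OF B0]])
    fix f assume f: "f \<in> columns_over F"
    have fe: "f \<in> edges \<Lambda>" by (rule columns_edge[OF f])
    have "star A (T f) \<otimes>\<^bsub>A\<^esub> (a \<otimes>\<^bsub>A\<^esub> A.vertex_sum H) =
        star A (T f) \<otimes>\<^bsub>A\<^esub> a \<otimes>\<^bsub>A\<^esub> (\<Oplus>\<^bsub>A\<^esub>h\<in>columns_over H. T h \<otimes>\<^bsub>A\<^esub> star A (T h))"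
      using a p fe by (simp add: A.mult_assoc vertex_sum_columns[OF H(1) Fv(2)])
    also have "\<dots> = (\<Oplus>\<^bsub>A\<^esub>h\<in>columns_over H. star A (T f) \<otimes>\<^bsub>A\<^esub> a \<otimes>\<^bsub>A\<^esub> (T h \<otimes>\<^bsub>A\<^esub> star A (T h)))"
      using a fe columns_edge by (intro A.finsum_mult_left) auto
    also have "\<dots> \<in> B0"
    proof (rule A.finsum_in_subspace[OF A.closed_subalgebra_subspace[OF B0]])
      fix h assume h: "h \<in> columns_over H"
      have "star A (T f) \<otimes>\<^bsub>A\<^esub> a \<otimes>\<^bsub>A\<^esub> (T h \<otimes>\<^bsub>A\<^esub> star A (T h)) = (star A (T f) \<otimes>\<^bsub>A\<^esub> a \<otimes>\<^bsub>A\<^esub> T h) \<otimes>\<^bsub>A\<^esub> star A (T h)"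
        using a fe columns_edge[OF h] by (simp add: A.mult_assoc)
      also have "\<dots> \<in> B0"
        by (rule B0D(5)[OF compressibleD(2)[OF compressible_all[OF a] in_col[OF f] in_col[OF h]]
          B0_star[OF T_in_B0[OF columns_over_remaining[OF H(2) h]]]])
      finally show "star A (T f) \<otimes>\<^bsub>A\<^esub> a \<otimes>\<^bsub>A\<^esub> (T h \<otimes>\<^bsub>A\<^esub> star A (T h)) \<in> B0" .
    qed
    finally have "star A (T f) \<otimes>\<^bsub>A\<^esub> (a \<otimes>\<^bsub>A\<^esub> A.vertex_sum H) \<in> B0" .
    from B0D(5)[OF T_in_B0[OF columns_over_remaining[OF F(2) f]] this]
    show "T f \<otimes>\<^bsub>A\<^esub> star A (T f) \<otimes>\<^bsub>A\<^esub> (a \<otimes>\<^bsub>A\<^esub> A.vertex_sum H) \<in> B0"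
      using a p fe by (simp add: A.mult_assoc)
  qed
  finally show ?thesis .
qed

text \<open>The subspace Ap, where p is the sum of all remaining vertex projections. In general p is
  at best a multiplier of \<open>A\<close>, so the condition x = xp is expressed by x annihilating
  the other vertex projections.\<close>

definition X :: "'a set" where
  "X = {x \<in> carrier A. \<forall>w\<in>vertices \<Lambda> - remaining. x \<otimes>\<^bsub>A\<^esub> P w = \<zero>\<^bsub>A\<^esub>}"

lemma X_closed [simp, intro]:
  "\<zero>\<^bsub>A\<^esub> \<in> X" "x \<in> X \<Longrightarrow> c \<odot>\<^bsub>A\<^esub> x \<in> X" "x \<in> X \<Longrightarrow> y \<in> X \<Longrightarrow> x \<oplus>\<^bsub>A\<^esub> y \<in> X"
  "a \<in> carrier A \<Longrightarrow> x \<in> X \<Longrightarrow> a \<otimes>\<^bsub>A\<^esub> x \<in> X"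
  by (auto simp: X_def A.smult_mult_left A.mult_add_left A.mult_assoc)

lemma P_in_X: "w \<in> remaining \<Longrightarrow> P w \<in> X"
  using remaining_vertex by (auto simp: X_def A.P_mult)

lemma vertex_sum_in_X:
  assumes F: "finite F" "F \<subseteq> remaining"
  shows "A.vertex_sum F \<in> X"
proof -
  have Fv: "F \<subseteq> vertices \<Lambda>" using F remaining_vertex by auto
  show ?thesis using A.vertex_sum_P[OF F(1) Fv] F(2) A.vertex_sum_closed[OF Fv] by (auto simp: X_def)
qed

lemma XD:
  assumes "x \<in> X"
  shows X_carrier [simp]: "x \<in> carrier A" and "w \<in> vertices \<Lambda> \<Longrightarrow> w \<notin> remaining \<Longrightarrow> x \<otimes>\<^bsub>A\<^esub> P w = \<zero>\<^bsub>A\<^esub>"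
  using assms by (simp_all add: X_def)

lemma X_minus [simp, intro]: "x \<in> X \<Longrightarrow> y \<in> X \<Longrightarrow> x \<ominus>\<^bsub>A\<^esub> y \<in> X"
  using X_closed(3)[OF _ X_closed(2), of x y "-1"] by (simp add: A.smult_minus_one A.minus_eq)

lemma X_limit:
  assumes s: "\<And>n. s n \<in> X" "A.converges_to s x"
  shows "x \<in> X"
  unfolding X_def
proof (intro CollectI conjI ballI)
  show "x \<in> carrier A" by (rule A.converges_toD[OF s(2)])
  fix w assume w: "w \<in> vertices \<Lambda> - remaining"
  have "A.converges_to (\<lambda>n. s n \<otimes>\<^bsub>A\<^esub> P w) (x \<otimes>\<^bsub>A\<^esub> P w)"
    using w by (intro A.converges_to_mult A.converges_to_const s(2)) auto
  moreover have "s n \<otimes>\<^bsub>A\<^esub> P w = \<zero>\<^bsub>A\<^esub>" for n using XD(2)[OF s(1)] w by simp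
  ultimately have "A.converges_to (\<lambda>_. \<zero>\<^bsub>A\<^esub>) (x \<otimes>\<^bsub>A\<^esub> P w)" by simp
  then show "x \<otimes>\<^bsub>A\<^esub> P w = \<zero>\<^bsub>A\<^esub>"
    by (rule A.converges_to_unique[OF _ A.converges_to_const[OF A.zero_closed]])
qed

text \<open>By an approximate unit of \<open>B\<close>, the element \<open>\<phi> b\<close> is a
  limit of multiples of sums of remaining vertex projections, and \<open>X\<close> is closed under
  limits.\<close>

lemma \<phi>_in_X:
  assumes b: "b \<in> carrier B"
  shows "\<phi> b \<in> X"
proof -
  obtain F where F: "\<And>n. finite (F n)" "\<And>n. F n \<subseteq> remaining" "B.converges_to (\<lambda>n. b \<otimes>\<^bsub>B\<^esub> B.vertex_sum (F n)) b"
    by (rule B.approximate_unit[OF genB b, unfolded vertices_remaining_graph]) (rule that)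
  have q: "B.vertex_sum (F n) \<in> carrier B" for n using F(2) by (intro B.vertex_sum_closed) (simp add: vertices_remaining_graph)
  have c: "A.converges_to (\<lambda>n. \<phi> (b \<otimes>\<^bsub>B\<^esub> B.vertex_sum (F n))) (\<phi> b)"
  proof (rule A.converges_toI[OF _ _ _ B.converges_toD(3)[OF F(3)]])
    show "cnorm A (\<phi> (b \<otimes>\<^bsub>B\<^esub> B.vertex_sum (F n)) \<ominus>\<^bsub>A\<^esub> \<phi> b) \<le> cnorm B (b \<otimes>\<^bsub>B\<^esub> B.vertex_sum (F n) \<ominus>\<^bsub>B\<^esub> b)" for n
      using b q[of n] by (simp add: \<phi>.isometric flip: \<phi>.map_diff)
  qed (use b q in auto)
  show ?thesis
  proof (rule X_limit[OF _ c])
    fix n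
    have "\<phi> (B.vertex_sum (F n)) = (\<Oplus>\<^bsub>A\<^esub>w\<in>F n. \<phi> (Q w))"
      unfolding B.vertex_sum_def by (rule \<phi>.map_finsum) (use F in auto)
    also have "\<dots> = A.vertex_sum (F n)"
      unfolding A.vertex_sum_def
      by (rule A.finsum_cong'[OF refl]) (use F(2)[of n] remaining_vertex \<phi>_Q in auto)
    finally have eq: "\<phi> (B.vertex_sum (F n)) = A.vertex_sum (F n)" .
    have "A.vertex_sum (F n) \<in> X" by (rule vertex_sum_in_X[OF F(1,2)])
    then show "\<phi> (b \<otimes>\<^bsub>B\<^esub> B.vertex_sum (F n)) \<in> X" using b q[of n] by (simp add: \<phi>.map_mult eq)
  qed
qed

lemma X_ract: "x \<in> X \<Longrightarrow> b \<in> carrier B \<Longrightarrow> x \<otimes>\<^bsub>A\<^esub> \<phi> b \<in> X"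
  using \<phi>_in_X by simp

text \<open>In an approximate unit for x the deleted vertices contribute zero, so they can be
  discarded.\<close>

lemma X_approx:
  assumes x: "x \<in> X"
  obtains F where "\<And>n. finite (F n)" "\<And>n. F n \<subseteq> remaining" "A.converges_to (\<lambda>n. x \<otimes>\<^bsub>A\<^esub> A.vertex_sum (F n)) x"
proof -
  obtain H where H: "\<And>n. finite (H n)" "\<And>n. H n \<subseteq> vertices \<Lambda>" "A.converges_to (\<lambda>n. x \<otimes>\<^bsub>A\<^esub> A.vertex_sum (H n)) x"
    by (rule A.approximate_unit[OF genA X_carrier[OF x]]) (rule that)
  have "x \<otimes>\<^bsub>A\<^esub> A.vertex_sum (H n) = x \<otimes>\<^bsub>A\<^esub> A.vertex_sum (H n \<inter> remaining)" for n
  proof -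
    have "x \<otimes>\<^bsub>A\<^esub> A.vertex_sum (H n) = (\<Oplus>\<^bsub>A\<^esub>w\<in>H n. x \<otimes>\<^bsub>A\<^esub> P w)"
      unfolding A.vertex_sum_def by (rule A.finsum_mult_left) (use x H(2)[of n] in auto)
    also have "\<dots> = (\<Oplus>\<^bsub>A\<^esub>w\<in>H n \<inter> remaining. x \<otimes>\<^bsub>A\<^esub> P w)"
      by (rule A.add.finprod_mono_neutral_cong_right) (use x H(1,2)[of n] XD(2)[OF x] in auto)
    also have "\<dots> = x \<otimes>\<^bsub>A\<^esub> A.vertex_sum (H n \<inter> remaining)"
      unfolding A.vertex_sum_def by (rule A.finsum_mult_left[symmetric]) (use x H(2)[of n] in auto)
    finally show ?thesis .
  qed
  then show ?thesis using H by (intro that[of "\<lambda>n. H n \<inter> remaining"]) auto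
qed

text \<open>Approximating x and y by cutting them down to finitely many remaining vertices turns the
  inner product into a limit of elements covered by \<open>corner_in_B0\<close>.\<close>

lemma inner_in_B0:
  assumes x: "x \<in> X" and y: "y \<in> X"
  shows "star A x \<otimes>\<^bsub>A\<^esub> y \<in> B0"
proof -
  obtain F where F: "\<And>n. finite (F n)" "\<And>n. F n \<subseteq> remaining" "A.converges_to (\<lambda>n. x \<otimes>\<^bsub>A\<^esub> A.vertex_sum (F n)) x"
    by (rule X_approx[OF x]) (rule that)
  obtain H where H: "\<And>n. finite (H n)" "\<And>n. H n \<subseteq> remaining" "A.converges_to (\<lambda>n. y \<otimes>\<^bsub>A\<^esub> A.vertex_sum (H n)) y"
    by (rule X_approx[OF y]) (rule that)
  have v: "F n \<subseteq> vertices \<Lambda>" "H n \<subseteq> vertices \<Lambda>" for n using F(2)[of n] H(2)[of n] remaining_vertex by auto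
  note p = A.vertex_sum_closed[OF v(1)] A.vertex_sum_closed[OF v(2)]
  have "A.converges_to (\<lambda>n. star A (x \<otimes>\<^bsub>A\<^esub> A.vertex_sum (F n)) \<otimes>\<^bsub>A\<^esub> (y \<otimes>\<^bsub>A\<^esub> A.vertex_sum (H n))) (star A x \<otimes>\<^bsub>A\<^esub> y)"
    by (intro A.converges_to_mult A.converges_to_star F(3) H(3))
  then show ?thesis
  proof (rule A.norm_closed_converges[OF B0D(6)])
    fix n
    have "star A (x \<otimes>\<^bsub>A\<^esub> A.vertex_sum (F n)) \<otimes>\<^bsub>A\<^esub> (y \<otimes>\<^bsub>A\<^esub> A.vertex_sum (H n)) =
        A.vertex_sum (F n) \<otimes>\<^bsub>A\<^esub> (star A x \<otimes>\<^bsub>A\<^esub> y) \<otimes>\<^bsub>A\<^esub> A.vertex_sum (H n)"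
      using x y p[of n] by (simp add: A.star_mult A.star_vertex_sum[OF v(1)] A.mult_assoc)
    then show "star A (x \<otimes>\<^bsub>A\<^esub> A.vertex_sum (F n)) \<otimes>\<^bsub>A\<^esub> (y \<otimes>\<^bsub>A\<^esub> A.vertex_sum (H n)) \<in> B0"
      using corner_in_B0[OF F(1,2) H(1,2), of "star A x \<otimes>\<^bsub>A\<^esub> y"] x y by simp
  qed
qed

end

section \<open>The bimodule operations, completeness and fullness\<close>

context corner_embedding
begin

definition \<rho> :: "'a \<Rightarrow> 'b" where
  "\<rho> = inv_into (carrier B) \<phi>"

lemma \<rho>_\<phi> [simp]: "b \<in> carrier B \<Longrightarrow> \<rho> (\<phi> b) = b"
  unfolding \<rho>_def by (rule inv_into_f_f[OF \<phi>.inj_on_carrier])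

lemma \<phi>_\<rho> [simp]: "z \<in> B0 \<Longrightarrow> \<phi> (\<rho> z) = z"
  and \<rho>_closed [simp, intro]: "z \<in> B0 \<Longrightarrow> \<rho> z \<in> carrier B"
  by auto

lemma \<rho>_add: "y \<in> B0 \<Longrightarrow> z \<in> B0 \<Longrightarrow> \<rho> (y \<oplus>\<^bsub>A\<^esub> z) = \<rho> y \<oplus>\<^bsub>B\<^esub> \<rho> z"
  and \<rho>_smult: "z \<in> B0 \<Longrightarrow> \<rho> (c \<odot>\<^bsub>A\<^esub> z) = c \<odot>\<^bsub>B\<^esub> \<rho> z"
  and \<rho>_star: "z \<in> B0 \<Longrightarrow> \<rho> (star A z) = star B (\<rho> z)"
  and \<rho>_mult: "z \<in> B0 \<Longrightarrow> b \<in> carrier B \<Longrightarrow> \<rho> (z \<otimes>\<^bsub>A\<^esub> \<phi> b) = \<rho> z \<otimes>\<^bsub>B\<^esub> b"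
  by (auto simp flip: \<phi>.map_add \<phi>.map_smult \<phi>.map_star \<phi>.map_mult)

lemma cnorm_\<rho>: "z \<in> B0 \<Longrightarrow> cnorm B (\<rho> z) = cnorm A z"
  by (auto simp: \<phi>.isometric)

text \<open>Only the first components matter; the second ones are there to meet the prescribed type.\<close>

definition corner_bimodule :: "('a, 'b, 'a \<times> 'b) bimodule" where
  "corner_bimodule = \<lparr>carrier = X \<times> {\<zero>\<^bsub>B\<^esub>}, mult = \<lambda>x y. x, one = (\<zero>\<^bsub>A\<^esub>, \<zero>\<^bsub>B\<^esub>), zero = (\<zero>\<^bsub>A\<^esub>, \<zero>\<^bsub>B\<^esub>),
     add = \<lambda>x y. (fst x \<oplus>\<^bsub>A\<^esub> fst y, \<zero>\<^bsub>B\<^esub>), smult = \<lambda>c x. (c \<odot>\<^bsub>A\<^esub> fst x, \<zero>\<^bsub>B\<^esub>),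
     lact = \<lambda>a x. (a \<otimes>\<^bsub>A\<^esub> fst x, \<zero>\<^bsub>B\<^esub>), ract = \<lambda>x b. (fst x \<otimes>\<^bsub>A\<^esub> \<phi> b, \<zero>\<^bsub>B\<^esub>),
     linner = \<lambda>x y. fst x \<otimes>\<^bsub>A\<^esub> star A (fst y), rinner = \<lambda>x y. \<rho> (star A (fst x) \<otimes>\<^bsub>A\<^esub> fst y)\<rparr>"

lemma corner_bimodule_simps [simp]:
  "carrier corner_bimodule = X \<times> {\<zero>\<^bsub>B\<^esub>}" "\<zero>\<^bsub>corner_bimodule\<^esub> = (\<zero>\<^bsub>A\<^esub>, \<zero>\<^bsub>B\<^esub>)"
  "x \<oplus>\<^bsub>corner_bimodule\<^esub> y = (fst x \<oplus>\<^bsub>A\<^esub> fst y, \<zero>\<^bsub>B\<^esub>)"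
  "c \<odot>\<^bsub>corner_bimodule\<^esub> x = (c \<odot>\<^bsub>A\<^esub> fst x, \<zero>\<^bsub>B\<^esub>)"
  "lact corner_bimodule a x = (a \<otimes>\<^bsub>A\<^esub> fst x, \<zero>\<^bsub>B\<^esub>)"
  "ract corner_bimodule x b = (fst x \<otimes>\<^bsub>A\<^esub> \<phi> b, \<zero>\<^bsub>B\<^esub>)"
  "linner corner_bimodule x y = fst x \<otimes>\<^bsub>A\<^esub> star A (fst y)"
  "rinner corner_bimodule x y = \<rho> (star A (fst x) \<otimes>\<^bsub>A\<^esub> fst y)"
  by (simp_all add: corner_bimodule_def)

lemma corner_bimodule_vector_space: "complex_vector_space corner_bimodule"
  by (rule complex_vector_spaceI)
    (auto simp: A.a_assoc A.smult_add_left A.smult_add_right A.smult_smult intro: A.a_comm)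

lemma corner_bimodule_minus:
  assumes x: "x \<in> carrier corner_bimodule" and y: "y \<in> carrier corner_bimodule"
  shows "x \<ominus>\<^bsub>corner_bimodule\<^esub> y = (fst x \<ominus>\<^bsub>A\<^esub> fst y, \<zero>\<^bsub>B\<^esub>)"
proof -
  interpret m: module complex_ring corner_bimodule by (rule corner_bimodule_vector_space)
  have yA: "fst y \<in> carrier A" "\<ominus>\<^bsub>A\<^esub> fst y \<in> X" using y X_closed(2)[of "fst y" "-1"] by (auto simp: A.smult_minus_one)
  have "\<ominus>\<^bsub>corner_bimodule\<^esub> y = (\<ominus>\<^bsub>A\<^esub> fst y, \<zero>\<^bsub>B\<^esub>)"
    by (rule m.minus_equality) (use y yA A.l_neg in auto)
  then show ?thesis by (simp add: m.minus_eq A.minus_eq)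
qed

text \<open>Both inner products induce the norm of \<open>A\<close> on \<open>X\<close>, so one
  argument serves both sides: \<open>A\<close> is complete and \<open>X\<close> contains its
  limits.\<close>

lemma complete_for_corner:
  assumes N: "\<And>x. x \<in> carrier corner_bimodule \<Longrightarrow> N x = cnorm A (fst x)"
  shows "complete_for corner_bimodule N"
  unfolding complete_for_def
proof (intro allI impI, elim conjE)
  fix s :: "nat \<Rightarrow> 'a \<times> 'b"
  assume s: "\<forall>n. s n \<in> carrier corner_bimodule"
    and cau: "\<forall>e>0. \<exists>n\<^sub>0. \<forall>m\<ge>n\<^sub>0. \<forall>n\<ge>n\<^sub>0. N (s m \<ominus>\<^bsub>corner_bimodule\<^esub> s n) < e"
  have sX: "fst (s n) \<in> X" for n using s by (metis corner_bimodule_simps(1) mem_Times_iff)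
  have d: "N (x \<ominus>\<^bsub>corner_bimodule\<^esub> y) = cnorm A (fst x \<ominus>\<^bsub>A\<^esub> fst y)"
    if "x \<in> carrier corner_bimodule" "y \<in> carrier corner_bimodule" for x y
    unfolding corner_bimodule_minus[OF that] by (subst N) (use that in auto)
  have "\<exists>l. A.converges_to (\<lambda>n. fst (s n)) l"
  proof (rule A.Cauchy_converges)
    show "fst (s n) \<in> carrier A" for n by (rule X_carrier[OF sX])
    fix e :: real assume "e > 0"
    then obtain n0 where n0: "\<forall>m\<ge>n0. \<forall>n\<ge>n0. N (s m \<ominus>\<^bsub>corner_bimodule\<^esub> s n) < e" using cau by blast
    have "cnorm A (fst (s m) \<ominus>\<^bsub>A\<^esub> fst (s n)) < e" if "m \<ge> n0" "n \<ge> n0" for m n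
      using n0[rule_format, OF that] unfolding d[OF spec[OF s] spec[OF s]] .
    then show "\<exists>n0. \<forall>m\<ge>n0. \<forall>n\<ge>n0. cnorm A (fst (s m) \<ominus>\<^bsub>A\<^esub> fst (s n)) < e" by blast
  qed
  then obtain l where l: "A.converges_to (\<lambda>n. fst (s n)) l" by blast
  have lc: "(l, \<zero>\<^bsub>B\<^esub>) \<in> carrier corner_bimodule" using X_limit[OF sX l] by simp
  have "(\<lambda>n. N (s n \<ominus>\<^bsub>corner_bimodule\<^esub> (l, \<zero>\<^bsub>B\<^esub>))) = (\<lambda>n. cnorm A (fst (s n) \<ominus>\<^bsub>A\<^esub> l))"
    using d[OF _ lc] s by (auto simp del: corner_bimodule_simps(1))
  then show "\<exists>l\<in>carrier corner_bimodule. (\<lambda>n. N (s n \<ominus>\<^bsub>corner_bimodule\<^esub> l)) \<longlonglongrightarrow> 0"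
    using A.converges_toD(3)[OF l] lc by (intro bexI[of _ "(l, \<zero>\<^bsub>B\<^esub>)"]) auto
qed

text \<open>A product of a with a vertex sum is a sum of terms (a T_l) T_l^* over edges l of colour
  i. Here T_l belongs to \<open>X\<close> because the source of l remains; this is where the corner
  is seen to be full.\<close>

lemma left_full: "densely_spanned_by A {x \<otimes>\<^bsub>A\<^esub> star A y | x y. x \<in> X \<and> y \<in> X}"
  unfolding densely_spanned_by_def
proof (intro allI impI, elim conjE)
  fix S assume S: "linear_subspace A S" "norm_closed A S" "{x \<otimes>\<^bsub>A\<^esub> star A y | x y. x \<in> X \<and> y \<in> X} \<subseteq> S"
  have "a \<in> S" if a: "a \<in> carrier A" for a
  proof -
    obtain F where F: "\<And>n. finite (F n)" "\<And>n. F n \<subseteq> vertices \<Lambda>" "A.converges_to (\<lambda>n. a \<otimes>\<^bsub>A\<^esub> A.vertex_sum (F n)) a"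
      by (rule A.approximate_unit[OF genA a]) (rule that)
    have TX: "T l \<in> X" if l: "l \<in> colour_edges w" for l w
    proof -
      note L = colour_edgesD[OF l]
      show ?thesis using X_closed(4)[OF A.T_closed[OF L(1)] P_in_X[OF L(5)]] A.T_P_src[OF L(1)] by simp
    qed
    have "a \<otimes>\<^bsub>A\<^esub> A.vertex_sum (F n) \<in> S" for n
    proof -
      have "a \<otimes>\<^bsub>A\<^esub> A.vertex_sum (F n) = (\<Oplus>\<^bsub>A\<^esub>l\<in>columns_over (F n). a \<otimes>\<^bsub>A\<^esub> (T l \<otimes>\<^bsub>A\<^esub> star A (T l)))"
        unfolding vertex_sum_columns[OF F(1,2)] by (rule A.finsum_mult_left) (use a columns_edge in auto)
      also have "\<dots> \<in> S"
      proof (rule A.finsum_in_subspace[OF S(1)])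
        fix l assume l: "l \<in> columns_over (F n)"
        then have lX: "T l \<in> X" using TX by (auto simp: columns_over_def)
        have "a \<otimes>\<^bsub>A\<^esub> T l \<otimes>\<^bsub>A\<^esub> star A (T l) \<in> S" by (rule subsetD[OF S(3)]) (use lX a in blast)
        then show "a \<otimes>\<^bsub>A\<^esub> (T l \<otimes>\<^bsub>A\<^esub> star A (T l)) \<in> S"
          using a columns_edge[OF l] by (simp add: A.mult_assoc)
      qed
      finally show ?thesis .
    qed
    then show ?thesis by (rule A.norm_closed_converges[OF S(2) F(3)])
  qed
  then show "S = carrier A" using S(1) by (auto simp: linear_subspace_def)
qed

text \<open>The elements \<open>b \<otimes> Q w\<close> are inner products of
  \<open>\<phi> (star B b)\<close> with \<open>P w\<close>, and sums of them approximate b.\<close>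

lemma right_full: "densely_spanned_by B {\<rho> (star A x \<otimes>\<^bsub>A\<^esub> y) | x y. x \<in> X \<and> y \<in> X}"
  unfolding densely_spanned_by_def
proof (intro allI impI, elim conjE)
  fix S assume S: "linear_subspace B S" "norm_closed B S" "{\<rho> (star A x \<otimes>\<^bsub>A\<^esub> y) | x y. x \<in> X \<and> y \<in> X} \<subseteq> S"
  have "b \<in> S" if b: "b \<in> carrier B" for b
  proof -
    obtain F where F: "\<And>n. finite (F n)" "\<And>n. F n \<subseteq> remaining" "B.converges_to (\<lambda>n. b \<otimes>\<^bsub>B\<^esub> B.vertex_sum (F n)) b"
      by (rule B.approximate_unit[OF genB b, unfolded vertices_remaining_graph]) (rule that)
    have "b \<otimes>\<^bsub>B\<^esub> B.vertex_sum (F n) \<in> S" for n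
    proof -
      have "b \<otimes>\<^bsub>B\<^esub> B.vertex_sum (F n) = (\<Oplus>\<^bsub>B\<^esub>w\<in>F n. b \<otimes>\<^bsub>B\<^esub> Q w)"
        unfolding B.vertex_sum_def by (rule B.finsum_mult_left) (use b F in auto)
      also have "\<dots> \<in> S"
      proof (rule B.finsum_in_subspace[OF S(1)])
        fix w assume "w \<in> F n"
        then have w: "w \<in> remaining" using F(2) by blast
        have "star A (\<phi> (star B b)) \<otimes>\<^bsub>A\<^esub> P w = \<phi> (b \<otimes>\<^bsub>B\<^esub> Q w)"
          using b w by (simp add: \<phi>.map_mult \<phi>_Q flip: \<phi>.map_star)
        then have "b \<otimes>\<^bsub>B\<^esub> Q w = \<rho> (star A (\<phi> (star B b)) \<otimes>\<^bsub>A\<^esub> P w)" using b w by simp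
        then show "b \<otimes>\<^bsub>B\<^esub> Q w \<in> S"
          using \<phi>_in_X[OF B.star_closed[OF b]] P_in_X[OF w] by (intro subsetD[OF S(3)]) blast
      qed
      finally show ?thesis .
    qed
    then show ?thesis by (rule B.norm_closed_converges[OF S(2) F(3)])
  qed
  then show "S = carrier B" using S(1) by (auto simp: linear_subspace_def)
qed

text \<open>Positivity is needed relative to \<open>B\<close>, not just \<open>A\<close>. The root
  of x^* x lies in every closed subalgebra containing x^* x, hence in \<open>B0\<close>, and pulls
  back to \<open>B\<close>.\<close>

lemma rinner_positive: 
  assumes x: "x \<in> X"
  shows "is_positive B (\<rho> (star A x \<otimes>\<^bsub>A\<^esub> x))"
proof -
  have p: "A.E.pos (A.\<iota> (star A x \<otimes>\<^bsub>A\<^esub> x))" 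
    by (rule A.is_positive_imp_pos[OF A.is_positive_star_mult]) (use x in simp)
  have c: "star A x \<otimes>\<^bsub>A\<^esub> x \<in> carrier A" using x by auto
  obtain c where c: "c \<in> carrier A" "star A c = c" "c \<otimes>\<^bsub>A\<^esub> c = star A x \<otimes>\<^bsub>A\<^esub> x"
    "\<And>S. A.closed_subalgebra S \<Longrightarrow> star A x \<otimes>\<^bsub>A\<^esub> x \<in> S \<Longrightarrow> c \<in> S"
    by (rule A.pos_root[OF c p]) (rule that)
  have "c \<in> B0" by (rule c(4)[OF B0 inner_in_B0[OF x x]])
  then obtain d where d: "d \<in> carrier B" "c = \<phi> d" by blast
  have "star A x \<otimes>\<^bsub>A\<^esub> x = \<phi> (star B d \<otimes>\<^bsub>B\<^esub> d)" using c(2,3) d by (simp add: \<phi>.map_mult \<phi>.map_star)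
  then show ?thesis using d(1) by (auto simp: is_positive_def)
qed

lemma cnorm_rinner: "x \<in> X \<Longrightarrow> sqrt (cnorm B (\<rho> (star A x \<otimes>\<^bsub>A\<^esub> x))) = cnorm A x"
  using inner_in_B0[of x x] by (simp add: cnorm_\<rho> A.cstar_identity)

lemma cnorm_linner: "x \<in> X \<Longrightarrow> sqrt (cnorm A (x \<otimes>\<^bsub>A\<^esub> star A x)) = cnorm A x"
  using A.cstar_identity[of "star A x"] by simp

lemma left_module: "full_left_hilbert_module A corner_bimodule"
proof (rule full_left_hilbert_module.intro)
  show "complex_vector_space corner_bimodule" by (rule corner_bimodule_vector_space)
  show "complete_for corner_bimodule (\<lambda>x. sqrt (cnorm A (linner corner_bimodule x x)))"
    by (rule complete_for_corner) (auto simp: cnorm_linner)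
  have "{linner corner_bimodule x y |x y. x \<in> carrier corner_bimodule \<and> y \<in> carrier corner_bimodule} =
      {x \<otimes>\<^bsub>A\<^esub> star A y | x y. x \<in> X \<and> y \<in> X}" by auto
  then show "densely_spanned_by A {linner corner_bimodule x y |x y. x \<in> carrier corner_bimodule \<and> y \<in> carrier corner_bimodule}"
    using left_full by simp
  fix x assume x: "x \<in> carrier corner_bimodule"
  show "is_positive A (linner corner_bimodule x x)"
    using A.is_positive_star_mult[of "star A (fst x)"] x by auto
  assume 0: "linner corner_bimodule x x = \<zero>\<^bsub>A\<^esub>"
  have "cnorm A (fst x) = 0" using cnorm_linner[of "fst x"] x 0 by auto
  then show "x = \<zero>\<^bsub>corner_bimodule\<^esub>" using x A.cnorm_eq_0[of "fst x"] by auto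
qed (auto simp: A.mult_add_right A.mult_add_left A.mult_assoc A.smult_mult_right A.smult_mult_left A.star_mult)

lemma right_module: "full_right_hilbert_module B corner_bimodule"
proof (rule full_right_hilbert_module.intro)
  show "complex_vector_space corner_bimodule" by (rule corner_bimodule_vector_space)
  show "complete_for corner_bimodule (\<lambda>x. sqrt (cnorm B (rinner corner_bimodule x x)))"
    by (rule complete_for_corner) (auto simp: cnorm_rinner)
  have "{rinner corner_bimodule x y |x y. x \<in> carrier corner_bimodule \<and> y \<in> carrier corner_bimodule} =
      {\<rho> (star A x \<otimes>\<^bsub>A\<^esub> y) | x y. x \<in> X \<and> y \<in> X}" by auto
  then show "densely_spanned_by B {rinner corner_bimodule x y |x y. x \<in> carrier corner_bimodule \<and> y \<in> carrier corner_bimodule}"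
    using right_full by simp
  fix x assume x: "x \<in> carrier corner_bimodule"
  then have xX: "fst x \<in> X" by auto
  show "is_positive B (rinner corner_bimodule x x)" using rinner_positive[OF xX] by simp
  show "x = \<zero>\<^bsub>corner_bimodule\<^esub>" if 0: "rinner corner_bimodule x x = \<zero>\<^bsub>B\<^esub>"
  proof -
    have "cnorm A (fst x) = 0" using cnorm_rinner[OF xX] 0 by simp
    then show ?thesis using x A.cnorm_eq_0[of "fst x"] by auto
  qed
  fix y assume y: "y \<in> carrier corner_bimodule"
  then have yX: "fst y \<in> X" by auto
  note i = inner_in_B0[OF xX yX] inner_in_B0[OF yX xX] and c = X_carrier[OF xX] X_carrier[OF yX]
  show "rinner corner_bimodule x y \<in> carrier B" using \<rho>_closed[OF i(1)] by simp
  show "rinner corner_bimodule x (z \<odot>\<^bsub>corner_bimodule\<^esub> y) = z \<odot>\<^bsub>B\<^esub> rinner corner_bimodule x y" for z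
    using \<rho>_smult[OF i(1)] c by (simp add: A.smult_mult_right)
  show "star B (rinner corner_bimodule x y) = rinner corner_bimodule y x"
    using \<rho>_star[OF i(1)] c by (simp add: A.star_mult)
  show "rinner corner_bimodule x (ract corner_bimodule y b) = rinner corner_bimodule x y \<otimes>\<^bsub>B\<^esub> b"
    if "b \<in> carrier B" for b
    using \<rho>_mult[OF i(1) that] c that by (simp add: A.mult_assoc)
  show "rinner corner_bimodule x (y \<oplus>\<^bsub>corner_bimodule\<^esub> w) = rinner corner_bimodule x y \<oplus>\<^bsub>B\<^esub> rinner corner_bimodule x w"
    if w: "w \<in> carrier corner_bimodule" for w
  proof -
    have wX: "fst w \<in> X" using w by auto
    show ?thesis using \<rho>_add[OF i(1) inner_in_B0[OF xX wX]] c X_carrier[OF wX] by (simp add: A.mult_add_right)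
  qed
qed (auto simp: X_ract A.mult_add_right A.mult_add_left A.mult_assoc A.smult_mult_right A.smult_mult_left
    \<phi>.map_add \<phi>.map_mult \<phi>.map_smult)

lemma imprimitivity: "imprimitivity_bimodule A B corner_bimodule"
proof (rule imprimitivity_bimodule.intro[OF left_module right_module], rule imprimitivity_bimodule_axioms.intro)
  fix x y w assume "x \<in> carrier corner_bimodule" "y \<in> carrier corner_bimodule" "w \<in> carrier corner_bimodule"
  then have c: "fst x \<in> X" "fst y \<in> X" "fst w \<in> X" by auto
  show "lact corner_bimodule (linner corner_bimodule x y) w = ract corner_bimodule x (rinner corner_bimodule y w)"
    using c \<phi>_\<rho>[OF inner_in_B0[OF c(2,3)]] by (simp add: A.mult_assoc)
qed (auto simp: A.mult_assoc A.star_mult \<phi>.map_star)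

lemma morita_equivalent: "morita_equivalent A B"
  unfolding morita_equivalent_def using imprimitivity by blast

end

lemma (in sink_setup) morita_equivalent_of_universal:
  assumes univA: "is_universal_ck \<Lambda> A P T" and univB: "is_universal_ck remaining_graph B Q U"
  shows "morita_equivalent A B"
proof -
  have UA: "cstar_algebra A" "ck_family \<Lambda> A P T" "generated_by A (P ` vertices \<Lambda> \<union> T ` edges \<Lambda>)"
    using univA by (simp_all add: is_universal_ck_def)
  have UB: "cstar_algebra B" "ck_family remaining_graph B Q U"
    "generated_by B (Q ` vertices remaining_graph \<union> U ` edges remaining_graph)"
    using univB by (simp_all add: is_universal_ck_def)
  interpret matrix_family \<Lambda> v i B Q U
    by (intro matrix_family.intro matrix_family_axioms.intro sink_setup_axioms UB)
  interpret A: ck_representation A \<Lambda> P T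
    by (intro ck_representation.intro ck_representation_axioms.intro cstar.intro UA finite_edges)
      (auto simp: src_in rng_in in_edges)
  have sub: "vertices \<Lambda> \<subseteq> mor \<Lambda>" "edges \<Lambda> \<subseteq> mor \<Lambda>" "vertices remaining_graph \<subseteq> mor \<Lambda>"
      "edges remaining_graph \<subseteq> mor \<Lambda>"
    by (auto simp: vertices_def of_degree_def edges_def)
  note count = countable_image[OF countable_subset[OF _ countable_mor]]
  obtain \<psi> where \<psi>: "star_hom A D \<psi>" "\<And>w. w \<in> vertices \<Lambda> \<Longrightarrow> \<psi> (P w) = PD w"
      "\<And>f. f \<in> edges \<Lambda> \<Longrightarrow> \<psi> (T f) = TD f"
    by (rule universal_ck[OF univA D.cstar_algebra_axioms ck_family_matrices count[OF sub(1)] count[OF sub(2)]]) (rule that)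
  \<comment> \<open>A remaining vertex keeps all edges pointing into it, so (CK4) is literally the
    same sum; the other relations are restrictions.\<close>
  have "ck_family remaining_graph A P T"
  proof (rule ck_familyI)
    fix w j assume "w \<in> vertices remaining_graph"
    then have w: "w \<in> remaining" by (simp add: vertices_remaining_graph)
    have "{f \<in> edges remaining_graph. rng remaining_graph f = w \<and> deg remaining_graph f = axis j 1} = A.row w j"
      using w by (auto simp: A.row_def edges_remaining_graph)
    then show "P w = (\<Oplus>\<^bsub>A\<^esub>f\<in>{f \<in> edges remaining_graph. rng remaining_graph f = w \<and> deg remaining_graph f = axis j 1}.
        T f \<otimes>\<^bsub>A\<^esub> star A (T f))"
      using A.P_sum[OF remaining_vertex[OF w], of j] by simp
  qed (use remaining_vertex in \<open>auto simp: vertices_remaining_graph edges_remaining_graph intro: ck_familyD[OF UA(2)]\<close>)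
  then obtain \<phi> where \<phi>: "star_hom B A \<phi>" "\<And>w. w \<in> vertices remaining_graph \<Longrightarrow> \<phi> (Q w) = P w"
      "\<And>f. f \<in> edges remaining_graph \<Longrightarrow> \<phi> (U f) = T f"
    by (rule universal_ck[OF univB UA(1) _ count[OF sub(3)] count[OF sub(4)]]) (rule that)
  \<comment> \<open>The composite of \<open>\<phi>\<close> and \<open>\<psi>\<close> sends the
    generators of \<open>B\<close> to the corresponding matrices, so it does not decrease norms.
    Since both maps are contractive, \<open>\<phi>\<close> is isometric.\<close>
  have iso: "cnorm A (\<phi> x) = cnorm B x" if x: "x \<in> carrier B" for x
  proof (rule antisym)
    show le: "cnorm A (\<phi> x) \<le> cnorm B x" by (rule star_hom_contractive[OF B.cstar_axioms A.cstar_axioms \<phi>(1) x])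
    have "cnorm B x \<le> cnorm D (\<psi> (\<phi> x))"
      by (rule cnorm_le_of_family_hom[OF UB(3) star_hom_compose[OF \<phi>(1) \<psi>(1)] _ _ x])
        (use \<phi> \<psi> remaining_vertex in \<open>auto simp: vertices_remaining_graph edges_remaining_graph\<close>)
    also have "\<dots> \<le> cnorm A (\<phi> x)"
      by (rule star_hom_contractive[OF A.cstar_axioms D.cstar_axioms \<psi>(1)]) (use \<phi>(1) x in \<open>auto simp: star_hom_def\<close>)
    finally show "cnorm B x \<le> cnorm A (\<phi> x)" .
  qed
  interpret corner_embedding \<Lambda> v i B Q U A P T \<phi>
    by unfold_locales (use \<phi> iso UA(3) UB(3) in \<open>auto simp: vertices_remaining_graph\<close>)
  show ?thesis by (rule morita_equivalent)
qed

theorem theorem5p7: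
  fixes \<Lambda> :: "('m, 'k::finite) kgraph_data"
    and v :: 'm
    and A :: "'a cstar"
    and B :: "'b cstar"
  assumes "k_graph \<Lambda>"
    and "row_finite \<Lambda>"
    and "source_free \<Lambda>"
    and "v \<in> vertices \<Lambda>"
    and "is_sink \<Lambda> v"
    and "is_kgraph_cstar_algebra \<Lambda> A"
    and "is_kgraph_cstar_algebra (delete_sink \<Lambda> v) B"
  shows "morita_equivalent A B"
proof -
  obtain i where i: "{x \<in> of_degree \<Lambda> (axis i 1). src \<Lambda> x = v} = {}"
    using assms(5) by (auto simp: is_sink_def)
  interpret sink_setup \<Lambda> v i
    by (intro sink_setup.intro sink_deletion.intro sink_setup_axioms.intro assms i)
  obtain P T where "is_universal_ck \<Lambda> A P T" using assms(6) by (auto simp: is_kgraph_cstar_algebra_def)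
  moreover obtain Q U where "is_universal_ck (delete_sink \<Lambda> v) B Q U"
    using assms(7) by (auto simp: is_kgraph_cstar_algebra_def)
  \<comment> \<open>Universality for \<open>delete_sink \<Lambda> v\<close> is moved to
    \<open>remaining_graph\<close> along the isomorphism \<open>path_set\<close>; the algebra B
    itself does not change.\<close>
  ultimately show ?thesis
    using morita_equivalent_of_universal[OF _ iso.is_universal_ck_transfer] by blast
qed

end
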